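(* For every $\eta>0$ there is a compact subset $\mathcal{Y}=\mathcal{Y}(\eta)$ of $\mathcal{X}=T^{1}(\mathrm{PSL}_2(\mathbb{Z})\backslash\mathbb{H})\cong \mathrm{PSL}_2(\mathbb{Z})\backslash \mathrm{PSL}_2(\mathbb{R})$ such that $$\#\{\text{closed geodesics on }\mathcal{X}\text{ which are low-lying with respect to }\mathcal{Y},\text{ fundamental, and reciprocal, with trace}<X\}\gg_{\eta} X^{1-\eta}$$ as $X\to\infty$.
   Context: All closed geodesics are primitive. Closed geodesics on $\mathcal{X}$ correspond bijectively to primitive conjugacy classes of hyperbolic elements of $\mathrm{PSL}_2(\mathbb{Z})$, and also to equivalence classes of indefinite binary quadratic forms; the trace of a closed geodesic is the (absolute value of the) trace of its conjugacy class, and its discriminant is the discriminant of the corresponding class of quadratic forms. A closed geodesic $\gamma$ is low-lying with respect to a compact set $\mathcal{Y}\subset\mathcal{X}$ if $\gamma\subset\mathcal{Y}$. It is fundamental if its discriminant $D$ is a fundamental discriminant, i.e. the discriminant of the real quadratic field $\mathbb{Q}(\sqrt D)$. It is reciprocal if it is invariant under time reversal on $\mathcal{X}$ (replacing every tangent vector by its negative). *)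

theory Defs
  imports
    "HOL-Analysis.Analysis"
    "HOL-Computational_Algebra.Polynomial"
    "HOL-Library.Landau_Symbols"
begin

section \<open>The unit tangent bundle of the modular surface\<close>

definition SL2R :: "(real^2^2) set" where
  "SL2R = {g. det g = 1}"

definition SL2Z :: "(int^2^2) set" where
  "SL2Z = {\<gamma>. det \<gamma> = 1}"

definition real_mat :: "int^2^2 \<Rightarrow> real^2^2" where
  "real_mat \<gamma> = (\<chi> i j. real_of_int (\<gamma> $ i $ j))"

text \<open>
  Since \<open>-I\<close> lies in \<open>SL2Z\<close>, the coset spaces of \<open>PSL\<^sub>2(\<int>)\<close> in \<open>PSL\<^sub>2(\<real>)\<close> and of
  \<open>SL\<^sub>2(\<int>)\<close> in \<open>SL\<^sub>2(\<real>)\<close> coincide; we use the latter. The unit tangent bundle of the upper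
  half-plane is identified with \<open>PSL\<^sub>2(\<real>)\<close> by letting \<open>g\<close> correspond to the image under the
  isometry \<open>g\<close> of the upward unit vector at \<open>\<i>\<close>.
\<close>

definition coset :: "real^2^2 \<Rightarrow> (real^2^2) set" where
  "coset g = (\<lambda>\<gamma>. real_mat \<gamma> ** g) ` SL2Z"

definition modular_X :: "(real^2^2) set set" where
  "modular_X = coset ` SL2R"

definition X_topology :: "(real^2^2) set topology" where
  "X_topology = topology (\<lambda>U. U \<subseteq> modular_X \<and>
     openin (top_of_set SL2R) {g \<in> SL2R. coset g \<in> U})"

lemma openin_X_topology:
  "openin X_topology U \<longleftrightarrow>
     U \<subseteq> modular_X \<and> openin (top_of_set SL2R) {g \<in> SL2R. coset g \<in> U}"
proof -
  let ?L = "\<lambda>U. U \<subseteq> modular_X \<and> openin (top_of_set SL2R) {g \<in> SL2R. coset g \<in> U}"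
  have "istopology ?L"
    unfolding istopology_def
  proof (intro conjI allI impI)
    fix S T assume S: "?L S" and T: "?L T"
    show "S \<inter> T \<subseteq> modular_X" using S by blast
    have "{g \<in> SL2R. coset g \<in> S \<inter> T} =
        {g \<in> SL2R. coset g \<in> S} \<inter> {g \<in> SL2R. coset g \<in> T}" by blast
    then show "openin (top_of_set SL2R) {g \<in> SL2R. coset g \<in> S \<inter> T}"
      using openin_Int[OF conjunct2[OF S] conjunct2[OF T]] by simp
  next
    fix \<K> assume K: "\<forall>K\<in>\<K>. ?L K"
    show "\<Union>\<K> \<subseteq> modular_X" using K by blast
    have "{g \<in> SL2R. coset g \<in> \<Union>\<K>} = (\<Union>K\<in>\<K>. {g \<in> SL2R. coset g \<in> K})" by blast
    moreover have "openin (top_of_set SL2R) (\<Union>K\<in>\<K>. {g \<in> SL2R. coset g \<in> K})"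
      using K by (intro openin_Union) blast
    ultimately show "openin (top_of_set SL2R) {g \<in> SL2R. coset g \<in> \<Union>\<K>}" by simp
  qed
  then show ?thesis
    unfolding X_topology_def by (simp only: topology_inverse')
qed

lemma quotient_map_coset: "quotient_map (top_of_set SL2R) X_topology coset"
proof -
  have "{g \<in> SL2R. coset g \<in> modular_X} = SL2R" by (auto simp: modular_X_def)
  then have "openin X_topology modular_X"
    by (simp add: openin_X_topology)
  moreover have "topspace X_topology \<subseteq> modular_X"
    using openin_X_topology[of "topspace X_topology"] by simp
  ultimately have "topspace X_topology = modular_X"
    using openin_subset by blast
  then show ?thesis
    unfolding quotient_map_def by (simp add: openin_X_topology modular_X_def)
qed

section \<open>Geodesic flow and time reversal\<close>

text \<open>
  Under the identification above, flowing for time \<open>t\<close> along the unit-speed geodesic is right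
  multiplication by \<open>diag (exp (t/2)) (exp (-t/2))\<close>, and replacing a tangent vector by its
  negative is right multiplication by the rotation that fixes \<open>\<i>\<close> and turns its tangent space by
  the angle \<open>\<pi>\<close>. Right multiplication acts on a left coset elementwise.
\<close>

definition geod_mat :: "real \<Rightarrow> real^2^2" where
  "geod_mat t = vector [vector [exp (t/2), 0], vector [0, exp (-t/2)]]"

definition geod_flow :: "real \<Rightarrow> (real^2^2) set \<Rightarrow> (real^2^2) set" where
  "geod_flow t x = (\<lambda>g. g ** geod_mat t) ` x"

definition reversal_mat :: "real^2^2" where
  "reversal_mat = vector [vector [0, 1], vector [-1, 0]]"

definition time_reversal :: "(real^2^2) set \<Rightarrow> (real^2^2) set" where
  "time_reversal x = (\<lambda>g. g ** reversal_mat) ` x"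

definition geod_orbit :: "(real^2^2) set \<Rightarrow> (real^2^2) set set" where
  "geod_orbit x = range (\<lambda>s. geod_flow s x)"

text \<open>
  A closed geodesic is taken as a subset of \<open>modular_X\<close>; this carries the orientation but forgets
  multiplicities, so that every closed geodesic is primitive.
\<close>

definition closed_geodesics :: "(real^2^2) set set set" where
  "closed_geodesics = {geod_orbit x | x. x \<in> modular_X \<and> (\<exists>t>0. geod_flow t x = x)}"

definition low_lying :: "(real^2^2) set set \<Rightarrow> (real^2^2) set set \<Rightarrow> bool" where
  "low_lying Y C \<longleftrightarrow> C \<subseteq> Y"

definition reciprocal :: "(real^2^2) set set \<Rightarrow> bool" where
  "reciprocal C \<longleftrightarrow> time_reversal ` C = C"

section \<open>The conjugacy class and the trace of a closed geodesic\<close>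

definition mat_power :: "int^2^2 \<Rightarrow> nat \<Rightarrow> int^2^2" where
  "mat_power \<gamma> n = (((**) \<gamma>) ^^ n) (mat 1)"

definition hyperbolic :: "int^2^2 \<Rightarrow> bool" where
  "hyperbolic \<gamma> \<longleftrightarrow> \<bar>trace \<gamma>\<bar> > 2"

text \<open>
  Elements of \<open>PSL\<^sub>2(\<int>)\<close> are represented by elements of \<open>SL2Z\<close> up to sign. So \<open>primitive \<gamma>\<close>
  says that the class of \<open>\<gamma>\<close> in \<open>PSL\<^sub>2(\<int>)\<close> is not a proper power, and \<open>geod_class C\<close>
  consists of the representatives, of either sign, of the elements of the conjugacy class.
\<close>

definition primitive :: "int^2^2 \<Rightarrow> bool" where
  "primitive \<gamma> \<longleftrightarrow>
     \<not> (\<exists>\<delta>\<in>SL2Z. \<exists>n\<ge>2. \<gamma> = mat_power \<delta> n \<or> \<gamma> = - mat_power \<delta> n)"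

definition geod_class :: "(real^2^2) set set \<Rightarrow> (int^2^2) set" where
  "geod_class C = {\<gamma> \<in> SL2Z. hyperbolic \<gamma> \<and> primitive \<gamma> \<and>
     (\<exists>g\<in>SL2R. geod_orbit (coset g) = C \<and>
       (\<exists>t>0. real_mat \<gamma> ** g = g ** geod_mat t \<or> real_mat \<gamma> ** g = - (g ** geod_mat t)))}"

definition geod_trace :: "(real^2^2) set set \<Rightarrow> int" where
  "geod_trace C = (THE t. \<exists>\<gamma>\<in>geod_class C. t = \<bar>trace \<gamma>\<bar>)"

section \<open>Quadratic forms and the discriminant of a closed geodesic\<close>

text \<open>The triple \<open>(A, B, C)\<close> stands for the form \<open>A x\<^sup>2 + B x y + C y\<^sup>2\<close>.\<close>

definition form_disc :: "int \<times> int \<times> int \<Rightarrow> int" where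
  "form_disc = (\<lambda>(A, B, C). B^2 - 4 * A * C)"

text \<open>
  The fixed points of \<open>\<gamma> = (a b; c d)\<close> are the roots of \<open>c z\<^sup>2 + (d - a) z - b\<close>. The form of
  \<open>\<gamma>\<close> is the primitive form with these roots; the sign of the trace makes it depend only on the
  class of \<open>\<gamma>\<close> in \<open>PSL\<^sub>2(\<int>)\<close>.
\<close>

definition form_of :: "int^2^2 \<Rightarrow> int \<times> int \<times> int" where
  "form_of \<gamma> =
     (let a = \<gamma> $ 1 $ 1; b = \<gamma> $ 1 $ 2; c = \<gamma> $ 2 $ 1; d = \<gamma> $ 2 $ 2;
          u = gcd c (gcd (d - a) b); s = sgn (trace \<gamma>)
      in (s * (c div u), s * ((d - a) div u), s * (- b div u)))"

definition geod_forms :: "(real^2^2) set set \<Rightarrow> (int \<times> int \<times> int) set" where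
  "geod_forms C = form_of ` geod_class C"

definition geod_disc :: "(real^2^2) set set \<Rightarrow> int" where
  "geod_disc C = (THE D. \<exists>Q\<in>geod_forms C. D = form_disc Q)"

section \<open>Fundamental discriminants\<close>

definition quad_field :: "int \<Rightarrow> real set" where
  "quad_field D = {of_rat a + of_rat b * sqrt (of_int D) | a b. True}"

definition quad_conj :: "int \<Rightarrow> real \<Rightarrow> real" where
  "quad_conj D x = (THE y. \<exists>a b. x = of_rat a + of_rat b * sqrt (of_int D) \<and>
                               y = of_rat a - of_rat b * sqrt (of_int D))"

definition quad_integers :: "int \<Rightarrow> real set" where
  "quad_integers D = {x \<in> quad_field D. algebraic_int x}"

definition integral_basis :: "int \<Rightarrow> real \<Rightarrow> real \<Rightarrow> bool" where
  "integral_basis D \<alpha> \<beta> \<longleftrightarrow> \<alpha> \<in> quad_integers D \<and> \<beta> \<in> quad_integers D \<and>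
     (\<forall>x\<in>quad_integers D. \<exists>!(m, n). x = of_int m * \<alpha> + of_int n * \<beta>)"

text \<open>
  \<open>D\<close> equals the discriminant of the real quadratic field generated by its square root. The
  discriminant of a number field is the squared determinant of the matrix of all embeddings of an
  integral basis, and does not depend on the basis.
\<close>

definition fundamental_discriminant :: "int \<Rightarrow> bool" where
  "fundamental_discriminant D \<longleftrightarrow> D > 0 \<and> sqrt (of_int D) \<notin> \<rat> \<and>
     (\<exists>\<alpha> \<beta>. integral_basis D \<alpha> \<beta> \<and>
        of_int D = (\<alpha> * quad_conj D \<beta> - \<beta> * quad_conj D \<alpha>)^2)"

definition fundamental :: "(real^2^2) set set \<Rightarrow> bool" where
  "fundamental C \<longleftrightarrow> fundamental_discriminant (geod_disc C)"

end

(* For M in SL2(Z) the matrix M M^T is symmetric, hence diagonalised by a rotation k.  The quarter turn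
   lies in SL2(Z), commutes with k and inverts the geodesic flow, so the geodesic through k is reciprocal.  Its trace is
   t = |M|^2, the sum of the squared entries, and if t^2 - 4 is squarefree and t is odd, the geodesic
   has discriminant t^2 - 4, which is fundamental.  If M is a product of letters from a finite set of
   positive matrices, the geodesic stays in a compact set depending on the letters only.  It remains to
   find many t.

   Take M = A^T N B, where A and B are words of length k in the matrices of determinant 1 with bottom
   row in [R, 2R) and 0 < top row <= bottom row.  About R^2 such blocks exist and they form a prefix
   code; they are restricted to one residue class modulo Q = (64!)^2, and k to multiples of the order
   of that class.  N = U_1 L_(Qj) U_(Qi) L_(Qh) varies over parameters h, j, i <= (R!)^2, so
   t = |N|^2 = 3 modulo Q.  A square p^2 dividing t - 2 or t + 2 is excluded as follows.
   - p <= 64: impossible by the congruence.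
   - 64 < p <= R: for fixed A, B at most 8/p^2 of the parameters (h, j, i) are bad.
   - R < p, p^2 <= g^k, g the number of blocks: t - 2 = (a - d)^2 + (b + c)^2 is divisible by p^2
     iff (a, b; c, d) satisfies one of two linear conditions modulo p^2 or one modulo p.  Two
     matrices M, M h satisfying the same condition have p^2 | |h|^2 - 2.  So with fixed A any two
     admissible B "collide", and similarly for A; a bipartite graph with this property has at most
     as many edges as there are collisions.  These are counted by the Farey spacing of A, A h and
     the bound t^(o(1)) for the number of h in SL2(Z) with |h|^2 = t.
   - p^2 > g^k: few values t are possible, each having at most 16^k t^(o(1)) preimages.
   The last loss is X^(o(1)) because R is large compared to the implied constants. *)
theory Submission
  imports Defs "HOL-Number_Theory.Cong" "HOL-Computational_Algebra.Squarefree"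
    "HOL-Computational_Algebra.Polynomial_Factorial"
begin

subsection \<open>Two by two matrices\<close>

text \<open>Why crude counting suffices: there are \<open>g ^ (2 * k)\<close> pairs of words, at
  least \<open>(R^4 / F^2) ^ k\<close>; their traces lie below \<open>T k\<close>, a constant times
  \<open>(256 * R^4) ^ k\<close>, and each trace has few preimages. The traces thus fill this range
  up to factors constant^k, which for large \<open>R\<close> are small powers of
  \<open>R ^ k\<close>. So a sieve may lose constant^k, and no equidistribution of words modulo
  large primes is required: up to p^2 = \<open>g ^ k\<close> collisions lose little, and beyond it
  the trivial count of t in a class modulo p^2 already saves \<open>sqrt (g ^ k)\<close>, a full
  power. What must not be lost is the total over all primes, which has to stay below 1. The
  collision bound carries the constant \<open>C\<close>, so it is useful only for p >
  \<open>R\<close>. The middle matrix N exists for the primes below, where it gives an absolute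
  constant; even that is too large for the smallest primes, which are left to the congruence modulo
  \<open>Q\<close>. The geodesics stay low because positive letters expand the positive cone by
  bounded factors: from any point of the geodesic a suitable prefix of the word can be cancelled to
  return to bounded matrices.\<close>

definition mat22 :: "'a::zero \<Rightarrow> 'a \<Rightarrow> 'a \<Rightarrow> 'a \<Rightarrow> 'a^2^2" where
  "mat22 a b c d = vector [vector [a, b], vector [c, d]]"

lemma mat22_nth [simp]:
  "mat22 a b c d $ 1 $ 1 = a" "mat22 a b c d $ 1 $ 2 = b"
  "mat22 a b c d $ 2 $ 1 = c" "mat22 a b c d $ 2 $ 2 = d"
  by (simp_all add: mat22_def)

lemma mat22_eq_iff:
  "A = B \<longleftrightarrow> A $ 1 $ 1 = B $ 1 $ 1 \<and> A $ 1 $ 2 = B $ 1 $ 2 \<and>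
     A $ 2 $ 1 = B $ 2 $ 1 \<and> A $ 2 $ 2 = (B $ 2 $ 2 :: 'a)" for A B :: "'a^2^2"
  by (auto simp: vec_eq_iff forall_2)

lemma mat22_collapse: "mat22 (A $ 1 $ 1) (A $ 1 $ 2) (A $ 2 $ 1) (A $ 2 $ 2) = A"
  by (simp add: mat22_eq_iff)

lemma mult22_nth [simp]:
  fixes A B :: "'a::semiring_1^2^2"
  shows "(A ** B) $ 1 $ 1 = A $ 1 $ 1 * B $ 1 $ 1 + A $ 1 $ 2 * B $ 2 $ 1"
    "(A ** B) $ 1 $ 2 = A $ 1 $ 1 * B $ 1 $ 2 + A $ 1 $ 2 * B $ 2 $ 2"
    "(A ** B) $ 2 $ 1 = A $ 2 $ 1 * B $ 1 $ 1 + A $ 2 $ 2 * B $ 2 $ 1"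
    "(A ** B) $ 2 $ 2 = A $ 2 $ 1 * B $ 1 $ 2 + A $ 2 $ 2 * B $ 2 $ 2"
  by (simp_all add: matrix_matrix_mult_def sum_2)

lemma mat1_nth [simp]:
  "(mat 1 :: 'a::semiring_1^2^2) $ 1 $ 1 = 1" "(mat 1 :: 'a^2^2) $ 1 $ 2 = 0"
  "(mat 1 :: 'a^2^2) $ 2 $ 1 = 0" "(mat 1 :: 'a^2^2) $ 2 $ 2 = 1"
  by (simp_all add: mat_def)

lemma transpose22_nth [simp]:
  fixes A :: "'a^2^2"
  shows "transpose A $ i $ j = A $ j $ i"
  by (simp add: transpose_def)

lemma trace22: "trace (A :: 'a::comm_ring_1^2^2) = A $ 1 $ 1 + A $ 2 $ 2"
  by (simp add: trace_def sum_2)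

definition adj22 :: "'a::ab_group_add^2^2 \<Rightarrow> 'a^2^2" where
  "adj22 A = mat22 (A $ 2 $ 2) (- A $ 1 $ 2) (- A $ 2 $ 1) (A $ 1 $ 1)"

lemma adj22_nth [simp]:
  "adj22 A $ 1 $ 1 = A $ 2 $ 2" "adj22 A $ 1 $ 2 = - A $ 1 $ 2"
  "adj22 A $ 2 $ 1 = - A $ 2 $ 1" "adj22 A $ 2 $ 2 = A $ 1 $ 1"
  by (simp_all add: adj22_def)

lemma adj22_mult_left: "det A = 1 \<Longrightarrow> adj22 A ** A = mat 1" for A :: "'a::comm_ring_1^2^2"
  by (simp add: mat22_eq_iff det_2 algebra_simps)

lemma adj22_mult_right: "det A = 1 \<Longrightarrow> A ** adj22 A = mat 1" for A :: "'a::comm_ring_1^2^2"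
  by (simp add: mat22_eq_iff det_2 algebra_simps)

lemma det_adj22: "det (adj22 A) = det A" for A :: "'a::comm_ring_1^2^2"
  by (simp add: det_2 algebra_simps)

lemma adj22_cancel_left: "det A = 1 \<Longrightarrow> adj22 A ** (A ** B) = B" for A :: "'a::comm_ring_1^2^2"
  by (simp add: matrix_mul_assoc adj22_mult_left)

lemma cancel_adj22_left: "det A = 1 \<Longrightarrow> A ** (adj22 A ** B) = B" for A :: "'a::comm_ring_1^2^2"
  by (simp add: matrix_mul_assoc adj22_mult_right)

lemma mult22_left_cancel:
  "det A = 1 \<Longrightarrow> A ** B = A ** C \<longleftrightarrow> B = C" for A :: "'a::comm_ring_1^2^2"
  by (metis adj22_cancel_left)

lemma mult22_right_cancel:
  fixes A :: "'a::comm_ring_1^2^2"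
  assumes "det A = 1" shows "B ** A = C ** A \<longleftrightarrow> B = C"
  by (metis adj22_mult_right assms matrix_mul_assoc matrix_mul_rid)

definition nsq :: "int^2^2 \<Rightarrow> int" where
  "nsq A = (A $ 1 $ 1)^2 + (A $ 1 $ 2)^2 + (A $ 2 $ 1)^2 + (A $ 2 $ 2)^2"

lemma nsq_minus_2: "det A = 1 \<Longrightarrow> nsq A - 2 = (A $ 1 $ 1 - A $ 2 $ 2)^2 + (A $ 1 $ 2 + A $ 2 $ 1)^2"
  by (simp add: nsq_def det_2 power2_eq_square algebra_simps)

lemma nsq_plus_2: "det A = 1 \<Longrightarrow> nsq A + 2 = (A $ 1 $ 1 + A $ 2 $ 2)^2 + (A $ 1 $ 2 - A $ 2 $ 1)^2"
  by (simp add: nsq_def det_2 power2_eq_square algebra_simps)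

lemma nsq_ge_2: "det A = 1 \<Longrightarrow> nsq A \<ge> 2"
  using nsq_minus_2[of A] by (metis diff_ge_0_iff_ge sum_power2_ge_zero)

lemma trace_mult_transpose: "trace (A ** transpose A) = nsq A"
  by (simp add: trace22 nsq_def power2_eq_square)

subsection \<open>Divisors and sums of two squares\<close>

lemma card_le_fibres:
  assumes D: "finite D" "\<And>s. s \<in> S \<Longrightarrow> f s \<in> D"
    and fin: "finite S" and b: "\<And>e. e \<in> D \<Longrightarrow> card {s \<in> S. f s = e} \<le> b"
  shows "card S \<le> b * card D"
proof -
  have "S = (\<Union>e\<in>D. {s \<in> S. f s = e})" using D(2) by auto
  then have "card S \<le> (\<Sum>e\<in>D. card {s \<in> S. f s = e})"
    using card_UN_le[OF D(1), of "\<lambda>e. {s \<in> S. f s = e}"] by simp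
  also have "\<dots> \<le> (\<Sum>e\<in>D. b)" by (intro sum_mono b)
  finally show ?thesis by (simp add: mult.commute)
qed

section \<open>The divisor bound\<close>

lemma card_divisors_mult_prime_power:
  fixes p m a :: nat
  assumes "prime p" "m > 0"
  shows "card {d. d dvd p ^ a * m} \<le> (a + 1) * card {d. d dvd m}"
proof -
  have "{d. d dvd p ^ a * m} \<subseteq> (\<lambda>(i, e). p ^ i * e) ` ({..a} \<times> {d. d dvd m})"
  proof
    fix d assume "d \<in> {d. d dvd p ^ a * m}"
    then obtain d1 d2 where d: "d = d1 * d2" "d1 dvd p ^ a" "d2 dvd m"
      using division_decomp[of d "p ^ a" m] by auto
    then obtain i where "i \<le> a" "d1 = p ^ i"
      using divides_primepow_nat[OF assms(1)] by auto
    then show "d \<in> (\<lambda>(i, e). p ^ i * e) ` ({..a} \<times> {d. d dvd m})"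
      using d by auto
  qed
  then have "card {d. d dvd p ^ a * m} \<le> card ({..a} \<times> {d. d dvd m})"
    using assms(2) by (intro surj_card_le) auto
  then show ?thesis by (simp add: card_cartesian_product)
qed

text \<open>Strip off one prime power p^a at a time. It contributes the factor a + 1, which is at
  most \<open>(p ^ a) powr \<epsilon>\<close> unless p lies below a bound depending on \<epsilon>;
  each such small prime costs one constant \<open>B\<close>.\<close>

theorem card_divisors_bound:
  fixes \<epsilon> :: real
  assumes "\<epsilon> > 0"
  shows "\<exists>C\<ge>1. \<forall>n::nat. n \<ge> 1 \<longrightarrow> real (card {d. d dvd n}) \<le> C * real n powr \<epsilon>"
proof -
  \<comment> \<open>With this \<open>B\<close> one has a + 1 <= B * (1 + a * \<epsilon> * ln 2), and
    the bracket is at most \<open>(2 powr \<epsilon>) ^ a\<close>.\<close>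
  define B where "B = max 1 (1 / (\<epsilon> * ln 2))"
  have B1: "B \<ge> 1" by (simp add: B_def)
  have "B \<ge> 1 / (\<epsilon> * ln 2)" by (simp add: B_def)
  then have B2: "B * (\<epsilon> * ln 2) \<ge> 1"
    using assms by (simp add: field_simps)
  have B: "real (a + 1) \<le> B * (2 powr \<epsilon>) ^ a" for a :: nat
  proof -
    have "real (a + 1) \<le> B + real a * (B * (\<epsilon> * ln 2))"
      using B1 mult_left_mono[OF B2, of "real a"] by simp
    also have "\<dots> = B * (1 + real a * (\<epsilon> * ln 2))" by (simp add: algebra_simps)
    also have "\<dots> \<le> B * exp (real a * (\<epsilon> * ln 2))"
      using B1 by (intro mult_left_mono) auto
    also have "\<dots> = B * (2 powr \<epsilon>) ^ a"
      by (simp add: powr_def exp_of_nat_mult)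
    finally show ?thesis .
  qed
  obtain P :: nat where P: "real P \<ge> 2 powr (1 / \<epsilon>)" using real_arch_simple by blast
  have P': "real (a + 1) \<le> (real p powr \<epsilon>) ^ a" if "p \<ge> P" for p a :: nat
  proof -
    have "2 = (2 powr (1 / \<epsilon>)) powr \<epsilon>" using assms by (simp add: powr_powr)
    also have "\<dots> \<le> real p powr \<epsilon>" using P that assms by (intro powr_mono2) auto
    finally have "2 ^ a \<le> (real p powr \<epsilon>) ^ a" by (intro power_mono) auto
    moreover have "real (a + 1) \<le> 2 ^ a"
      by (metis Suc_eq_plus1 Suc_leI less_exp of_nat_le_iff of_nat_numeral of_nat_power)
    ultimately show ?thesis by linarith
  qed
  define sm where "sm n = {p::nat. prime p \<and> p dvd n \<and> p < P}" for n :: nat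
  have "n \<ge> 1 \<Longrightarrow> real (card {d. d dvd n}) \<le> B ^ card (sm n) * real n powr \<epsilon>" for n :: nat
  proof (induction n rule: less_induct)
    case (less n)
    show ?case
    proof (cases "n = 1")
      case True
      then have "{d. d dvd n} = {1}" by auto
      then have "card {d. d dvd n} = 1" by simp
      then show ?thesis using True B1 by simp
    next
      case False
      then obtain p where p: "prime p" "p dvd n" using prime_factor_nat by blast
      have n0: "n \<noteq> 0" using less.prems by simp
      have "\<not> is_unit p" using p(1) not_prime_unit by blast
      then obtain m where m: "n = p ^ multiplicity p n * m" "\<not> p dvd m"
        using multiplicity_decompose'[of n p] n0 by blast
      define a where "a = multiplicity p n"
      have n: "n = p ^ a * m" using m a_def by simp
      have a0: "a > 0" using p(2) n m(2) by (cases a) auto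
      have m0: "m > 0" using n n0 by (cases m) auto
      have "p ^ a > 1" using a0 p(1) by (meson one_less_power prime_gt_1_nat)
      then have "m < n" using n m0 by simp
      then have IH: "real (card {d. d dvd m}) \<le> B ^ card (sm m) * real m powr \<epsilon>"
        using less.IH m0 by auto
      have np: "real n powr \<epsilon> = (real p powr \<epsilon>) ^ a * real m powr \<epsilon>"
        using p(1) by (simp add: n powr_mult powr_power powr_realpow[symmetric] powr_powr
            prime_gt_0_nat mult.commute)
      have finm: "finite (sm k)" for k by (simp add: sm_def)
      have "real (card {d. d dvd n}) \<le> real (a + 1) * real (card {d. d dvd m})"
        using card_divisors_mult_prime_power[OF p(1) m0, of a] n
        by (metis of_nat_le_iff of_nat_mult)
      also have "\<dots> \<le> real (a + 1) * (B ^ card (sm m) * real m powr \<epsilon>)"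
        by (intro mult_left_mono IH) auto
      also have "\<dots> \<le> B ^ card (sm n) * real n powr \<epsilon>"
      proof (cases "p < P")
        case True
        have "insert p (sm m) \<subseteq> sm n" using True p n by (auto simp: sm_def)
        moreover have "p \<notin> sm m" using m(2) by (simp add: sm_def)
        ultimately have "card (sm m) + 1 \<le> card (sm n)"
          using card_mono[OF finm, of "insert p (sm m)" n] finm by simp
        then have "B ^ (card (sm m) + 1) \<le> B ^ card (sm n)"
          using B1 by (intro power_increasing) auto
        moreover have "real (a + 1) \<le> B * (real p powr \<epsilon>) ^ a"
        proof -
          have "(2 powr \<epsilon>) ^ a \<le> (real p powr \<epsilon>) ^ a"
            using prime_ge_2_nat[OF p(1)] assms by (intro power_mono powr_mono2) auto
          then show ?thesis using B[of a] B1
            by (meson mult_left_mono order_trans zero_le_one)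
        qed
        ultimately have "real (a + 1) * (B ^ card (sm m) * real m powr \<epsilon>)
            \<le> (B * (real p powr \<epsilon>) ^ a) * (B ^ card (sm m) * real m powr \<epsilon>)"
          using B1 by (intro mult_right_mono) auto
        also have "\<dots> = B ^ (card (sm m) + 1) * real n powr \<epsilon>"
          by (simp add: np)
        also have "\<dots> \<le> B ^ card (sm n) * real n powr \<epsilon>"
          using \<open>B ^ (card (sm m) + 1) \<le> B ^ card (sm n)\<close> by (intro mult_right_mono) auto
        finally show ?thesis .
      next
        case False
        have "sm m \<subseteq> sm n" using n by (auto simp: sm_def)
        then have "card (sm m) \<le> card (sm n)" by (rule card_mono[OF finm])
        then have le: "B ^ card (sm m) \<le> B ^ card (sm n)"
          using B1 by (intro power_increasing) auto
        have "real (a + 1) * (B ^ card (sm m) * real m powr \<epsilon>)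
            \<le> (real p powr \<epsilon>) ^ a * (B ^ card (sm n) * real m powr \<epsilon>)"
          using B1 P'[of p a] False le by (intro mult_mono) auto
        also have "\<dots> = B ^ card (sm n) * real n powr \<epsilon>" by (simp add: np)
        finally show ?thesis .
      qed
      finally show ?thesis .
    qed
  qed
  moreover have "B ^ card (sm n) \<le> B ^ P" for n
  proof -
    have "sm n \<subseteq> {..<P}" by (auto simp: sm_def)
    then have "card (sm n) \<le> P" using card_mono[of "{..<P}" "sm n"] by simp
    then show ?thesis using B1 by (intro power_increasing) auto
  qed
  ultimately have "real (card {d. d dvd n}) \<le> B ^ P * real n powr \<epsilon>" if "n \<ge> 1" for n :: nat
    using that by (meson mult_right_mono order_trans powr_ge_zero)
  moreover have "B ^ P \<ge> 1" using B1 by simp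
  ultimately show ?thesis by blast
qed

lemma finite_two_squares: "finite {(x::int, y). x^2 + y^2 = n}"
proof -
  have *: "\<bar>z\<bar> \<le> z^2" for z :: int
    using self_le_power[of "\<bar>z\<bar>" 2] by (cases "z = 0") auto
  have "\<bar>x\<bar> \<le> \<bar>n\<bar> \<and> \<bar>y\<bar> \<le> \<bar>n\<bar>" if "x^2 + y^2 = n" for x y :: int
    using that *[of x] *[of y] zero_le_power2[of x] zero_le_power2[of y] by linarith
  then have "s \<in> {- \<bar>n\<bar>..\<bar>n\<bar>} \<times> {- \<bar>n\<bar>..\<bar>n\<bar>}" if "s \<in> {(x, y). x^2 + y^2 = n}" for s
    using that by (cases s) (simp add: abs_le_iff minus_le_iff)
  then have "{(x::int, y). x^2 + y^2 = n} \<subseteq> {- \<bar>n\<bar>..\<bar>n\<bar>} \<times> {- \<bar>n\<bar>..\<bar>n\<bar>}"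
    by blast
  then show ?thesis by (rule finite_subset) auto
qed

text \<open>Read z = x + i y and z0 = x0 + i y0 as Gaussian integers. Up to sign, \<open>e\<close>
  divides the imaginary part of z times the conjugate of z0, and the complementary divisor
  \<open>f\<close> of n divides that of z times z0. If z and z' share the same \<open>e\<close>,
  then both \<open>e\<close> and \<open>f\<close> divide their cross product
  \<open>\<kappa>\<close>; as gcd e f divides 2, their product n divides
  \<open>2 * \<kappa>\<close>.\<close>

lemma cross_dvd:
  fixes n x y x' y' x0 y0 :: int
  assumes n: "n > 0" and z: "x^2 + y^2 = n" "x'^2 + y'^2 = n" "x0^2 + y0^2 = n"
    and cop: "coprime x y" "coprime x0 y0"
    and g: "gcd n (x * y0 - y * x0) = gcd n (x' * y0 - y' * x0)"
  shows "n dvd 2 * (x * y' - x' * y)"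
proof -
  define \<kappa> where "\<kappa> = x * y' - x' * y"
  have cop_sq: "coprime v (u^2 + v^2)" if "coprime u v" for u v :: int
  proof -
    have "gcd v (v * v + u^2) = gcd v (u^2)" by (rule gcd_add_mult)
    moreover have "coprime v (u^2)" using that by (simp add: coprime_commute)
    ultimately show ?thesis by (simp add: coprime_iff_gcd_eq_1 power2_eq_square add.commute)
  qed
  have c0: "coprime y0 n" using cop_sq[OF cop(2)] z by simp
  have cx: "coprime x n" using cop_sq[of y x] cop(1) z by (simp add: coprime_commute add.commute)
  define e where "e = gcd n (x * y0 - y * x0)"
  have e0: "e > 0" using n by (simp add: e_def)
  obtain f where f: "n = e * f" unfolding e_def by (meson dvdE gcd_dvd1)
  have half: "f dvd u * y0 + v * x0" if "u^2 + v^2 = n" "gcd n (u * y0 - v * x0) = e" for u v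
  proof -
    have uv: "u^2 + v^2 = n" "gcd n (u * y0 - v * x0) = e" using that by auto
    obtain w where w: "u * y0 - v * x0 = e * w" using uv(2) by (metis dvdE gcd_dvd2)
    have "coprime f w"
    proof -
      have "e * gcd f w = gcd (e * f) (e * w)" using e0 by (simp add: gcd_mult_left abs_mult)
      also have "\<dots> = e" using uv(2) w f by simp
      finally show ?thesis using e0 by (simp add: coprime_iff_gcd_eq_1)
    qed
    have "(u * y0 - v * x0) * (u * y0 + v * x0) = (u^2 + v^2) * y0^2 - v^2 * (x0^2 + y0^2)"
      by (simp add: algebra_simps power2_eq_square)
    also have "\<dots> = n * (y0^2 - v^2)" unfolding uv(1) z(3) by (simp add: algebra_simps)
    finally have "e * (w * (u * y0 + v * x0)) = e * (f * (y0^2 - v^2))"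
      using w f by (simp add: mult.assoc)
    then have "w * (u * y0 + v * x0) = f * (y0^2 - v^2)" using e0 by simp
    then have "f dvd w * (u * y0 + v * x0)" by simp
    then show ?thesis using \<open>coprime f w\<close> by (simp add: coprime_dvd_mult_right_iff)
  qed
  have e1: "e dvd x * y0 - y * x0" "e dvd x' * y0 - y' * x0"
    unfolding e_def by simp (simp add: g)
  have f1: "f dvd x * y0 + y * x0" "f dvd x' * y0 + y' * x0"
    using half[of x y] half[of x' y'] z g e_def by auto
  have ce: "coprime e y0" "coprime f y0" "coprime e x"
    using c0 cx f by (auto simp: coprime_commute)
  have "y0 * \<kappa> = y' * (x * y0 - y * x0) - y * (x' * y0 - y' * x0)"
    by (simp add: \<kappa>_def algebra_simps)
  then have "e dvd y0 * \<kappa>" using e1 by simp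
  then have ek: "e dvd \<kappa>" using ce by (simp add: coprime_dvd_mult_right_iff)
  have "y0 * \<kappa> = y' * (x * y0 + y * x0) - y * (x' * y0 + y' * x0)"
    by (simp add: \<kappa>_def algebra_simps)
  then have "f dvd y0 * \<kappa>" using f1 by simp
  then have fk: "f dvd \<kappa>" using ce by (simp add: coprime_dvd_mult_right_iff)
  have "gcd e f dvd (x * y0 - y * x0) + (x * y0 + y * x0)"
    using e1(1) f1(1) by (meson dvd_add dvd_trans gcd_dvd1 gcd_dvd2)
  then have "gcd e f dvd x * (y0 * 2)" by (simp add: algebra_simps)
  moreover have "coprime (gcd e f) x" "coprime (gcd e f) y0"
    using ce by (meson coprime_divisors dvd_refl gcd_dvd1)+
  ultimately have g2: "gcd e f dvd 2" by (simp add: coprime_dvd_mult_right_iff)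
  have "e * f dvd gcd (\<kappa> * f) (\<kappa> * e)"
    using ek fk by (simp add: mult_dvd_mono mult.commute)
  then have "e * f dvd \<kappa> * gcd f e" by (metis gcd_mult_left dvd_abs_iff abs_mult abs_gcd_int dvd_normalize_iff normalize_mult normalize_gcd)
  then show ?thesis using g2 f unfolding \<kappa>_def[symmetric]
    by (metis dvd_trans gcd.commute mult.commute mult_dvd_mono dvd_refl)
qed

text \<open>Relative to one fixed primitive point, the divisors of n index the fibres. Inside a
  fibre the cross product with a second fixed point is one of five multiples of n / 2, and the dot
  product is then known up to sign: 5 * 2 = 10 points.\<close>

lemma card_coprime_two_squares:
  fixes n :: nat
  assumes "n \<ge> 1"
  shows "card {(x::int, y). x^2 + y^2 = int n \<and> coprime x y} \<le> 10 * card {d. d dvd n}"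
proof -
  let ?S = "{(x::int, y). x^2 + y^2 = int n \<and> coprime x y}"
  have fin: "finite ?S"
    by (rule finite_subset[OF _ finite_two_squares[of "int n"]]) auto
  show ?thesis
  proof (cases "?S = {}")
    case False
    then obtain x0 y0 where z0: "x0^2 + y0^2 = int n" "coprime x0 y0" by auto
    define f where "f = (\<lambda>(x, y). nat (gcd (int n) (x * y0 - y * x0)))"
    show ?thesis
    proof (rule card_le_fibres[where f = f])
      show "finite {d. d dvd n}" using assms by simp
      show "f s \<in> {d. d dvd n}" for s
        by (auto simp: f_def split: prod.splits)
           (metis gcd_dvd1 gcd_ge_0_int int_nat_eq int_dvd_int_iff)
      show "finite ?S" by (rule fin)
    next
      fix e assume "e \<in> {d. d dvd n}"
      let ?F = "{s \<in> ?S. f s = e}"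
      show "card ?F \<le> 10"
      proof (cases "?F = {}")
        case True
        then show ?thesis by (metis card.empty zero_le)
      next
        case False
        then obtain x y where xy: "x^2 + y^2 = int n" "coprime x y" "f (x, y) = e" by auto
        define h where "h = (\<lambda>(x', y'). (2 * (x * y' - x' * y) div int n, x * x' + y * y' \<ge> 0))"
        have key: "int n * (2 * (x * y' - x' * y) div int n) = 2 * (x * y' - x' * y)"
          "2 * (x * y' - x' * y) div int n \<in> {-2..2}"
          "(x * y' - x' * y)^2 + (x * x' + y * y')^2 = (int n)^2"
          if "(x', y') \<in> ?F" for x' y'
        proof -
          have z: "x'^2 + y'^2 = int n" using that by auto
          have "gcd (int n) (x * y0 - y * x0) = gcd (int n) (x' * y0 - y' * x0)"
            using that xy(3) by (simp add: f_def) (metis gcd_ge_0_int nat_0_le)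
          then have "int n dvd 2 * (x * y' - x' * y)"
            using cross_dvd[of "int n" x y x' y' x0 y0] xy z z0 assms by auto
          then show 1: "int n * (2 * (x * y' - x' * y) div int n) = 2 * (x * y' - x' * y)"
            by simp
          have "(x * y' - x' * y)^2 + (x * x' + y * y')^2 = (x^2 + y^2) * (x'^2 + y'^2)"
            by (simp add: algebra_simps power2_eq_square)
          then show 2: "(x * y' - x' * y)^2 + (x * x' + y * y')^2 = (int n)^2"
            using xy z by (simp add: power2_eq_square)
          let ?m = "2 * (x * y' - x' * y) div int n"
          have "(int n * ?m)^2 \<le> 4 * (int n)^2"
            unfolding 1 power_mult_distrib using 2[symmetric] by simp
          then have "?m^2 \<le> 2^2" using assms by (simp add: power_mult_distrib)
          then have "\<bar>?m\<bar> \<le> 2" using abs_le_square_iff[of ?m 2] by simp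
          then show "?m \<in> {-2..2}" by auto
        qed
        have "inj_on h ?F"
        proof (rule inj_onI)
          fix s s' assume s: "s \<in> ?F" "s' \<in> ?F" and hs: "h s = h s'"
          obtain u v u' v' where uv: "s = (u, v)" "s' = (u', v')" by (metis surj_pair)
          have "2 * (x * v - u * y) div int n = 2 * (x * v' - u' * y) div int n"
            using hs uv by (simp add: h_def)
          then have "2 * (x * v - u * y) = 2 * (x * v' - u' * y)"
            using key(1)[OF s(1)[unfolded uv]] key(1)[OF s(2)[unfolded uv]] by metis
          then have cr: "x * v - u * y = x * v' - u' * y" by simp
          have "(x * u + y * v)^2 = (x * u' + y * v')^2"
            using key(3)[OF s(1)[unfolded uv]] key(3)[OF s(2)[unfolded uv]] cr by simp
          moreover have "(x * u + y * v \<ge> 0) = (x * u' + y * v' \<ge> 0)"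
            using hs uv by (simp add: h_def)
          ultimately have dt: "x * u + y * v = x * u' + y * v'"
            unfolding power2_eq_iff by linarith
          have "int n * u = x * (x * u + y * v) - y * (x * v - u * y)"
            by (simp add: xy(1)[symmetric] algebra_simps power2_eq_square)
          also have "\<dots> = int n * u'"
            unfolding cr dt by (simp add: xy(1)[symmetric] algebra_simps power2_eq_square)
          finally have "u = u'" using assms by simp
          have "int n * v = y * (x * u + y * v) + x * (x * v - u * y)"
            by (simp add: xy(1)[symmetric] algebra_simps power2_eq_square)
          also have "\<dots> = int n * v'"
            unfolding cr dt by (simp add: xy(1)[symmetric] algebra_simps power2_eq_square)
          finally have "v = v'" using assms by simp
          then show "s = s'" using \<open>u = u'\<close> uv by simp
        qed
        moreover have "h ` ?F \<subseteq> {-2..2} \<times> (UNIV :: bool set)"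
          using key(2) by (fastforce simp: h_def)
        ultimately have "card ?F \<le> card ({-2..2::int} \<times> (UNIV :: bool set))"
          by (intro card_inj_on_le[of h]) auto
        also have "\<dots> = 10" by (simp add: card_cartesian_product)
        finally show ?thesis .
      qed
    qed
  next
    case True
    then show ?thesis by (metis card.empty zero_le)
  qed
qed

lemma card_two_squares:
  fixes n :: nat
  assumes "n \<ge> 1"
  shows "card {(x::int, y). x^2 + y^2 = int n} \<le> 10 * (card {d. d dvd n})^2"
proof -
  let ?S = "{(x::int, y). x^2 + y^2 = int n}"
  have "card ?S \<le> (10 * card {d. d dvd n}) * card {d. d dvd n}"
  proof (rule card_le_fibres[where f = "\<lambda>(x, y). nat (gcd x y)"])
    show "finite {d. d dvd n}" using assms by simp
    show fin: "finite ?S" by (rule finite_two_squares)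
    show "(case s of (x, y) \<Rightarrow> nat (gcd x y)) \<in> {d. d dvd n}" if "s \<in> ?S" for s
    proof -
      obtain x y where s: "s = (x, y)" by (metis surj_pair)
      have "gcd x y dvd x^2 + y^2" by (simp add: power2_eq_square)
      then have "gcd x y dvd int n" using that s by simp
      then show ?thesis using s by (simp add: nat_dvd_iff)
    qed
    fix e assume e: "e \<in> {d. d dvd n}"
    then have e0: "e > 0" using assms by (auto intro: Nat.gr0I)
    let ?F = "{s \<in> ?S. (case s of (x, y) \<Rightarrow> nat (gcd x y)) = e}"
    show "card ?F \<le> 10 * card {d. d dvd n}"
    proof (cases "?F = {}")
      case True
      then show ?thesis by (metis card.empty zero_le)
    next
      case False
      have ex: "\<exists>u v. x = int e * u \<and> y = int e * v \<and> coprime u v \<and> u^2 + v^2 = int (n div e^2)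
          \<and> e^2 dvd n" if "(x, y) \<in> ?F" for x y
      proof -
        have g: "gcd x y = int e" using that e0 by auto
        then have "gcd x y \<noteq> 0" using e0 by simp
        then obtain u v where uv: "x = u * gcd x y" "y = v * gcd x y" "coprime u v"
          using gcd_coprime_exists[of x y] by auto
        have xy: "x = u * int e" "y = v * int e" using uv g by simp_all
        have "int n = x^2 + y^2" using that by simp
        also have "\<dots> = int (e^2) * (u^2 + v^2)"
          unfolding xy by (simp add: power_mult_distrib algebra_simps)
        finally have n: "int n = int (e^2) * (u^2 + v^2)" .
        then have d: "e^2 dvd n" by (metis dvd_triv_left int_dvd_int_iff)
        then have "int n = int (e^2) * int (n div e^2)"
          by (metis dvd_mult_div_cancel of_nat_mult)
        then have "u^2 + v^2 = int (n div e^2)" using n e0 by simp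
        then show ?thesis using uv(3) xy d by (metis mult.commute)
      qed
      obtain x y where "(x, y) \<in> ?F" using False by (metis (no_types, lifting) ex_in_conv surj_pair)
      then have d: "e^2 dvd n" using ex by blast
      define m where "m = n div e^2"
      have n_eq: "n = e^2 * m" using d by (simp add: m_def)
      have m: "m \<ge> 1" "m dvd n" using n_eq assms dvd_triv_right[of m "e^2"] by (cases m; simp)+
      have "?F \<subseteq> (\<lambda>(u, v). (int e * u, int e * v)) ` {(x::int, y). x^2 + y^2 = int m \<and> coprime x y}"
      proof
        fix s assume "s \<in> ?F"
        moreover obtain x y where s: "s = (x, y)" by (metis surj_pair)
        ultimately obtain u v where "x = int e * u" "y = int e * v" "coprime u v"
          "u^2 + v^2 = int m" using ex m_def by blast
        then show "s \<in> (\<lambda>(u, v). (int e * u, int e * v)) `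
            {(x::int, y). x^2 + y^2 = int m \<and> coprime x y}" using s by force
      qed
      then have "card ?F \<le> card {(x::int, y). x^2 + y^2 = int m \<and> coprime x y}"
        by (intro surj_card_le finite_subset[OF _ finite_two_squares[of "int m"]]) auto
      also have "\<dots> \<le> 10 * card {d. d dvd m}" by (rule card_coprime_two_squares[OF m(1)])
      also have "\<dots> \<le> 10 * card {d. d dvd n}"
        using m(2) assms by (intro mult_left_mono card_mono) (auto intro: dvd_trans)
      finally show ?thesis .
    qed
  qed
  then show ?thesis by (simp add: power2_eq_square)
qed

text \<open>The shift to \<open>n + 1\<close> admits n = 0, which occurs below as t - 2 for t =
  2.\<close>

theorem two_squares_bound:
  fixes \<epsilon> :: real
  assumes "\<epsilon> > 0"
  shows "\<exists>C\<ge>1. \<forall>n::int. n \<ge> 0 \<longrightarrow>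
    real (card {(x::int, y). x^2 + y^2 = n}) \<le> C * real_of_int (n + 1) powr \<epsilon>"
proof -
  obtain C where C: "C \<ge> 1" "\<And>n::nat. n \<ge> 1 \<Longrightarrow> real (card {d. d dvd n}) \<le> C * real n powr (\<epsilon> / 2)"
    using card_divisors_bound[of "\<epsilon> / 2"] assms by auto
  have "real (card {(x::int, y). x^2 + y^2 = n}) \<le> (10 * C^2) * real_of_int (n + 1) powr \<epsilon>"
    if "n \<ge> 0" for n :: int
  proof (cases "n = 0")
    case True
    then have "{(x::int, y). x^2 + y^2 = n} = {(0, 0)}" by (auto simp: sum_power2_eq_zero_iff)
    then have "card {(x::int, y). x^2 + y^2 = n} = 1" by simp
    moreover have "C^2 \<ge> 1" using C(1) by simp
    ultimately show ?thesis using True by simp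
  next
    case False
    define m where "m = nat n"
    have m: "m \<ge> 1" "n = int m" using False that by (auto simp: m_def)
    have "real (card {(x::int, y). x^2 + y^2 = n}) \<le> 10 * (real (card {d. d dvd m}))^2"
      using card_two_squares[OF m(1)] m(2) by (simp flip: of_nat_power add: of_nat_le_iff)
    also have "\<dots> \<le> 10 * (C * real m powr (\<epsilon> / 2))^2"
      using C(2)[OF m(1)] by (intro mult_left_mono power_mono) auto
    also have "\<dots> = 10 * C^2 * real m powr \<epsilon>"
      using m(1) by (simp add: power_mult_distrib powr_power)
    also have "\<dots> \<le> 10 * C^2 * real_of_int (n + 1) powr \<epsilon>"
      using m assms by (intro mult_left_mono powr_mono2) auto
    finally show ?thesis .
  qed
  moreover have "10 * C^2 \<ge> 1" using one_le_power[OF C(1), of 2] by simp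
  ultimately show ?thesis by blast
qed

section \<open>Integral matrices of determinant 1 and given norm\<close>

lemma finite_nsq: "finite {A. nsq A \<le> n}"
proof -
  have "A \<in> (\<lambda>(a, b, c, d). mat22 a b c d) ` ({-\<bar>n\<bar>..\<bar>n\<bar>} \<times> {-\<bar>n\<bar>..\<bar>n\<bar>} \<times> {-\<bar>n\<bar>..\<bar>n\<bar>} \<times> {-\<bar>n\<bar>..\<bar>n\<bar>})"
    if "nsq A \<le> n" for A
  proof -
    have *: "\<bar>z\<bar> \<le> z^2" for z :: int
      using self_le_power[of "\<bar>z\<bar>" 2] by (cases "z = 0") auto
    have "\<bar>A $ 1 $ 1\<bar> \<le> \<bar>n\<bar>" "\<bar>A $ 1 $ 2\<bar> \<le> \<bar>n\<bar>" "\<bar>A $ 2 $ 1\<bar> \<le> \<bar>n\<bar>" "\<bar>A $ 2 $ 2\<bar> \<le> \<bar>n\<bar>"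
      using that *[of "A $ 1 $ 1"] *[of "A $ 1 $ 2"] *[of "A $ 2 $ 1"] *[of "A $ 2 $ 2"]
        zero_le_power2[of "A $ 1 $ 1"] zero_le_power2[of "A $ 1 $ 2"]
        zero_le_power2[of "A $ 2 $ 1"] zero_le_power2[of "A $ 2 $ 2"]
      unfolding nsq_def by linarith+
    then show ?thesis
      by (intro image_eqI[where x = "(A $ 1 $ 1, A $ 1 $ 2, A $ 2 $ 1, A $ 2 $ 2)"])
         (auto simp: mat22_collapse abs_le_iff)
  qed
  then have "{A. nsq A \<le> n} \<subseteq> (\<lambda>(a, b, c, d). mat22 a b c d) ` ({-\<bar>n\<bar>..\<bar>n\<bar>} \<times> {-\<bar>n\<bar>..\<bar>n\<bar>} \<times> {-\<bar>n\<bar>..\<bar>n\<bar>} \<times> {-\<bar>n\<bar>..\<bar>n\<bar>})"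
    by blast
  then show ?thesis by (rule finite_subset) simp
qed

text \<open>By \<open>nsq_minus_2\<close> and \<open>nsq_plus_2\<close> a matrix is encoded by one
  representation of t - 2 and one of t + 2 as a sum of two squares, and both numbers have few
  representations.\<close>

theorem card_nsq_bound:
  fixes \<epsilon> :: real
  assumes "\<epsilon> > 0"
  shows "\<exists>C\<ge>1. \<forall>t::int. t \<ge> 2 \<longrightarrow>
    real (card {A. det A = 1 \<and> nsq A = t}) \<le> C * real_of_int t powr \<epsilon>"
proof -
  obtain C where C: "C \<ge> 1" "\<And>n::int. n \<ge> 0 \<Longrightarrow>
      real (card {(x::int, y). x^2 + y^2 = n}) \<le> C * real_of_int (n + 1) powr (\<epsilon> / 2)"
    using two_squares_bound[of "\<epsilon> / 2"] assms by auto
  have "real (card {A. det A = 1 \<and> nsq A = t}) \<le> (C^2 * 3 powr (\<epsilon> / 2)) * real_of_int t powr \<epsilon>"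
    if t: "t \<ge> 2" for t :: int
  proof -
    define h where "h = (\<lambda>A::int^2^2. ((A $ 1 $ 1 - A $ 2 $ 2, A $ 1 $ 2 + A $ 2 $ 1),
      (A $ 1 $ 1 + A $ 2 $ 2, A $ 1 $ 2 - A $ 2 $ 1)))"
    let ?r = "\<lambda>n. {(x::int, y). x^2 + y^2 = n}"
    have "inj_on h {A. det A = 1 \<and> nsq A = t}"
      by (rule inj_onI) (auto simp: h_def mat22_eq_iff)
    moreover have "h ` {A. det A = 1 \<and> nsq A = t} \<subseteq> ?r (t - 2) \<times> ?r (t + 2)"
    proof safe
      fix A :: "int^2^2" and u v x y :: int
      assume A: "det A = 1" and h: "((u, v), (x, y)) = h A" and t: "t = nsq A"
      show "u^2 + v^2 = nsq A - 2" using nsq_minus_2[OF A] h by (simp add: h_def)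
      show "x^2 + y^2 = nsq A + 2" using nsq_plus_2[OF A] h by (simp add: h_def)
    qed
    ultimately have "card {A. det A = 1 \<and> nsq A = t} \<le> card (?r (t - 2) \<times> ?r (t + 2))"
      by (intro card_inj_on_le[of h] finite_cartesian_product finite_two_squares)
    then have "real (card {A. det A = 1 \<and> nsq A = t}) \<le> real (card (?r (t - 2))) * real (card (?r (t + 2)))"
      unfolding card_cartesian_product by (simp flip: of_nat_mult)
    also have "\<dots> \<le> (C * real_of_int (t - 2 + 1) powr (\<epsilon> / 2)) * (C * real_of_int (t + 2 + 1) powr (\<epsilon> / 2))"
      using C(1) t by (intro mult_mono C(2)) auto
    also have "\<dots> \<le> (C * real_of_int t powr (\<epsilon> / 2)) * (C * (3 * real_of_int t) powr (\<epsilon> / 2))"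
      using C(1) t assms by (intro mult_mono mult_left_mono powr_mono2) auto
    also have "\<dots> = (C^2 * 3 powr (\<epsilon> / 2)) * (real_of_int t powr (\<epsilon> / 2) * real_of_int t powr (\<epsilon> / 2))"
      using t by (simp add: powr_mult power2_eq_square)
    also have "\<dots> = (C^2 * 3 powr (\<epsilon> / 2)) * real_of_int t powr \<epsilon>"
      by (simp flip: powr_add)
    finally show ?thesis .
  qed
  moreover have "C^2 * 3 powr (\<epsilon> / 2) \<ge> 1"
    using one_le_power[OF C(1), of 2] ge_one_powr_ge_zero[of 3 "\<epsilon> / 2"] assms
    by (intro mult_ge1_I) auto
  ultimately show ?thesis by blast
qed

subsection \<open>Counting fractions\<close>

text \<open>Distinct reduced fractions with denominators at most \<open>L\<close> are at least 1 /
  L^2 apart, so scaling by \<open>L^2\<close> and taking floors is injective.\<close>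

lemma card_fractions:
  fixes V :: "(int \<times> int) set" and \<alpha> \<delta> L :: real
  assumes V: "\<And>c d. (c, d) \<in> V \<Longrightarrow> c \<ge> 1 \<and> real_of_int c \<le> L \<and> coprime c d
      \<and> \<alpha> \<le> real_of_int d / real_of_int c \<and> real_of_int d / real_of_int c \<le> \<alpha> + \<delta>"
    and L: "L \<ge> 1" and \<delta>: "\<delta> \<ge> 0"
  shows "finite V" "real (card V) \<le> 1 + \<delta> * L^2"
proof -
  define h where "h = (\<lambda>(c::int, d::int). \<lfloor>(real_of_int d / real_of_int c - \<alpha>) * L^2\<rfloor>)"
  have inj: "inj_on h V"
  proof (rule inj_onI)
    fix s s' assume s: "s \<in> V" "s' \<in> V" and eq: "h s = h s'"
    obtain c d c' d' where cd: "s = (c, d)" "s' = (c', d')" by (metis surj_pair)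
    have c: "c \<ge> 1" "real_of_int c \<le> L" "coprime c d" and c': "c' \<ge> 1" "real_of_int c' \<le> L" "coprime c' d'"
      using V s cd by auto
    define \<Delta> where "\<Delta> = real_of_int (d * c' - d' * c)"
    have pos: "real_of_int (c * c') > 0" using c c' by simp
    have "\<bar>(real_of_int d / real_of_int c - \<alpha>) * L^2 - (real_of_int d' / real_of_int c' - \<alpha>) * L^2\<bar> < 1"
      using eq unfolding cd h_def prod.case by linarith
    moreover have "(real_of_int d / real_of_int c - \<alpha>) * L^2 - (real_of_int d' / real_of_int c' - \<alpha>) * L^2
        = \<Delta> / real_of_int (c * c') * L^2"
      using c c' by (simp add: field_simps \<Delta>_def)
    ultimately have "\<bar>\<Delta>\<bar> / real_of_int (c * c') * L^2 < 1"
      using pos by (metis abs_divide abs_mult abs_of_pos abs_power2)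
    moreover have "real_of_int (c * c') \<le> L^2"
      using mult_mono[OF c(2) c'(2)] c c' by (simp add: power2_eq_square)
    then have "\<bar>\<Delta>\<bar> / real_of_int (c * c') * real_of_int (c * c') \<le> \<bar>\<Delta>\<bar> / real_of_int (c * c') * L^2"
      using pos by (intro mult_left_mono) auto
    ultimately have "\<bar>\<Delta>\<bar> / real_of_int (c * c') * real_of_int (c * c') < 1" by linarith
    moreover have "\<bar>\<Delta>\<bar> / real_of_int (c * c') * real_of_int (c * c') = \<bar>\<Delta>\<bar>"
      using pos by (metis less_irrefl nonzero_eq_divide_eq)
    ultimately have "\<bar>\<Delta>\<bar> < 1" by simp
    then have "\<bar>d * c' - d' * c\<bar> < 1" unfolding \<Delta>_def by linarith
    then have e: "d * c' = d' * c" by linarith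
    then have "c dvd c'" using c(3) by (metis coprime_dvd_mult_right_iff dvd_triv_right)
    moreover have "c' dvd c" using c'(3) e by (metis coprime_dvd_mult_right_iff dvd_triv_right)
    ultimately have "c = c'" using c c' by (simp add: zdvd_antisym_nonneg)
    then show "s = s'" using e c cd by simp
  qed
  have sub: "h ` V \<subseteq> {0..\<lfloor>\<delta> * L^2\<rfloor>}"
  proof clarify
    fix c d assume "(c, d) \<in> V"
    then have "0 \<le> real_of_int d / real_of_int c - \<alpha>" "real_of_int d / real_of_int c - \<alpha> \<le> \<delta>"
      using V by force+
    then have "0 \<le> (real_of_int d / real_of_int c - \<alpha>) * L^2"
      "(real_of_int d / real_of_int c - \<alpha>) * L^2 \<le> \<delta> * L^2"
      by (auto intro: mult_right_mono)
    then show "h (c, d) \<in> {0..\<lfloor>\<delta> * L^2\<rfloor>}" unfolding h_def by (simp add: floor_mono)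
  qed
  show "finite V" using finite_imageD[OF finite_subset[OF sub] inj] by simp
  have "card V = card (h ` V)" using card_image[OF inj] by simp
  also have "\<dots> \<le> card {0..\<lfloor>\<delta> * L^2\<rfloor>}" by (rule card_mono[OF _ sub]) simp
  finally have "real (card V) \<le> real (nat (\<lfloor>\<delta> * L^2\<rfloor> + 1))" by simp
  also have "\<dots> = real_of_int \<lfloor>\<delta> * L^2\<rfloor> + 1" using \<delta> by simp
  finally show "real (card V) \<le> 1 + \<delta> * L^2" by linarith
qed

subsection \<open>Admissible matrices\<close>

text \<open>The shape of a product of blocks: the bottom row dominates the top row, and its entries
  agree up to the factor \<open>L / l\<close>. All counting goes through the bottom row, which
  determines the matrix.\<close>

definition adm :: "real \<Rightarrow> real \<Rightarrow> int^2^2 \<Rightarrow> bool" where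
  "adm l L A \<longleftrightarrow> det A = 1 \<and> 0 \<le> A $ 1 $ 1 \<and> A $ 1 $ 1 \<le> A $ 2 $ 1 \<and> 0 \<le> A $ 1 $ 2 \<and> A $ 1 $ 2 \<le> A $ 2 $ 2
     \<and> l \<le> real_of_int (A $ 2 $ 1) \<and> real_of_int (A $ 2 $ 1) \<le> L
     \<and> l \<le> real_of_int (A $ 2 $ 2) \<and> real_of_int (A $ 2 $ 2) \<le> L"

lemma adm_det: "adm l L A \<Longrightarrow> det A = 1"
  by (simp add: adm_def)

lemma adm_bounds:
  assumes "adm l L A" "l \<ge> 1"
  shows "A $ 1 $ 1 \<ge> 1" "A $ 1 $ 1 \<le> A $ 2 $ 1" "A $ 1 $ 2 \<ge> 0" "A $ 1 $ 2 \<le> A $ 2 $ 2"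
    "A $ 2 $ 1 \<ge> 1" "A $ 2 $ 2 \<ge> 1"
proof -
  have A: "A $ 1 $ 1 * A $ 2 $ 2 - A $ 1 $ 2 * A $ 2 $ 1 = 1" "0 \<le> A $ 1 $ 1" "0 \<le> A $ 1 $ 2"
    using assms(1) by (auto simp: adm_def det_2)
  show b: "A $ 1 $ 1 \<le> A $ 2 $ 1" "A $ 1 $ 2 \<ge> 0" "A $ 1 $ 2 \<le> A $ 2 $ 2"
    using assms(1) by (auto simp: adm_def)
  have "real_of_int (A $ 2 $ 1) \<ge> 1" "real_of_int (A $ 2 $ 2) \<ge> 1"
    using assms by (auto simp: adm_def)
  then show c: "A $ 2 $ 1 \<ge> 1" "A $ 2 $ 2 \<ge> 1" by simp_all
  have "A $ 1 $ 2 * A $ 2 $ 1 \<ge> 0" using A(3) c by simp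
  then have "A $ 1 $ 1 \<noteq> 0" using A(1) by auto
  then show "A $ 1 $ 1 \<ge> 1" using A(2) by simp
qed

lemma adm_coprime: "adm l L A \<Longrightarrow> coprime (A $ 2 $ 1) (A $ 2 $ 2)"
proof -
  assume "adm l L A"
  then have A: "A $ 1 $ 1 * A $ 2 $ 2 - A $ 1 $ 2 * A $ 2 $ 1 = 1" by (simp add: adm_def det_2)
  show ?thesis
  proof (rule coprimeI)
    fix k assume "k dvd A $ 2 $ 1" "k dvd A $ 2 $ 2"
    then have "k dvd A $ 1 $ 1 * A $ 2 $ 2 - A $ 1 $ 2 * A $ 2 $ 1" by simp
    then show "is_unit k" unfolding A .
  qed
qed

text \<open>Two completions of the same bottom row differ by a multiple of it. The top left entry
  lies between 1 and the entry below it, which leaves one choice.\<close>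

lemma adm_eqI:
  assumes "adm l L A" "adm l L B" "l \<ge> 1" "A $ 2 $ 1 = B $ 2 $ 1" "A $ 2 $ 2 = B $ 2 $ 2"
  shows "A = B"
proof -
  note a = adm_bounds[OF assms(1,3)] and b = adm_bounds[OF assms(2,3)]
  have "(A $ 1 $ 1 - B $ 1 $ 1) * A $ 2 $ 2 = (A $ 1 $ 2 - B $ 1 $ 2) * A $ 2 $ 1"
    using adm_det[OF assms(1)] adm_det[OF assms(2)] assms(4,5) by (simp add: det_2 algebra_simps)
  then have "A $ 2 $ 1 dvd A $ 1 $ 1 - B $ 1 $ 1"
    using adm_coprime[OF assms(1)] by (metis coprime_dvd_mult_left_iff dvd_triv_right)
  moreover have "\<bar>A $ 1 $ 1 - B $ 1 $ 1\<bar> < A $ 2 $ 1" using a b assms(4) by linarith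
  ultimately have e: "A $ 1 $ 1 = B $ 1 $ 1" using zdvd_not_zless[of "\<bar>A $ 1 $ 1 - B $ 1 $ 1\<bar>" "A $ 2 $ 1"]
    by force
  then have "(A $ 1 $ 2 - B $ 1 $ 2) * A $ 2 $ 1 = 0"
    using \<open>(A $ 1 $ 1 - B $ 1 $ 1) * A $ 2 $ 2 = (A $ 1 $ 2 - B $ 1 $ 2) * A $ 2 $ 1\<close> by simp
  then have "A $ 1 $ 2 = B $ 1 $ 2" using a(5) by simp
  then show ?thesis using e assms by (simp add: mat22_eq_iff)
qed

lemma card_adm_interval:
  assumes S: "\<And>A. A \<in> S \<Longrightarrow> adm l L A" and l: "1 \<le> l" "l \<le> L" and \<delta>: "\<delta> \<ge> 0"
    and V: "\<And>A. A \<in> S \<Longrightarrow> \<alpha> \<le> real_of_int (A $ 2 $ 2) / real_of_int (A $ 2 $ 1) \<and>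
        real_of_int (A $ 2 $ 2) / real_of_int (A $ 2 $ 1) \<le> \<alpha> + \<delta>"
  shows "real (card S) \<le> 1 + \<delta> * L^2"
proof -
  let ?h = "\<lambda>A::int^2^2. (A $ 2 $ 1, A $ 2 $ 2)"
  have "inj_on ?h S" using S l by (intro inj_onI) (auto intro: adm_eqI)
  then have "card S = card (?h ` S)" by (simp add: card_image)
  moreover have "real (card (?h ` S)) \<le> 1 + \<delta> * L^2"
  proof (rule card_fractions(2))
    fix c d assume "(c, d) \<in> ?h ` S"
    then obtain A where A: "A \<in> S" "c = A $ 2 $ 1" "d = A $ 2 $ 2" by auto
    show "c \<ge> 1 \<and> real_of_int c \<le> L \<and> coprime c d
      \<and> \<alpha> \<le> real_of_int d / real_of_int c \<and> real_of_int d / real_of_int c \<le> \<alpha> + \<delta>"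
      using S[OF A(1)] V[OF A(1)] adm_bounds(5)[OF S[OF A(1)] l(1)] adm_coprime[OF S[OF A(1)]] A
      by (auto simp: adm_def)
  qed (use l \<delta> in auto)
  ultimately show ?thesis by simp
qed

text \<open>Division by the lower left entry c, which is at least \<open>l\<close>, turns the
  condition into 0 <= x + (d / c) z <= L / l, an interval of length (L / l) / |z| for the fraction d
  / c.\<close>

lemma card_adm_linear:
  fixes x z :: int
  assumes S: "\<And>A. A \<in> S \<Longrightarrow> adm l L A" and l: "1 \<le> l" "l \<le> L" and z: "z \<noteq> 0"
    and V: "\<And>A. A \<in> S \<Longrightarrow> 0 \<le> A $ 2 $ 1 * x + A $ 2 $ 2 * z \<and> real_of_int (A $ 2 $ 1 * x + A $ 2 $ 2 * z) \<le> L"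
  shows "real (card S) \<le> 1 + (L / l) / \<bar>real_of_int z\<bar> * L^2"
proof (rule card_adm_interval[OF S l, where \<alpha> = "if z > 0 then - real_of_int x / real_of_int z
      else (L / l - real_of_int x) / real_of_int z"])
  show "0 \<le> L / l / \<bar>real_of_int z\<bar>" using l by simp
  fix A assume A: "A \<in> S"
  define c d where "c = real_of_int (A $ 2 $ 1)" and "d = real_of_int (A $ 2 $ 2)"
  have c: "c \<ge> l" "c > 0" using S[OF A] l by (auto simp: adm_def c_def)
  define v where "v = real_of_int x + d / c * real_of_int z"
  have eq: "c * v = real_of_int (A $ 2 $ 1 * x + A $ 2 $ 2 * z)"
    using c by (simp add: v_def c_def d_def field_simps)
  have "real_of_int (A $ 2 $ 1 * x + A $ 2 $ 2 * z) \<ge> 0" using V[OF A] by (metis of_int_0_le_iff)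
  then have v0: "v \<ge> 0" using eq c by (metis zero_le_mult_iff less_le_not_le)
  have "l * v \<le> c * v" using c v0 by (intro mult_right_mono) auto
  also have "\<dots> \<le> L" using eq V[OF A] by simp
  finally have v1: "v \<le> L / l" using l by (simp add: field_simps)
  have dc: "d / c = (v - real_of_int x) / real_of_int z" using z by (simp add: v_def)
  show "(if z > 0 then - real_of_int x / real_of_int z else (L / l - real_of_int x) / real_of_int z)
        \<le> real_of_int (A $ 2 $ 2) / real_of_int (A $ 2 $ 1) \<and>
      real_of_int (A $ 2 $ 2) / real_of_int (A $ 2 $ 1)
        \<le> (if z > 0 then - real_of_int x / real_of_int z else (L / l - real_of_int x) / real_of_int z)
          + L / l / \<bar>real_of_int z\<bar>"
  proof (cases "z > 0")
    case True
    then have "- real_of_int x / real_of_int z \<le> d / c"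
      unfolding dc using v0 by (intro divide_right_mono) auto
    moreover have "d / c \<le> (L / l - real_of_int x) / real_of_int z"
      unfolding dc using True v1 by (intro divide_right_mono) auto
    ultimately show ?thesis using True unfolding c_def d_def by (simp add: diff_divide_distrib)
  next
    case False
    then have "d / c \<le> - real_of_int x / real_of_int z"
      unfolding dc using v0 by (intro divide_right_mono_neg) auto
    moreover have "(L / l - real_of_int x) / real_of_int z \<le> d / c"
      unfolding dc using False v1 by (intro divide_right_mono_neg) auto
    ultimately show ?thesis using False z unfolding c_def d_def
      by (simp add: diff_divide_distrib abs_if)
  qed
qed

lemma linear_coeff_bound:
  fixes x z c d c' l L :: real
  assumes "1 \<le> l" "l \<le> c" "0 \<le> d" "d \<le> L" "0 \<le> c'" "c' \<le> L" "c * x + d * z = c'"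
  shows "\<bar>x\<bar> \<le> L / l * (1 + \<bar>z\<bar>)"
proof -
  have "c * x = c' - d * z" using assms(7) by simp
  moreover have "c * \<bar>x\<bar> = \<bar>c * x\<bar>" using assms(1,2) by (simp add: abs_mult)
  ultimately have "c * \<bar>x\<bar> = \<bar>c' - d * z\<bar>" by simp
  also have "\<dots> \<le> L + L * \<bar>z\<bar>"
    using assms mult_right_mono[of d L "\<bar>z\<bar>"] abs_triangle_ineq4[of c' "d * z"] by (simp add: abs_mult)
  finally have "l * \<bar>x\<bar> \<le> L * (1 + \<bar>z\<bar>)"
    using mult_right_mono[OF assms(2), of "\<bar>x\<bar>"] by (simp add: algebra_simps)
  then show ?thesis using assms by (simp add: field_simps)
qed

text \<open>The bottom row of \<open>A ** g\<close> is linear in that of \<open>A\<close>, so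
  \<open>card_adm_linear\<close> applies with a column of \<open>g\<close>. The column with the
  larger lower entry \<open>Z\<close> is used. A single solution already bounds all entries of
  \<open>g\<close> in terms of \<open>Z\<close>, so \<open>Z\<close> is the norm of \<open>g\<close>
  up to the factor \<open>4 * (L / l)\<close>.\<close>

lemma card_adm_translate:
  assumes S: "\<And>A. A \<in> S \<Longrightarrow> adm l L A" and l: "1 \<le> l" "l \<le> L" and g: "det g = 1"
  shows "real (card {A \<in> S. A ** g \<in> S}) \<le> 1 + 4 * (L / l)^2 * L^2 / sqrt (real_of_int (nsq g))"
proof (cases "{A \<in> S. A ** g \<in> S} = {}")
  case True
  moreover have "sqrt (real_of_int (nsq g)) \<ge> 0" by (simp add: nsq_def)
  ultimately show ?thesis by (simp only: card.empty) simp
next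
  case False
  define F where "F = {A \<in> S. A ** g \<in> S}"
  obtain A where A: "A \<in> S" "A ** g \<in> S" using False by auto
  define \<kappa> where "\<kappa> = L / l"
  have \<kappa>1: "\<kappa> \<ge> 1" using l by (simp add: \<kappa>_def)
  define x y z w where "x = real_of_int (g $ 1 $ 1)" and "y = real_of_int (g $ 1 $ 2)"
    and "z = real_of_int (g $ 2 $ 1)" and "w = real_of_int (g $ 2 $ 2)"
  define Z where "Z = max \<bar>z\<bar> \<bar>w\<bar>"
  note aA = S[OF A(1), unfolded adm_def] and aB = S[OF A(2), unfolded adm_def]
  have "real_of_int ((A ** g) $ 2 $ 1) = real_of_int (A $ 2 $ 1) * x + real_of_int (A $ 2 $ 2) * z"
    "real_of_int ((A ** g) $ 2 $ 2) = real_of_int (A $ 2 $ 1) * y + real_of_int (A $ 2 $ 2) * w"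
    by (simp_all add: x_def y_def z_def w_def)
  note Ag = this
  have A22: "0 \<le> real_of_int (A $ 2 $ 2)" "0 \<le> real_of_int ((A ** g) $ 2 $ 1)"
    "0 \<le> real_of_int ((A ** g) $ 2 $ 2)" using aA aB l by auto
  have xy: "\<bar>x\<bar> \<le> \<kappa> * (1 + \<bar>z\<bar>)"
    unfolding \<kappa>_def by (rule linear_coeff_bound[OF l(1) _ A22(1) _ A22(2) _ Ag(1)[symmetric]])
      (use aA aB in auto)
  have yw: "\<bar>y\<bar> \<le> \<kappa> * (1 + \<bar>w\<bar>)"
    unfolding \<kappa>_def by (rule linear_coeff_bound[OF l(1) _ A22(1) _ A22(3) _ Ag(2)[symmetric]])
      (use aA aB in auto)
  have "g $ 2 $ 1 \<noteq> 0 \<or> g $ 2 $ 2 \<noteq> 0" using g by (auto simp: det_2)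
  then have Z1: "Z \<ge> 1" unfolding Z_def z_def w_def by linarith
  have zw: "\<bar>z\<bar> \<le> Z" "\<bar>w\<bar> \<le> Z" by (auto simp: Z_def)
  have "\<kappa> * (1 + \<bar>z\<bar>) \<le> \<kappa> * (2 * Z)" "\<kappa> * (1 + \<bar>w\<bar>) \<le> \<kappa> * (2 * Z)"
    using \<kappa>1 Z1 zw by (auto intro!: mult_left_mono)
  then have xy': "\<bar>x\<bar> \<le> 2 * \<kappa> * Z" "\<bar>y\<bar> \<le> 2 * \<kappa> * Z" using xy yw by auto
  have "Z \<le> \<kappa> * Z" using \<kappa>1 Z1 mult_right_mono[of 1 \<kappa> Z] by simp
  then have zw': "\<bar>z\<bar> \<le> \<kappa> * Z" "\<bar>w\<bar> \<le> \<kappa> * Z"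
    using zw by linarith+
  have sq: "u^2 \<le> v^2" if "\<bar>u\<bar> \<le> v" for u v :: real
    using that by (metis abs_ge_zero power2_abs power_mono)
  have "real_of_int (nsq g) = x^2 + y^2 + z^2 + w^2" by (simp add: nsq_def x_def y_def z_def w_def)
  also have "\<dots> \<le> (2 * \<kappa> * Z)^2 + (2 * \<kappa> * Z)^2 + (\<kappa> * Z)^2 + (\<kappa> * Z)^2"
    using sq[OF xy'(1)] sq[OF xy'(2)] sq[OF zw'(1)] sq[OF zw'(2)] by linarith
  also have "\<dots> \<le> (4 * \<kappa> * Z)^2"
    using \<kappa>1 Z1 by (simp add: power_mult_distrib)
  finally have "sqrt (real_of_int (nsq g)) \<le> 4 * \<kappa> * Z"
    using \<kappa>1 Z1 by (intro real_le_lsqrt) (auto simp: nsq_def)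
  moreover have n0: "sqrt (real_of_int (nsq g)) > 0" using nsq_ge_2[OF g] by simp
  ultimately have "1 / Z \<le> 4 * \<kappa> / sqrt (real_of_int (nsq g))"
    using Z1 by (simp add: field_simps)
  moreover have "\<kappa> * L^2 \<ge> 0" using \<kappa>1 by simp
  ultimately have le: "\<kappa> * L^2 * (1 / Z) \<le> \<kappa> * L^2 * (4 * \<kappa> / sqrt (real_of_int (nsq g)))"
    by (rule mult_left_mono)
  have SF: "\<And>A. A \<in> F \<Longrightarrow> adm l L A" using S by (simp add: F_def)
  have "real (card F) \<le> 1 + \<kappa> / Z * L^2"
  proof (cases "\<bar>z\<bar> \<ge> \<bar>w\<bar>")
    case True
    then have Zz: "Z = \<bar>real_of_int (g $ 2 $ 1)\<bar>" by (simp add: Z_def z_def)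
    show ?thesis unfolding \<kappa>_def Zz
    proof (rule card_adm_linear[OF SF l, where x = "g $ 1 $ 1"])
      show "g $ 2 $ 1 \<noteq> 0" using Z1 Zz by auto
      fix A assume "A \<in> F"
      then show "0 \<le> A $ 2 $ 1 * g $ 1 $ 1 + A $ 2 $ 2 * g $ 2 $ 1 \<and>
          real_of_int (A $ 2 $ 1 * g $ 1 $ 1 + A $ 2 $ 2 * g $ 2 $ 1) \<le> L"
        using adm_bounds(5)[OF S l(1), of "A ** g"] S[of "A ** g"] by (simp add: F_def adm_def)
    qed
  next
    case False
    then have Zz: "Z = \<bar>real_of_int (g $ 2 $ 2)\<bar>" by (simp add: Z_def w_def)
    show ?thesis unfolding \<kappa>_def Zz
    proof (rule card_adm_linear[OF SF l, where x = "g $ 1 $ 2"])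
      show "g $ 2 $ 2 \<noteq> 0" using Z1 Zz by auto
      fix A assume "A \<in> F"
      then show "0 \<le> A $ 2 $ 1 * g $ 1 $ 2 + A $ 2 $ 2 * g $ 2 $ 2 \<and>
          real_of_int (A $ 2 $ 1 * g $ 1 $ 2 + A $ 2 $ 2 * g $ 2 $ 2) \<le> L"
        using adm_bounds(6)[OF S l(1), of "A ** g"] S[of "A ** g"] by (simp add: F_def adm_def)
    qed
  qed
  then show ?thesis using le unfolding F_def \<kappa>_def by (simp add: power2_eq_square field_simps)
qed

text \<open>Pairs of matrices that can be completed to two solutions of the same linear condition modulo \<open>q\<close>.\<close>

definition coll :: "int \<Rightarrow> (int^2^2) set \<Rightarrow> ((int^2^2) \<times> (int^2^2)) set" where
  "coll q S = {(A, B) \<in> S \<times> S. q dvd nsq (adj22 A ** B) - 2}"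

section \<open>Counting collisions, and bipartite graphs\<close>

lemma sum_inverse_sqrt: "(\<Sum>m=1..n. 1 / sqrt (real m)) \<le> 2 * sqrt (real n)"
proof (induction n)
  case (Suc n)
  define u v where "u = sqrt (real n)" and "v = sqrt (real (Suc n))"
  have v: "v > 0" "v^2 = u^2 + 1" "u \<ge> 0" by (simp_all add: u_def v_def)
  have "0 \<le> (v - u)^2" by simp
  then have "2 * u * v + 1 \<le> 2 * v * v" using v by (simp add: power2_eq_square algebra_simps)
  then have "2 * u + 1 / v \<le> 2 * v" using v by (simp add: field_simps)
  then show ?case using Suc unfolding u_def v_def by simp
qed auto

text \<open>Sort the pairs by g = A^(-1) B. Its norm t is at most 4 L^4 and congruent to 2 modulo
  \<open>q\<close>. At most \<open>C * t powr \<epsilon>\<close> matrices g have norm t, and each is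
  controlled by \<open>card_adm_translate\<close>. What remains is a sum of 1 / sqrt t over t = 2 +
  q m.\<close>

lemma card_coll_bound:
  fixes \<epsilon> C l L :: real and q :: int
  assumes C: "C \<ge> 1" "\<And>t::int. t \<ge> 2 \<Longrightarrow> real (card {A. det A = 1 \<and> nsq A = t}) \<le> C * real_of_int t powr \<epsilon>"
    and eps: "\<epsilon> > 0" and S: "finite S" "\<And>A. A \<in> S \<Longrightarrow> adm l L A" and l: "1 \<le> l" "l \<le> L" and q: "q \<ge> 1"
  shows "real (card (coll q S)) \<le> C * (4 * L^4) powr \<epsilon> * (real (card S) + 20 * (L / l)^2 * L^4 / real_of_int q)"
proof -
  define \<kappa> where "\<kappa> = L / l"
  have \<kappa>1: "\<kappa> \<ge> 1" using l by (simp add: \<kappa>_def)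
  define CT where "CT = C * (4 * L^4) powr \<epsilon>"
  have CT0: "CT \<ge> 0" using C by (simp add: CT_def)
  define F where "F t = {(A, B) \<in> S \<times> S. nsq (adj22 A ** B) = t}" for t
  \<comment> \<open>At t = 2 the norm of g is too small for \<open>card_adm_translate\<close> to
    save anything; the trivial bound is used and yields the diagonal term
    \<open>card S\<close>.\<close>
  define w where "w t = (if t = 2 then real (card S) else 1 + 4 * \<kappa>^2 * L^2 / sqrt (real_of_int t))" for t :: int
  have nsq_le: "real_of_int (nsq (adj22 A ** B)) \<le> 4 * L^4" if "A \<in> S" "B \<in> S" for A B
  proof -
    note a = adm_bounds[OF S(2)[OF that(1)] l(1)] and b = adm_bounds[OF S(2)[OF that(2)] l(1)]
    have La: "real_of_int (A $ i $ j) \<le> L" "real_of_int (A $ i $ j) \<ge> 0" for i j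
      using S(2)[OF that(1)] a exhaust_2[of i] exhaust_2[of j] by (auto simp: adm_def)
    have Lb: "real_of_int (B $ i $ j) \<le> L" "real_of_int (B $ i $ j) \<ge> 0" for i j
      using S(2)[OF that(2)] b exhaust_2[of i] exhaust_2[of j] by (auto simp: adm_def)
    have pr: "0 \<le> real_of_int (A $ i $ j) * real_of_int (B $ i' $ j')"
      "real_of_int (A $ i $ j) * real_of_int (B $ i' $ j') \<le> L^2" for i j i' j'
      unfolding power2_eq_square using La Lb l by (auto intro!: mult_mono mult_nonneg_nonneg order_trans[OF l(1) l(2)])
    have sq: "(u - v)^2 \<le> L^4" if "0 \<le> u" "u \<le> L^2" "0 \<le> v" "v \<le> L^2" for u v :: real
    proof -
      have "\<bar>u - v\<bar> \<le> L^2" using that by linarith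
      then have "\<bar>u - v\<bar>^2 \<le> (L^2)^2" by (intro power_mono) auto
      then show ?thesis by simp
    qed
    have "real_of_int (nsq (adj22 A ** B)) =
        (real_of_int (A $ 2 $ 2) * real_of_int (B $ 1 $ 1) - real_of_int (A $ 1 $ 2) * real_of_int (B $ 2 $ 1))^2 +
        (real_of_int (A $ 2 $ 2) * real_of_int (B $ 1 $ 2) - real_of_int (A $ 1 $ 2) * real_of_int (B $ 2 $ 2))^2 +
        (real_of_int (A $ 1 $ 1) * real_of_int (B $ 2 $ 1) - real_of_int (A $ 2 $ 1) * real_of_int (B $ 1 $ 1))^2 +
        (real_of_int (A $ 1 $ 1) * real_of_int (B $ 2 $ 2) - real_of_int (A $ 2 $ 1) * real_of_int (B $ 1 $ 2))^2"
      by (simp add: nsq_def)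
    also have "\<dots> \<le> L^4 + L^4 + L^4 + L^4"
      by (intro add_mono sq pr)
    finally show ?thesis by simp
  qed
  have finF: "finite (F t)" for t
    by (rule finite_subset[of _ "S \<times> S"]) (use S(1) in \<open>auto simp: F_def\<close>)
  have cardF: "real (card (F t)) \<le> CT * w t" if t: "t \<ge> 2" "real_of_int t \<le> 4 * L^4" for t
  proof -
    let ?G = "{g. det g = 1 \<and> nsq g = t}"
    have finG: "finite ?G" by (rule finite_subset[OF _ finite_nsq[of t]]) auto
    have "F t \<subseteq> (\<Union>g\<in>?G. (\<lambda>A. (A, A ** g)) ` {A \<in> S. A ** g \<in> S})"
    proof
      fix s assume "s \<in> F t"
      then obtain A B where s: "s = (A, B)" "A \<in> S" "B \<in> S" "nsq (adj22 A ** B) = t"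
        by (auto simp: F_def)
      have dA: "det A = 1" "det B = 1" using S(2) s adm_det by auto
      have "A ** (adj22 A ** B) = B" by (rule cancel_adj22_left[OF dA(1)])
      then have "s \<in> (\<lambda>A'. (A', A' ** (adj22 A ** B))) ` {A' \<in> S. A' ** (adj22 A ** B) \<in> S}"
        using s by (intro image_eqI[of _ _ A]) auto
      moreover have "adj22 A ** B \<in> ?G" using s dA by (simp add: det_mul det_adj22)
      ultimately show "s \<in> (\<Union>g\<in>?G. (\<lambda>A. (A, A ** g)) ` {A \<in> S. A ** g \<in> S})" by blast
    qed
    then have "card (F t) \<le> card (\<Union>g\<in>?G. (\<lambda>A. (A, A ** g)) ` {A \<in> S. A ** g \<in> S})"
      using finG S(1) by (intro card_mono) auto
    also have "\<dots> \<le> (\<Sum>g\<in>?G. card ((\<lambda>A. (A, A ** g)) ` {A \<in> S. A ** g \<in> S}))"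
      by (rule card_UN_le[OF finG])
    also have "\<dots> \<le> (\<Sum>g\<in>?G. card {A \<in> S. A ** g \<in> S})"
      by (intro sum_mono card_image_le) (use S(1) in auto)
    finally have "real (card (F t)) \<le> (\<Sum>g\<in>?G. real (card {A \<in> S. A ** g \<in> S}))"
      unfolding of_nat_sum[symmetric] of_nat_le_iff .
    also have "\<dots> \<le> (\<Sum>g\<in>?G. w t)"
    proof (rule sum_mono)
      fix g assume g: "g \<in> ?G"
      show "real (card {A \<in> S. A ** g \<in> S}) \<le> w t"
      proof (cases "t = 2")
        case True
        then show ?thesis using card_mono[OF S(1), of "{A \<in> S. A ** g \<in> S}"] by (simp add: w_def)
      next
        case False
        then show ?thesis using card_adm_translate[OF S(2) l, where g = g] g by (simp add: w_def \<kappa>_def)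
      qed
    qed
    also have "\<dots> = real (card ?G) * w t" by simp
    also have "\<dots> \<le> CT * w t"
    proof (rule mult_right_mono)
      have "real (card ?G) \<le> C * real_of_int t powr \<epsilon>" using C(2) t by simp
      also have "\<dots> \<le> CT" unfolding CT_def using C(1) t eps by (intro mult_left_mono powr_mono2) auto
      finally show "real (card ?G) \<le> CT" .
      show "w t \<ge> 0" using t by (simp add: w_def)
    qed
    finally show ?thesis .
  qed
  define M where "M = nat \<lfloor>4 * L^4 / real_of_int q\<rfloor>"
  have M: "real M \<le> 4 * L^4 / real_of_int q" using q by (simp add: M_def)
  have "coll q S \<subseteq> (\<Union>m\<in>{m. m \<le> M \<and> real_of_int (2 + q * int m) \<le> 4 * L^4}. F (2 + q * int m))"
  proof
    fix s assume "s \<in> coll q S"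
    then obtain A B where s: "s = (A, B)" "A \<in> S" "B \<in> S" "q dvd nsq (adj22 A ** B) - 2"
      by (auto simp: coll_def)
    obtain k where k: "nsq (adj22 A ** B) - 2 = q * k" using s(4) by (elim dvdE)
    have "nsq (adj22 A ** B) \<ge> 2"
      using adm_det[OF S(2)[OF s(2)]] adm_det[OF S(2)[OF s(3)]]
      by (intro nsq_ge_2) (simp add: det_mul det_adj22)
    then have "k \<ge> 0" using k q by (smt (verit) zero_le_mult_iff)
    define m where "m = nat k"
    have m: "nsq (adj22 A ** B) = 2 + q * int m" using k \<open>k \<ge> 0\<close> by (simp add: m_def)
    have le: "real_of_int (2 + q * int m) \<le> 4 * L^4" using nsq_le[OF s(2,3)] unfolding m .
    then have "real m * real_of_int q \<le> 4 * L^4" by (simp add: mult.commute)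
    then have "real m \<le> 4 * L^4 / real_of_int q" using q by (simp add: field_simps)
    then have "m \<le> M" unfolding M_def by (simp add: le_nat_floor)
    then show "s \<in> (\<Union>m\<in>{m. m \<le> M \<and> real_of_int (2 + q * int m) \<le> 4 * L^4}. F (2 + q * int m))"
      using s m le by (auto simp: F_def)
  qed
  then have "card (coll q S) \<le> card (\<Union>m\<in>{m. m \<le> M \<and> real_of_int (2 + q * int m) \<le> 4 * L^4}. F (2 + q * int m))"
    using finF by (intro card_mono) auto
  also have "\<dots> \<le> (\<Sum>m\<in>{m. m \<le> M \<and> real_of_int (2 + q * int m) \<le> 4 * L^4}. card (F (2 + q * int m)))"
    by (rule card_UN_le) simp
  finally have "real (card (coll q S)) \<le> (\<Sum>m\<in>{m. m \<le> M \<and> real_of_int (2 + q * int m) \<le> 4 * L^4}. real (card (F (2 + q * int m))))"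
    unfolding of_nat_sum[symmetric] of_nat_le_iff .
  also have "\<dots> \<le> (\<Sum>m\<in>{m. m \<le> M \<and> real_of_int (2 + q * int m) \<le> 4 * L^4}. CT * w (2 + q * int m))"
    using q by (intro sum_mono cardF) auto
  also have "\<dots> \<le> (\<Sum>m\<in>{0..M}. CT * w (2 + q * int m))"
    using CT0 q by (intro sum_mono2) (auto simp: w_def)
  also have "\<dots> = CT * (w 2 + (\<Sum>m=1..M. w (2 + q * int m)))"
    by (simp add: sum_distrib_left sum.atLeast_Suc_atMost distrib_left)
  also have "\<dots> \<le> CT * (real (card S) + (\<Sum>m=1..M. 1 + 4 * \<kappa>^2 * L^2 / sqrt (real_of_int q) * (1 / sqrt (real m))))"
  proof (intro mult_left_mono add_mono sum_mono CT0)
    show "w 2 \<le> real (card S)" by (simp add: w_def)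
    fix m assume m: "m \<in> {1..M}"
    have "sqrt (real_of_int q) * sqrt (real m) \<le> sqrt (real_of_int (2 + q * int m))"
      by (simp add: real_sqrt_mult[symmetric])
    moreover have "sqrt (real_of_int q) * sqrt (real m) > 0" using m q by simp
    ultimately have "4 * \<kappa>^2 * L^2 / sqrt (real_of_int (2 + q * int m)) \<le> 4 * \<kappa>^2 * L^2 / (sqrt (real_of_int q) * sqrt (real m))"
      by (intro divide_left_mono mult_pos_pos) (use m q in \<open>auto intro: add_pos_nonneg\<close>)
    moreover have "2 + q * int m \<noteq> 2" using m q by auto
    ultimately show "w (2 + q * int m) \<le> 1 + 4 * \<kappa>^2 * L^2 / sqrt (real_of_int q) * (1 / sqrt (real m))"
      by (simp add: w_def)
  qed
  also have "(\<Sum>m=1..M. 1 + 4 * \<kappa>^2 * L^2 / sqrt (real_of_int q) * (1 / sqrt (real m)))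
      = real M + 4 * \<kappa>^2 * L^2 / sqrt (real_of_int q) * (\<Sum>m=1..M. 1 / sqrt (real m))"
    by (simp add: sum.distrib sum_distrib_left)
  \<comment> \<open>20 = 4 + 16: there are \<open>M\<close> <= 4 L^4 / q values of m, and the sum of
    1 / sqrt m over them is at most 2 sqrt M.\<close>
  also have "\<dots> \<le> 20 * \<kappa>^2 * L^4 / real_of_int q"
  proof -
    define sq where "sq = sqrt (real_of_int q)"
    have sq: "sq > 0" "sq * sq = real_of_int q" using q by (simp_all add: sq_def)
    have "sqrt (real M) \<le> sqrt (4 * L^4 / real_of_int q)" using M by simp
    also have "\<dots> = sqrt ((2 * L^2 / sq)^2)"
      using sq by (simp add: power_divide power_mult_distrib power2_eq_square[of sq])
    also have "\<dots> = 2 * L^2 / sq" using sq by simp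
    finally have "(\<Sum>m=1..M. 1 / sqrt (real m)) \<le> 2 * (2 * L^2 / sq)"
      using sum_inverse_sqrt[of M] by linarith
    then have "4 * \<kappa>^2 * L^2 / sq * (\<Sum>m=1..M. 1 / sqrt (real m)) \<le> 4 * \<kappa>^2 * L^2 / sq * (2 * (2 * L^2 / sq))"
      using sq by (intro mult_left_mono) auto
    also have "\<dots> = 16 * \<kappa>^2 * L^4 / real_of_int q"
      by (simp add: sq(2)[symmetric] power2_eq_square power4_eq_xxxx)
    finally have 1: "4 * \<kappa>^2 * L^2 / sq * (\<Sum>m=1..M. 1 / sqrt (real m)) \<le> 16 * \<kappa>^2 * L^4 / real_of_int q" .
    have "1 * (4 * L^4 / real_of_int q) \<le> \<kappa>^2 * (4 * L^4 / real_of_int q)"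
      using \<kappa>1 q by (intro mult_right_mono) auto
    then have "real M \<le> 4 * \<kappa>^2 * L^4 / real_of_int q" using M by (simp add: mult_ac)
    then show ?thesis using 1 unfolding sq_def by (simp add: add_divide_distrib[symmetric])
  qed
  finally show ?thesis using CT0 unfolding CT_def \<kappa>_def by (simp add: mult_left_mono)
qed

text \<open>By the inequality \<open>2 \<le> a / b + b / a\<close>, summed over the edges with \<open>a\<close> and \<open>b\<close> the degrees of
  the end points.\<close>

lemma card_bipartite:
  assumes S: "finite S" "finite T" and E: "E \<subseteq> S \<times> T" and PQ: "finite P" "finite Q"
    and Q: "\<And>A B B'. (A, B) \<in> E \<Longrightarrow> (A, B') \<in> E \<Longrightarrow> (B, B') \<in> Q"
    and P: "\<And>A A' B. (A, B) \<in> E \<Longrightarrow> (A', B) \<in> E \<Longrightarrow> (A, A') \<in> P"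
  shows "2 * card E \<le> card P + card Q"
proof -
  define e where "e A B = (of_bool ((A, B) \<in> E) :: real)" for A B
  define a where "a A = (\<Sum>B\<in>T. e A B)" for A
  define b where "b B = (\<Sum>A\<in>S. e A B)" for B
  have e01: "0 \<le> e A B" "e A B \<le> 1" for A B by (auto simp: e_def)
  have ab0: "0 \<le> a A" "0 \<le> b B" for A B by (auto simp: a_def b_def e01 sum_nonneg)
  have card_eq: "real (card R) = (\<Sum>A\<in>U. \<Sum>B\<in>V. of_bool ((A, B) \<in> R))"
    if "R \<subseteq> U \<times> V" "finite U" "finite V" for R :: "('x \<times> 'y) set" and U V
  proof -
    have "(\<Sum>A\<in>U. \<Sum>B\<in>V. of_bool ((A, B) \<in> R) :: real) = (\<Sum>x\<in>U \<times> V. of_bool (x \<in> R))"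
      by (simp add: sum.cartesian_product case_prod_unfold)
    also have "\<dots> = (\<Sum>x\<in>R. of_bool (x \<in> R))"
      using that by (intro sum.mono_neutral_right) auto
    finally show ?thesis by simp
  qed
  have pos: "1 \<le> a A" "1 \<le> b B" if "(A, B) \<in> E" for A B
  proof -
    have AB: "A \<in> S" "B \<in> T" using that E by auto
    have "e A B \<le> a A" unfolding a_def by (rule member_le_sum) (use AB S e01 in auto)
    then show "1 \<le> a A" using that by (simp add: e_def)
    have "e A B \<le> b B" unfolding b_def
      by (rule member_le_sum[of A S "\<lambda>A. e A B"]) (use AB S e01 in auto)
    then show "1 \<le> b B" using that by (simp add: e_def)
  qed
  \<comment> \<open>Expanding \<open>a A\<close> gives triples (A, B, B') of weight 1 / b B. A pair
    (B, B') has at most \<open>b B\<close> common neighbours A, so it contributes at most 1, and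
    only if it lies in \<open>Q\<close>.\<close>
  have Qle: "(\<Sum>A\<in>S. \<Sum>B\<in>T. e A B * (a A / b B)) \<le> real (card Q)"
  proof -
    have "(\<Sum>A\<in>S. \<Sum>B\<in>T. e A B * (a A / b B)) = (\<Sum>A\<in>S. \<Sum>B\<in>T. \<Sum>B'\<in>T. e A B * e A B' / b B)"
      by (simp add: a_def sum_distrib_left sum_divide_distrib)
    also have "\<dots> = (\<Sum>B\<in>T. \<Sum>A\<in>S. \<Sum>B'\<in>T. e A B * e A B' / b B)" by (rule sum.swap)
    also have "\<dots> = (\<Sum>B\<in>T. \<Sum>B'\<in>T. \<Sum>A\<in>S. e A B * e A B' / b B)" by (intro sum.cong refl sum.swap)
    also have "\<dots> \<le> (\<Sum>B\<in>T. \<Sum>B'\<in>T. of_bool ((B, B') \<in> Q \<inter> T \<times> T))"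
    proof (intro sum_mono)
      fix B B' assume B: "B \<in> T" "B' \<in> T"
      show "(\<Sum>A\<in>S. e A B * e A B' / b B) \<le> of_bool ((B, B') \<in> Q \<inter> T \<times> T)"
      proof (cases "(B, B') \<in> Q")
        case True
        have "(\<Sum>A\<in>S. e A B * e A B' / b B) \<le> (\<Sum>A\<in>S. e A B / b B)"
          using e01 ab0 by (intro sum_mono divide_right_mono) (auto simp: mult_left_le)
        also have "\<dots> = b B / b B" unfolding sum_divide_distrib[symmetric] b_def[symmetric] ..
        also have "\<dots> \<le> 1" by simp
        finally show ?thesis using True B by simp
      next
        case False
        then have "e A B * e A B' = 0" for A using Q by (auto simp: e_def)
        then have "(\<Sum>A\<in>S. e A B * e A B' / b B) = 0" by (simp only: div_0 sum.neutral_const)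
        then show ?thesis by simp
      qed
    qed
    also have "\<dots> = real (card (Q \<inter> T \<times> T))" by (rule card_eq[symmetric]) (use S in auto)
    also have "\<dots> \<le> real (card Q)" using PQ by (simp add: card_mono)
    finally show ?thesis .
  qed
  have Ple: "(\<Sum>A\<in>S. \<Sum>B\<in>T. e A B * (b B / a A)) \<le> real (card P)"
  proof -
    have "(\<Sum>A\<in>S. \<Sum>B\<in>T. e A B * (b B / a A)) = (\<Sum>A\<in>S. \<Sum>B\<in>T. \<Sum>A'\<in>S. e A B * e A' B / a A)"
      by (simp add: b_def sum_distrib_left sum_divide_distrib)
    also have "\<dots> = (\<Sum>A\<in>S. \<Sum>A'\<in>S. \<Sum>B\<in>T. e A B * e A' B / a A)" by (intro sum.cong refl sum.swap)
    also have "\<dots> \<le> (\<Sum>A\<in>S. \<Sum>A'\<in>S. of_bool ((A, A') \<in> P \<inter> S \<times> S))"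
    proof (intro sum_mono)
      fix A A' assume A: "A \<in> S" "A' \<in> S"
      show "(\<Sum>B\<in>T. e A B * e A' B / a A) \<le> of_bool ((A, A') \<in> P \<inter> S \<times> S)"
      proof (cases "(A, A') \<in> P")
        case True
        have "(\<Sum>B\<in>T. e A B * e A' B / a A) \<le> (\<Sum>B\<in>T. e A B / a A)"
          using e01 ab0 by (intro sum_mono divide_right_mono) (auto simp: mult_left_le)
        also have "\<dots> = a A / a A" unfolding sum_divide_distrib[symmetric] a_def[symmetric] ..
        also have "\<dots> \<le> 1" by simp
        finally show ?thesis using True A by simp
      next
        case False
        then have "e A B * e A' B = 0" for B using P by (auto simp: e_def)
        then have "(\<Sum>B\<in>T. e A B * e A' B / a A) = 0" by (simp only: div_0 sum.neutral_const)
        then show ?thesis by simp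
      qed
    qed
    also have "\<dots> = real (card (P \<inter> S \<times> S))" by (rule card_eq[symmetric]) (use S in auto)
    also have "\<dots> \<le> real (card P)" using PQ by (simp add: card_mono)
    finally show ?thesis .
  qed
  have "2 * real (card E) = (\<Sum>A\<in>S. \<Sum>B\<in>T. 2 * e A B)"
    using card_eq[OF E S] by (simp add: e_def sum_distrib_left)
  also have "\<dots> \<le> (\<Sum>A\<in>S. \<Sum>B\<in>T. e A B * (a A / b B) + e A B * (b B / a A))"
  proof (intro sum_mono)
    fix A B
    show "2 * e A B \<le> e A B * (a A / b B) + e A B * (b B / a A)"
    proof (cases "(A, B) \<in> E")
      case True
      have p: "a A > 0" "b B > 0" using pos[OF True] by auto
      have "0 \<le> (a A - b B)^2" by simp
      then have "2 \<le> a A / b B + b B / a A"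
        using p by (simp add: field_simps power2_eq_square)
      then show ?thesis using True by (simp add: e_def)
    qed (simp add: e_def)
  qed
  also have "\<dots> \<le> real (card P) + real (card Q)"
    using Ple Qle by (simp add: sum.distrib)
  finally show ?thesis by linarith
qed

subsection \<open>Square divisors of bilinear families\<close>

text \<open>Modulo \<open>q\<close>, where i^2 = -1, the condition on \<open>M\<close> says that the
  row (1, -i) M annihilates the column v = (1, s i). The condition on \<open>M ** g\<close> says
  that the same row annihilates g v. The row is primitive because det M = 1, so v and g v are
  proportional, that is, \<open>q\<close> divides \<open>W\<close>; and modulo \<open>q\<close>,
  \<open>W\<close> is a factor of x^2 + y^2 = nsq g - 2.\<close>

lemma root_condition_translate:
  fixes M g :: "int^2^2" and s i q :: int
  assumes s: "s = 1 \<or> s = -1" and q: "q dvd i^2 + 1" and M: "det M = 1" and g: "det g = 1"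
    and 1: "q dvd M $ 1 $ 1 + s * M $ 2 $ 2 + s * i * (M $ 1 $ 2 - s * M $ 2 $ 1)"
    and 2: "q dvd (M ** g) $ 1 $ 1 + s * (M ** g) $ 2 $ 2 + s * i * ((M ** g) $ 1 $ 2 - s * (M ** g) $ 2 $ 1)"
  shows "q dvd nsq g - 2"
proof -
  define a b c d where "a = M $ 1 $ 1" and "b = M $ 1 $ 2" and "c = M $ 2 $ 1" and "d = M $ 2 $ 2"
  define x y where "x = g $ 1 $ 1 - g $ 2 $ 2" and "y = g $ 1 $ 2 + g $ 2 $ 1"
  define W where "W = y - s * i * x"
  define r2 where "r2 = b - i * d"
  define f1 where "f1 = a - i * c + s * i * r2"
  define f2 where "f2 = (a - i * c) * (g $ 1 $ 1 + s * i * g $ 1 $ 2) + r2 * (g $ 2 $ 1 + s * i * g $ 2 $ 2)"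
  have "f1 = M $ 1 $ 1 + s * M $ 2 $ 2 + s * i * (M $ 1 $ 2 - s * M $ 2 $ 1) - (i^2 + 1) * (s * d)"
    using s by (elim disjE) (simp_all add: f1_def r2_def a_def b_def c_def d_def algebra_simps power2_eq_square)
  then have f1: "q dvd f1" using 1 q by (metis dvd_diff dvd_mult2)
  have "f2 = (M ** g) $ 1 $ 1 + s * (M ** g) $ 2 $ 2 + s * i * ((M ** g) $ 1 $ 2 - s * (M ** g) $ 2 $ 1)
      - (i^2 + 1) * (s * (M ** g) $ 2 $ 2)"
    using s by (elim disjE) (simp_all add: f2_def r2_def a_def b_def c_def d_def algebra_simps power2_eq_square)
  then have f2: "q dvd f2" using 2 q by (metis dvd_diff dvd_mult2)
  have "r2 * W = f2 - f1 * (g $ 1 $ 1 + s * i * g $ 1 $ 2) + (i^2 + 1) * (r2 * g $ 1 $ 2)"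
    using s by (elim disjE) (simp_all add: W_def x_def y_def f2_def f1_def algebra_simps power2_eq_square)
  then have rW: "q dvd r2 * W" using f1 f2 q by (metis dvd_add dvd_diff dvd_mult2)
  have "a * d - b * c = 1" using M by (simp add: det_2 a_def b_def c_def d_def)
  then have "W * 1 = W * (a * d - b * c)" by simp
  also have "\<dots> = f1 * (W * d) - (r2 * W) * (s * i * d + c)"
    using s by (elim disjE) (simp_all add: f1_def r2_def algebra_simps power2_eq_square)
  finally have W: "q dvd W" using f1 rW by (metis dvd_diff dvd_mult2 mult_1_right)
  have "nsq g - 2 = x^2 + y^2" using nsq_minus_2[OF g] by (simp add: x_def y_def)
  also have "\<dots> = W * (y + s * i * x) + (i^2 + 1) * x^2"
    using s by (elim disjE) (simp_all add: W_def algebra_simps power2_eq_square)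
  finally show ?thesis using W q by (metis dvd_add dvd_mult2)
qed

text \<open>Modulo p, the condition says that a matrix commutes (s = -1) or anticommutes (s = 1)
  with the quarter turn. If \<open>M\<close> and \<open>M ** g\<close> behave alike, then g commutes
  with it modulo p, so p divides both terms whose squares add up to nsq g - 2.\<close>

lemma orthogonal_condition_translate:
  fixes M g :: "int^2^2" and s p :: int
  assumes s: "s = 1 \<or> s = -1" and M: "det M = 1" and g: "det g = 1"
    and 1: "p dvd M $ 1 $ 1 + s * M $ 2 $ 2" "p dvd M $ 1 $ 2 - s * M $ 2 $ 1"
    and 2: "p dvd (M ** g) $ 1 $ 1 + s * (M ** g) $ 2 $ 2" "p dvd (M ** g) $ 1 $ 2 - s * (M ** g) $ 2 $ 1"
  shows "p^2 dvd nsq g - 2"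
proof -
  define N where "N = M ** g"
  have gN: "g = adj22 M ** N" by (simp add: N_def adj22_cancel_left[OF M])
  define X Y where "X = M $ 1 $ 1 + s * M $ 2 $ 2" and "Y = M $ 1 $ 2 - s * M $ 2 $ 1"
  define X' Y' where "X' = N $ 1 $ 1 + s * N $ 2 $ 2" and "Y' = N $ 1 $ 2 - s * N $ 2 $ 1"
  have "g $ 1 $ 1 - g $ 2 $ 2 = X * (s * N $ 1 $ 1) + Y' * (s * M $ 1 $ 2) - Y * (s * N $ 1 $ 2) - X' * (s * M $ 1 $ 1)"
    unfolding gN using s
    by (elim disjE) (simp_all add: X_def Y_def X'_def Y'_def algebra_simps)
  moreover have "g $ 1 $ 2 + g $ 2 $ 1 = X * (s * N $ 1 $ 2) - X' * (s * M $ 1 $ 2) + Y * (s * N $ 1 $ 1) - Y' * (s * M $ 1 $ 1)"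
    unfolding gN using s
    by (elim disjE) (simp_all add: X_def Y_def X'_def Y'_def algebra_simps)
  moreover have "p dvd X" "p dvd Y" "p dvd X'" "p dvd Y'"
    using 1 2 by (simp_all only: X_def Y_def X'_def Y'_def N_def)
  ultimately have "p dvd g $ 1 $ 1 - g $ 2 $ 2" "p dvd g $ 1 $ 2 + g $ 2 $ 1"
    by (metis dvd_add dvd_diff dvd_mult2)+
  then show ?thesis unfolding nsq_minus_2[OF g] by (intro dvd_add) (simp_all add: dvd_power_same)
qed

text \<open>If p does not divide Y, then X / Y squares to -1 modulo p^2 and is, up to sign, the root
  i. This replaces a quadratic condition by conditions linear in X and Y, as the collision argument
  needs.\<close>

lemma square_dvd_sum_squares:
  fixes p X Y :: int
  assumes p: "prime p" and d: "p^2 dvd X^2 + Y^2" and s: "s = 1 \<or> s = -1"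
  shows "(p dvd X \<and> p dvd Y) \<or> (\<exists>i. p^2 dvd i^2 + 1 \<and> p^2 dvd X + s * i * Y)"
proof (cases "p dvd Y")
  case True
  have "p dvd X^2 + Y^2" using d by (meson dvd_trans dvd_power zero_less_numeral)
  then have "p dvd X^2" using True by (metis dvd_add_left_iff dvd_mult2 power2_eq_square)
  then show ?thesis using True p by (meson prime_dvd_power)
next
  case False
  then have "coprime Y (p^2)" using prime_imp_coprime[OF p False] by (simp add: coprime_commute)
  then obtain v where v: "[Y * v = 1] (mod p^2)" using cong_solve_coprime_int by blast
  then have v': "p^2 dvd Y * v - 1" by (simp add: cong_iff_dvd_diff)
  define i where "i = - s * X * v"
  have "X + s * i * Y = (Y * v - 1) * (- X)"
    using s by (elim disjE) (simp_all add: i_def algebra_simps)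
  then have 1: "p^2 dvd X + s * i * Y" using v' by (metis dvd_mult2)
  have "i^2 + 1 = (X^2 + Y^2) * v^2 - (Y * v - 1) * (Y * v + 1)"
    using s by (elim disjE) (simp_all add: i_def algebra_simps power2_eq_square)
  then have "p^2 dvd i^2 + 1" using v' d by (metis dvd_diff dvd_mult2)
  then show ?thesis using 1 by blast
qed

text \<open>Reduces the linear conditions to two, those for a root and its negative.\<close>

lemma roots_of_minus_one:
  fixes p i j :: int
  assumes p: "prime p" "p \<noteq> 2" and i: "p^2 dvd i^2 + 1" and j: "p^2 dvd j^2 + 1"
  shows "p^2 dvd i - j \<or> p^2 dvd i + j"
proof -
  have pr: "(i - j) * (i + j) = (i^2 + 1) - (j^2 + 1)" by (simp add: algebra_simps power2_eq_square)
  have d: "p^2 dvd (i - j) * (i + j)" unfolding pr using i j by (rule dvd_diff)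
  have "\<not> (p dvd i - j \<and> p dvd i + j)"
  proof
    assume "p dvd i - j \<and> p dvd i + j"
    then have "p dvd (i - j) + (i + j)" using dvd_add by blast
    then have "p dvd 2 * i" by simp
    moreover have "\<not> p dvd 2" using p by (metis primes_dvd_imp_eq two_is_prime)
    ultimately have "p dvd i" using p(1) by (meson prime_dvd_multD)
    moreover have "p dvd i^2 + 1" using i by (meson dvd_trans dvd_power zero_less_numeral)
    ultimately have "p dvd 1" by (metis dvd_add_right_iff dvd_mult2 power2_eq_square)
    then show False using p(1) not_prime_unit by blast
  qed
  then show ?thesis
  proof (cases "p dvd i - j")
    case True
    then have "\<not> p dvd i + j" using \<open>\<not> (p dvd i - j \<and> p dvd i + j)\<close> by blast
    then have "coprime (p^2) (i + j)" using p(1) by (simp add: prime_imp_coprime)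
    then show ?thesis using d by (simp add: coprime_dvd_mult_left_iff)
  next
    case False
    then have "coprime (p^2) (i - j)" using p(1) by (simp add: prime_imp_coprime)
    then show ?thesis using d by (simp add: coprime_dvd_mult_right_iff)
  qed
qed

lemma finite_coll: "finite S \<Longrightarrow> finite (coll q S)"
  by (rule finite_subset[of _ "S \<times> S"]) (auto simp: coll_def)

text \<open>Fixing \<open>A\<close> and varying \<open>B\<close> multiplies A^T N B on the right by
  B^(-1) B'; fixing \<open>B\<close> and varying \<open>A\<close> does the same to the transpose.
  So, if two solutions of a condition always differ by such a g with q dividing nsq g - 2, then both
  neighbourhood relations of the graph \<open>E\<close> consist of collisions.\<close>

lemma card_le_coll:
  fixes q :: int
  assumes S: "finite S" "\<And>A. A \<in> S \<Longrightarrow> det A = 1" and N: "det N = 1" and E: "E \<subseteq> S \<times> S"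
    and R: "\<And>A B. (A, B) \<in> E \<Longrightarrow> R (transpose A ** N ** B) \<and> R' (transpose (transpose A ** N ** B))"
    and RR: "\<And>M g. det M = 1 \<Longrightarrow> det g = 1 \<Longrightarrow> R M \<Longrightarrow> R (M ** g) \<Longrightarrow> q dvd nsq g - 2"
      "\<And>M g. det M = 1 \<Longrightarrow> det g = 1 \<Longrightarrow> R' M \<Longrightarrow> R' (M ** g) \<Longrightarrow> q dvd nsq g - 2"
  shows "card E \<le> card (coll q S)"
proof -
  have "2 * card E \<le> card (coll q S) + card (coll q S)"
  proof (rule card_bipartite[OF S(1) S(1) E finite_coll[OF S(1)] finite_coll[OF S(1)]])
    fix A B B' assume e: "(A, B) \<in> E" "(A, B') \<in> E"
    then have d: "A \<in> S" "B \<in> S" "B' \<in> S" "det A = 1" "det B = 1" "det B' = 1" using E S by auto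
    have "transpose A ** N ** B' = (transpose A ** N ** B) ** (adj22 B ** B')"
      by (simp add: matrix_mul_assoc[symmetric] cancel_adj22_left[OF d(5)])
    then have "q dvd nsq (adj22 B ** B') - 2"
      using R[OF e(1)] R[OF e(2)] d N
      by (intro RR(1)[of "transpose A ** N ** B"]) (auto simp: det_mul det_adj22)
    then show "(B, B') \<in> coll q S" using d by (simp add: coll_def)
  next
    fix A A' B assume e: "(A, B) \<in> E" "(A', B) \<in> E"
    then have d: "A \<in> S" "B \<in> S" "A' \<in> S" "det A = 1" "det B = 1" "det A' = 1" using E S by auto
    have "transpose (transpose A' ** N ** B) = transpose (transpose A ** N ** B) ** (adj22 A ** A')"
      by (simp add: matrix_transpose_mul matrix_mul_assoc[symmetric] cancel_adj22_left[OF d(4)])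
    then have "q dvd nsq (adj22 A ** A') - 2"
      using R[OF e(1)] R[OF e(2)] d N
      by (intro RR(2)[of "transpose (transpose A ** N ** B)"]) (auto simp: det_mul det_adj22)
    then show "(A, A') \<in> coll q S" using d by (simp add: coll_def)
  qed
  then show ?thesis by simp
qed

text \<open>The factor 3 counts the conditions: both terms divisible by p, and one linear condition
  modulo p^2 for each of the two square roots of -1.\<close>

theorem card_square_divisor:
  fixes p s :: int
  assumes S: "finite S" "\<And>A. A \<in> S \<Longrightarrow> det A = 1" and N: "det N = 1"
    and p: "prime p" "p \<noteq> 2" and s: "s = 1 \<or> s = -1"
  shows "card {(A, B) \<in> S \<times> S. p^2 dvd nsq (transpose A ** N ** B) + 2 * s} \<le> 3 * card (coll (p^2) S)"
proof -
  define E where "E = {(A, B) \<in> S \<times> S. p^2 dvd nsq (transpose A ** N ** B) + 2 * s}"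
  define R0 where "R0 M \<longleftrightarrow> p dvd M $ 1 $ 1 + s * M $ 2 $ 2 \<and> p dvd M $ 1 $ 2 - s * M $ 2 $ 1" for M :: "int^2^2"
  define R1 where "R1 i M \<longleftrightarrow> p^2 dvd M $ 1 $ 1 + s * M $ 2 $ 2 + s * i * (M $ 1 $ 2 - s * M $ 2 $ 1)"
    for i and M :: "int^2^2"
  define E0 where "E0 = {(A, B) \<in> S \<times> S. R0 (transpose A ** N ** B)}"
  define E1 where "E1 i = {(A, B) \<in> S \<times> S. R1 i (transpose A ** N ** B)}" for i
  have fin: "finite E0" "finite (E1 i)" for i
    by (rule finite_subset[of _ "S \<times> S"]; use S(1) in \<open>force simp: E0_def E1_def\<close>)+
  have c0: "card E0 \<le> card (coll (p^2) S)"
  proof (rule card_le_coll[OF S N, where R = R0 and R' = R0])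
    show "E0 \<subseteq> S \<times> S" by (auto simp: E0_def)
    fix A B assume "(A, B) \<in> E0"
    moreover have "R0 M \<Longrightarrow> R0 (transpose M)" for M
      unfolding R0_def transpose22_nth using s
      by (elim disjE conjE) (auto simp: add.commute dvd_diff_commute)
    ultimately show "R0 (transpose A ** N ** B) \<and> R0 (transpose (transpose A ** N ** B))"
      by (simp add: E0_def)
  qed (use orthogonal_condition_translate[OF s] R0_def in blast)+
  have c1: "card (E1 i) \<le> card (coll (p^2) S)" if i: "p^2 dvd i^2 + 1" for i
  \<comment> \<open>Transposition multiplies b - s c by -s and keeps a + s d, so the root
    \<open>i\<close> becomes \<open>- s * i\<close>.\<close>
  proof (rule card_le_coll[OF S N, where R = "R1 i" and R' = "R1 (- s * i)"])
    show "E1 i \<subseteq> S \<times> S" by (auto simp: E1_def)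
    fix A B assume "(A, B) \<in> E1 i"
    moreover have "R1 i M \<Longrightarrow> R1 (- s * i) (transpose M)" for M
      unfolding R1_def transpose22_nth using s by (elim disjE) (auto simp: algebra_simps)
    ultimately show "R1 i (transpose A ** N ** B) \<and> R1 (- s * i) (transpose (transpose A ** N ** B))"
      by (simp add: E1_def)
  next
    fix M g :: "int^2^2" assume "det M = 1" "det g = 1" "R1 i M" "R1 i (M ** g)"
    then show "p^2 dvd nsq g - 2" using root_condition_translate[OF s i] unfolding R1_def by blast
  next
    fix M g :: "int^2^2" assume "det M = 1" "det g = 1" "R1 (- s * i) M" "R1 (- s * i) (M ** g)"
    moreover have "p^2 dvd (- s * i)^2 + 1" using s i by (elim disjE) auto
    ultimately show "p^2 dvd nsq g - 2"
      using root_condition_translate[OF s, of "p^2" "- s * i"] unfolding R1_def by blast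
  qed
  have split: "(A, B) \<in> E0 \<or> (\<exists>i. p^2 dvd i^2 + 1 \<and> (A, B) \<in> E1 i)" if "(A, B) \<in> E" for A B
  proof -
    define M where "M = transpose A ** N ** B"
    have AB: "A \<in> S" "B \<in> S" "p^2 dvd nsq M + 2 * s" using that by (auto simp: E_def M_def)
    then have dM: "det M = 1" using S N by (simp add: M_def det_mul)
    have "nsq M + 2 * s = (M $ 1 $ 1 + s * M $ 2 $ 2)^2 + (M $ 1 $ 2 - s * M $ 2 $ 1)^2"
      using s nsq_minus_2[OF dM] nsq_plus_2[OF dM] by auto
    then have "R0 M \<or> (\<exists>i. p^2 dvd i^2 + 1 \<and> R1 i M)"
      using square_dvd_sum_squares[OF p(1) _ s, of "M $ 1 $ 1 + s * M $ 2 $ 2" "M $ 1 $ 2 - s * M $ 2 $ 1"] AB(3)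
      unfolding R0_def R1_def by simp
    then show ?thesis using AB unfolding E0_def E1_def M_def by blast
  qed
  show ?thesis
  proof (cases "\<exists>j. p^2 dvd j^2 + 1")
    case False
    then have "E \<subseteq> E0" using split by auto
    then have "card E \<le> card E0" using fin by (intro card_mono)
    then show ?thesis using c0 unfolding E_def by linarith
  next
    case True
    then obtain j where j: "p^2 dvd j^2 + 1" by blast
    have R1_cong: "R1 k M" if "p^2 dvd i - k" "R1 i M" for i k M
    proof -
      have "M $ 1 $ 1 + s * M $ 2 $ 2 + s * k * (M $ 1 $ 2 - s * M $ 2 $ 1) =
        (M $ 1 $ 1 + s * M $ 2 $ 2 + s * i * (M $ 1 $ 2 - s * M $ 2 $ 1)) - (i - k) * (s * (M $ 1 $ 2 - s * M $ 2 $ 1))"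
        by (simp add: algebra_simps)
      then show ?thesis using that unfolding R1_def by (metis dvd_diff dvd_mult2)
    qed
    have "E \<subseteq> E0 \<union> (E1 j \<union> E1 (- j))"
    proof
      fix e assume e: "e \<in> E"
      obtain A B where AB: "e = (A, B)" by (metis surj_pair)
      from split[OF e[unfolded AB]] show "e \<in> E0 \<union> (E1 j \<union> E1 (- j))"
      proof
        assume "\<exists>i. p^2 dvd i^2 + 1 \<and> (A, B) \<in> E1 i"
        then obtain i where i: "p^2 dvd i^2 + 1" "(A, B) \<in> E1 i" by blast
        have "p^2 dvd i - j \<or> p^2 dvd i - (- j)" using roots_of_minus_one[OF p i(1) j] by simp
        then have "(A, B) \<in> E1 j \<or> (A, B) \<in> E1 (- j)"
          using i(2) R1_cong unfolding E1_def by blast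
        then show ?thesis using AB by auto
      qed (use AB in auto)
    qed
    then have "card E \<le> card (E0 \<union> (E1 j \<union> E1 (- j)))" using fin by (intro card_mono) auto
    also have "\<dots> \<le> card E0 + (card (E1 j) + card (E1 (- j)))"
      using card_Un_le[of E0 "E1 j \<union> E1 (- j)"] card_Un_le[of "E1 j" "E1 (- j)"] by linarith
    also have "\<dots> \<le> 3 * card (coll (p^2) S)"
      using c0 c1[OF j] c1[of "- j"] j by simp
    finally show ?thesis unfolding E_def .
  qed
qed

subsection \<open>Unipotent parameters and primes of bounded size\<close>

lemma finite_Icc_int_filter [simp]: "finite {x::int. a \<le> x \<and> x \<le> b \<and> P x}"
  by (rule finite_subset[of _ "{a..b}"]) auto

lemma card_residue_classes:
  fixes I m :: int
  assumes I: "I \<ge> 1" and m: "m > 0" "m dvd I" and Z: "Z \<subseteq> {1..I}" and r: "card ((\<lambda>i. i mod m) ` Z) \<le> r"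
  shows "int (card Z) * m \<le> int r * I"
proof -
  have fin: "finite Z" using Z by (rule finite_subset) simp
  obtain k where k: "I = m * k" using m(2) by (elim dvdE)
  have k0: "k > 0" using I m(1) k by (smt (verit) mult_nonneg_nonpos)
  show ?thesis
  proof -
    have "card Z \<le> nat k * card ((\<lambda>i. i mod m) ` Z)"
    proof -
      have "card {s \<in> Z. s mod m = e} \<le> nat k" for e
      proof -
        have "inj_on (\<lambda>s. (s - 1) div m) {s \<in> Z. s mod m = e}"
        proof (rule inj_onI)
          fix x y assume xy: "x \<in> {s \<in> Z. s mod m = e}" "y \<in> {s \<in> Z. s mod m = e}"
            "(x - 1) div m = (y - 1) div m"
          then have "x mod m = y mod m" by simp
          then have "(x - 1) mod m = (y - 1) mod m" by (rule mod_diff_cong) simp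
          then have "x - 1 = y - 1" using xy(3) by (metis div_mult_mod_eq)
          then show "x = y" by simp
        qed
        moreover have "(\<lambda>s. (s - 1) div m) ` {s \<in> Z. s mod m = e} \<subseteq> {0..<k}"
        proof clarify
          fix s assume "s \<in> Z"
          then have s: "1 \<le> s" "s \<le> m * k" using Z k by auto
          define d where "d = (s - 1) div m"
          have "m * d + (s - 1) mod m = s - 1" unfolding d_def by (rule mult_div_mod_eq)
          moreover have "(s - 1) mod m \<ge> 0" using m(1) by simp
          ultimately have "m * d < m * k" using s(2) by linarith
          then have "d < k" using m(1) by (simp add: mult_less_cancel_left_pos)
          moreover have "d \<ge> 0" using m(1) s(1) by (simp add: d_def pos_imp_zdiv_nonneg_iff)
          ultimately show "(s - 1) div m \<in> {0..<k}" by (simp add: d_def)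
        qed
        ultimately have "card {s \<in> Z. s mod m = e} \<le> card {0..<k}"
          by (intro card_inj_on_le) auto
        then show ?thesis by simp
      qed
      moreover have "Z = (\<Union>e\<in>(\<lambda>i. i mod m) ` Z. {s \<in> Z. s mod m = e})" by auto
      then have "card Z \<le> (\<Sum>e\<in>(\<lambda>i. i mod m) ` Z. card {s \<in> Z. s mod m = e})"
        using card_UN_le[of "(\<lambda>i. i mod m) ` Z" "\<lambda>e. {s \<in> Z. s mod m = e}"] fin by simp
      ultimately have "card Z \<le> (\<Sum>e\<in>(\<lambda>i. i mod m) ` Z. nat k)"
        by (meson order_trans sum_mono)
      then show ?thesis by (simp add: mult.commute)
    qed
    also have "\<dots> \<le> nat k * r" using r by simp
    finally have "int (card Z) \<le> int (nat k * r)" by (simp only: of_nat_le_iff)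
    then have "int (card Z) \<le> k * int r" using k0 by simp
    then have "int (card Z) * m \<le> (k * int r) * m" using m(1) by (intro mult_right_mono) auto
    then show ?thesis by (simp add: k mult_ac)
  qed
qed

lemma card_le_2I:
  assumes "finite R" "\<And>x y z. x \<in> R \<Longrightarrow> y \<in> R \<Longrightarrow> z \<in> R \<Longrightarrow> x = y \<or> y = z \<or> x = z"
  shows "card R \<le> 2"
proof (rule ccontr)
  assume "\<not> card R \<le> 2"
  then have "card R \<ge> 3" by simp
  then obtain T where "T \<subseteq> R" "card T = 3" using obtain_subset_with_card_n by metis
  then obtain x y z where "x \<in> R" "y \<in> R" "z \<in> R" "x \<noteq> y" "y \<noteq> z" "x \<noteq> z"
    unfolding card_3_iff by blast
  then show False using assms(2) by blast
qed

lemma quadratic_roots_incongruent: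
  fixes p \<alpha> \<beta> \<gamma> :: int
  assumes p: "prime p" and nz: "\<not> (p dvd \<alpha> \<and> p dvd \<beta>)"
    and r: "p dvd \<alpha> * x^2 + \<beta> * x + \<gamma>" "p dvd \<alpha> * y^2 + \<beta> * y + \<gamma>" "p dvd \<alpha> * z^2 + \<beta> * z + \<gamma>"
  shows "p dvd x - y \<or> p dvd y - z \<or> p dvd x - z"
proof (rule ccontr)
  assume n: "\<not> ?thesis"
  have *: "p dvd \<alpha> * (u + v) + \<beta>" if "p dvd \<alpha> * u^2 + \<beta> * u + \<gamma>" "p dvd \<alpha> * v^2 + \<beta> * v + \<gamma>" "\<not> p dvd u - v"
    for u v
  proof -
    have "(u - v) * (\<alpha> * (u + v) + \<beta>) = (\<alpha> * u^2 + \<beta> * u + \<gamma>) - (\<alpha> * v^2 + \<beta> * v + \<gamma>)"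
      by (simp add: algebra_simps power2_eq_square)
    then have "p dvd (u - v) * (\<alpha> * (u + v) + \<beta>)" using that by (metis dvd_diff)
    then show ?thesis using that(3) p by (meson prime_dvd_multD)
  qed
  have 1: "p dvd \<alpha> * (x + y) + \<beta>" using * r n by blast
  have "p dvd \<alpha> * (x + z) + \<beta>" using * r n by blast
  with 1 have "p dvd (\<alpha> * (x + y) + \<beta>) - (\<alpha> * (x + z) + \<beta>)" by (rule dvd_diff)
  then have "p dvd \<alpha> * (y - z)" by (simp add: algebra_simps)
  then have a: "p dvd \<alpha>" using n p by (meson prime_dvd_multD)
  then have "p dvd \<beta>" using 1 by (meson dvd_add_right_iff dvd_mult2)
  then show False using a nz by blast
qed

lemma card_quadratic_roots:
  fixes p \<alpha> \<beta> \<gamma> I :: int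
  assumes I: "I \<ge> 1" and p: "prime p" "p dvd I" and nz: "\<not> (p dvd \<alpha> \<and> p dvd \<beta>)"
  shows "int (card {x \<in> {1..I}. p dvd \<alpha> * x^2 + \<beta> * x + \<gamma>}) * p \<le> 2 * I"
proof -
  let ?Z = "{x \<in> {1..I}. p dvd \<alpha> * x^2 + \<beta> * x + \<gamma>}"
  have "card ((\<lambda>i. i mod p) ` ?Z) \<le> 2"
  proof (rule card_le_2I)
    fix a b c assume "a \<in> (\<lambda>i. i mod p) ` ?Z" "b \<in> (\<lambda>i. i mod p) ` ?Z" "c \<in> (\<lambda>i. i mod p) ` ?Z"
    then obtain x y z where xyz: "x \<in> ?Z" "y \<in> ?Z" "z \<in> ?Z" "a = x mod p" "b = y mod p" "c = z mod p"
      by blast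
    then have "p dvd x - y \<or> p dvd y - z \<or> p dvd x - z"
      using quadratic_roots_incongruent[OF p(1) nz, of x \<gamma> y z] by blast
    then show "a = b \<or> b = c \<or> a = c" unfolding xyz(4-6) mod_eq_dvd_iff .
  qed simp
  from card_residue_classes[OF I _ p(2) Collect_restrict this] show ?thesis
    using prime_gt_0_int[OF p(1)] by simp
qed

lemma card_linear_roots:
  fixes p \<beta> \<gamma> I :: int
  assumes I: "I \<ge> 1" and p: "prime p" "p dvd I" and nz: "\<not> p dvd \<beta>"
  shows "int (card {x \<in> {1..I}. p dvd \<beta> * x + \<gamma>}) * p \<le> I"
proof -
  let ?Z = "{x \<in> {1..I}. p dvd \<beta> * x + \<gamma>}"
  have "card ((\<lambda>i. i mod p) ` ?Z) \<le> 1"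
  proof -
    have "a = b" if ab: "a \<in> (\<lambda>i. i mod p) ` ?Z" "b \<in> (\<lambda>i. i mod p) ` ?Z" for a b
    proof -
      obtain x y where xy: "x \<in> ?Z" "y \<in> ?Z" "a = x mod p" "b = y mod p" using ab by blast
      then have "p dvd (\<beta> * x + \<gamma>) - (\<beta> * y + \<gamma>)" by (intro dvd_diff) auto
      then have "p dvd \<beta> * (x - y)" by (simp add: algebra_simps)
      then have "p dvd x - y" using nz prime_dvd_multD[OF p(1)] by blast
      then show "a = b" unfolding xy(3,4) mod_eq_dvd_iff .
    qed
    then show ?thesis by (simp add: card_le_Suc0_iff_eq)
  qed
  then have "card ((\<lambda>i. i mod p) ` ?Z) \<le> 1" .
  from card_residue_classes[OF I _ p(2) Collect_restrict this] show ?thesis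
    using prime_gt_0_int[OF p(1)] by simp
qed

text \<open>Hensel: two roots modulo p^2 that agree modulo p agree modulo p^2 if the derivative is a
  unit there, so there are at most two classes of roots, as modulo p.\<close>

lemma card_simple_roots_square:
  fixes p \<alpha> \<beta> \<gamma> I :: int
  assumes I: "I \<ge> 1" and p: "prime p" "p^2 dvd I"
    and simple: "\<And>x. p^2 dvd \<alpha> * x^2 + \<beta> * x + \<gamma> \<Longrightarrow> \<not> p dvd 2 * \<alpha> * x + \<beta>"
  shows "int (card {x \<in> {1..I}. p^2 dvd \<alpha> * x^2 + \<beta> * x + \<gamma>}) * p^2 \<le> 2 * I"
proof -
  let ?Z = "{x \<in> {1..I}. p^2 dvd \<alpha> * x^2 + \<beta> * x + \<gamma>}"
  have pd: "p dvd w" if "p^2 dvd w" for w :: int using that by (meson dvd_trans dvd_power zero_less_numeral)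
  have lift: "p^2 dvd x - y" if "x \<in> ?Z" "y \<in> ?Z" "p dvd x - y" for x y
  proof -
    have "(x - y) * (\<alpha> * (x + y) + \<beta>) = (\<alpha> * x^2 + \<beta> * x + \<gamma>) - (\<alpha> * y^2 + \<beta> * y + \<gamma>)"
      by (simp add: algebra_simps power2_eq_square)
    then have d: "p^2 dvd (x - y) * (\<alpha> * (x + y) + \<beta>)" using that by (metis (no_types, lifting) dvd_diff mem_Collect_eq)
    have "\<alpha> * (x + y) + \<beta> = (2 * \<alpha> * x + \<beta>) - (x - y) * \<alpha>" by (simp add: algebra_simps)
    moreover have "\<not> p dvd 2 * \<alpha> * x + \<beta>" using simple that by blast
    ultimately have "\<not> p dvd \<alpha> * (x + y) + \<beta>" using that(3) by (metis dvd_diff_left_iff dvd_mult2)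
    then have "coprime (p^2) (\<alpha> * (x + y) + \<beta>)" using prime_imp_coprime[OF p(1)] by simp
    then show ?thesis using d by (simp add: coprime_dvd_mult_left_iff)
  qed
  have "card ((\<lambda>i. i mod p^2) ` ?Z) \<le> 2"
  proof (rule card_le_2I)
    fix a b c assume "a \<in> (\<lambda>i. i mod p^2) ` ?Z" "b \<in> (\<lambda>i. i mod p^2) ` ?Z" "c \<in> (\<lambda>i. i mod p^2) ` ?Z"
    then obtain x y z where xyz: "x \<in> ?Z" "y \<in> ?Z" "z \<in> ?Z" "a = x mod p^2" "b = y mod p^2" "c = z mod p^2"
      by blast
    have "\<not> p dvd 2 * \<alpha> * x + \<beta>" using simple xyz(1) by blast
    then have nz: "\<not> (p dvd \<alpha> \<and> p dvd \<beta>)" by (metis dvd_add dvd_mult dvd_mult2)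
    have "p dvd x - y \<or> p dvd y - z \<or> p dvd x - z"
      using quadratic_roots_incongruent[OF p(1) nz, of x \<gamma> y z] xyz pd by blast
    then have "p^2 dvd x - y \<or> p^2 dvd y - z \<or> p^2 dvd x - z" using lift xyz by blast
    then show "a = b \<or> b = c \<or> a = c" unfolding xyz(4-6) mod_eq_dvd_iff .
  qed simp
  from card_residue_classes[OF I _ p(2) Collect_restrict this] show ?thesis
    using prime_gt_0_int[OF p(1)] by simp
qed

text \<open>The factor with \<open>i\<close> makes \<open>nsq\<close> quadratic in \<open>i\<close>; the factors with \<open>j\<close> and \<open>h\<close> equidistribute
  the leading coefficient modulo \<open>p\<close>.\<close>

definition center :: "int \<Rightarrow> int \<times> int \<times> int \<Rightarrow> int^2^2" where
  "center Q = (\<lambda>(h, j, i). mat22 1 1 0 1 ** mat22 1 0 (Q * j) 1 ** mat22 1 (Q * i) 0 1 ** mat22 1 0 (Q * h) 1)"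

lemma det_mat22 [simp]: "det (mat22 a b c d) = a * d - b * c" for a :: "'a::comm_ring_1"
  by (simp add: det_2)

lemma det_center [simp]: "det (center Q \<theta>) = 1"
  by (cases \<theta>) (simp add: center_def det_mul)

text \<open>The norm of P U B is the trace of (P^T P) U (B B^T) U^T. It depends on \<open>P\<close>
  and \<open>B\<close> only through two Gram matrices and is quadratic in \<open>x\<close>.\<close>

lemma nsq_unipotent:
  "nsq (P ** mat22 1 x 0 1 ** B) =
    ((P $ 1 $ 1)^2 + (P $ 2 $ 1)^2) *
      ((B $ 1 $ 1)^2 + (B $ 1 $ 2)^2 + 2 * x * (B $ 1 $ 1 * B $ 2 $ 1 + B $ 1 $ 2 * B $ 2 $ 2) + x^2 * ((B $ 2 $ 1)^2 + (B $ 2 $ 2)^2)) +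
    2 * (P $ 1 $ 1 * P $ 1 $ 2 + P $ 2 $ 1 * P $ 2 $ 2) *
      (B $ 1 $ 1 * B $ 2 $ 1 + B $ 1 $ 2 * B $ 2 $ 2 + x * ((B $ 2 $ 1)^2 + (B $ 2 $ 2)^2)) +
    ((P $ 1 $ 2)^2 + (P $ 2 $ 2)^2) * ((B $ 2 $ 1)^2 + (B $ 2 $ 2)^2)"
  by (simp add: nsq_def power2_eq_square algebra_simps)

text \<open>For fixed j and h, t is a quadratic polynomial in i with derivative
  \<open>2 * Q * D\<close>, and completing the square gives l g t = D^2 + (l + s g)^2. A double root
  modulo p therefore forces p to divide l + s g. The bound is 4 + 2 + 2, from \<open>T1\<close>,
  \<open>T2\<close> and \<open>T3\<close>.\<close>

theorem card_bad_parameters: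
  fixes A B :: "int^2^2" and p I Q s :: int
  assumes AB: "det A = 1" "det B = 1" and p: "prime p" "p \<noteq> 2" "\<not> p dvd Q" "p^2 dvd I" and s: "s = 1 \<or> s = -1" and I1: "I \<ge> 1"
  shows "int (card {\<theta> \<in> {1..I} \<times> {1..I} \<times> {1..I}. p^2 dvd nsq (transpose A ** center Q \<theta> ** B) + 2 * s}) * p^2
    \<le> 8 * I^3"
proof -
  define P where "P = transpose A ** mat22 1 1 0 1"
  have dP: "det P = 1" by (simp add: P_def det_mul AB)
  define l' k' m where "l' = (P $ 1 $ 1)^2 + (P $ 2 $ 1)^2"
    and "k' = P $ 1 $ 1 * P $ 1 $ 2 + P $ 2 $ 1 * P $ 2 $ 2" and "m = (P $ 1 $ 2)^2 + (P $ 2 $ 2)^2"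
  define e f' g' where "e = (B $ 1 $ 1)^2 + (B $ 1 $ 2)^2"
    and "f' = B $ 1 $ 1 * B $ 2 $ 1 + B $ 1 $ 2 * B $ 2 $ 2" and "g' = (B $ 2 $ 1)^2 + (B $ 2 $ 2)^2"
  have lkm': "l' * m - k'^2 = 1"
  proof -
    have "l' * m - k'^2 = (det P)^2" by (simp add: l'_def k'_def m_def det_2 power2_eq_square algebra_simps)
    then show ?thesis by (simp add: dP)
  qed
  have efg': "e * g' - f'^2 = 1"
  proof -
    have "e * g' - f'^2 = (det B)^2" by (simp add: e_def f'_def g'_def det_2 power2_eq_square algebra_simps)
    then show ?thesis by (simp add: AB)
  qed
  \<comment> \<open>(l, k; k, m) is the Gram matrix of the columns of the part left of the i-factor,
    and (e, f; f, g) that of the rows of the part right of it. Both have determinant 1, which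
    \<open>lkm\<close> and \<open>efg\<close> record.\<close>
  define l where "l j = (m * Q^2) * j^2 + (2 * Q * k') * j + l'" for j
  define k where "k j = k' + Q * j * m" for j
  define g where "g h = (e * Q^2) * h^2 + (2 * Q * f') * h + g'" for h
  define f where "f h = f' + Q * h * e" for h
  define t where "t h j i = nsq (transpose A ** center Q (h, j, i) ** B) + 2 * s" for h j i
  have lkm: "l j * m - (k j)^2 = 1" for j
  proof -
    have "l j * m - (k j)^2 = l' * m - k'^2" by (simp add: l_def k_def power2_eq_square algebra_simps)
    then show ?thesis using lkm' by simp
  qed
  have efg: "e * g h - (f h)^2 = 1" for h
  proof -
    have "e * g h - (f h)^2 = e * g' - f'^2" by (simp add: g_def f_def power2_eq_square algebra_simps)
    then show ?thesis using efg' by simp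
  qed
  have t_eq: "t h j i = (l j * g h * Q^2) * i^2 + (2 * Q * (l j * f h + k j * g h)) * i
      + (l j * e + 2 * k j * f h + m * g h + 2 * s)" for h j i
  proof -
    have "transpose A ** center Q (h, j, i) ** B = (P ** mat22 1 0 (Q * j) 1) ** mat22 1 (Q * i) 0 1 ** (mat22 1 0 (Q * h) 1 ** B)"
      by (simp add: P_def center_def matrix_mul_assoc)
    moreover define P' B' where "P' = P ** mat22 1 0 (Q * j) 1" and "B' = mat22 1 0 (Q * h) 1 ** B"
    moreover have "(P' $ 1 $ 1)^2 + (P' $ 2 $ 1)^2 = l j"
      by (simp add: P'_def l_def l'_def k'_def m_def power2_eq_square algebra_simps)
    moreover have "P' $ 1 $ 1 * P' $ 1 $ 2 + P' $ 2 $ 1 * P' $ 2 $ 2 = k j" "(P' $ 1 $ 2)^2 + (P' $ 2 $ 2)^2 = m"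
      by (simp_all add: P'_def k_def k'_def m_def power2_eq_square algebra_simps)
    moreover have "(B' $ 2 $ 1)^2 + (B' $ 2 $ 2)^2 = g h"
      by (simp add: B'_def g_def g'_def f'_def e_def power2_eq_square algebra_simps)
    moreover have "B' $ 1 $ 1 * B' $ 2 $ 1 + B' $ 1 $ 2 * B' $ 2 $ 2 = f h" "(B' $ 1 $ 1)^2 + (B' $ 1 $ 2)^2 = e"
      by (simp_all add: B'_def f_def f'_def e_def power2_eq_square algebra_simps)
    ultimately have "nsq (transpose A ** center Q (h, j, i) ** B) =
        l j * (e + 2 * (Q * i) * f h + (Q * i)^2 * g h) + 2 * k j * (f h + Q * i * g h) + m * g h"
      using nsq_unipotent[of P' "Q * i" B'] by simp
    also have "\<dots> = (l j * g h * Q^2) * i^2 + (2 * Q * (l j * f h + k j * g h)) * i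
      + (l j * e + 2 * k j * f h + m * g h)"
      by (simp add: power2_eq_square algebra_simps)
    finally have "nsq (transpose A ** center Q (h, j, i) ** B) = \<dots>" .
    then show ?thesis by (simp add: t_def)
  qed
  define D where "D h j i = l j * g h * Q * i + (l j * f h + k j * g h)" for h j i
  have square: "l j * g h * t h j i = (D h j i)^2 + (l j + s * g h)^2" for h j i
  proof -
    have "l j * g h * t h j i = (D h j i)^2 + (l j)^2 * (e * g h - (f h)^2) + (g h)^2 * (l j * m - (k j)^2)
        + 2 * s * l j * g h"
      unfolding t_eq D_def by (simp add: power2_eq_square algebra_simps)
    then show ?thesis unfolding lkm efg using s by (auto simp: power2_eq_square algebra_simps)
  qed
  have p2: "\<not> p dvd 2" using p(1,2) by (metis primes_dvd_imp_eq two_is_prime)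
  have pI: "p dvd I" using p(4) by (meson dvd_trans dvd_power zero_less_numeral)
  have nzl: "\<not> (p dvd m * Q^2 \<and> p dvd 2 * Q * k')"
  proof
    assume "p dvd m * Q^2 \<and> p dvd 2 * Q * k'"
    then have "p dvd m" "p dvd k'" using p(1,3) p2 by (meson prime_dvd_multD prime_dvd_power)+
    then have "p dvd l' * m - k'^2" by (simp add: power2_eq_square)
    then show False unfolding lkm' using p(1) not_prime_unit by blast
  qed
  have nzg: "\<not> (p dvd e * Q^2 \<and> p dvd 2 * Q * f')"
  proof
    assume "p dvd e * Q^2 \<and> p dvd 2 * Q * f'"
    then have "p dvd e" "p dvd f'" using p(1,3) p2 by (meson prime_dvd_multD prime_dvd_power)+
    then have "p dvd e * g' - f'^2" by (simp add: power2_eq_square)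
    then show False unfolding efg' using p(1) not_prime_unit by blast
  qed
  \<comment> \<open>\<open>T1\<close>: the leading coefficient vanishes through both factors, each
    quadratic in its own parameter. \<open>T2\<close>: a double root modulo p, with j in at most two
    classes and i in one. \<open>T3\<close>: simple roots, in at most two classes modulo
    p^2.\<close>
  define T1 where "T1 = {h \<in> {1..I}. p dvd g h} \<times> {j \<in> {1..I}. p dvd l j} \<times> {1..I}"
  define T2 where "T2 = (SIGMA h:{1..I}. SIGMA j:{j \<in> {1..I}. p dvd l j + s * g h}.
     {i \<in> {1..I}. \<not> p dvd l j * g h * Q \<and> p dvd D h j i})"
  define T3 where "T3 = (SIGMA h:{1..I}. SIGMA j:{1..I}.
     {i \<in> {1..I}. \<not> p dvd l j + s * g h \<and> p^2 dvd t h j i})"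
  let ?T = "{\<theta> \<in> {1..I} \<times> {1..I} \<times> {1..I}. p^2 dvd nsq (transpose A ** center Q \<theta> ** B) + 2 * s}"
  have sub: "?T \<subseteq> T1 \<union> (T2 \<union> T3)"
  proof
    fix \<theta> assume \<theta>: "\<theta> \<in> ?T"
    obtain h j i where hji: "\<theta> = (h, j, i)" by (metis surj_pair)
    have r: "h \<in> {1..I}" "j \<in> {1..I}" "i \<in> {1..I}" "p^2 dvd t h j i" using \<theta> by (auto simp: hji t_def)
    show "\<theta> \<in> T1 \<union> (T2 \<union> T3)"
    proof (cases "p dvd l j + s * g h")
      case False
      then have "\<theta> \<in> T3" using r by (auto simp: T3_def hji)
      then show ?thesis by blast
    next
      case True
      have eq: "p dvd l j \<longleftrightarrow> p dvd g h"
      proof -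
        have "p dvd l j \<longleftrightarrow> p dvd s * g h" using True dvd_add_left_iff dvd_add_right_iff by blast
        then show ?thesis using s by auto
      qed
      show ?thesis
      proof (cases "p dvd l j")
        case True
        then show ?thesis using r eq by (simp add: T1_def hji)
      next
        case False
        then have 1: "\<not> p dvd l j * g h * Q" using eq p(1,3) by (meson prime_dvd_multD)
        have "p dvd l j * g h * t h j i" using r(4) by (meson dvd_mult dvd_trans dvd_power zero_less_numeral)
        moreover have "p dvd (l j + s * g h)^2" using True by (simp add: power2_eq_square)
        ultimately have "p dvd (D h j i)^2" unfolding square using dvd_add_left_iff by blast
        then have "p dvd D h j i" using p(1) by (meson prime_dvd_power)
        then show ?thesis using r True 1 by (simp add: T2_def hji)
      qed
    qed
  qed
  show ?thesis
  proof -
    have cI: "int (card {1..I}) = I" using I1 by simp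
    have "int (card T1) * p^2 = (int (card {h \<in> {1..I}. p dvd g h}) * p) * (int (card {j \<in> {1..I}. p dvd l j}) * p) * I"
      by (simp add: T1_def card_cartesian_product power2_eq_square cI I1 del: card_atLeastAtMost_int)
    also have "\<dots> \<le> (2 * I) * (2 * I) * I"
    proof (rule mult_right_mono[OF mult_mono])
      show "int (card {h \<in> {1..I}. p dvd g h}) * p \<le> 2 * I"
        unfolding g_def by (rule card_quadratic_roots[OF I1 p(1) pI nzg])
      show "int (card {j \<in> {1..I}. p dvd l j}) * p \<le> 2 * I"
        unfolding l_def by (rule card_quadratic_roots[OF I1 p(1) pI nzl])
    qed (use I1 prime_gt_0_int[OF p(1)] in auto)
    finally have 1: "int (card T1) * p^2 \<le> 4 * I^3" by (simp add: power3_eq_cube mult_ac)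
    have "int (card T2) * p^2 = (\<Sum>h\<in>{1..I}. \<Sum>j\<in>{j \<in> {1..I}. p dvd l j + s * g h}.
        int (card {i \<in> {1..I}. \<not> p dvd l j * g h * Q \<and> p dvd D h j i}) * p) * p"
      unfolding T2_def by (simp add: card_SigmaI finite_SigmaI sum_distrib_left power2_eq_square mult_ac)
    also have "\<dots> \<le> (\<Sum>h\<in>{1..I}. \<Sum>j\<in>{j \<in> {1..I}. p dvd l j + s * g h}. I) * p"
    proof (intro mult_right_mono sum_mono)
      fix h j
      show "int (card {i \<in> {1..I}. \<not> p dvd l j * g h * Q \<and> p dvd D h j i}) * p \<le> I"
        using card_linear_roots[OF I1 p(1) pI, of "l j * g h * Q" "l j * f h + k j * g h"] I1
        by (cases "p dvd l j * g h * Q") (simp_all add: D_def)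
    qed (use prime_gt_0_int[OF p(1)] in auto)
    also have "\<dots> = (\<Sum>h\<in>{1..I}. int (card {j \<in> {1..I}. p dvd l j + s * g h}) * p) * I"
      by (simp add: sum_distrib_left mult_ac)
    also have "\<dots> \<le> (\<Sum>h\<in>{1..I}. 2 * I) * I"
    proof (intro mult_right_mono sum_mono)
      fix h
      have "{j \<in> {1..I}. p dvd l j + s * g h} =
          {j \<in> {1..I}. p dvd (m * Q^2) * j^2 + (2 * Q * k') * j + (l' + s * g h)}"
        by (simp add: l_def add.assoc)
      then show "int (card {j \<in> {1..I}. p dvd l j + s * g h}) * p \<le> 2 * I"
        using card_quadratic_roots[OF I1 p(1) pI nzl, of "l' + s * g h"] by simp
    qed (use I1 in auto)
    finally have 2: "int (card T2) * p^2 \<le> 2 * I^3" using I1 by (simp add: power3_eq_cube mult_ac)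
    have "int (card T3) * p^2 = (\<Sum>h\<in>{1..I}. \<Sum>j\<in>{1..I}.
        int (card {i \<in> {1..I}. \<not> p dvd l j + s * g h \<and> p^2 dvd t h j i}) * p^2)"
      unfolding T3_def by (simp add: card_SigmaI finite_SigmaI sum_distrib_left mult_ac)
    also have "\<dots> \<le> (\<Sum>h\<in>{1..I}. \<Sum>j\<in>{1..I}. 2 * I)"
    proof (intro sum_mono)
      fix h j
      show "int (card {i \<in> {1..I}. \<not> p dvd l j + s * g h \<and> p^2 dvd t h j i}) * p^2 \<le> 2 * I"
      proof (cases "p dvd l j + s * g h")
        case True
        then show ?thesis using I1 by simp
      next
        case False
        have simple: "\<not> p dvd 2 * (l j * g h * Q^2) * i + 2 * Q * (l j * f h + k j * g h)"
          if "p^2 dvd t h j i" for i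
        proof
          assume "p dvd 2 * (l j * g h * Q^2) * i + 2 * Q * (l j * f h + k j * g h)"
          then have "p dvd 2 * Q * D h j i" by (simp add: D_def algebra_simps power2_eq_square)
          then have "p dvd D h j i" using p(1,3) p2 by (meson prime_dvd_multD)
          then have "p dvd (D h j i)^2" by (simp add: power2_eq_square)
          moreover have "p dvd l j * g h * t h j i" using that by (meson dvd_mult dvd_trans dvd_power zero_less_numeral)
          ultimately have "p dvd (l j + s * g h)^2" unfolding square using dvd_add_right_iff by blast
          then show False using False p(1) by (meson prime_dvd_power)
        qed
        show ?thesis
          using card_simple_roots_square[OF I1 p(1,4), of "l j * g h * Q^2" "2 * Q * (l j * f h + k j * g h)"
            "l j * e + 2 * k j * f h + m * g h + 2 * s"] simple False
          unfolding t_eq by simp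
      qed
    qed
    also have "\<dots> = 2 * I^3" using I1 by (simp add: power3_eq_cube mult_ac)
    finally have 3: "int (card T3) * p^2 \<le> 2 * I^3" .
    have fin: "finite T1" "finite T2" "finite T3"
      unfolding T1_def T2_def T3_def by (intro finite_SigmaI; simp)+
    have "card ?T \<le> card (T1 \<union> (T2 \<union> T3))" using fin by (intro card_mono sub) auto
    also have "\<dots> \<le> card T1 + (card T2 + card T3)"
      using card_Un_le[of T1 "T2 \<union> T3"] card_Un_le[of T2 T3] by linarith
    finally have "int (card ?T) * p^2 \<le> (int (card T1) + (int (card T2) + int (card T3))) * p^2"
      by (intro mult_right_mono) auto
    also have "\<dots> \<le> 8 * I^3" using 1 2 3 by (simp add: algebra_simps)
    finally show ?thesis .
  qed
qed

subsection \<open>Blocks and words\<close>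

definition blocks :: "int \<Rightarrow> (int^2^2) set" where
  "blocks R = {A. det A = 1 \<and> 1 \<le> A $ 1 $ 1 \<and> A $ 1 $ 1 \<le> A $ 2 $ 1 \<and> 1 \<le> A $ 1 $ 2 \<and> A $ 1 $ 2 \<le> A $ 2 $ 2
     \<and> R \<le> A $ 2 $ 1 \<and> A $ 2 $ 1 < 2 * R \<and> R \<le> A $ 2 $ 2 \<and> A $ 2 $ 2 < 2 * R}"

lemma finite_blocks: "finite (blocks R)"
proof -
  have "blocks R \<subseteq> (\<lambda>(a, b, c, d). mat22 a b c d) ` ({1..2*R} \<times> {1..2*R} \<times> {R..2*R} \<times> {R..2*R})"
  proof
    fix A assume "A \<in> blocks R"
    then show "A \<in> (\<lambda>(a, b, c, d). mat22 a b c d) ` ({1..2*R} \<times> {1..2*R} \<times> {R..2*R} \<times> {R..2*R})"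
      by (intro image_eqI[where x = "(A $ 1 $ 1, A $ 1 $ 2, A $ 2 $ 1, A $ 2 $ 2)"])
         (auto simp: mat22_collapse blocks_def)
  qed
  then show ?thesis by (rule finite_subset) simp
qed

text \<open>The top left entry is the inverse of d modulo c in [1, c); the determinant then yields
  the other top entry, which falls into [1, d).\<close>

lemma coprime_pair_block:
  assumes R: "R \<ge> 2" and c: "R \<le> c" "c < 2 * R" and d: "R \<le> d" "d < 2 * R" and cop: "coprime c d"
  shows "\<exists>A\<in>blocks R. A $ 2 $ 1 = c \<and> A $ 2 $ 2 = d"
proof -
  obtain x where "[d * x = 1] (mod c)" using cong_solve_coprime_int cop by (metis coprime_commute)
  define a where "a = x mod c"
  have "[d * a = 1] (mod c)"
    using \<open>[d * x = 1] (mod c)\<close> by (simp add: a_def cong_def mod_mult_right_eq)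
  then have "c dvd d * a - 1" by (simp add: cong_iff_dvd_diff)
  then obtain b where b: "d * a - 1 = c * b" by (elim dvdE)
  have a: "0 \<le> a" "a < c" using R c by (simp_all add: a_def)
  have a0: "a \<noteq> 0"
  proof
    assume "a = 0"
    then have "c dvd 1" using b by (metis dvd_minus_iff dvd_triv_left diff_0 mult_zero_right)
    then show False using R c by simp
  qed
  then have a1: "a \<ge> 1" using a by simp
  have "d * 1 \<le> d * a" using a1 R d by (intro mult_left_mono) auto
  then have "c * b > 0" using b R d by linarith
  then have b1: "b \<ge> 1" using R c by (simp add: zero_less_mult_iff)
  have "d * a \<le> d * c" using a R d by (intro mult_left_mono) auto
  then have "c * b < c * d" using b by (simp add: mult.commute)
  then have "b < d" using R c by (simp add: mult_less_cancel_left_pos)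
  then have "mat22 a b c d \<in> blocks R"
    using a1 a b1 b c d by (simp add: blocks_def algebra_simps)
  then show ?thesis by (intro bexI[of _ "mat22 a b c d"]) auto
qed

lemma card_multiples:
  fixes R g :: int
  assumes "g \<ge> 1" "R \<ge> 1"
  shows "real (card {c \<in> {R..<2*R}. g dvd c}) \<le> real_of_int R / real_of_int g + 1"
proof -
  let ?S = "{c \<in> {R..<2*R}. g dvd c}"
  have "inj_on (\<lambda>c. (c - R) div g) ?S"
  proof (rule inj_onI)
    fix c c' assume c: "c \<in> ?S" "c' \<in> ?S" "(c - R) div g = (c' - R) div g"
    have "c mod g = c' mod g" using c(1,2) by auto
    then have "(c - R) mod g = (c' - R) mod g" by (rule mod_diff_cong) simp
    then have "c - R = c' - R" using c(3) by (metis div_mult_mod_eq)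
    then show "c = c'" by simp
  qed
  moreover have "(\<lambda>c. (c - R) div g) ` ?S \<subseteq> {0..R div g}"
    using assms by (auto simp: pos_imp_zdiv_nonneg_iff intro!: zdiv_mono1)
  ultimately have "card ?S \<le> card {0..R div g}" by (intro card_inj_on_le) auto
  then have "real (card ?S) \<le> real (nat (R div g + 1))" by simp
  also have "\<dots> = real_of_int (R div g) + 1"
    using assms by (simp add: pos_imp_zdiv_nonneg_iff)
  also have "\<dots> \<le> real_of_int R / real_of_int g + 1" using real_of_int_div4[of R g] by simp
  finally show ?thesis .
qed

text \<open>What counts is that 3/4 is below 1: a union bound over all common divisors then leaves a
  positive proportion of coprime pairs.\<close>

lemma sum_inverse_squares: "n \<ge> 2 \<Longrightarrow> (\<Sum>g=2..n. 1 / (real g)^2) \<le> 3/4 - 1 / real n"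
proof (induction n rule: nat_induct_at_least)
  case base
  then show ?case by simp
next
  case (Suc n)
  have "1 / (real (Suc n))^2 \<le> 1 / (real n * real (Suc n))"
    using Suc(1) by (intro divide_left_mono) (auto simp: power2_eq_square)
  also have "\<dots> = 1 / real n - 1 / real (Suc n)"
    using Suc(1) by (simp add: field_simps)
  finally show ?case using Suc by (simp del: of_nat_Suc)
qed

text \<open>The pairs with a common divisor g >= 2 number at most the sum of (R / g + 1)^2. Its main
  term is 3/4 of R^2, and R >= 10000 keeps the remaining terms below R^2 / 8.\<close>

theorem card_blocks:
  fixes R :: nat
  assumes R: "R \<ge> 10000"
  shows "real (card (blocks (int R))) \<ge> (real R)^2 / 8"
proof -
  define J where "J = {int R..<2 * int R}"
  define N where "N g = {c \<in> J. int g dvd c} \<times> {d \<in> J. int g dvd d}" for g :: nat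
  define K where "K = {(c, d) \<in> J \<times> J. coprime c d}"
  have fin: "finite K" "finite (N g)" for g
    by (auto simp: K_def N_def J_def intro: finite_subset[of _ "J \<times> J"])
  have "K \<subseteq> (\<lambda>A. (A $ 2 $ 1, A $ 2 $ 2)) ` blocks (int R)"
  proof
    fix s assume "s \<in> K"
    then obtain c d where s: "s = (c, d)" "c \<in> J" "d \<in> J" "coprime c d" by (auto simp: K_def)
    then obtain A where "A \<in> blocks (int R)" "A $ 2 $ 1 = c" "A $ 2 $ 2 = d"
      using coprime_pair_block[of "int R" c d] R by (auto simp: J_def)
    then show "s \<in> (\<lambda>A. (A $ 2 $ 1, A $ 2 $ 2)) ` blocks (int R)" using s by force
  qed
  then have cardK: "card K \<le> card (blocks (int R))" using finite_blocks by (intro surj_card_le)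
  have cover: "J \<times> J \<subseteq> K \<union> (\<Union>g\<in>{2..2*R}. N g)"
  proof
    fix s assume "s \<in> J \<times> J"
    then obtain c d where s: "s = (c, d)" "c \<in> J" "d \<in> J" by auto
    show "s \<in> K \<union> (\<Union>g\<in>{2..2*R}. N g)"
    proof (cases "coprime c d")
      case True
      then show ?thesis using s by (simp add: K_def)
    next
      case False
      define g where "g = nat (gcd c d)"
      have c0: "c > 0" "c < 2 * int R" using s R by (auto simp: J_def)
      have "gcd c d > 0" using c0 by simp
      moreover have "gcd c d \<noteq> 1" using False by (simp add: coprime_iff_gcd_eq_1)
      ultimately have "gcd c d \<ge> 2" by linarith
      moreover have "gcd c d \<le> c" using c0 by (simp add: zdvd_imp_le)
      ultimately have "2 \<le> gcd c d" "gcd c d \<le> 2 * int R" using c0 by linarith+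
      then have "g \<in> {2..2*R}" "int g = gcd c d" by (simp_all add: g_def nat_le_iff le_nat_iff)
      then have "s \<in> N g" using s by (simp add: N_def)
      then show ?thesis using \<open>g \<in> {2..2*R}\<close> by blast
    qed
  qed
  have "card (J \<times> J) \<le> card (K \<union> (\<Union>g\<in>{2..2*R}. N g))"
    using fin by (intro card_mono cover) auto
  also have "\<dots> \<le> card K + card (\<Union>g\<in>{2..2*R}. N g)" by (rule card_Un_le)
  also have "\<dots> \<le> card K + (\<Sum>g\<in>{2..2*R}. card (N g))" by (intro add_left_mono card_UN_le) simp
  finally have "R * R \<le> card K + (\<Sum>g\<in>{2..2*R}. card (N g))"
    by (simp add: J_def card_cartesian_product)
  then have "real (R * R) \<le> real (card K + (\<Sum>g\<in>{2..2*R}. card (N g)))" by (simp only: of_nat_le_iff)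
  then have 1: "(real R)^2 \<le> real (card K) + (\<Sum>g\<in>{2..2*R}. real (card (N g)))"
    by (simp add: power2_eq_square)
  have "(\<Sum>g\<in>{2..2*R}. real (card (N g))) \<le> (\<Sum>g\<in>{2..2*R}. (real R)^2 * (1 / (real g)^2) + 2 * real R * (1 / sqrt (real g)) + 1)"
  proof (rule sum_mono)
    fix g assume g: "g \<in> {2..2*R}"
    have le: "real (card {c \<in> J. int g dvd c}) \<le> real R / real g + 1"
      using card_multiples[of "int g" "int R"] g R by (simp add: J_def)
    have "real (card (N g)) = real (card {c \<in> J. int g dvd c}) * real (card {c \<in> J. int g dvd c})"
      by (simp add: N_def card_cartesian_product)
    also have "\<dots> \<le> (real R / real g + 1) * (real R / real g + 1)"
      using le by (intro mult_mono) auto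
    also have "\<dots> = (real R)^2 * (1 / (real g)^2) + 2 * real R * (1 / real g) + 1"
      by (simp add: power2_eq_square algebra_simps)
    \<comment> \<open>The cross term is weakened from 1 / g to 1 / sqrt g so that
      \<open>sum_inverse_sqrt\<close> applies; the resulting R^(3/2) is still small against
      R^2.\<close>
    also have "\<dots> \<le> (real R)^2 * (1 / (real g)^2) + 2 * real R * (1 / sqrt (real g)) + 1"
    proof -
      have "sqrt (real g) * 1 \<le> sqrt (real g) * sqrt (real g)" using g by (intro mult_left_mono) auto
      then have "sqrt (real g) \<le> real g" by simp
      then have "1 / real g \<le> 1 / sqrt (real g)" using g by (intro divide_left_mono) auto
      then show ?thesis by (intro add_mono mult_left_mono order_refl) auto
    qed
    finally show "real (card (N g)) \<le> \<dots>" .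
  qed
  also have "\<dots> = (real R)^2 * (\<Sum>g\<in>{2..2*R}. 1 / (real g)^2) + 2 * real R * (\<Sum>g\<in>{2..2*R}. 1 / sqrt (real g))
      + real (card {2..2*R})"
    by (simp add: sum.distrib sum_distrib_left)
  also have "\<dots> \<le> (real R)^2 * (3 / 4) + 2 * real R * (2 * sqrt (real (2 * R))) + real (2 * R)"
  proof (intro add_mono mult_left_mono)
    have "3 / 4 - 1 / real (2 * R) \<le> 3 / 4" by simp
    then show "(\<Sum>g\<in>{2..2*R}. 1 / (real g)^2) \<le> 3 / 4"
      using sum_inverse_squares[of "2 * R"] R by linarith
    have "(\<Sum>g\<in>{2..2*R}. 1 / sqrt (real g)) \<le> (\<Sum>g\<in>{1..2*R}. 1 / sqrt (real g))"
      by (intro sum_mono2) auto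
    then show "(\<Sum>g\<in>{2..2*R}. 1 / sqrt (real g)) \<le> 2 * sqrt (real (2 * R))"
      using sum_inverse_sqrt[of "2 * R"] by linarith
  qed auto
  also have "\<dots> \<le> (real R)^2 * (7 / 8)"
  proof -
    define r where "r = sqrt (real (2 * R))"
    have r2: "2 * real R = r^2" by (simp add: r_def)
    have "sqrt ((100::real)^2) \<le> r" unfolding r_def using R by (intro real_sqrt_le_mono) simp
    then have r: "r \<ge> 100" by simp
    have "100 * r^3 \<le> r * r^3" "100 * r^2 \<le> r * r^2" using r by (auto intro!: mult_right_mono)
    moreover have "r * r^3 = r^4" "r * r^2 = r^3" by (simp_all add: power2_eq_square power3_eq_cube power4_eq_xxxx)
    moreover have "r^3 \<ge> 0" using r by simp
    ultimately have "2 * r^3 + r^2 \<le> r^4 / 32" by linarith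
    moreover have Rr: "real R = r^2 / 2" using r2 by simp
    moreover have "(real R)^2 = r^4 / 4" unfolding Rr by (simp add: power_divide flip: power_mult)
    moreover have "2 * real R * (2 * r) = 2 * r^3" "real (2 * R) = r^2"
      using r2 by (simp_all add: power2_eq_square power3_eq_cube)
    ultimately show ?thesis unfolding r_def[symmetric] by linarith
  qed
  finally have "(real R)^2 / 8 \<le> real (card K)" using 1 by simp
  then show ?thesis using cardK by simp
qed

section \<open>Words in the blocks\<close>

definition lprod :: "('a::semiring_1^2^2) list \<Rightarrow> 'a^2^2" where
  "lprod xs = foldr (**) xs (mat 1)"

lemma lprod_simps [simp]: "lprod [] = mat 1" "lprod (A # xs) = A ** lprod xs"
  by (simp_all add: lprod_def)

lemma lprod_append: "lprod (xs @ ys) = lprod xs ** lprod ys"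
  by (induction xs) (simp_all add: matrix_mul_assoc)

lemma lprod_transpose:
  fixes xs :: "('a::comm_semiring_1^2^2) list"
  shows "transpose (lprod xs) = lprod (rev (map transpose xs))"
  by (induction xs) (simp_all add: lprod_append matrix_transpose_mul transpose_mat)

lemma det_lprod: "(\<And>A. A \<in> set xs \<Longrightarrow> det A = 1) \<Longrightarrow> det (lprod xs) = 1"
  for xs :: "('a::comm_ring_1^2^2) list"
  by (induction xs) (auto simp: det_mul)

lemma blocks_det: "A \<in> blocks R \<Longrightarrow> det A = 1"
  by (simp add: blocks_def)

text \<open>The first column of the common product lies in the positive cones of both blocks, so W =
  A^(-1) A' = (x, y; z, w) has a positive diagonal. All bottom entries lie in [R, 2R), so two of
  them already add up to at least 2R: a nonzero z or y would make another bottom entry that large.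
  Hence W = 1.\<close>

lemma block_prefix_unique:
  fixes A A' M M' :: "int^2^2"
  assumes A: "A \<in> blocks R" "A' \<in> blocks R" and R: "R \<ge> 1"
    and M: "M $ 1 $ 1 > 0" "M $ 2 $ 1 > 0" "M' $ 1 $ 1 > 0" "M' $ 2 $ 1 > 0"
    and eq: "A ** M = A' ** M'"
  shows "A = A'"
proof -
  define a b c d where "a = A $ 1 $ 1" and "b = A $ 1 $ 2" and "c = A $ 2 $ 1" and "d = A $ 2 $ 2"
  define a' b' c' d' where "a' = A' $ 1 $ 1" and "b' = A' $ 1 $ 2" and "c' = A' $ 2 $ 1" and "d' = A' $ 2 $ 2"
  note defs = a_def b_def c_def d_def a'_def b'_def c'_def d'_def
  have det: "a * d - b * c = 1" "a' * d' - b' * c' = 1" using A by (auto simp: blocks_def det_2 defs)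
  have bd: "a \<ge> 1" "b \<ge> 1" "a' \<ge> 1" "b' \<ge> 1" "R \<le> c" "c < 2 * R" "R \<le> d" "d < 2 * R" "R \<le> c'" "c' < 2 * R" "R \<le> d'" "d' < 2 * R"
    using A by (auto simp: blocks_def defs)
  define u v where "u = a * M $ 1 $ 1 + b * M $ 2 $ 1" and "v = c * M $ 1 $ 1 + d * M $ 2 $ 1"
  have uv': "u = a' * M' $ 1 $ 1 + b' * M' $ 2 $ 1" "v = c' * M' $ 1 $ 1 + d' * M' $ 2 $ 1"
    using arg_cong[OF eq, of "\<lambda>X. X $ 1 $ 1"] arg_cong[OF eq, of "\<lambda>X. X $ 2 $ 1"] by (simp_all add: u_def v_def defs)
  have pos: "u > 0" "v > 0" using bd M R by (auto simp: u_def v_def intro!: add_pos_pos)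
  have "a * v - c * u = (a * d - b * c) * M $ 2 $ 1" "d * u - b * v = (a * d - b * c) * M $ 1 $ 1"
    by (simp_all add: u_def v_def algebra_simps)
  then have "a * v - c * u = M $ 2 $ 1" "d * u - b * v = M $ 1 $ 1" by (simp_all add: det)
  then have i1: "c * u < a * v" "b * v < d * u" using M by linarith+
  have "a' * v - c' * u = (a' * d' - b' * c') * M' $ 2 $ 1" "d' * u - b' * v = (a' * d' - b' * c') * M' $ 1 $ 1"
    by (simp_all add: uv' algebra_simps)
  then have "a' * v - c' * u = M' $ 2 $ 1" "d' * u - b' * v = M' $ 1 $ 1" by (simp_all add: det)
  then have i2: "c' * u < a' * v" "b' * v < d' * u" using M by linarith+
  define x y z w where "x = d * a' - b * c'" and "y = d * b' - b * d'" and "z = a * c' - c * a'" and "w = a * d' - c * b'"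
  have "(b * v) * (c' * u) < (d * u) * (a' * v)"
    by (rule mult_strict_mono[OF i1(2) i2(1)]) (use bd pos R in auto)
  then have "(u * v) * x > 0" by (simp add: x_def algebra_simps)
  then have "x > 0" by (rule zero_less_mult_pos) (simp add: pos)
  then have x1: "x \<ge> 1" by simp
  have "(c * u) * (b' * v) < (a * v) * (d' * u)"
    by (rule mult_strict_mono[OF i1(1) i2(2)]) (use bd pos R in auto)
  then have "(u * v) * w > 0" by (simp add: w_def algebra_simps)
  then have "w > 0" by (rule zero_less_mult_pos) (simp add: pos)
  then have w1: "w \<ge> 1" by simp
  have detW: "x * w - y * z = 1"
  proof -
    have "x * w - y * z = (a * d - b * c) * (a' * d' - b' * c')"
      by (simp add: x_def y_def z_def w_def algebra_simps)
    then show ?thesis by (simp add: det)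
  qed
  have "c * x + d * z = (a * d - b * c) * c'" "c * y + d * w = (a * d - b * c) * d'"
    "a * x + b * z = (a * d - b * c) * a'" "a * y + b * w = (a * d - b * c) * b'"
    by (simp_all add: x_def y_def z_def w_def algebra_simps)
  then have W: "c * x + d * z = c'" "c * y + d * w = d'" "a * x + b * z = a'" "a * y + b * w = b'"
    by (simp_all add: det)
  have "c' * w - d' * z = c * (a' * d' - b' * c')"
    by (simp add: z_def w_def algebra_simps)
  then have Wi: "c' * w - d' * z = c" by (simp add: det)
  have up: "e \<le> e * r" if "r \<ge> 1" "e \<ge> 0" for e r :: int
    using mult_left_mono[OF that] by simp
  have z0: "z = 0"
  proof (rule ccontr)
    assume "z \<noteq> 0"
    then consider "z \<ge> 1" | "z \<le> -1" by linarith
    then show False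
    proof cases
      case 1
      then show False using up[OF x1, of c] up[of z d] W(1) bd R by linarith
    next
      case 2
      have "d' \<le> d' * (- z)" using up[of "- z" d'] 2 bd R by linarith
      then show False using up[OF w1, of c'] Wi bd R by linarith
    qed
  qed
  have "x * w = 1" using detW z0 by simp
  then have xw: "x = 1" "w = 1" using x1 w1 by (auto simp: zmult_eq_1_iff)
  have W2: "c * y + d = d'" using W(2) xw by simp
  have y0: "y = 0"
  proof (rule ccontr)
    assume "y \<noteq> 0"
    then consider "y \<ge> 1" | "y \<le> -1" by linarith
    then show False
    proof cases
      case 1
      have "c \<le> c * y" using up[of y c] 1 bd R by linarith
      then show False using W2 bd R by linarith
    next
      case 2
      have "c \<le> c * (- y)" using up[of "- y" c] 2 bd R by linarith
      then show False using W2 bd R by linarith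
    qed
  qed
  show ?thesis using W xw y0 z0 by (simp add: mat22_eq_iff defs)
qed

text \<open>A further block on the left multiplies the bottom entries by at least R and at most 4R:
  a factor 2R from the block, and 2 because the top entry of a column never exceeds the bottom one.
  The spread \<open>L / l\<close> after k blocks is therefore 4^k whatever \<open>R\<close> is,
  which is why a large \<open>R\<close> makes it negligible.\<close>

lemma lprod_blocks_adm:
  assumes "xs \<noteq> []" "set xs \<subseteq> blocks R" "R \<ge> 1"
  shows "adm (real_of_int R ^ length xs) ((4 * real_of_int R) ^ length xs) (lprod xs)"
  using assms(1,2)
proof (induction xs rule: list_nonempty_induct)
  case (single A)
  then show ?case using assms(3) by (auto simp: adm_def blocks_def)
next
  case (cons A xs)
  define M where "M = lprod xs"
  define l L where "l = real_of_int R ^ length xs" and "L = (4 * real_of_int R) ^ length xs"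
  have M: "adm l L M" using cons by (simp add: M_def l_def L_def)
  have A: "A \<in> blocks R" using cons by simp
  have l1: "l \<ge> 1" using assms(3) by (simp add: l_def)
  note b = adm_bounds[OF M l1]
  have a: "1 \<le> A $ 1 $ 1" "A $ 1 $ 1 \<le> A $ 2 $ 1" "1 \<le> A $ 1 $ 2" "A $ 1 $ 2 \<le> A $ 2 $ 2"
    "R \<le> A $ 2 $ 1" "A $ 2 $ 1 \<le> 2 * R" "R \<le> A $ 2 $ 2" "A $ 2 $ 2 \<le> 2 * R" "det A = 1"
    using A by (auto simp: blocks_def)
  have dM: "det M = 1" "l \<le> real_of_int (M $ 2 $ 1)" "real_of_int (M $ 2 $ 1) \<le> L"
    "l \<le> real_of_int (M $ 2 $ 2)" "real_of_int (M $ 2 $ 2) \<le> L"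
    using M by (auto simp: adm_def)
  have col: "real_of_int R * l \<le> real_of_int (A $ 2 $ 1 * m1 + A $ 2 $ 2 * m2) \<and>
      real_of_int (A $ 2 $ 1 * m1 + A $ 2 $ 2 * m2) \<le> 4 * real_of_int R * L"
    if "0 \<le> m1" "m1 \<le> m2" "l \<le> real_of_int m2" "real_of_int m2 \<le> L" for m1 m2
  proof
    have "real_of_int R * l \<le> real_of_int (A $ 2 $ 2) * real_of_int m2"
      using a that l1 assms(3) by (intro mult_mono) auto
    also have "\<dots> \<le> real_of_int (A $ 2 $ 1 * m1 + A $ 2 $ 2 * m2)"
      using a that assms(3) by simp
    finally show "real_of_int R * l \<le> real_of_int (A $ 2 $ 1 * m1 + A $ 2 $ 2 * m2)" .
    have "A $ 2 $ 1 * m1 + A $ 2 $ 2 * m2 \<le> 2 * R * m2 + 2 * R * m2"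
      using a that assms(3) by (intro add_mono mult_mono) auto
    then have "real_of_int (A $ 2 $ 1 * m1 + A $ 2 $ 2 * m2) \<le> real_of_int (4 * R * m2)"
      by (intro of_int_le_iff[THEN iffD2]) simp
    also have "\<dots> \<le> 4 * real_of_int R * L"
      using that assms(3) by simp
    finally show "real_of_int (A $ 2 $ 1 * m1 + A $ 2 $ 2 * m2) \<le> 4 * real_of_int R * L" .
  qed
  have "adm (real_of_int R * l) (4 * real_of_int R * L) (A ** M)"
    unfolding adm_def mult22_nth
    using col[of "M $ 1 $ 1" "M $ 2 $ 1"] col[of "M $ 1 $ 2" "M $ 2 $ 2"] b a dM
    by (auto simp: det_mul intro!: add_nonneg_nonneg add_mono mult_right_mono)
  then show ?case by (simp add: M_def l_def L_def)
qed

lemma lprod_blocks_pos: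
  assumes "xs \<noteq> []" "set xs \<subseteq> blocks R" "R \<ge> 1"
  shows "lprod xs $ 1 $ 1 > 0" "lprod xs $ 2 $ 1 > 0"
proof -
  have l: "real_of_int R ^ length xs \<ge> 1" using assms(3) by simp
  show "lprod xs $ 1 $ 1 > 0" "lprod xs $ 2 $ 1 > 0"
    using adm_bounds(1,5)[OF lprod_blocks_adm[OF assms] l] by auto
qed

lemma lprod_blocks_inj:
  assumes "set xs \<subseteq> blocks R" "set ys \<subseteq> blocks R" "R \<ge> 1" "length xs = length ys" "lprod xs = lprod ys"
  shows "xs = ys"
  using assms(4,1,2,5)
proof (induction xs ys rule: list_induct2)
  case (Cons A xs B ys)
  have "A = B"
  proof (cases "xs = []")
    case True
    then show ?thesis using Cons by simp
  next
    case False
    then have "ys \<noteq> []" using Cons by auto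
    then show ?thesis
      using Cons False lprod_blocks_pos[OF False, of R] lprod_blocks_pos[of ys R] assms(3)
      by (intro block_prefix_unique[of A R B "lprod xs" "lprod ys"]) auto
  qed
  moreover have "det A = 1" using Cons.prems by (auto simp: blocks_def)
  ultimately have "lprod xs = lprod ys" using Cons.prems by (simp add: mult22_left_cancel)
  then show ?case using Cons \<open>A = B\<close> by simp
qed auto

definition words :: "('a::semiring_1^2^2) set \<Rightarrow> nat \<Rightarrow> ('a^2^2) set" where
  "words S k = lprod ` {xs. set xs \<subseteq> S \<and> length xs = k}"

lemma finite_words: "finite S \<Longrightarrow> finite (words S k)"
  by (simp add: words_def finite_lists_length_eq)

lemma card_words:
  assumes "S \<subseteq> blocks R" "R \<ge> 1"
  shows "card (words S k) = card S ^ k"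
proof -
  have "inj_on lprod {xs. set xs \<subseteq> S \<and> length xs = k}"
    using assms by (intro inj_onI lprod_blocks_inj[of _ R]) auto
  moreover have "finite S" using assms(1) finite_blocks finite_subset by blast
  ultimately show ?thesis by (simp add: words_def card_image card_lists_length_eq)
qed

lemma words_adm:
  assumes "S \<subseteq> blocks R" "R \<ge> 1" "k \<ge> 1" "A \<in> words S k"
  shows "adm (real_of_int R ^ k) ((4 * real_of_int R) ^ k) A"
proof -
  obtain xs where xs: "A = lprod xs" "set xs \<subseteq> S" "length xs = k" using assms(4) by (auto simp: words_def)
  then have "xs \<noteq> []" "set xs \<subseteq> blocks R" using assms(1,3) by auto
  from lprod_blocks_adm[OF this assms(2)] show ?thesis using xs by simp
qed

lemma words_add: "words S (i + j) = (\<lambda>(A, B). A ** B) ` (words S i \<times> words S j)"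
proof safe
  fix M assume "M \<in> words S (i + j)"
  then obtain xs where xs: "M = lprod xs" "set xs \<subseteq> S" "length xs = i + j" by (auto simp: words_def)
  have "M = lprod (take i xs) ** lprod (drop i xs)"
    using xs(1) by (simp flip: lprod_append)
  moreover have "lprod (take i xs) \<in> words S i" "lprod (drop i xs) \<in> words S j"
    using xs set_take_subset[of i xs] set_drop_subset[of i xs] by (auto simp: words_def)
  ultimately show "M \<in> (\<lambda>(A, B). A ** B) ` (words S i \<times> words S j)" by force
next
  fix A B assume "A \<in> words S i" "B \<in> words S j"
  then obtain xs ys where "A = lprod xs" "set xs \<subseteq> S" "length xs = i" "B = lprod ys" "set ys \<subseteq> S" "length ys = j"
    by (auto simp: words_def)
  then show "A ** B \<in> words S (i + j)"
    unfolding words_def by (intro image_eqI[of _ _ "xs @ ys"]) (auto simp: lprod_append)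
qed

lemma words_det: "(\<And>A. A \<in> S \<Longrightarrow> det A = 1) \<Longrightarrow> M \<in> words S k \<Longrightarrow> det M = 1"
  for S :: "('a::comm_ring_1^2^2) set"
  by (auto simp: words_def intro!: det_lprod)

subsection \<open>Congruences\<close>

definition mcong :: "int \<Rightarrow> int^2^2 \<Rightarrow> int^2^2 \<Rightarrow> bool" where
  "mcong q A B \<longleftrightarrow> (\<forall>i j. [A $ i $ j = B $ i $ j] (mod q))"

lemma mcong_refl [simp]: "mcong q A A"
  by (simp add: mcong_def)

lemma mcong_trans: "mcong q A B \<Longrightarrow> mcong q B C \<Longrightarrow> mcong q A C"
  by (meson mcong_def cong_trans)

lemma mcong_mult: "mcong q A A' \<Longrightarrow> mcong q B B' \<Longrightarrow> mcong q (A ** B) (A' ** B')"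
  by (auto simp: mcong_def forall_2 intro!: cong_add cong_mult)

lemma mcong_transpose: "mcong q A A' \<Longrightarrow> mcong q (transpose A) (transpose A')"
  by (simp add: mcong_def)

lemma mcong_nsq: "mcong q A A' \<Longrightarrow> [nsq A = nsq A'] (mod q)"
  unfolding nsq_def mcong_def by (intro cong_add cong_pow) auto

definition residue :: "int \<Rightarrow> int^2^2 \<Rightarrow> int \<times> int \<times> int \<times> int" where
  "residue q A = (A $ 1 $ 1 mod q, A $ 1 $ 2 mod q, A $ 2 $ 1 mod q, A $ 2 $ 2 mod q)"

lemma mcong_iff_residue: "mcong q A B \<longleftrightarrow> residue q A = residue q B"
  by (auto simp: mcong_def residue_def forall_2 cong_def)

lemma residue_range: "q > 0 \<Longrightarrow> residue q A \<in> {0..<q} \<times> {0..<q} \<times> {0..<q} \<times> {0..<q}"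
  by (simp add: residue_def)

lemma popular_class:
  fixes q :: int
  assumes "q > 0" "finite S"
  obtains T where "T \<subseteq> S" "card S \<le> card T * nat q ^ 4" "\<And>A B. A \<in> T \<Longrightarrow> B \<in> T \<Longrightarrow> mcong q A B"
proof -
  let ?D = "{0..<q} \<times> {0..<q} \<times> {0..<q} \<times> {0..<q}"
  define b where "b = Max ((\<lambda>e. card {A \<in> S. residue q A = e}) ` ?D)"
  have ne: "?D \<noteq> {}" using assms(1) by auto
  have "b \<in> (\<lambda>e. card {A \<in> S. residue q A = e}) ` ?D"
    unfolding b_def using ne by (intro Max_in) auto
  then obtain e where e: "card {A \<in> S. residue q A = e} = b" by blast
  have "card S \<le> b * card ?D"
  proof (rule card_le_fibres[where f = "residue q"])
    fix e assume "e \<in> ?D"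
    then show "card {s \<in> S. residue q s = e} \<le> b" unfolding b_def by (intro Max_ge) auto
  qed (use assms residue_range in auto)
  moreover have "card ?D = nat q ^ 4"
    by (simp add: card_cartesian_product power4_eq_xxxx)
  ultimately show thesis
    using e that[of "{A \<in> S. residue q A = e}"] by (auto simp: mcong_iff_residue)
qed

lemma power_mcong_one:
  fixes q :: int and A :: "int^2^2"
  assumes q: "q > 0" and A: "det A = 1"
  obtains n where "n \<ge> 1" "mcong q (lprod (replicate n A)) (mat 1)"
proof -
  let ?D = "{0..<q} \<times> {0..<q} \<times> {0..<q} \<times> {0..<q}"
  have "\<not> inj_on (\<lambda>n. residue q (lprod (replicate n A))) (UNIV :: nat set)"
  proof
    assume "inj_on (\<lambda>n. residue q (lprod (replicate n A))) (UNIV :: nat set)"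
    then have "infinite ((\<lambda>n. residue q (lprod (replicate n A))) ` (UNIV :: nat set))"
      using finite_imageD infinite_UNIV_nat by blast
    moreover have "(\<lambda>n. residue q (lprod (replicate n A))) ` (UNIV :: nat set) \<subseteq> ?D"
      using residue_range[OF q] by blast
    ultimately show False using finite_subset by blast
  qed
  then obtain m n where mn: "m < n" "residue q (lprod (replicate m A)) = residue q (lprod (replicate n A))"
    unfolding inj_on_def by (metis linorder_neqE_nat)
  define P where "P = lprod (replicate m A)"
  have dP: "det P = 1" unfolding P_def by (intro det_lprod) (use A in auto)
  have "lprod (replicate n A) = P ** lprod (replicate (n - m) A)"
    using mn(1) by (simp add: P_def flip: lprod_append replicate_add)
  then have "mcong q (P ** lprod (replicate (n - m) A)) P"
    using mn(2) by (simp add: mcong_iff_residue P_def)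
  then have "mcong q (adj22 P ** (P ** lprod (replicate (n - m) A))) (adj22 P ** P)"
    by (intro mcong_mult) auto
  then have "mcong q (lprod (replicate (n - m) A)) (mat 1)"
    by (simp add: adj22_cancel_left[OF dP] adj22_mult_left[OF dP])
  then show thesis using that[of "n - m"] mn(1) by simp
qed

lemma words_mcong_one:
  fixes q :: int
  assumes q: "q > 0" and S: "S \<noteq> {}" "\<And>A. A \<in> S \<Longrightarrow> det A = 1" "\<And>A B. A \<in> S \<Longrightarrow> B \<in> S \<Longrightarrow> mcong q A B"
  obtains n where "n \<ge> 1" "\<And>m M. M \<in> words S (n * m) \<Longrightarrow> mcong q M (mat 1)"
proof -
  obtain A where A: "A \<in> S" using S by blast
  obtain n where n: "n \<ge> 1" "mcong q (lprod (replicate n A)) (mat 1)"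
    using power_mcong_one[OF q S(2)[OF A]] by blast
  have pw: "mcong q (lprod (replicate (n * m) A)) (mat 1)" for m
  proof (induction m)
    case (Suc m)
    have "lprod (replicate (n * Suc m) A) = lprod (replicate n A) ** lprod (replicate (n * m) A)"
      by (simp flip: lprod_append replicate_add)
    then show ?case using mcong_mult[OF n(2) Suc.IH] by simp
  qed simp
  have eq: "set xs \<subseteq> S \<Longrightarrow> mcong q (lprod xs) (lprod (replicate (length xs) A))" for xs
    by (induction xs) (simp_all add: mcong_mult S(3)[OF _ A])
  have "mcong q M (mat 1)" if "M \<in> words S (n * m)" for m M
    using that eq pw mcong_trans by (force simp: words_def)
  then show thesis using that n(1) by blast
qed

lemma mcong_center: "mcong Q (center Q \<theta>) (mat22 1 1 0 1)"
proof -
  obtain h j i where \<theta>: "\<theta> = (h, j, i)" by (metis surj_pair)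
  have "mcong Q (mat22 1 1 0 1 ** mat22 1 0 (Q * j) 1 ** mat22 1 (Q * i) 0 1 ** mat22 1 0 (Q * h) 1)
      (mat22 1 1 0 1 ** mat 1 ** mat 1 ** mat 1)"
    by (intro mcong_mult) (auto simp: mcong_def forall_2 cong_def)
  then show ?thesis by (simp add: center_def \<theta>)
qed

text \<open>This is the purpose of the constant first factor of \<open>center\<close>: modulo
  \<open>Q\<close> only it survives, so t - 2 = 1 and t + 2 = 5, both squarefree. Without it t - 2
  would vanish modulo \<open>Q\<close>.\<close>

lemma nsq_mod:
  assumes "mcong Q A (mat 1)" "mcong Q B (mat 1)"
  shows "[nsq (transpose A ** center Q \<theta> ** B) = 3] (mod Q)"
proof -
  have "mcong Q (transpose A ** center Q \<theta> ** B) (transpose (mat 1) ** mat22 1 1 0 1 ** mat 1)"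
    by (intro mcong_mult mcong_transpose mcong_center assms)
  then have "[nsq (transpose A ** center Q \<theta> ** B) = nsq (mat22 1 1 0 1)] (mod Q)"
    by (auto dest!: mcong_nsq simp: transpose_mat)
  then show ?thesis by (simp add: nsq_def)
qed

lemma center_bounds:
  assumes "\<theta> \<in> {1..I} \<times> {1..I} \<times> {1..I}" "Q \<ge> 1"
  shows "1 \<le> center Q \<theta> $ i $ j" "center Q \<theta> $ i $ j \<le> 5 * (Q * I)^3"
proof -
  obtain h j' i' where \<theta>: "\<theta> = (h, j', i')" by (metis surj_pair)
  define H J K where "H = Q * h" and "J = Q * j'" and "K = Q * i'"
  define N where "N = Q * I"
  have b: "1 \<le> H" "H \<le> N" "1 \<le> J" "J \<le> N" "1 \<le> K" "K \<le> N" "1 \<le> N"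
    using assms by (auto simp: \<theta> H_def J_def K_def N_def intro: mult_left_mono order_trans[OF _ mult_mono[of 1 Q 1]]
        mult_ge1_I)
  have e: "center Q \<theta> $ 1 $ 1 = 1 + K * H + J + J * (K * H) + H" "center Q \<theta> $ 1 $ 2 = K + J * K + 1"
    "center Q \<theta> $ 2 $ 1 = J + J * (K * H) + H" "center Q \<theta> $ 2 $ 2 = J * K + 1"
    by (simp_all add: center_def \<theta> H_def J_def K_def algebra_simps)
  have p: "0 \<le> J * K" "J * K \<le> N * N" "0 \<le> K * H" "K * H \<le> N * N" "0 \<le> J * (K * H)" "J * (K * H) \<le> N * (N * N)"
    using b by (auto intro!: mult_mono)
  have N: "1 \<le> N^3" "N \<le> N^3" "N * N \<le> N^3" "N * (N * N) = N^3"
    using b(7) self_le_power[of N 3] power_increasing[of 2 3 N] one_le_power[of N 3]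
    by (simp_all add: power3_eq_cube power2_eq_square mult.assoc)
  have "1 \<le> center Q \<theta> $ 1 $ 1" "center Q \<theta> $ 1 $ 1 \<le> 5 * N^3" "1 \<le> center Q \<theta> $ 1 $ 2" "center Q \<theta> $ 1 $ 2 \<le> 5 * N^3"
    "1 \<le> center Q \<theta> $ 2 $ 1" "center Q \<theta> $ 2 $ 1 \<le> 5 * N^3" "1 \<le> center Q \<theta> $ 2 $ 2" "center Q \<theta> $ 2 $ 2 \<le> 5 * N^3"
    unfolding e using p N b by linarith+
  then have "\<forall>i j. 1 \<le> center Q \<theta> $ i $ j \<and> center Q \<theta> $ i $ j \<le> 5 * N^3"
    by (simp only: forall_2)
  then show "1 \<le> center Q \<theta> $ i $ j" "center Q \<theta> $ i $ j \<le> 5 * (Q * I)^3" by (auto simp: N_def)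
qed

text \<open>The first column of \<open>M\<close> is A^T applied to a nonnegative vector, which keeps
  d / c, for the bottom row (c, d) of \<open>A\<close>, within 2K / l^2 of the ratio of the entries
  of that column. So \<open>A\<close> is confined to a short interval of fractions, and
  \<open>A\<close> determines \<open>B\<close>.\<close>

lemma card_factorisations:
  fixes K l L :: real
  assumes S: "\<And>A. A \<in> S \<Longrightarrow> adm l L A" "finite S" and l: "1 \<le> l" "l \<le> L"
    and C: "det C = 1" "\<And>i j. 1 \<le> C $ i $ j" "\<And>i j. real_of_int (C $ i $ j) \<le> K"
  shows "real (card {(A, B) \<in> S \<times> S. transpose A ** C ** B = M}) \<le> 1 + 2 * K * (L / l)^2"
proof -
  define P where "P = {(A, B) \<in> S \<times> S. transpose A ** C ** B = M}"
  have inj: "inj_on fst P"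
  proof (rule inj_onI)
    fix x y assume xy: "x \<in> P" "y \<in> P" "fst x = fst y"
    obtain A B B' where AB: "x = (A, B)" "y = (A, B')" using xy(3) by (metis prod.collapse)
    have "det (transpose A ** C) = 1" using xy AB S(1) adm_det C(1) by (force simp: P_def det_mul)
    moreover have "(transpose A ** C) ** B = (transpose A ** C) ** B'" using xy AB by (simp add: P_def)
    ultimately show "x = y" using AB by (simp add: mult22_left_cancel)
  qed
  have "real (card (fst ` P)) \<le> 1 + (2 * K / l^2) * L^2"
  proof (rule card_adm_interval[where \<alpha> = "real_of_int (M $ 2 $ 1) / real_of_int (M $ 1 $ 1)"])
    show "adm l L A" if "A \<in> fst ` P" for A using that S by (auto simp: P_def)
    have "K \<ge> 1" using C(2)[of 1 1] C(3)[of 1 1] by linarith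
    then show "0 \<le> 2 * K / l^2" by simp
    show "1 \<le> l" "l \<le> L" by fact+
    fix A assume "A \<in> fst ` P"
    then obtain B where AB: "A \<in> S" "B \<in> S" "transpose A ** C ** B = M" by (auto simp: P_def)
    note a = adm_bounds[OF S(1)[OF AB(1)] l(1)] and b = adm_bounds[OF S(1)[OF AB(2)] l(1)]
    define n1 n2 where "n1 = C $ 1 $ 1 * B $ 1 $ 1 + C $ 1 $ 2 * B $ 2 $ 1"
      and "n2 = C $ 2 $ 1 * B $ 1 $ 1 + C $ 2 $ 2 * B $ 2 $ 1"
    have M: "M $ 1 $ 1 = A $ 1 $ 1 * n1 + A $ 2 $ 1 * n2" "M $ 2 $ 1 = A $ 1 $ 2 * n1 + A $ 2 $ 2 * n2"
      unfolding AB(3)[symmetric] n1_def n2_def by (simp_all add: algebra_simps)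
    define c d m n where "c = real_of_int (A $ 2 $ 1)" and "d = real_of_int (A $ 2 $ 2)"
      and "m = real_of_int (M $ 1 $ 1)" and "n = real_of_int (B $ 2 $ 1)"
    have cl: "c \<ge> l" "c > 0" using S(1)[OF AB(1)] l by (auto simp: adm_def c_def)
    have n0: "n \<ge> 1" using b by (simp add: n_def)
    have n1: "n1 \<ge> 0" "real_of_int n1 \<le> 2 * K * n"
    proof -
      show "n1 \<ge> 0" using b C(2)[of 1 1] C(2)[of 1 2] by (simp add: n1_def)
      have "real_of_int n1 \<le> K * n + K * n"
        unfolding n1_def n_def of_int_add of_int_mult using C(3) b \<open>K \<ge> 1\<close>
        by (intro add_mono mult_mono) auto
      then show "real_of_int n1 \<le> 2 * K * n" by simp
    qed
    have n2: "real_of_int n2 \<ge> n"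
    proof -
      have "C $ 2 $ 2 * B $ 2 $ 1 \<ge> 1 * B $ 2 $ 1" using b C(2) by (intro mult_right_mono) auto
      moreover have "C $ 2 $ 1 * B $ 1 $ 1 \<ge> 0" using b C(2)[of 2 1] by simp
      ultimately show ?thesis unfolding n_def n2_def by linarith
    qed
    have "m \<ge> c * n"
    proof -
      have "c * n \<le> c * real_of_int n2" using cl n2 by (intro mult_left_mono) auto
      moreover have "A $ 1 $ 1 * n1 \<ge> 0" using a n1 by simp
      then have "real_of_int (A $ 1 $ 1 * n1) \<ge> 0" by linarith
      ultimately show ?thesis by (simp add: m_def M c_def)
    qed
    moreover have "c * n > 0" using cl n0 by simp
    ultimately have m: "m > 0" "m \<ge> c * n" by linarith+
    have det: "real_of_int (A $ 1 $ 1) * d - real_of_int (A $ 1 $ 2) * c = 1"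
      using arg_cong[OF adm_det[OF S(1)[OF AB(1)]], of real_of_int] by (simp add: det_2 c_def d_def)
    have "d * m - c * real_of_int (M $ 2 $ 1) = real_of_int n1 * (real_of_int (A $ 1 $ 1) * d - real_of_int (A $ 1 $ 2) * c)"
      by (simp add: m_def M c_def d_def algebra_simps)
    then have "d * m - c * real_of_int (M $ 2 $ 1) = real_of_int n1" by (simp add: det)
    then have diff: "d / c = real_of_int (M $ 2 $ 1) / m + real_of_int n1 / (c * m)"
      using cl m by (simp add: field_simps)
    have "real_of_int n1 / (c * m) \<le> (2 * K * n) / (l * (l * n))"
    proof (rule frac_le)
      show "l * (l * n) > 0" using l n0 by simp
      have "l * n \<le> c * n" using cl n0 by (intro mult_right_mono) auto
      then have "l * n \<le> m" using m(2) by linarith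
      then show "l * (l * n) \<le> c * m" using cl(1) l n0 by (intro mult_mono) auto
    qed (use n1 in auto)
    also have "\<dots> = 2 * K / l^2" using n0 l by (simp add: power2_eq_square field_simps)
    finally have up: "real_of_int n1 / (c * m) \<le> 2 * K / l^2" .
    have "real_of_int n1 / (c * m) \<ge> 0" using n1 cl m by simp
    then show "real_of_int (M $ 2 $ 1) / real_of_int (M $ 1 $ 1) \<le> real_of_int (A $ 2 $ 2) / real_of_int (A $ 2 $ 1) \<and>
      real_of_int (A $ 2 $ 2) / real_of_int (A $ 2 $ 1) \<le> real_of_int (M $ 2 $ 1) / real_of_int (M $ 1 $ 1) + 2 * K / l^2"
      using up diff unfolding c_def d_def m_def by linarith
  qed
  then show ?thesis using card_image[OF inj] unfolding P_def by (simp add: power_divide)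
qed

subsection \<open>Many squarefree discriminants\<close>

lemma card_le_fibres_real:
  fixes b :: real
  assumes D: "finite D" "\<And>s. s \<in> S \<Longrightarrow> f s \<in> D"
    and fin: "finite S" and b: "\<And>e. e \<in> D \<Longrightarrow> real (card {s \<in> S. f s = e}) \<le> b"
  shows "real (card S) \<le> b * real (card D)"
proof -
  have "S = (\<Union>e\<in>D. {s \<in> S. f s = e})" using D(2) by auto
  then have "card S \<le> (\<Sum>e\<in>D. card {s \<in> S. f s = e})"
    using card_UN_le[OF D(1), of "\<lambda>e. {s \<in> S. f s = e}"] by simp
  then have "real (card S) \<le> (\<Sum>e\<in>D. real (card {s \<in> S. f s = e}))"
    unfolding of_nat_sum[symmetric] of_nat_le_iff .
  also have "\<dots> \<le> (\<Sum>e\<in>D. b)" by (intro sum_mono b)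
  finally show ?thesis by (simp add: mult.commute)
qed

lemma card_UN_le_real:
  assumes "finite I" "\<And>i. i \<in> I \<Longrightarrow> real (card (A i)) \<le> b i"
  shows "real (card (\<Union>i\<in>I. A i)) \<le> (\<Sum>i\<in>I. b i)"
proof -
  have "real (card (\<Union>i\<in>I. A i)) \<le> (\<Sum>i\<in>I. real (card (A i)))"
    using card_UN_le[OF assms(1), of A] unfolding of_nat_sum[symmetric] of_nat_le_iff .
  also have "\<dots> \<le> (\<Sum>i\<in>I. b i)" by (intro sum_mono assms(2))
  finally show ?thesis .
qed

lemma sum_inverse_squares_tail:
  assumes "a \<ge> 1"
  shows "(\<Sum>n\<in>{a<..b}. 1 / (real n)^2) \<le> 1 / real a"
proof -
  have "(\<Sum>n\<in>{a<..b}. 1 / (real n)^2) \<le> 1 / real a - 1 / real b" if "b \<ge> a" for b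
    using that
  proof (induction b rule: nat_induct_at_least)
    case (Suc n)
    have "1 / (real (Suc n))^2 \<le> 1 / (real n * real (Suc n))"
      using Suc(1) assms by (intro divide_left_mono) (auto simp: power2_eq_square)
    also have "\<dots> = 1 / real n - 1 / real (Suc n)"
      using Suc(1) assms by (simp add: field_simps)
    moreover have "{a<..Suc n} = insert (Suc n) {a<..n}" using Suc(1) by auto
    ultimately show ?case using Suc by (simp del: of_nat_Suc)
  qed simp
  moreover have "1 / real b \<ge> 0" by simp
  ultimately show ?thesis by (cases "b \<ge> a") (smt (verit), simp)
qed

lemma sum_inverse_three_halves_tail:
  assumes "a \<ge> 1"
  shows "(\<Sum>n\<in>{a<..b}. 1 / (real n * sqrt (real n))) \<le> 2 / sqrt (real a)"
proof -
  have "(\<Sum>n\<in>{a<..b}. 1 / (real n * sqrt (real n))) \<le> 2 / sqrt (real a) - 2 / sqrt (real b)" if "b \<ge> a" for b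
    using that
  proof (induction b rule: nat_induct_at_least)
    case (Suc n)
    define u v where "u = sqrt (real n)" and "v = sqrt (real (Suc n))"
    have uv: "u > 0" "v > 0" "u \<le> v" "v^2 = u^2 + 1" using Suc(1) assms by (auto simp: u_def v_def)
    have "real (Suc n) * sqrt (real (Suc n)) = v * v * v" by (simp add: v_def)
    moreover have "1 / (v * v * v) \<le> 2 / u - 2 / v"
    proof -
      have "(v - u) * (v + u) = 1" using uv(4) by (simp add: power2_eq_square algebra_simps)
      then have "1 \<le> (v - u) * (2 * v)" using uv mult_left_mono[of "v + u" "2 * v" "v - u"] by simp
      then have "1 * (u * v) \<le> (v - u) * (2 * v) * (v * v)"
        using uv by (intro mult_mono) auto
      then have "1 * (u * v) / (u * v * (v * v * v)) \<le> (v - u) * (2 * v) * (v * v) / (u * v * (v * v * v))"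
        using uv by (intro divide_right_mono) auto
      moreover have "1 * (u * v) / (u * v * (v * v * v)) = 1 / (v * v * v)" using uv by simp
      moreover have "(v - u) * (2 * v) * (v * v) / (u * v * (v * v * v)) = 2 / u - 2 / v"
        using uv by (simp add: field_simps)
      ultimately show ?thesis by simp
    qed
    moreover have "{a<..Suc n} = insert (Suc n) {a<..n}" using Suc(1) by auto
    ultimately show ?case using Suc unfolding u_def v_def by (simp del: of_nat_Suc)
  qed simp
  moreover have "2 / sqrt (real b) \<ge> 0" by simp
  ultimately show ?thesis by (cases "b \<ge> a") (smt (verit), simp)
qed

lemma power_swap: "(x ^ m) ^ n = (x ^ n) ^ m" for x :: real
  by (simp add: mult.commute flip: power_mult)

lemma power_powr_swap: "x > 0 \<Longrightarrow> (x powr a) ^ n = (x ^ n) powr a" for x :: real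
  by (simp add: powr_power powr_powr mult.commute flip: powr_realpow)

text \<open>\<open>R\<close> is chosen so large that \<open>R powr \<epsilon>\<close> absorbs the constants that would otherwise be raised to
  the power \<open>k\<close>.\<close>

locale word_family =
  fixes C \<epsilon> F :: real and Q :: int and R :: nat and G :: "(int^2^2) set"
  assumes C1: "C \<ge> 1"
    and C: "\<And>t::int. t \<ge> 2 \<Longrightarrow> real (card {A. det A = 1 \<and> nsq A = t}) \<le> C * real_of_int t powr \<epsilon>"
    and eps: "\<epsilon> > 0" "\<epsilon> \<le> 1/48"
    and Q: "Q = (fact 64)^2"
    and G: "G \<subseteq> blocks (int R)" "real (card G) \<ge> (real R)^2 / F"
    and F1: "F \<ge> 1"
    and RF: "real R powr \<epsilon> \<ge> 4096 * F^2" and RC: "sqrt (real R) \<ge> 8064 * C"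
begin

definition g :: real where "g = real (card G)"
text \<open>Divisible by p^2 for every prime p <= \<open>R\<close>, as
  \<open>card_bad_parameters\<close> requires of the parameter range.\<close>

definition I :: int where "I = (fact R)^2"
definition \<Theta> :: "(int \<times> int \<times> int) set" where "\<Theta> = {1..I} \<times> {1..I} \<times> {1..I}"
definition W :: "nat \<Rightarrow> (int^2^2) set" where "W k = words G k"
definition K :: real where "K = 5 * (real_of_int (Q * I))^3"
definition T :: "nat \<Rightarrow> real" where "T k = 64 * K^2 * (256 * (real R)^4)^k"
text \<open>Bounds the number of pairs with a given trace: at most
  \<open>C * T k powr \<epsilon>\<close> matrices have that norm, and each has at most
  \<open>1 + 2 * K * 16^k\<close> factorisations.\<close>

definition \<mu> :: "nat \<Rightarrow> real" where "\<mu> k = C * T k powr \<epsilon> * (1 + 2 * K * 16^k)"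
definition f :: "int^2^2 \<Rightarrow> int^2^2 \<Rightarrow> int \<times> int \<times> int \<Rightarrow> int" where
  "f A B \<theta> = nsq (transpose A ** center Q \<theta> ** B)"

lemma R_ge: "real R \<ge> 4096 * F^2" "real R \<ge> 4096" "real R \<ge> F" "R \<ge> 1"
proof -
  have F2: "F \<le> F^2" "1 \<le> F^2" using F1 self_le_power[of F 2] by auto
  then have "1 \<le> real R powr \<epsilon>" using RF by linarith
  then have "real R \<noteq> 0" by (cases "R = 0") auto
  then have R1: "real R \<ge> 1" by simp
  then have "real R powr \<epsilon> \<le> real R powr 1" using eps by (intro powr_mono) auto
  then show 1: "real R \<ge> 4096 * F^2" using RF R1 by simp
  then show "real R \<ge> 4096" "real R \<ge> F" "R \<ge> 1" using F2 R1 by linarith+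
qed

lemma R_int: "int R \<ge> 1" using R_ge(4) by simp

lemma g_ge: "F * g \<ge> (real R)^2" "g \<ge> real R" "g \<ge> 1"
proof -
  show 1: "F * g \<ge> (real R)^2" using G(2) F1 by (simp add: g_def field_simps)
  have "F * real R \<le> real R * real R" using R_ge by (intro mult_right_mono) auto
  then have "F * real R \<le> F * g" using 1 by (simp add: power2_eq_square)
  then show "g \<ge> real R" using F1 by simp
  then show "g \<ge> 1" using R_ge by linarith
qed

lemma fin_G: "finite G" using G(1) finite_blocks finite_subset by blast
lemma fin_W: "finite (W k)" by (simp add: W_def finite_words fin_G)
lemma card_W: "real (card (W k)) = g ^ k"
  using card_words[OF G(1) R_int] by (simp add: W_def g_def)
lemma det_W: "A \<in> W k \<Longrightarrow> det A = 1"
  unfolding W_def using words_det[of G] G(1) blocks_det by blast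
lemma W_adm: "k \<ge> 1 \<Longrightarrow> A \<in> W k \<Longrightarrow> adm (real R ^ k) ((4 * real R) ^ k) A"
  using words_adm[OF G(1) R_int, of k A] by (simp add: W_def)
lemma I1: "I \<ge> 1" by (simp add: I_def)
lemma Q1: "Q \<ge> 1" by (simp add: Q)
lemma fin_\<Theta>: "finite \<Theta>" by (simp add: \<Theta>_def)
lemma card_\<Theta>: "real (card \<Theta>) = real_of_int I ^ 3"
  using I1 by (simp add: \<Theta>_def card_cartesian_product power3_eq_cube)
lemma card_\<Theta>_pos: "real (card \<Theta>) > 0" using I1 by (simp add: card_\<Theta>)
lemma K1: "K \<ge> 1"
proof -
  have "1 * 1 \<le> Q * I" by (intro mult_mono) (use Q1 I1 in auto)
  then have "real_of_int (Q * I) \<ge> 1" by (simp only: of_int_1_le_iff mult_1)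

  then have "(real_of_int (Q * I))^3 \<ge> 1" by (rule one_le_power)
  then show ?thesis unfolding K_def by linarith
qed

text \<open>The collision bound is efficient when \<open>p\<^sup>2\<close> is close to the number of words, so only the last \<open>j\<close>
  blocks of \<open>A\<close> and \<open>B\<close> vary, with \<open>j\<close> minimal such that \<open>p\<^sup>2 \<le> g ^ j\<close>.\<close>

lemma high_prime:
  fixes p :: nat
  assumes p: "prime (int p)" "R < p" "(real p)^2 \<le> g ^ k" and s: "s = 1 \<or> s = -1" and N: "det N = 1"
  shows "real (card {(A, B) \<in> W k \<times> W k. (int p)^2 dvd nsq (transpose A ** N ** B) + 2 * s})
    \<le> 252 * C / (real p * sqrt (real p)) * (g ^ k)^2"
proof -
  define q where "q = (real p)^2"
  have pR: "real p > real R" using p(2) by simp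
  have p1: "real p \<ge> 1" using pR R_ge by linarith
  have q1: "q \<ge> 1" "q \<ge> real p" using p1 self_le_power[of "real p" 2] by (auto simp: q_def)
  define j where "j = (LEAST j. q \<le> g ^ j)"
  have j: "q \<le> g ^ j" "j \<le> k" unfolding j_def using p(3) by (auto simp: q_def intro: LeastI Least_le)
  have "\<not> q \<le> g ^ 0" using pR R_ge q1 by simp
  then have j1: "j \<ge> 1" using j by (cases j) auto
  have "\<not> q \<le> g ^ (j - 1)" using j1 not_less_Least[of "j - 1" "\<lambda>j. q \<le> g ^ j"] by (simp add: j_def)
  then have gj: "g ^ (j - 1) < q" by simp
  \<comment> \<open>Minimality of j keeps \<open>g ^ (j - 1)\<close> below q, so R^j is at most q^2,
    and every factor constant^j can be measured as a small power of q.\<close>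
  have Rj: "real R ^ j \<le> q^2"
  proof -
    have "real R ^ j = real R * real R ^ (j - 1)" using j1 by (cases j) auto
    also have "\<dots> \<le> q * g ^ (j - 1)" using pR q1 g_ge R_ge by (intro mult_mono power_mono) auto
    also have "\<dots> \<le> q * q" using gj q1 by (intro mult_left_mono) auto
    finally show ?thesis by (simp add: power2_eq_square)
  qed
  define l L where "l = real R ^ j" and "L = (4 * real R) ^ j"
  have l: "1 \<le> l" "l \<le> L" using R_ge by (auto simp: l_def L_def intro!: power_mono)
  have coll: "real (card (coll ((int p)^2) (W j))) \<le> 84 * C / (real p * sqrt (real p)) * (g ^ j)^2"
  proof -
    have "real (card (coll ((int p)^2) (W j))) \<le>
        C * (4 * L^4) powr \<epsilon> * (real (card (W j)) + 20 * (L / l)^2 * L^4 / real_of_int ((int p)^2))"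
      using C1 C eps fin_W W_adm[OF j1] l p1 by (intro card_coll_bound) (auto simp: l_def L_def)
    also have "real_of_int ((int p)^2) = q" by (simp add: q_def)
    \<comment> \<open>21 = 1 + 20: the diagonal term is absorbed because q <= \<open>g ^ j\<close>.
      The exponents 10 \<epsilon> and 2 \<epsilon> come from L^4 <= q^10 and from
      \<open>fj\<close>.\<close>
    also have "C * (4 * L^4) powr \<epsilon> * (real (card (W j)) + 20 * (L / l)^2 * L^4 / q)
        \<le> C * (4 * q powr (10 * \<epsilon>)) * (21 * q powr (2 * \<epsilon>) * (g ^ j)^2 / q)"
    proof (intro mult_mono mult_left_mono)
      have L4: "L^4 = (256 * (real R)^4) ^ j" unfolding L_def power_swap[of _ _ 4] by (simp add: power_mult_distrib)
      have "L^4 \<le> ((real R)^5) ^ j"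
      proof -
        have "256 * (real R)^4 \<le> real R * (real R)^4" using R_ge by (intro mult_right_mono) auto
        then show ?thesis unfolding L4 by (intro power_mono) (auto simp: power_Suc[symmetric] simp del: power_Suc)
      qed
      also have "\<dots> = (real R ^ j)^5" by (rule power_swap)
      also have "\<dots> \<le> (q^2)^5" by (intro power_mono Rj) auto
      also have "\<dots> = q powr 10" using q1 by (simp add: powr_numeral flip: power_mult)
      finally have "L^4 \<le> q powr 10" .
      then have "(4 * L^4) powr \<epsilon> \<le> (4 * q powr 10) powr \<epsilon>" using l eps by (intro powr_mono2) auto
      also have "\<dots> = 4 powr \<epsilon> * q powr (10 * \<epsilon>)" by (simp add: powr_mult powr_powr)
      also have "\<dots> \<le> 4 powr 1 * q powr (10 * \<epsilon>)" using eps by (intro mult_right_mono powr_mono) auto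
      finally show "(4 * L^4) powr \<epsilon> \<le> 4 * q powr (10 * \<epsilon>)" by simp
      have fj: "(4096 * F^2) ^ j \<le> q powr (2 * \<epsilon>)"
      proof -
        have "(4096 * F^2) ^ j \<le> (real R powr \<epsilon>) ^ j" using RF by (intro power_mono) auto
        also have "\<dots> = (real R ^ j) powr \<epsilon>" using R_ge(4) by (intro power_powr_swap) simp
        also have "\<dots> \<le> (q^2) powr \<epsilon>" using Rj eps by (intro powr_mono2) auto
        also have "\<dots> = q powr (2 * \<epsilon>)" using q1 power_powr_swap[of q \<epsilon> 2] by (simp add: powr_power mult.commute)
        finally show ?thesis .
      qed
      have "real (card (W j)) = g ^ j * q / q" using card_W q1 by simp
      also have "\<dots> \<le> (g ^ j)^2 / q" using j(1) q1 g_ge by (intro divide_right_mono) (auto simp: power2_eq_square)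
      also have "\<dots> \<le> q powr (2 * \<epsilon>) * (g ^ j)^2 / q"
      proof -
        have "1 \<le> q powr (2 * \<epsilon>)" using q1 eps by (intro ge_one_powr_ge_zero) auto
        then have "1 * (g ^ j)^2 \<le> q powr (2 * \<epsilon>) * (g ^ j)^2" by (intro mult_right_mono) auto
        then show ?thesis using q1 by (intro divide_right_mono) auto
      qed
      finally have 1: "real (card (W j)) \<le> q powr (2 * \<epsilon>) * (g ^ j)^2 / q" .
      have "(L / l)^2 * L^4 = (16 * (256 * (real R)^4)) ^ j"
      proof -
        have "L / l = 4 ^ j" using R_ge by (simp add: L_def l_def power_mult_distrib)
        then have "(L / l)^2 = 16 ^ j" by (simp add: power_mult_distrib[symmetric] power2_eq_square)
        then show ?thesis unfolding L4 by (simp only: power_mult_distrib)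
      qed
      \<comment> \<open>16 is the squared spread per block, 256 = 4^4 comes from L^4, and F^2 from
        R^4 <= (F g)^2: this is the constant \<open>4096 * F^2\<close> that \<open>RF\<close>
        absorbs.\<close>
      also have "\<dots> \<le> ((4096 * F^2) * g^2) ^ j"
      proof (rule power_mono)
        have "((real R)^2)^2 \<le> (F * g)^2" using g_ge by (intro power_mono) auto
        then show "16 * (256 * (real R)^4) \<le> (4096 * F^2) * g^2" by (simp add: power_mult_distrib)
      qed simp
      also have "\<dots> = (4096 * F^2) ^ j * (g ^ j)^2" by (simp add: power_mult_distrib mult.commute flip: power_mult)
      also have "\<dots> \<le> q powr (2 * \<epsilon>) * (g ^ j)^2" using fj by (intro mult_right_mono) auto
      finally have "20 * ((L / l)^2 * L^4 / q) \<le> 20 * (q powr (2 * \<epsilon>) * (g ^ j)^2 / q)"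
        using q1 by (intro mult_left_mono divide_right_mono) auto
      moreover have "20 * (L / l)^2 * L^4 / q = 20 * ((L / l)^2 * L^4 / q)" by (simp only: mult.assoc times_divide_eq_right)
      ultimately have "20 * (L / l)^2 * L^4 / q \<le> 20 * (q powr (2 * \<epsilon>) * (g ^ j)^2 / q)" by simp
      then show "real (card (W j)) + 20 * (L / l)^2 * L^4 / q \<le> 21 * q powr (2 * \<epsilon>) * (g ^ j)^2 / q"
        using 1 by simp
    qed (use C1 q1 l in auto)
    also have "\<dots> = 84 * C * (q powr (12 * \<epsilon>) / q) * (g ^ j)^2"
    proof -
      have "q powr (10 * \<epsilon>) * q powr (2 * \<epsilon>) = q powr (12 * \<epsilon>)" by (simp add: powr_add[symmetric])
      then show ?thesis by (simp add: field_simps)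
    qed
    also have "\<dots> \<le> 84 * C * (1 / (real p * sqrt (real p))) * (g ^ j)^2"
    proof (intro mult_right_mono mult_left_mono)
      \<comment> \<open>Here \<epsilon> <= 1/48 enters: the loss stays below sqrt p, so the bound
        decays like p^(-3/2) and can be summed over p.\<close>
      have "q powr (12 * \<epsilon>) \<le> q powr (1/4)" using q1 eps by (intro powr_mono) auto
      also have "\<dots> = sqrt (real p)"
      proof -
        have "q = real p powr 2" using p1 by (simp add: q_def)
        then have "q powr (1/4) = real p powr (2 * (1/4))" by (simp only: powr_powr)
        then show ?thesis by (simp add: powr_half_sqrt)
      qed
      finally have "q powr (12 * \<epsilon>) / q \<le> sqrt (real p) / q" using q1 by (intro divide_right_mono) auto
      also have "\<dots> = sqrt (real p) / (real p * (sqrt (real p) * sqrt (real p)))" by (simp add: q_def power2_eq_square)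
      also have "\<dots> = 1 / (real p * sqrt (real p))" using p1 by (simp add: divide_simps)
      finally show "q powr (12 * \<epsilon>) / q \<le> 1 / (real p * sqrt (real p))" .
    qed (use C1 in auto)
    finally show ?thesis by simp
  qed
  define E where "E A1 B1 = {(A, B) \<in> W j \<times> W j. (int p)^2 dvd nsq (transpose A ** (transpose A1 ** N ** B1) ** B) + 2 * s}" for A1 B1
  have finE: "finite (E A1 B1)" for A1 B1
    by (rule finite_subset[of _ "W j \<times> W j"]) (auto simp: E_def fin_W)
  have "int p \<noteq> 2" using pR R_ge by auto
  then have cE: "card (E A1 B1) \<le> 3 * card (coll ((int p)^2) (W j))" if "A1 \<in> W (k - j)" "B1 \<in> W (k - j)" for A1 B1
    unfolding E_def using that det_W N p(1) s
    by (intro card_square_divisor) (auto simp: fin_W det_mul)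
  have Wk: "W k = (\<lambda>(A, B). A ** B) ` (W (k - j) \<times> W j)"
    using words_add[of G "k - j" j] j(2) by (simp add: W_def)
  have "{(A, B) \<in> W k \<times> W k. (int p)^2 dvd nsq (transpose A ** N ** B) + 2 * s}
     \<subseteq> (\<Union>(A1, B1)\<in>W (k - j) \<times> W (k - j). (\<lambda>(A, B). (A1 ** A, B1 ** B)) ` E A1 B1)" (is "?L \<subseteq> ?U")
  proof
    fix x assume "x \<in> ?L"
    then obtain A B where x: "x = (A, B)" "A \<in> W k" "B \<in> W k" "(int p)^2 dvd nsq (transpose A ** N ** B) + 2 * s" by auto
    then obtain A1 A2 B1 B2 where AB: "A = A1 ** A2" "B = B1 ** B2" "A1 \<in> W (k - j)" "B1 \<in> W (k - j)"
      "A2 \<in> W j" "B2 \<in> W j" unfolding Wk by auto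
    have "transpose A ** N ** B = transpose A2 ** (transpose A1 ** N ** B1) ** B2"
      by (simp add: AB matrix_transpose_mul matrix_mul_assoc)
    then have "(A2, B2) \<in> E A1 B1" using x AB by (simp add: E_def)
    then show "x \<in> ?U" using AB x by force
  qed
  then have "card ?L \<le> card ?U" using fin_W finE by (intro card_mono) (auto intro!: finite_UN_I finite_cartesian_product)
  then have "real (card ?L) \<le> real (card ?U)" by simp
  also have "\<dots> \<le> (\<Sum>(A1, B1)\<in>W (k - j) \<times> W (k - j). 3 * real (card (coll ((int p)^2) (W j))))"
    unfolding case_prod_unfold
  proof (rule card_UN_le_real)
    fix x assume x: "x \<in> W (k - j) \<times> W (k - j)"
    have "card ((\<lambda>y. (fst x ** fst y, snd x ** snd y)) ` E (fst x) (snd x)) \<le> card (E (fst x) (snd x))"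
      by (rule card_image_le[OF finE])
    also have "\<dots> \<le> 3 * card (coll ((int p)^2) (W j))" using cE x by auto
    finally show "real (card ((\<lambda>y. (fst x ** fst y, snd x ** snd y)) ` E (fst x) (snd x))) \<le> 3 * real (card (coll ((int p)^2) (W j)))"
      by linarith
  qed (simp add: fin_W)
  also have "\<dots> = (g ^ (k - j))^2 * (3 * real (card (coll ((int p)^2) (W j))))"
    by (simp add: card_cartesian_product card_W power2_eq_square case_prod_unfold)
  also have "\<dots> \<le> (g ^ (k - j))^2 * (3 * (84 * C / (real p * sqrt (real p)) * (g ^ j)^2))"
    using coll by (intro mult_left_mono) auto
  also have "\<dots> = 252 * C / (real p * sqrt (real p)) * (g ^ (k - j) * g ^ j)^2"
    by (simp add: power_mult_distrib)
  also have "g ^ (k - j) * g ^ j = g ^ k" using j(2) by (simp flip: power_add)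
  finally show ?thesis .
qed

lemma fibre:
  assumes "k \<ge> 1" "\<theta> \<in> \<Theta>" "t \<ge> 2" "real_of_int t \<le> T k"
  shows "real (card {(A, B) \<in> W k \<times> W k. f A B \<theta> = t}) \<le> \<mu> k"
proof -
  define l L where "l = real R ^ k" and "L = (4 * real R) ^ k"
  have l: "1 \<le> l" "l \<le> L" using R_ge by (auto simp: l_def L_def intro!: power_mono)
  have Ll: "(L / l)^2 = 16 ^ k"
  proof -
    have "L / l = 4 ^ k" using R_ge by (simp add: L_def l_def power_mult_distrib)
    then show ?thesis by (simp add: power_mult_distrib[symmetric] power2_eq_square)
  qed
  let ?M = "{M. det M = 1 \<and> nsq M = t}"
  have finM: "finite ?M" by (rule finite_subset[OF _ finite_nsq[of t]]) auto
  have KK: "real_of_int (center Q \<theta> $ i $ j) \<le> K" for i j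
  proof -
    have "real_of_int (center Q \<theta> $ i $ j) \<le> real_of_int (5 * (Q * I)^3)"
      using center_bounds(2)[of \<theta> I Q i j] assms(2) Q1 unfolding \<Theta>_def by (simp only: of_int_le_iff)
    then show ?thesis by (simp add: K_def)
  qed
  have "real (card {(A, B) \<in> W k \<times> W k. f A B \<theta> = t}) \<le> (1 + 2 * K * 16^k) * real (card ?M)"
  proof (rule card_le_fibres_real[where f = "\<lambda>(A, B). transpose A ** center Q \<theta> ** B"])
    show "finite ?M" by (rule finM)
    show "(case s of (A, B) \<Rightarrow> transpose A ** center Q \<theta> ** B) \<in> ?M" if "s \<in> {(A, B) \<in> W k \<times> W k. f A B \<theta> = t}" for s
      using that det_W by (auto simp: f_def det_mul)
    show "finite {(A, B) \<in> W k \<times> W k. f A B \<theta> = t}"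
      by (rule finite_subset[of _ "W k \<times> W k"]) (auto simp: fin_W)
    fix M assume "M \<in> ?M"
    have "{s \<in> {(A, B) \<in> W k \<times> W k. f A B \<theta> = t}. (case s of (A, B) \<Rightarrow> transpose A ** center Q \<theta> ** B) = M}
      \<subseteq> {(A, B) \<in> W k \<times> W k. transpose A ** center Q \<theta> ** B = M}" (is "?a \<subseteq> ?b") by auto
    then have "card ?a \<le> card ?b"
      by (intro card_mono finite_subset[of ?b "W k \<times> W k"]) (auto simp: fin_W)
    moreover have "real (card ?b) \<le> 1 + 2 * K * (L / l)^2"
      using W_adm[OF assms(1)] fin_W l KK center_bounds(1)[of \<theta> I Q] assms(2) Q1
      by (intro card_factorisations) (auto simp: l_def L_def \<Theta>_def)
    ultimately show "real (card ?a) \<le> 1 + 2 * K * 16^k" unfolding Ll by linarith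
  qed
  also have "\<dots> \<le> (1 + 2 * K * 16^k) * (C * T k powr \<epsilon>)"
  proof (rule mult_left_mono)
    have "real (card ?M) \<le> C * real_of_int t powr \<epsilon>" by (rule C[OF assms(3)])
    also have "\<dots> \<le> C * T k powr \<epsilon>" using assms eps C1 by (intro mult_left_mono powr_mono2) auto
    finally show "real (card ?M) \<le> C * T k powr \<epsilon>" .
  qed (use K1 in auto)
  finally show ?thesis by (simp add: \<mu>_def mult_ac)
qed

lemma f_bounds:
  assumes "k \<ge> 1" "A \<in> W k" "B \<in> W k" "\<theta> \<in> \<Theta>"
  shows "f A B \<theta> \<ge> 4" "real_of_int (f A B \<theta>) \<le> T k"
proof -
  define l L where "l = real R ^ k" and "L = (4 * real R) ^ k"
  have l: "1 \<le> l" "l \<le> L" using R_ge by (auto simp: l_def L_def intro!: power_mono)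
  define N where "N = center Q \<theta>"
  have N: "1 \<le> N $ i $ j" "real_of_int (N $ i $ j) \<le> K" for i j
  proof -
    have "real_of_int (center Q \<theta> $ i $ j) \<le> real_of_int (5 * (Q * I)^3)"
      using center_bounds(2)[of \<theta> I Q i j] assms(4) Q1 unfolding \<Theta>_def by (simp only: of_int_le_iff)
    then show "real_of_int (N $ i $ j) \<le> K" by (simp add: K_def N_def)
    show "1 \<le> N $ i $ j" using center_bounds(1)[of \<theta> I Q i j] assms(4) Q1 by (simp add: N_def \<Theta>_def)
  qed
  have ad: "adm l L A" "adm l L B" using W_adm assms by (auto simp: l_def L_def)
  have entry: "0 \<le> real_of_int (X $ i $ j)" "real_of_int (X $ i $ j) \<le> L" if "adm l L X" for X i j
    using that adm_bounds[OF that l(1)] exhaust_2[of i] exhaust_2[of j] by (auto simp: adm_def)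
  define M where "M = transpose A ** N ** B"
  have up: "0 \<le> real_of_int (M $ i $ j) \<and> real_of_int (M $ i $ j) \<le> 4 * K * L^2" for i j
  proof -
    have pr: "0 \<le> real_of_int (A $ i' $ i) * real_of_int (N $ i' $ j') * real_of_int (B $ j' $ j)"
      "real_of_int (A $ i' $ i) * real_of_int (N $ i' $ j') * real_of_int (B $ j' $ j) \<le> K * L^2" for i' j'
    proof -
      have "real_of_int (A $ i' $ i) * real_of_int (N $ i' $ j') * real_of_int (B $ j' $ j) \<le> L * K * L"
        using entry[OF ad(1)] entry[OF ad(2)] N(2)[of i' j'] N(1)[of i' j'] K1 l
        by (intro mult_mono mult_nonneg_nonneg) auto
      also have "\<dots> = K * L^2" by (simp add: power2_eq_square)
      finally show "real_of_int (A $ i' $ i) * real_of_int (N $ i' $ j') * real_of_int (B $ j' $ j) \<le> K * L^2" .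
      show "0 \<le> real_of_int (A $ i' $ i) * real_of_int (N $ i' $ j') * real_of_int (B $ j' $ j)"
        using entry[OF ad(1)] entry[OF ad(2)] N(1)[of i' j'] by (intro mult_nonneg_nonneg) auto
    qed
    have "real_of_int (M $ i $ j) = real_of_int (A $ 1 $ i) * real_of_int (N $ 1 $ 1) * real_of_int (B $ 1 $ j)
      + real_of_int (A $ 1 $ i) * real_of_int (N $ 1 $ 2) * real_of_int (B $ 2 $ j)
      + real_of_int (A $ 2 $ i) * real_of_int (N $ 2 $ 1) * real_of_int (B $ 1 $ j)
      + real_of_int (A $ 2 $ i) * real_of_int (N $ 2 $ 2) * real_of_int (B $ 2 $ j)"
      unfolding M_def matrix_matrix_mult_def transpose_def by (simp add: sum_2 algebra_simps)
    then show ?thesis using pr[of 1 1] pr[of 1 2] pr[of 2 1] pr[of 2 2]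
      by linarith
  qed
  have low: "M $ i $ j \<ge> 1" for i j
  proof -
    have z: "0 \<le> A $ i' $ i * N $ i' $ j' * B $ j' $ j" for i' j'
      using entry[OF ad(1)] entry[OF ad(2)] N(1)[of i' j'] by (auto intro!: mult_nonneg_nonneg)
    have "1 \<le> A $ 2 $ i" "1 \<le> B $ 2 $ j"
      using adm_bounds[OF ad(1) l(1)] adm_bounds[OF ad(2) l(1)] exhaust_2[of i] exhaust_2[of j] by auto
    then have "1 * 1 * 1 \<le> A $ 2 $ i * N $ 2 $ 2 * B $ 2 $ j" using N(1)[of 2 2] by (intro mult_mono) auto
    moreover have "M $ i $ j = A $ 1 $ i * N $ 1 $ 1 * B $ 1 $ j + A $ 1 $ i * N $ 1 $ 2 * B $ 2 $ j
      + A $ 2 $ i * N $ 2 $ 1 * B $ 1 $ j + A $ 2 $ i * N $ 2 $ 2 * B $ 2 $ j"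
      unfolding M_def matrix_matrix_mult_def transpose_def by (simp add: sum_2 algebra_simps)
    ultimately show ?thesis using z[of 1 1] z[of 1 2] z[of 2 1] by linarith
  qed
  have "1 \<le> (M $ i $ j)^2" for i j using one_le_power[OF low, of i j 2] .
  from this[of 1 1] this[of 1 2] this[of 2 1] this[of 2 2] show "f A B \<theta> \<ge> 4"
    unfolding f_def nsq_def M_def[symmetric] N_def[symmetric] by linarith
  have sq: "(real_of_int (M $ i $ j))^2 \<le> (4 * K * L^2)^2" for i j using up[of i j] by (intro power_mono) auto
  have "real_of_int (f A B \<theta>) = (real_of_int (M $ 1 $ 1))^2 + (real_of_int (M $ 1 $ 2))^2 + (real_of_int (M $ 2 $ 1))^2 + (real_of_int (M $ 2 $ 2))^2"
    by (simp add: f_def nsq_def M_def N_def)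
  also have "\<dots> \<le> 4 * (4 * K * L^2)^2" using sq[of 1 1] sq[of 1 2] sq[of 2 1] sq[of 2 2] by linarith
  also have "\<dots> = 64 * K^2 * L^4" by (simp add: power_mult_distrib)
  also have "L^4 = (256 * (real R)^4)^k" unfolding L_def power_swap[of _ _ 4] by (simp add: power_mult_distrib)
  finally show "real_of_int (f A B \<theta>) \<le> T k" by (simp add: T_def)
qed

section \<open>The bad primes, by size\<close>

lemma T_pos: "T k > 0" using K1 R_ge by (simp add: T_def)

lemma mu_nonneg: "\<mu> k \<ge> 0" using C1 K1 by (simp add: \<mu>_def)

lemma mu_pos: "\<mu> k > 0"
proof -
  have "1 + 2 * K * 16 ^ k > 0" using K1 by (simp add: add_pos_nonneg)
  then show ?thesis using C1 T_pos[of k] by (simp add: \<mu>_def)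
qed

text \<open>The two signs give 16 / p^2 per prime, and the tail beyond 64 adds up to at most 16 / 64
  = 1/4: this is the origin of the threshold 64.\<close>

lemma bad_mid:
  assumes "det A = 1" "det B = 1"
  shows "real (card {\<theta> \<in> \<Theta>. \<exists>n\<in>{64<..R}. prime (int n) \<and> (\<exists>s\<in>{1, -1}. (int n)^2 dvd f A B \<theta> + 2 * s)})
    \<le> real (card \<Theta>) / 4"
proof -
  define N where "N = {n \<in> {64<..R}. prime (int n)}"
  define E where "E n s = {\<theta> \<in> \<Theta>. (int n)^2 dvd f A B \<theta> + 2 * s}" for n :: nat and s :: int
  have cE: "real (card (E n s)) \<le> 8 * real (card \<Theta>) * (1 / (real n)^2)" if n: "n \<in> N" and s: "s = 1 \<or> s = -1" for n s
  proof -
    have p: "prime (int n)" "int n \<noteq> 2" "n > 64" "n \<le> R" using n by (auto simp: N_def)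
    have "\<not> int n dvd Q"
    proof
      assume "int n dvd Q"
      then have "int n dvd fact 64" unfolding Q by (rule prime_dvd_power[OF p(1)])
      then have "int n dvd int (fact 64)" by (simp only: of_nat_fact)
      then have "n dvd fact 64" by (simp only: int_dvd_int_iff)
      then show False using p prime_dvd_fact_iff[of n 64] by (simp add: prime_int_nat_transfer)
    qed
    moreover have "(int n)^2 dvd I"
    proof -
      have "int n dvd int (fact R)" using p by (intro int_dvd_int_iff[THEN iffD2] dvd_fact) auto
      then show ?thesis unfolding I_def by (simp only: of_nat_fact dvd_power_same)
    qed
    ultimately have "int (card (E n s)) * (int n)^2 \<le> 8 * I^3"
      unfolding E_def \<Theta>_def f_def using assms p s I1 by (intro card_bad_parameters) auto
    then have "real_of_int (int (card (E n s)) * (int n)^2) \<le> real_of_int (8 * I^3)" by (simp only: of_int_le_iff)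
    then show ?thesis using p(3) by (simp add: card_\<Theta> field_simps)
  qed
  have "{\<theta> \<in> \<Theta>. \<exists>n\<in>{64<..R}. prime (int n) \<and> (\<exists>s\<in>{1, -1}. (int n)^2 dvd f A B \<theta> + 2 * s)}
    = (\<Union>n\<in>N. E n 1 \<union> E n (- 1))" by (auto simp: N_def E_def)
  also have "real (card \<dots>) \<le> (\<Sum>n\<in>N. 16 * real (card \<Theta>) * (1 / (real n)^2))"
  proof (rule card_UN_le_real)
    fix n assume n: "n \<in> N"
    have "real (card (E n 1 \<union> E n (- 1))) \<le> real (card (E n 1)) + real (card (E n (- 1)))"
      using card_Un_le[of "E n 1" "E n (- 1)"] by (simp flip: of_nat_add)
    then show "real (card (E n 1 \<union> E n (- 1))) \<le> 16 * real (card \<Theta>) * (1 / (real n)^2)"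
      using cE[OF n, of 1] cE[OF n, of "- 1"] by linarith
  qed (simp add: N_def)
  also have "\<dots> \<le> (\<Sum>n\<in>{64<..R}. 16 * real (card \<Theta>) * (1 / (real n)^2))"
    by (intro sum_mono2) (auto simp: N_def)
  also have "\<dots> = 16 * real (card \<Theta>) * (\<Sum>n\<in>{64<..R}. 1 / (real n)^2)" by (simp add: sum_distrib_left)
  also have "\<dots> \<le> 16 * real (card \<Theta>) * (1 / real 64)"
    by (intro mult_left_mono sum_inverse_squares_tail) auto
  finally show ?thesis by simp
qed

text \<open>The two signs give 504 C p^(-3/2) per prime, the tail beyond \<open>R\<close> is at most
  1008 C / sqrt R, and the constant 8064 = 8 * 1008 in \<open>RC\<close> turns this into
  1/8.\<close>

lemma bad_high:
  assumes "\<theta> \<in> \<Theta>"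
  shows "real (card {(A, B) \<in> W k \<times> W k. \<exists>n>R. prime (int n) \<and> (real n)^2 \<le> g ^ k \<and>
      (\<exists>s\<in>{1, -1}. (int n)^2 dvd f A B \<theta> + 2 * s)}) \<le> (g ^ k)^2 / 8"
proof -
  define M where "M = nat \<lfloor>g ^ k\<rfloor>"
  define N where "N = {n \<in> {R<..M}. prime (int n) \<and> (real n)^2 \<le> g ^ k}"
  define E where "E n s = {(A, B) \<in> W k \<times> W k. (int n)^2 dvd f A B \<theta> + 2 * s}" for n :: nat and s :: int
  have finE: "finite (E n s)" for n s
    by (rule finite_subset[of _ "W k \<times> W k"]) (auto simp: E_def fin_W)
  have M: "n \<le> M" if "(real n)^2 \<le> g ^ k" for n
  proof -
    have "real n \<le> (real n)^2" by (cases "n = 0") (auto intro: self_le_power)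
    then have "real n \<le> g ^ k" using that by linarith
    then show ?thesis unfolding M_def by (rule le_nat_floor)
  qed
  have cE: "real (card (E n s)) \<le> 252 * C / (real n * sqrt (real n)) * (g ^ k)^2" if "n \<in> N" "s = 1 \<or> s = -1" for n s
    unfolding E_def f_def using that by (intro high_prime) (auto simp: N_def)
  have "{(A, B) \<in> W k \<times> W k. \<exists>n>R. prime (int n) \<and> (real n)^2 \<le> g ^ k \<and>
      (\<exists>s\<in>{1, -1}. (int n)^2 dvd f A B \<theta> + 2 * s)} \<subseteq> (\<Union>n\<in>N. E n 1 \<union> E n (- 1))"
    (is "?L \<subseteq> ?U")
  proof clarify
    fix A B n s assume AB: "A \<in> W k" "B \<in> W k" and n: "R < n" "prime (int n)" "(real n)^2 \<le> g ^ k"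
      and s: "s \<in> {1, - 1 :: int}" "(int n)^2 dvd f A B \<theta> + 2 * s"
    have "n \<in> N" using n M[OF n(3)] by (simp add: N_def)
    moreover have "(A, B) \<in> E n 1 \<union> E n (- 1)" using AB s by (auto simp: E_def)
    ultimately show "(A, B) \<in> ?U" by blast
  qed
  moreover have "finite ?U" using finE by (simp add: N_def)
  ultimately have "real (card ?L) \<le> real (card ?U)" by (intro of_nat_mono card_mono)
  also have "\<dots> \<le> (\<Sum>n\<in>N. 504 * C * (g ^ k)^2 * (1 / (real n * sqrt (real n))))"
  proof (rule card_UN_le_real)
    fix n assume n: "n \<in> N"
    have "real (card (E n 1 \<union> E n (- 1))) \<le> real (card (E n 1)) + real (card (E n (- 1)))"
      using card_Un_le[of "E n 1" "E n (- 1)"] by (simp flip: of_nat_add)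
    then show "real (card (E n 1 \<union> E n (- 1))) \<le> 504 * C * (g ^ k)^2 * (1 / (real n * sqrt (real n)))"
      using cE[OF n, of 1] cE[OF n, of "- 1"] by simp
  qed (simp add: N_def)
  also have "\<dots> \<le> (\<Sum>n\<in>{R<..M}. 504 * C * (g ^ k)^2 * (1 / (real n * sqrt (real n))))"
    using C1 by (intro sum_mono2) (auto simp: N_def)
  also have "\<dots> = 504 * C * (g ^ k)^2 * (\<Sum>n\<in>{R<..M}. 1 / (real n * sqrt (real n)))" by (simp add: sum_distrib_left)
  also have "\<dots> \<le> 504 * C * (g ^ k)^2 * (2 / sqrt (real R))"
    using C1 R_ge by (intro mult_left_mono sum_inverse_three_halves_tail) auto
  also have "\<dots> = (g ^ k)^2 * (1008 * C / sqrt (real R))" by simp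
  also have "\<dots> \<le> (g ^ k)^2 * (1 / 8)"
    using RC R_ge C1 by (intro mult_left_mono) (auto simp: field_simps)
  finally show ?thesis by simp
qed

text \<open>Here the words matter only through the bound on fibres: t lies in a progression modulo
  p^2, which has at most (T + 2) / p^2 admissible terms, each with at most \<open>\<mu> k\<close>
  preimages. Summing 1 / p^2 over p > sqrt (g^k) saves the factor sqrt (g^k).\<close>

lemma bad_huge:
  assumes k: "k \<ge> 1" and \<theta>: "\<theta> \<in> \<Theta>"
  shows "real (card {(A, B) \<in> W k \<times> W k. \<exists>n. prime (int n) \<and> g ^ k < (real n)^2 \<and>
      (\<exists>s\<in>{1, -1}. (int n)^2 dvd f A B \<theta> + 2 * s)}) \<le> 4 * \<mu> k * (T k + 2) / sqrt (g ^ k)"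
proof -
  define y where "y = sqrt (g ^ k)"
  have y1: "y \<ge> 1" using g_ge by (simp add: y_def)
  define P where "P = nat \<lfloor>y\<rfloor>"
  have "\<lfloor>y\<rfloor> \<ge> 1" using y1 by simp
  then have "real_of_int \<lfloor>y\<rfloor> \<ge> 1" "real P = real_of_int \<lfloor>y\<rfloor>" by (simp_all add: P_def)
  then have P: "P \<ge> 1" "real P \<ge> y / 2" by linarith+
  define M where "M = nat \<lfloor>T k + 2\<rfloor>"
  define N where "N = {n \<in> {P<..M}. prime (int n)}"
  define E where "E n s = {(A, B) \<in> W k \<times> W k. (int n)^2 dvd f A B \<theta> + 2 * s}" for n :: nat and s :: int
  have finE: "finite (E n s)" for n s
    by (rule finite_subset[of _ "W k \<times> W k"]) (auto simp: E_def fin_W)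
  have quot: "\<exists>m\<in>{1..nat \<lfloor>(T k + 2) / (real n)^2\<rfloor>}. f A B \<theta> = (int n)^2 * int m - 2 * s"
    if AB: "(A, B) \<in> E n s" and s: "s = 1 \<or> s = -1" and n: "n \<ge> 1" for A B n s
  proof -
    obtain m where m: "f A B \<theta> + 2 * s = (int n)^2 * m" using AB by (auto simp: E_def)
    have fb: "f A B \<theta> \<ge> 4" "real_of_int (f A B \<theta>) \<le> T k" using f_bounds[OF k _ _ \<theta>] AB by (auto simp: E_def)
    then have "(int n)^2 * m > 0" using m s by auto
    then have m1: "m \<ge> 1" using n by (simp add: zero_less_mult_iff)
    have "(real n)^2 * real_of_int m = real_of_int (f A B \<theta> + 2 * s)" by (simp only: m) simp
    also have "\<dots> \<le> T k + 2" using fb s by auto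
    finally have "real (nat m) \<le> (T k + 2) / (real n)^2" using n m1 by (simp add: field_simps)
    then have "nat m \<le> nat \<lfloor>(T k + 2) / (real n)^2\<rfloor>" by (rule le_nat_floor)
    then show ?thesis using m m1 by (intro bexI[of _ "nat m"]) auto
  qed
  have cE: "real (card (E n s)) \<le> (T k + 2) / (real n)^2 * \<mu> k" if s: "s = 1 \<or> s = -1" and n: "n \<ge> 1" for n s
  proof -
    have "E n s \<subseteq> (\<Union>m\<in>{1..nat \<lfloor>(T k + 2) / (real n)^2\<rfloor>}. {(A, B) \<in> W k \<times> W k. f A B \<theta> = (int n)^2 * int m - 2 * s})"
      (is "_ \<subseteq> ?V")
    proof clarify
      fix A B assume AB: "(A, B) \<in> E n s"
      then have "A \<in> W k" "B \<in> W k" by (auto simp: E_def)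
      then show "(A, B) \<in> ?V" using quot[OF AB s n] by auto
    qed
    moreover have "finite ?V"
      by (rule finite_subset[of _ "W k \<times> W k"]) (auto simp: fin_W)
    ultimately have "real (card (E n s)) \<le> real (card ?V)" by (intro of_nat_mono card_mono)
    also have "\<dots> \<le> (\<Sum>m\<in>{1..nat \<lfloor>(T k + 2) / (real n)^2\<rfloor>}. \<mu> k)"
    proof (rule card_UN_le_real)
      fix m
      show "real (card {(A, B) \<in> W k \<times> W k. f A B \<theta> = (int n)^2 * int m - 2 * s}) \<le> \<mu> k"
      proof (cases "{(A, B) \<in> W k \<times> W k. f A B \<theta> = (int n)^2 * int m - 2 * s} = {}")
        case True
        then show ?thesis using mu_nonneg by (simp only: card.empty) simp
      next
        case False
        then obtain A B where "A \<in> W k" "B \<in> W k" "f A B \<theta> = (int n)^2 * int m - 2 * s" by auto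
        then show ?thesis using f_bounds[OF k _ _ \<theta>, of A B] by (intro fibre[OF k \<theta>]) auto
      qed
    qed simp
    also have "\<dots> = real (nat \<lfloor>(T k + 2) / (real n)^2\<rfloor>) * \<mu> k" by simp
    also have "\<dots> \<le> (T k + 2) / (real n)^2 * \<mu> k"
      using mu_nonneg T_pos[of k] by (intro mult_right_mono) auto
    finally show ?thesis .
  qed
  have "{(A, B) \<in> W k \<times> W k. \<exists>n. prime (int n) \<and> g ^ k < (real n)^2 \<and>
      (\<exists>s\<in>{1, -1}. (int n)^2 dvd f A B \<theta> + 2 * s)} \<subseteq> (\<Union>n\<in>N. E n 1 \<union> E n (- 1))" (is "?L \<subseteq> ?U")
  proof clarify
    fix A B n s assume AB: "A \<in> W k" "B \<in> W k" and n: "prime (int n)" "g ^ k < (real n)^2"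
      and s: "s \<in> {1, - 1 :: int}" "(int n)^2 dvd f A B \<theta> + 2 * s"
    have n1: "n \<ge> 1" using n(1) by (metis not_prime_0 of_nat_0 One_nat_def Suc_leI neq0_conv)
    have "y < real n" unfolding y_def using n(2) by (intro real_less_lsqrt) auto
    then have "P < n" unfolding P_def using y1 by linarith
    have "(A, B) \<in> E n s" using AB s by (simp add: E_def)
    moreover have "s = 1 \<or> s = - 1" using s(1) by auto
    ultimately obtain m where m: "m \<ge> 1" "m \<le> nat \<lfloor>(T k + 2) / (real n)^2\<rfloor>"
      using quot[of A B n s] n1 by auto
    have "(T k + 2) / (real n)^2 \<ge> 0" using T_pos[of k] by simp
    have "real m \<le> (T k + 2) / (real n)^2"
      using m(2) of_nat_floor[OF \<open>(T k + 2) / (real n)^2 \<ge> 0\<close>] by linarith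
    then have "(real n)^2 * real m \<le> T k + 2" using n1 by (simp add: field_simps)
    moreover have "(real n)^2 * 1 \<le> (real n)^2 * real m" using m(1) by (intro mult_left_mono) auto
    moreover have "real n \<le> (real n)^2" using n1 by (intro self_le_power) auto
    ultimately have "real n \<le> T k + 2" by linarith
    then have "n \<le> M" unfolding M_def by (rule le_nat_floor)
    then have "n \<in> N" using \<open>P < n\<close> n(1) by (simp add: N_def)
    then show "(A, B) \<in> ?U" using AB s by (auto simp: E_def)
  qed
  moreover have "finite ?U" using finE by (simp add: N_def)
  ultimately have "real (card ?L) \<le> real (card ?U)" by (intro of_nat_mono card_mono)
  also have "\<dots> \<le> (\<Sum>n\<in>N. 2 * (T k + 2) * \<mu> k * (1 / (real n)^2))"
  proof (rule card_UN_le_real)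
    fix n assume n: "n \<in> N"
    then have n1: "n \<ge> 1" by (simp add: N_def)
    have "real (card (E n 1 \<union> E n (- 1))) \<le> real (card (E n 1)) + real (card (E n (- 1)))"
      using card_Un_le[of "E n 1" "E n (- 1)"] by (simp flip: of_nat_add)
    show "real (card (E n 1 \<union> E n (- 1))) \<le> 2 * (T k + 2) * \<mu> k * (1 / (real n)^2)"
    proof -
      have "2 * (T k + 2) * \<mu> k * (1 / (real n)^2) = (T k + 2) / (real n)^2 * \<mu> k + (T k + 2) / (real n)^2 * \<mu> k"
        by (simp add: field_simps)
      then show ?thesis
        using cE[OF _ n1, of 1] cE[OF _ n1, of "- 1"] \<open>real (card (E n 1 \<union> E n (- 1))) \<le> real (card (E n 1)) + real (card (E n (- 1)))\<close>
        by linarith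
    qed
  qed (simp add: N_def)
  also have "\<dots> \<le> (\<Sum>n\<in>{P<..M}. 2 * (T k + 2) * \<mu> k * (1 / (real n)^2))"
    using mu_nonneg T_pos[of k] by (intro sum_mono2) (auto simp: N_def)
  also have "\<dots> = 2 * (T k + 2) * \<mu> k * (\<Sum>n\<in>{P<..M}. 1 / (real n)^2)" by (simp add: sum_distrib_left)
  also have "\<dots> \<le> 2 * (T k + 2) * \<mu> k * (2 / y)"
  proof (rule mult_left_mono)
    have "(\<Sum>n\<in>{P<..M}. 1 / (real n)^2) \<le> 1 / real P" by (rule sum_inverse_squares_tail[OF P(1)])
    also have "\<dots> \<le> 1 / (y / 2)" using P y1 by (intro divide_left_mono) auto
    finally show "(\<Sum>n\<in>{P<..M}. 1 / (real n)^2) \<le> 2 / y" by simp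
  qed (use mu_nonneg T_pos[of k] in auto)
  also have "\<dots> = 4 * \<mu> k * (T k + 2) / y" by simp
  finally show ?thesis unfolding y_def .
qed

text \<open>Primes up to 64 are absent because they are excluded by the congruence modulo
  \<open>Q\<close>, which is only available for suitable word lengths.\<close>

definition good :: "nat \<Rightarrow> (((int^2^2) \<times> (int^2^2)) \<times> (int \<times> int \<times> int)) set" where
  "good k = {((A, B), \<theta>) \<in> (W k \<times> W k) \<times> \<Theta>.
     \<forall>n>64. prime (int n) \<longrightarrow> (\<forall>s\<in>{1, -1}. \<not> (int n)^2 dvd f A B \<theta> + 2 * s)}"

text \<open>The three ranges of primes remove at most 1/4 + 1/8 + 1/8 of all triples; the hypothesis
  \<open>large\<close> pays for the last range.\<close>

lemma card_good:
  assumes k: "k \<ge> 1" and large: "32 * \<mu> k * (T k + 2) \<le> (g ^ k)^2 * sqrt (g ^ k)"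
  shows "real (card (good k)) \<ge> (g ^ k)^2 * real (card \<Theta>) / 2"
proof -
  define B1 where "B1 = (SIGMA x:W k \<times> W k. {\<theta> \<in> \<Theta>. \<exists>n\<in>{64<..R}. prime (int n) \<and>
    (\<exists>s\<in>{1, -1}. (int n)^2 dvd f (fst x) (snd x) \<theta> + 2 * s)})"
  define B2 where "B2 = (\<Union>\<theta>\<in>\<Theta>. {(A, B) \<in> W k \<times> W k. \<exists>n>R. prime (int n) \<and> (real n)^2 \<le> g ^ k \<and>
      (\<exists>s\<in>{1, -1}. (int n)^2 dvd f A B \<theta> + 2 * s)} \<times> {\<theta>})"
  define B3 where "B3 = (\<Union>\<theta>\<in>\<Theta>. {(A, B) \<in> W k \<times> W k. \<exists>n. prime (int n) \<and> g ^ k < (real n)^2 \<and>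
      (\<exists>s\<in>{1, -1}. (int n)^2 dvd f A B \<theta> + 2 * s)} \<times> {\<theta>})"
  have cW: "real (card ((W k \<times> W k) \<times> \<Theta>)) = (g ^ k)^2 * real (card \<Theta>)"
    by (simp add: card_cartesian_product card_W power2_eq_square)
  have sub: "(W k \<times> W k) \<times> \<Theta> \<subseteq> good k \<union> (B1 \<union> (B2 \<union> B3))"
  proof (rule subsetI, rule ccontr)
    fix x assume x: "x \<in> (W k \<times> W k) \<times> \<Theta>" "x \<notin> good k \<union> (B1 \<union> (B2 \<union> B3))"
    obtain A B \<theta> where x_def: "x = ((A, B), \<theta>)" by (metis surj_pair)
    have AB: "A \<in> W k" "B \<in> W k" and \<theta>: "\<theta> \<in> \<Theta>" using x by (auto simp: x_def)
    have nB: "((A, B), \<theta>) \<notin> B3" "((A, B), \<theta>) \<notin> B2" "((A, B), \<theta>) \<notin> B1" "((A, B), \<theta>) \<notin> good k"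
      using x(2) by (auto simp: x_def)
    have "\<not> (int n)^2 dvd f A B \<theta> + 2 * s" if n: "n > 64" "prime (int n)" and s: "s \<in> {1, -1}" for n s
    proof
      assume d: "(int n)^2 dvd f A B \<theta> + 2 * s"
      consider "n \<le> R" | "n > R" "(real n)^2 \<le> g ^ k" | "g ^ k < (real n)^2" by linarith
      then show False
      proof cases
        case 1
        then have "\<exists>n\<in>{64<..R}. prime (int n) \<and> (\<exists>s\<in>{1, -1}. (int n)^2 dvd f A B \<theta> + 2 * s)"
          using n s d by (intro bexI[of _ n] conjI bexI[of _ s]) auto
        then have "((A, B), \<theta>) \<in> B1" unfolding B1_def using AB \<theta> by simp
        then show False using nB by simp
      next
        case 2
        then have "\<exists>n>R. prime (int n) \<and> (real n)^2 \<le> g ^ k \<and> (\<exists>s\<in>{1, -1}. (int n)^2 dvd f A B \<theta> + 2 * s)"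
          using n s d by blast
        then have "((A, B), \<theta>) \<in> B2" unfolding B2_def using AB \<theta> by simp
        then show False using nB by simp
      next
        case 3
        then have "\<exists>n. prime (int n) \<and> g ^ k < (real n)^2 \<and> (\<exists>s\<in>{1, -1}. (int n)^2 dvd f A B \<theta> + 2 * s)"
          using n s d by blast
        then have "((A, B), \<theta>) \<in> B3" unfolding B3_def using AB \<theta> by simp
        then show False using nB by simp
      qed
    qed
    then have "\<forall>n>64. prime (int n) \<longrightarrow> (\<forall>s\<in>{1, -1}. \<not> (int n)^2 dvd f A B \<theta> + 2 * s)" by blast
    then have "((A, B), \<theta>) \<in> good k" unfolding good_def using AB \<theta> by blast
    then show False using nB by simp
  qed
  have "good k \<subseteq> (W k \<times> W k) \<times> \<Theta>" "B1 \<subseteq> (W k \<times> W k) \<times> \<Theta>" "B2 \<subseteq> (W k \<times> W k) \<times> \<Theta>" "B3 \<subseteq> (W k \<times> W k) \<times> \<Theta>"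
    unfolding good_def B1_def B2_def B3_def by blast+
  then have fin: "finite (good k)" "finite B1" "finite B2" "finite B3"
    using finite_subset[of _ "(W k \<times> W k) \<times> \<Theta>"] fin_W fin_\<Theta> by simp_all
  have "card ((W k \<times> W k) \<times> \<Theta>) \<le> card (good k \<union> (B1 \<union> (B2 \<union> B3)))"
    using fin by (intro card_mono sub finite_UnI)
  also have "\<dots> \<le> card (good k) + (card B1 + (card B2 + card B3))"
    using card_Un_le[of "good k" "B1 \<union> (B2 \<union> B3)"] card_Un_le[of B1 "B2 \<union> B3"] card_Un_le[of B2 B3] by linarith
  finally have 0: "(g ^ k)^2 * real (card \<Theta>) \<le> real (card (good k)) + (real (card B1) + (real (card B2) + real (card B3)))"
    unfolding cW[symmetric] by simp
  have "real (card B1) = (\<Sum>x\<in>W k \<times> W k. real (card {\<theta> \<in> \<Theta>. \<exists>n\<in>{64<..R}. prime (int n) \<and>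
    (\<exists>s\<in>{1, -1}. (int n)^2 dvd f (fst x) (snd x) \<theta> + 2 * s)}))"
    unfolding B1_def by (subst card_SigmaI) (auto simp: fin_W fin_\<Theta>)
  also have "\<dots> \<le> (\<Sum>x\<in>W k \<times> W k. real (card \<Theta>) / 4)"
    by (intro sum_mono bad_mid) (auto simp: det_W)
  also have "\<dots> = (g ^ k)^2 * real (card \<Theta>) / 4"
    by (simp add: card_cartesian_product card_W power2_eq_square)
  finally have 1: "real (card B1) \<le> (g ^ k)^2 * real (card \<Theta>) / 4" .
  have "real (card B2) \<le> (\<Sum>\<theta>\<in>\<Theta>. (g ^ k)^2 / 8)"
    unfolding B2_def using bad_high by (intro card_UN_le_real fin_\<Theta>) (simp add: card_cartesian_product)
  then have 2: "real (card B2) \<le> (g ^ k)^2 * real (card \<Theta>) / 8" by (simp add: mult_ac)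
  have "real (card B3) \<le> (\<Sum>\<theta>\<in>\<Theta>. 4 * \<mu> k * (T k + 2) / sqrt (g ^ k))"
    unfolding B3_def using bad_huge[OF k] by (intro card_UN_le_real fin_\<Theta>) (simp add: card_cartesian_product)
  also have "\<dots> = real (card \<Theta>) * (4 * \<mu> k * (T k + 2) / sqrt (g ^ k))" by simp
  also have "\<dots> \<le> real (card \<Theta>) * ((g ^ k)^2 / 8)"
  proof (rule mult_left_mono)
    have "sqrt (g ^ k) > 0" using g_ge by simp
    then show "4 * \<mu> k * (T k + 2) / sqrt (g ^ k) \<le> (g ^ k)^2 / 8"
      using large by (simp add: field_simps)
  qed simp
  finally have 3: "real (card B3) \<le> (g ^ k)^2 * real (card \<Theta>) / 8" by (simp add: mult_ac)
  show ?thesis using 0 1 2 3 by linarith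
qed

text \<open>A trace has at most \<open>card \<Theta> * \<mu> k\<close> preimages among the triples.
  The factor \<open>card \<Theta>\<close> cancels against the number of good triples, so averaging
  over the parameters costs nothing.\<close>

lemma card_good_values:
  assumes k: "k \<ge> 1" and large: "32 * \<mu> k * (T k + 2) \<le> (g ^ k)^2 * sqrt (g ^ k)"
  shows "real (card ((\<lambda>((A, B), \<theta>). f A B \<theta>) ` good k)) \<ge> (g ^ k)^2 / (2 * \<mu> k)"
proof -
  let ?v = "\<lambda>((A, B), \<theta>). f A B \<theta>"
  have fin: "finite (good k)"
    by (rule finite_subset[of _ "(W k \<times> W k) \<times> \<Theta>"]) (auto simp: good_def fin_W fin_\<Theta>)
  have "real (card (good k)) \<le> (real (card \<Theta>) * \<mu> k) * real (card (?v ` good k))"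
  proof (rule card_le_fibres_real[where f = ?v])
    fix t assume "t \<in> ?v ` good k"
    then obtain A B \<theta> where t: "A \<in> W k" "B \<in> W k" "\<theta> \<in> \<Theta>" "t = f A B \<theta>" by (auto simp: good_def)
    then have tb: "t \<ge> 2" "real_of_int t \<le> T k" using f_bounds[OF k t(1,2,3)] by auto
    have "{s \<in> good k. ?v s = t} \<subseteq> (\<Union>\<theta>\<in>\<Theta>. {(A, B) \<in> W k \<times> W k. f A B \<theta> = t} \<times> {\<theta>})"
      by (auto simp: good_def)
    moreover have "finite (\<Union>\<theta>\<in>\<Theta>. {(A, B) \<in> W k \<times> W k. f A B \<theta> = t} \<times> {\<theta>})"
      by (rule finite_subset[of _ "(W k \<times> W k) \<times> \<Theta>"]) (auto simp: fin_W fin_\<Theta>)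
    ultimately have "real (card {s \<in> good k. ?v s = t}) \<le> real (card (\<Union>\<theta>\<in>\<Theta>. {(A, B) \<in> W k \<times> W k. f A B \<theta> = t} \<times> {\<theta>}))"
      by (intro of_nat_mono card_mono)
    also have "\<dots> \<le> (\<Sum>\<theta>\<in>\<Theta>. \<mu> k)"
      using fibre[OF k _ tb] by (intro card_UN_le_real fin_\<Theta>) (simp add: card_cartesian_product)
    finally show "real (card {s \<in> good k. ?v s = t}) \<le> real (card \<Theta>) * \<mu> k" by simp
  qed (use fin in auto)
  then have "(g ^ k)^2 * real (card \<Theta>) / 2 \<le> (real (card \<Theta>) * \<mu> k) * real (card (?v ` good k))"
    using card_good[OF assms] by linarith
  then show ?thesis using card_\<Theta>_pos mu_pos[of k] by (simp add: field_simps)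
qed

lemma good_squarefree:
  assumes "((A, B), \<theta>) \<in> good k" "k \<ge> 1" "mcong Q A (mat 1)" "mcong Q B (mat 1)"
  shows "odd (f A B \<theta>)" "squarefree ((f A B \<theta>)^2 - 4)"
proof -
  define t where "t = f A B \<theta>"
  have t3: "[t = 3] (mod Q)" unfolding t_def f_def by (rule nsq_mod[OF assms(3,4)])
  have t4: "t \<ge> 4" using assms f_bounds(1) by (auto simp: t_def good_def)
  have small: "[t = 3] (mod d)" if "d dvd Q" for d using t3 that by (rule cong_dvd_modulus)
  have sqQ: "(int n)^2 dvd Q" if "n \<le> 64" "n \<ge> 1" for n
  proof -
    have "int n dvd int (fact 64)" using that by (intro int_dvd_int_iff[THEN iffD2] dvd_fact) auto
    then show ?thesis unfolding Q by (simp only: of_nat_fact dvd_power_same)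
  qed
  have "2 dvd Q" using dvd_trans[of 2 "(int 2)^2" Q] sqQ[of 2] by simp
  then have "[t = 3] (mod 2)" by (rule small)
  then show odd: "odd (f A B \<theta>)" unfolding t_def[symmetric] by (auto simp: cong_def odd_iff_mod_2_eq_one)
  have main: "\<not> p^2 dvd t^2 - 4" if p: "prime p" for p :: int
  proof
    assume d: "p^2 dvd t^2 - 4"
    have eq: "t^2 - 4 = (t - 2) * (t + 2)" by (simp add: algebra_simps power2_eq_square)
    have pp: "p dvd t^2 - 4" using d by (meson dvd_trans dvd_power zero_less_numeral)
    have p2: "p \<noteq> 2"
    proof
      assume "p = 2"
      then have "even (t^2 - 4)" using pp by simp
      then show False using odd by (simp add: t_def)
    qed
    have "\<not> (p dvd t - 2 \<and> p dvd t + 2)"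
    proof
      assume "p dvd t - 2 \<and> p dvd t + 2"
      then have "p dvd (t + 2) - (t - 2)" using dvd_diff by blast
      then have "p dvd 2^2" by simp
      then have "p dvd 2" by (rule prime_dvd_power[OF p])
      then show False using p p2 by (metis primes_dvd_imp_eq two_is_prime)
    qed
    then have "coprime (p^2) (t - 2) \<or> coprime (p^2) (t + 2)"
      using prime_imp_coprime[OF p] by auto
    then have "p^2 dvd t + 2 \<or> p^2 dvd t - 2"
      using d unfolding eq by (auto simp: coprime_dvd_mult_left_iff coprime_dvd_mult_right_iff)
    then have "\<exists>s\<in>{1, -1}. p^2 dvd t + 2 * s" by auto
    then obtain s where s: "s \<in> {1, -1}" "p^2 dvd t + 2 * s" by blast
    define n where "n = nat p"
    have n: "p = int n" "n \<ge> 2" using prime_ge_2_int[OF p] by (auto simp: n_def)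
    show False
    proof (cases "n \<le> 64")
      case True
      then have "p^2 dvd Q" using sqQ[of n] n by simp
      then have "p^2 dvd t - 3" using small by (simp add: cong_iff_dvd_diff)
      with s(2) have "p^2 dvd (t + 2 * s) - (t - 3)" by (rule dvd_diff)
      \<comment> \<open>t + 2 s is congruent to 5 or 1 modulo p^2, whereas p is odd and so p^2 >=
        9.\<close>
      then have "p^2 dvd 5 \<or> p^2 dvd 1" using s(1) by auto
      then have "p^2 \<le> 5" using zdvd_imp_le[of "p^2" 5] zdvd_imp_le[of "p^2" 1] by auto
      moreover have "3 \<le> p" using n p2 by simp
      then have "3^2 \<le> p^2" by (intro power_mono) auto
      ultimately show False by simp
    next
      case False
      then show False using assms(1) s p n by (auto simp: good_def t_def)
    qed
  qed
  have "4^2 \<le> t^2" using t4 by (intro power_mono) auto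
  then have "t^2 - 4 \<noteq> 0" by simp
  then show "squarefree ((f A B \<theta>)^2 - 4)"
    using main unfolding t_def by (subst squarefree_factorial_semiring) auto
qed

section \<open>Asymptotics in the word length\<close>

definition \<rho> :: real where "\<rho> = real R powr \<epsilon>"
definition D :: real where "D = 256 * (real R)^4"

lemma rho_ge: "\<rho> \<ge> 4096 * F^2" "\<rho> \<ge> 1"
proof -
  have "1 \<le> F^2" using F1 by simp
  then show "\<rho> \<ge> 4096 * F^2" "\<rho> \<ge> 1" using RF unfolding \<rho>_def by linarith+
qed

lemma rho_power: "\<rho> ^ n = real R powr (real n * \<epsilon>)"
  using R_ge(4) by (simp add: \<rho>_def powr_power mult.commute)

lemma D_ge: "D \<ge> 2" "D \<ge> real R"
proof -
  have "real R \<le> (real R)^4" using R_ge(4) by (intro self_le_power) auto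
  then show "D \<ge> 2" "D \<ge> real R" using R_ge(2) unfolding D_def by linarith+
qed

lemma T_eq: "T k = 64 * K^2 * D^k"
  by (simp add: T_def D_def)

text \<open>One more block costs a factor 16 for factorisations and \<rho>^5 for the norm bound, as
  D <= R^5. The constant in front is independent of k.\<close>

lemma mu_le: "\<mu> k \<le> 192 * C * K^3 * (16 * \<rho>^5)^k"
proof -
  have "D \<le> (real R)^5"
  proof -
    have "256 * (real R)^4 \<le> real R * (real R)^4" using R_ge by (intro mult_right_mono) auto
    also have "\<dots> = (real R)^5" by (simp flip: power_Suc)
    finally show ?thesis by (simp add: D_def)
  qed
  then have "(D^k) powr \<epsilon> \<le> (((real R)^5)^k) powr \<epsilon>"
    using D_ge eps by (intro powr_mono2 power_mono) auto
  also have "\<dots> = (\<rho>^5)^k"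
    unfolding \<rho>_def using R_ge(4) by (simp only: power_powr_swap zero_less_power of_nat_0_less_iff)
  finally have Dk: "(D^k) powr \<epsilon> \<le> (\<rho>^5)^k" .
  have K2: "64 * K^2 \<ge> 1" using one_le_power[OF K1, of 2] by simp
  have "T k powr \<epsilon> = (64 * K^2) powr \<epsilon> * (D^k) powr \<epsilon>" unfolding T_eq by (rule powr_mult)
  also have "\<dots> \<le> (64 * K^2) powr 1 * (\<rho>^5)^k"
    using K2 eps Dk by (intro mult_mono powr_mono) auto
  finally have T: "T k powr \<epsilon> \<le> 64 * K^2 * (\<rho>^5)^k" using K2 by simp
  have "1 * 1 \<le> K * 16^k" using K1 by (intro mult_mono) auto
  then have K3: "1 + 2 * K * 16^k \<le> 3 * K * 16^k" by simp
  have "\<mu> k \<le> C * (64 * K^2 * (\<rho>^5)^k) * (3 * K * 16^k)"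
    unfolding \<mu>_def using C1 K1 T K3 rho_ge by (intro mult_mono mult_left_mono) auto
  also have "\<dots> = 192 * C * K^3 * (16 * \<rho>^5)^k"
    by (simp add: power_mult_distrib power2_eq_square power3_eq_cube)
  finally show ?thesis .
qed

lemma g_lower: "g \<ge> (real R)^2 / F" "sqrt g \<ge> real R / F"
proof -
  show 1: "g \<ge> (real R)^2 / F" using g_ge(1) F1 by (simp add: field_simps)
  have "(real R / F)^2 \<le> (real R)^2 / F"
  proof -
    have "F \<le> F^2" using F1 by (intro self_le_power) auto
    then show ?thesis unfolding power_divide using F1 by (intro divide_left_mono) auto
  qed
  then show "sqrt g \<ge> real R / F" using 1 by (intro real_le_rsqrt) simp
qed

lemma eventually_large:
  "\<exists>k0\<ge>1. \<forall>k\<ge>k0. 32 * \<mu> k * (T k + 2) \<le> (g ^ k)^2 * sqrt (g ^ k)"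
proof -
  define A0 where "A0 = 32 * (192 * C * K^3) * (66 * K^2)"
  obtain k0 where k0: "A0 < 2 ^ k0" using real_arch_pow[of 2 A0] by auto
  have K2: "K^2 \<ge> 1" using one_le_power[OF K1, of 2] by simp
  \<comment> \<open>Per block, R^4 times \<rho>^5 has to stay below g^(5/2), which is at least R^5 /
    F^3. The spare factor R pays for \<rho>^7, the part \<rho>^2 of which covers 8192 F^3. The
    factor 2 on the left produces 2^k, which outgrows \<open>A0\<close>.\<close>
  have base: "2 * (16 * \<rho>^5 * D) \<le> g^2 * sqrt g"
  proof -
    have F3: "F^3 \<le> F^4" "1 \<le> F^3" using F1 by (auto intro: power_increasing)
    have "8192 * F^3 \<le> (4096 * F^2)^2" using F3 by (simp add: power_mult_distrib)
    also have "\<dots> \<le> \<rho>^2" using rho_ge F1 by (intro power_mono) auto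
    finally have "8192 * F^3 * \<rho>^5 \<le> \<rho>^2 * \<rho>^5" using rho_ge by (intro mult_right_mono) auto
    also have "\<dots> = real R powr (real 7 * \<epsilon>)" unfolding rho_power[symmetric] by (simp flip: power_add)
    also have "\<dots> \<le> real R powr 1" using eps R_ge(4) by (intro powr_mono) auto
    finally have 1: "8192 * F^3 * \<rho>^5 \<le> real R" using R_ge(4) by simp
    have "2 * (16 * \<rho>^5 * D) = (8192 * F^3 * \<rho>^5) * (real R)^4 / F^3"
      using F1 by (simp add: D_def)
    also have "\<dots> \<le> real R * (real R)^4 / F^3"
      using 1 F1 by (intro divide_right_mono mult_right_mono) auto
    also have "\<dots> = ((real R)^2 / F)^2 * (real R / F)"
      by (simp add: power_divide power2_eq_square power3_eq_cube power4_eq_xxxx)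
    also have "\<dots> \<le> g^2 * sqrt g"
      using g_lower F1 by (intro mult_mono power_mono) auto
    finally show ?thesis .
  qed
  have "32 * \<mu> k * (T k + 2) \<le> (g ^ k)^2 * sqrt (g ^ k)" if "k \<ge> k0" for k
  proof -
    have "1 * 1 \<le> K^2 * D^k" using K2 D_ge by (intro mult_mono) auto
    then have T2: "T k + 2 \<le> 66 * K^2 * D^k" unfolding T_eq mult.assoc by linarith
    have "32 * \<mu> k * (T k + 2) \<le> 32 * (192 * C * K^3 * (16 * \<rho>^5)^k) * (66 * K^2 * D^k)"
      using mu_le[of k] T2 mu_nonneg[of k] T_pos[of k] K1 C1 rho_ge D_ge
      by (intro mult_mono mult_left_mono mult_nonneg_nonneg) auto
    also have "\<dots> = A0 * (16 * \<rho>^5 * D)^k"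
      by (simp add: A0_def power_mult_distrib)
    also have "\<dots> \<le> 2^k * (16 * \<rho>^5 * D)^k"
    proof (rule mult_right_mono)
      have "(2::real)^k0 \<le> 2^k" using that by (intro power_increasing) auto
      then show "A0 \<le> 2^k" using k0 by linarith
      show "0 \<le> (16 * \<rho>^5 * D)^k" using rho_ge D_ge by simp
    qed
    also have "\<dots> = (2 * (16 * \<rho>^5 * D))^k" by (simp only: power_mult_distrib)
    also have "\<dots> \<le> (g^2 * sqrt g)^k" using base rho_ge D_ge by (intro power_mono) auto
    also have "\<dots> = (g ^ k)^2 * sqrt (g ^ k)"
      by (simp add: power_mult_distrib real_sqrt_power power_swap[of g 2 k])
    finally show ?thesis .
  qed
  then show ?thesis by (intro exI[of _ "max 1 k0"]) auto
qed

text \<open>Per block: g^2 is at least R^4 / F^2 = D / (256 F^2), and the total loss 16 * 256 * F^2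
  * \<rho>^5 is at most \<rho>^6, hence at most \<open>R powr \<eta>\<close> and
  \<open>D powr \<eta>\<close>.\<close>

lemma values_lower:
  assumes "48 * \<epsilon> \<le> \<eta>" "\<eta> < 1"
  shows "\<exists>c>0. \<forall>k. (g ^ k)^2 / (2 * \<mu> k) \<ge> c * (D powr (1 - \<eta>)) ^ k"
proof (intro exI conjI allI)
  have CK: "C * K^3 > 0" using C1 K1 by simp
  then show "1 / (384 * C * K^3) > 0" by (simp add: mult.assoc)
  fix k
  have Dp: "D powr (1 - \<eta>) * (16 * \<rho>^5) \<le> g^2"
  proof -
    have "\<rho>^6 = real R powr (real 6 * \<epsilon>)" by (rule rho_power)
    also have "\<dots> \<le> real R powr \<eta>" using R_ge(4) assms eps by (intro powr_mono) auto
    also have "\<dots> \<le> D powr \<eta>" using D_ge assms eps by (intro powr_mono2) auto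
    finally have "(4096 * F^2) * \<rho>^5 \<le> D powr \<eta>"
      using mult_right_mono[OF rho_ge(1), of "\<rho>^5"] rho_ge by (simp flip: power_Suc)
    then have "D powr (1 - \<eta>) * ((4096 * F^2) * \<rho>^5) \<le> D powr (1 - \<eta>) * D powr \<eta>"
      by (intro mult_left_mono) auto
    also have "\<dots> = 256 * (real R)^4" using D_ge by (simp flip: powr_add) (simp add: D_def)
    finally have "D powr (1 - \<eta>) * (16 * \<rho>^5) \<le> ((real R)^2 / F)^2"
      using F1 by (simp add: power_divide field_simps)
    also have "\<dots> \<le> g^2" using g_lower F1 by (intro power_mono) auto
    finally show ?thesis .
  qed
  have "1 / (384 * C * K^3) * (D powr (1 - \<eta>)) ^ k * (2 * \<mu> k)
      \<le> 1 / (384 * C * K^3) * (D powr (1 - \<eta>)) ^ k * (2 * (192 * C * K^3 * (16 * \<rho>^5)^k))"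
    using mu_le[of k] CK by (intro mult_left_mono) (auto simp: mult.assoc)
  also have "\<dots> = (D powr (1 - \<eta>) * (16 * \<rho>^5)) ^ k"
    using C1 K1 by (simp add: power_mult_distrib)
  also have "\<dots> \<le> (g^2)^k" using Dp rho_ge by (intro power_mono) auto
  also have "\<dots> = (g^k)^2" by (rule power_swap)
  finally show "1 / (384 * C * K^3) * (D powr (1 - \<eta>)) ^ k \<le> (g ^ k)^2 / (2 * \<mu> k)"
    using mu_pos[of k] by (simp add: field_simps)
qed

text \<open>A finite set independent of the word length k, so that one compact set serves all
  traces.\<close>

definition letters :: "(int^2^2) set" where
  "letters = transpose ` G \<union> center Q ` \<Theta> \<union> G"

lemma finite_letters: "finite letters"
  by (simp add: letters_def fin_G fin_\<Theta>)

lemma letters_props: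
  assumes "A \<in> letters"
  shows "det A = 1" "1 \<le> A $ i $ j"
proof -
  have b: "det B = 1 \<and> (\<forall>i j. 1 \<le> B $ i $ j)" if "B \<in> G" for B
    using that G(1) R_int by (force simp: blocks_def forall_2)
  have c: "det B = 1 \<and> (\<forall>i j. 1 \<le> B $ i $ j)" if "B \<in> center Q ` \<Theta>" for B
    using that center_bounds(1)[of _ I Q] Q1 by (auto simp: \<Theta>_def)
  show "det A = 1" "1 \<le> A $ i $ j"
    using assms b c by (auto simp: letters_def)
qed

lemma f_letters:
  assumes "A \<in> W k" "B \<in> W k" "\<theta> \<in> \<Theta>"
  shows "\<exists>xs. xs \<noteq> [] \<and> set xs \<subseteq> letters \<and> nsq (lprod xs) = f A B \<theta>"
proof -
  obtain ys zs where yz: "A = lprod ys" "set ys \<subseteq> G" "B = lprod zs" "set zs \<subseteq> G"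
    using assms by (auto simp: W_def words_def)
  let ?xs = "rev (map transpose ys) @ [center Q \<theta>] @ zs"
  have "lprod ?xs = transpose A ** center Q \<theta> ** B"
    by (simp add: lprod_append yz lprod_transpose matrix_mul_assoc)
  moreover have "set ?xs \<subseteq> letters" using yz assms(3) by (auto simp: letters_def)
  ultimately show ?thesis by (intro exI[of _ ?xs]) (simp add: f_def)
qed

end

theorem many_squarefree_traces:
  fixes \<eta> :: real
  assumes \<eta>: "0 < \<eta>" "\<eta> < 1"
  shows "\<exists>S. finite S \<and> (\<forall>A\<in>S. det A = 1 \<and> (\<forall>i j. 1 \<le> A $ i $ j)) \<and>
    (\<exists>c>0. \<exists>X0. \<forall>X\<ge>X0. c * X powr (1 - \<eta>) \<le>
      real (card {t::int. real_of_int t < X \<and> odd t \<and> squarefree (t^2 - 4) \<and>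
        (\<exists>xs. xs \<noteq> [] \<and> set xs \<subseteq> S \<and> nsq (lprod xs) = t)}))"
proof -
  define \<epsilon> where "\<epsilon> = \<eta> / 48"
  have eps: "\<epsilon> > 0" "\<epsilon> \<le> 1 / 48" using \<eta> by (auto simp: \<epsilon>_def)
  obtain C where C: "C \<ge> 1" "\<And>t::int. t \<ge> 2 \<Longrightarrow> real (card {A. det A = 1 \<and> nsq A = t}) \<le> C * real_of_int t powr \<epsilon>"
    using card_nsq_bound[OF eps(1)] by auto
  define Q :: int where "Q = (fact 64)^2"
  have Q1: "Q \<ge> 1" by (simp add: Q_def)
  \<comment> \<open>8 comes from \<open>card_blocks\<close>, the fourth power from the number of
    residue classes of matrices modulo \<open>Q\<close>.\<close>
  define F where "F = 8 * real (nat Q ^ 4)"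
  have "nat Q ^ 4 > 0" using Q1 by simp
  then have "real (nat Q ^ 4) \<ge> 1" by linarith
  then have F1: "F \<ge> 1" unfolding F_def by linarith
  \<comment> \<open>\<open>R\<close> is chosen last: \<open>C\<close> depends only on \<epsilon> and
    \<open>F\<close> only on the fixed \<open>Q\<close>, so \<open>RF\<close> and \<open>RC\<close>
    are not circular. The summand 10000 serves \<open>card_blocks\<close>.\<close>
  define R where "R = nat \<lceil>10000 + (4096 * F^2) powr (1 / \<epsilon>) + (8064 * C)^2\<rceil>"
  have R: "real R \<ge> 10000 + (4096 * F^2) powr (1 / \<epsilon>) + (8064 * C)^2" by (simp add: R_def real_nat_ceiling_ge)
  have "real R \<ge> 10000"
    using R powr_ge_zero[of "4096 * F^2" "1 / \<epsilon>"] zero_le_power2[of "8064 * C"] by linarith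
  then have R4: "R \<ge> 10000" by linarith
  have Rb: "(4096 * F^2) powr (1 / \<epsilon>) \<le> real R" "(8064 * C)^2 \<le> real R"
    using R powr_ge_zero[of "4096 * F^2" "1 / \<epsilon>"] zero_le_power2[of "8064 * C"] by linarith+
  have "4096 * F^2 = ((4096 * F^2) powr (1 / \<epsilon>)) powr \<epsilon>" using F1 eps by (simp add: powr_powr)
  also have "\<dots> \<le> real R powr \<epsilon>" using Rb(1) eps by (intro powr_mono2) auto
  finally have RF: "real R powr \<epsilon> \<ge> 4096 * F^2" .
  have RC: "sqrt (real R) \<ge> 8064 * C" using Rb(2) by (rule real_le_rsqrt)
  obtain G where blk: "G \<subseteq> blocks (int R)" "card (blocks (int R)) \<le> card G * nat Q ^ 4"
    "\<And>A B. A \<in> G \<Longrightarrow> B \<in> G \<Longrightarrow> mcong Q A B"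
    using popular_class[of Q "blocks (int R)"] Q1 finite_blocks by auto
  have cG: "real (card G) \<ge> (real R)^2 / F"
  proof -
    have "(real R)^2 / 8 \<le> real (card (blocks (int R)))" by (rule card_blocks[OF R4])
    also have "\<dots> \<le> real (card G * nat Q ^ 4)" using blk(2) by (simp only: of_nat_le_iff)
    finally show ?thesis using Q1 by (simp add: F_def field_simps)
  qed
  interpret word_family C \<epsilon> F Q R G
    by unfold_locales (use C eps blk(1) cG F1 RF RC Q_def in auto)
  have "G \<noteq> {}" using g_ge(3) unfolding g_def by auto
  then obtain n where n: "n \<ge> 1" "\<And>m M. M \<in> words G (n * m) \<Longrightarrow> mcong Q M (mat 1)"
    using words_mcong_one[of Q G] Q1 blk(1,3) blocks_det by (metis less_le_trans subsetD zero_less_one)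
  define V where "V X = {t::int. real_of_int t < X \<and> odd t \<and> squarefree (t^2 - 4) \<and>
        (\<exists>xs. xs \<noteq> [] \<and> set xs \<subseteq> letters \<and> nsq (lprod xs) = t)}" for X
  have finV: "finite (V X)" for X
  proof -
    have "V X \<subseteq> {0..\<lceil>X\<rceil>}"
    proof
      fix t assume "t \<in> V X"
      then obtain xs where t: "real_of_int t < X" "nsq (lprod xs) = t" by (auto simp: V_def)
      have "0 \<le> nsq (lprod xs)" by (simp add: nsq_def)
      then have "0 \<le> t" "t \<le> \<lceil>X\<rceil>" using t by (simp_all, linarith)
      then show "t \<in> {0..\<lceil>X\<rceil>}" by simp
    qed
    then show ?thesis by (rule finite_subset) simp
  qed
  obtain k0 where k0: "k0 \<ge> 1" "\<And>k. k \<ge> k0 \<Longrightarrow> 32 * \<mu> k * (T k + 2) \<le> (g ^ k)^2 * sqrt (g ^ k)"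
    using eventually_large by auto
  obtain c where c: "c > 0" "\<And>k. (g ^ k)^2 / (2 * \<mu> k) \<ge> c * (D powr (1 - \<eta>)) ^ k"
    using values_lower[of \<eta>] \<eta> by (auto simp: \<epsilon>_def)
  have main: "real (card (V X)) \<ge> c * (D powr (1 - \<eta>)) ^ (n * m)" if m: "m \<ge> k0" and X: "T (n * m) < X" for m X
  proof -
    define k where "k = n * m"
    have "1 * m \<le> n * m" using n(1) by (rule mult_right_mono) simp
    then have k: "k \<ge> k0" "k \<ge> 1" using m k0(1) unfolding k_def by linarith+
    have "(\<lambda>((A, B), \<theta>). f A B \<theta>) ` good k \<subseteq> V X"
    proof clarify
      fix A B h j i assume gd: "((A, B), (h, j, i)) \<in> good k"
      then have AB: "A \<in> W k" "B \<in> W k" "(h, j, i) \<in> \<Theta>" by (auto simp: good_def)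
      then have "mcong Q A (mat 1)" "mcong Q B (mat 1)" using n(2) by (auto simp: W_def k_def)
      from good_squarefree[OF gd k(2) this] show "f A B (h, j, i) \<in> V X"
        using f_letters[OF AB] f_bounds(2)[OF k(2) AB] X unfolding V_def k_def by auto
    qed
    then have "real (card ((\<lambda>((A, B), \<theta>). f A B \<theta>) ` good k)) \<le> real (card (V X))"
      by (intro of_nat_mono card_mono finV)
    then show ?thesis using card_good_values[OF k(2) k0(2)[OF k(1)]] c(2)[of k] unfolding k_def by linarith
  qed
  \<comment> \<open>The scales reached directly are a * E^m = T (n * m). An X between two
    consecutive scales is compared with the lower one, at the cost of the fixed factor a *
    E.\<close>
  define a E where "a = 64 * K^2" and "E = D ^ n"
  have a1: "a \<ge> 1" using one_le_power[OF K1, of 2] by (simp add: a_def)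
  have E2: "E \<ge> 2"
  proof -
    have "D \<le> D ^ n" using D_ge n(1) by (intro self_le_power) auto
    then show ?thesis using D_ge unfolding E_def by linarith
  qed
  have "c / (a * E) * X powr (1 - \<eta>) \<le> real (card (V X))" if X: "X \<ge> a * E ^ k0 + 1" for X
  proof -
    have aE: "a * E ^ k0 < X" using X by simp
    obtain m' where m': "X \<le> a * E ^ m'"
    proof -
      obtain m' where "X / a < E ^ m'" using real_arch_pow[of E "X / a"] E2 by auto
      then show thesis using that[of m'] a1 by (simp add: field_simps)
    qed
    define M where "M = (LEAST m. X \<le> a * E ^ m)"
    have M: "X \<le> a * E ^ M" unfolding M_def using m' by (rule LeastI)
    have "M > k0"
    proof (rule ccontr)
      assume "\<not> M > k0"
      then have "E ^ M \<le> E ^ k0" using E2 by (intro power_increasing) auto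
      then have "a * E ^ M \<le> a * E ^ k0" using a1 by (intro mult_left_mono) auto
      then show False using M aE by linarith
    qed
    then obtain m where m: "M = Suc m" "m \<ge> k0" by (cases M) auto
    have "\<not> X \<le> a * E ^ m" using not_less_Least[of m "\<lambda>m. X \<le> a * E ^ m"] m by (simp add: M_def)
    then have "T (n * m) < X" by (simp add: T_eq a_def E_def power_mult)
    then have 1: "real (card (V X)) \<ge> c * (D powr (1 - \<eta>)) ^ (n * m)" by (rule main[OF m(2)])
    have aE1: "a * E \<ge> 1" using mult_mono[of 1 a 1 E] a1 E2 by simp
    have X0: "X \<ge> 0" using aE a1 E2 by (smt (verit) mult_nonneg_nonneg zero_le_power)
    have "X powr (1 - \<eta>) \<le> ((a * E) * E ^ m) powr (1 - \<eta>)"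
      using M m X0 \<eta> by (intro powr_mono2) (auto simp: mult_ac)
    also have "\<dots> = (a * E) powr (1 - \<eta>) * (E ^ m) powr (1 - \<eta>)" by (rule powr_mult)
    also have "\<dots> \<le> (a * E) powr 1 * (E ^ m) powr (1 - \<eta>)"
      using aE1 \<eta> by (intro mult_right_mono powr_mono) auto
    also have "(E ^ m) powr (1 - \<eta>) = (D powr (1 - \<eta>)) ^ (n * m)"
      using D_ge power_powr_swap[of D "1 - \<eta>" "n * m"] by (simp add: E_def power_mult)
    finally have "X powr (1 - \<eta>) \<le> (a * E) * (D powr (1 - \<eta>)) ^ (n * m)" using aE1 by simp
    then have "c / (a * E) * X powr (1 - \<eta>) \<le> c / (a * E) * ((a * E) * (D powr (1 - \<eta>)) ^ (n * m))"
      using c(1) aE1 by (intro mult_left_mono) auto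
    also have "c / b * (b * y) = c * y" if "b \<ge> 1" for b y using that by simp
    from this[OF aE1] have "c / (a * E) * ((a * E) * (D powr (1 - \<eta>)) ^ (n * m)) = c * (D powr (1 - \<eta>)) ^ (n * m)" .
    finally show ?thesis using 1 by linarith
  qed
  moreover have "c / (a * E) > 0" using c(1) a1 E2 by simp
  ultimately have "\<exists>c>0. \<exists>X0. \<forall>X\<ge>X0. c * X powr (1 - \<eta>) \<le> real (card (V X))" by blast
  then show ?thesis unfolding V_def using finite_letters letters_props
    by (intro exI[of _ letters]) auto
qed

subsection \<open>Squarefree discriminants are fundamental\<close>

lemma sqrt_irrational:
  fixes D :: int
  assumes "squarefree D" "D > 1"
  shows "sqrt (of_int D) \<notin> \<rat>"
proof
  assume "sqrt (of_int D) \<in> \<rat>"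
  moreover have "algebraic_int (sqrt (of_int D))" by (intro algebraic_int_sqrt) (auto intro: int_imp_algebraic_int)
  ultimately have "sqrt (of_int D) \<in> \<int>" using rational_algebraic_int_is_int by blast
  then obtain m where m: "sqrt (of_int D) = of_int m" by (elim Ints_cases)
  have "of_int D = (sqrt (of_int D))^2" using assms(2) by simp
  also have "\<dots> = of_int (m^2)" by (simp add: m)
  finally have D: "D = m^2" by (simp only: of_int_eq_iff)
  then have "is_unit m" using assms(1) squarefreeD[of D m] by simp
  then have "m^2 = 1" by (auto simp: zdvd1_eq power2_eq_1_iff)
  then show False using D assms(2) by simp
qed

lemma rat_sqrt_eq_iff:
  fixes a b c d :: rat
  assumes "sqrt (of_int D) \<notin> \<rat>"
  shows "of_rat a + of_rat b * sqrt (of_int D) = of_rat c + of_rat d * sqrt (of_int D) \<longleftrightarrow> a = c \<and> b = d"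
proof
  assume e: "of_rat a + of_rat b * sqrt (of_int D) = of_rat c + of_rat d * sqrt (of_int D)"
  have "b = d"
  proof (rule ccontr)
    assume "b \<noteq> d"
    then have nz: "(of_rat (b - d) :: real) \<noteq> 0" by simp
    have "of_rat (b - d) * sqrt (of_int D) = of_rat (c - a)" using e by (simp add: of_rat_diff algebra_simps)
    then have "sqrt (of_int D) = of_rat (c - a) / of_rat (b - d)" using nz by (simp add: field_simps)
    then have "sqrt (of_int D) \<in> \<rat>" by simp
    then show False using assms by blast
  qed
  then show "a = c \<and> b = d" using e by simp
qed simp

lemma quad_conj_eq:
  assumes "sqrt (of_int D) \<notin> \<rat>"
  shows "quad_conj D (of_rat a + of_rat b * sqrt (of_int D)) = of_rat a - of_rat b * sqrt (of_int D)"
  unfolding quad_conj_def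
  by (rule the_equality) (auto simp: rat_sqrt_eq_iff[OF assms])

text \<open>Gauss: the primitive integral quadratic \<open>c\<close> with root x divides every
  integral polynomial with root x, because a nonzero remainder of degree at most 1 would make x
  rational. Dividing a monic one, it has a unit as leading coefficient.\<close>

lemma quadratic_algebraic_int:
  fixes x \<tau> \<nu> :: real
  assumes x: "algebraic_int x" "x \<notin> \<rat>" and eq: "x^2 - \<tau> * x + \<nu> = 0" and rat: "\<tau> \<in> \<rat>" "\<nu> \<in> \<rat>"
  shows "\<tau> \<in> \<int>" "\<nu> \<in> \<int>"
proof -
  obtain n1 d1 where t: "d1 > 0" "\<tau> = of_int n1 / of_int d1" using rat(1) by (metis Rats_cases')
  obtain n2 d2 where v: "d2 > 0" "\<nu> = of_int n2 / of_int d2" using rat(2) by (metis Rats_cases')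
  define N where "N = d1 * d2"
  have N: "N > 0" using t v by (simp add: N_def)
  define c1 where "c1 = [:n2 * d1, - n1 * d2, N:]"
  have c1x: "poly (map_poly real_of_int c1) x = 0"
  proof -
    have "poly (map_poly real_of_int c1) x = of_int N * (x^2 - \<tau> * x + \<nu>)"
      using t v N by (simp add: c1_def map_poly_pCons N_def field_simps power2_eq_square)
    then show ?thesis using eq by simp
  qed
  define c where "c = primitive_part c1"
  define k where "k = content c1"
  have c1: "c1 = smult k c" by (simp add: c_def k_def)
  have c1nz: "c1 \<noteq> 0" using N by (simp add: c1_def)
  have k0: "k \<noteq> 0" using c1nz by (simp add: k_def)
  have mapsm: "map_poly real_of_int (smult k c) = smult (of_int k) (map_poly real_of_int c)"
    by (intro poly_eqI) (simp add: coeff_map_poly)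
  have cx: "poly (map_poly real_of_int c) x = 0"
    using c1x k0 unfolding c1 mapsm by simp
  have contc: "content c = 1" using c1nz by (simp add: c_def)
  have degc: "degree c = 2"
  proof -
    have "degree c1 = 2" using N by (simp add: c1_def)
    then show ?thesis using k0 by (simp add: c1)
  qed
  obtain P :: "int poly" where P: "poly (map_poly of_int P) x = 0" "lead_coeff P = 1"
    using x(1) unfolding algebraic_int_altdef_ipoly by blast
  obtain q r where qr: "pseudo_divmod P c = (q, r)" by fastforce
  have c0: "c \<noteq> 0" using degc by auto
  define e where "e = coeff c (degree c) ^ (Suc (degree P) - degree c)"
  have e0: "e \<noteq> 0" using c0 by (simp add: e_def)
  have pd: "smult e P = c * q + r" "r = 0 \<or> degree r < degree c"
    using pseudo_divmod[OF c0 qr] by (simp_all add: e_def)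
  have rx: "poly (map_poly real_of_int r) x = 0"
  proof -
    have "map_poly real_of_int (smult e P) = map_poly real_of_int c * map_poly real_of_int q + map_poly real_of_int r"
      unfolding pd(1) by (intro poly_eqI) (simp add: coeff_map_poly coeff_mult)
    moreover have "map_poly real_of_int (smult e P) = smult (of_int e) (map_poly real_of_int P)"
      by (intro poly_eqI) (simp add: coeff_map_poly)
    ultimately have "poly (smult (of_int e) (map_poly real_of_int P)) x
      = poly (map_poly real_of_int c * map_poly real_of_int q + map_poly real_of_int r) x" by simp
    then show ?thesis using P cx by simp
  qed
  have "r = 0"
  proof (rule ccontr)
    assume "r \<noteq> 0"
    then have "degree r < 2" using pd(2) degc by auto
    then have r: "r = [:coeff r 0, coeff r 1:]"
      by (intro poly_eqI) (auto simp: coeff_pCons coeff_eq_0 split: nat.splits)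
    then have "poly (map_poly real_of_int [:coeff r 0, coeff r 1:]) x = 0" using rx by simp
    then have e: "of_int (coeff r 0) + x * of_int (coeff r 1) = 0" by (simp add: map_poly_pCons)
    have "coeff r 1 = 0"
    proof (rule ccontr)
      assume "coeff r 1 \<noteq> 0"
      then have "x = - of_int (coeff r 0) / of_int (coeff r 1)" using e by (simp add: field_simps)
      then have "x \<in> \<rat>" by simp
      then show False using x(2) by blast
    qed
    then show False using e r \<open>r \<noteq> 0\<close> by simp
  qed
  then have "c dvd smult e P" using pd(1) by simp
  then have "fract_poly c dvd fract_poly (smult e P)" by (rule fract_poly_dvd)
  then have "fract_poly c dvd smult (to_fract e) (fract_poly P)" by (simp add: fract_poly_smult)
  then have "fract_poly c dvd fract_poly P" using e0 by (simp add: dvd_smult_iff)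
  then have "c dvd P" using contc by (rule fract_poly_dvdD)
  then have "lead_coeff c dvd 1" using P(2) by (metis dvdE dvd_triv_left lead_coeff_mult)
  moreover have "N = k * lead_coeff c"
  proof -
    have "lead_coeff c1 = N" using N by (simp add: c1_def)
    then show ?thesis using k0 by (simp add: c1)
  qed
  \<comment> \<open>The leading coefficient of \<open>c1\<close> thus divides its content, so it
    divides the other coefficients too; the quotients are the trace and the norm of x, up to
    sign.\<close>
  ultimately have "N dvd k" by (metis dvd_refl mult.right_neutral mult_dvd_mono dvd_trans dvd_def mult.assoc)
  then have "N dvd coeff c1 i" for i unfolding k_def using content_dvd_coeff dvd_trans by blast
  from this[of 0] this[of 1] have "N dvd n2 * d1" "N dvd n1 * d2" by (simp_all add: c1_def)
  then obtain u w where uw: "n2 * d1 = N * u" "n1 * d2 = N * w" by (elim dvdE)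
  have "\<tau> = of_int w"
  proof -
    have "n1 = d1 * w" using uw(2) v(1) by (simp add: N_def)
    then show ?thesis using t by simp
  qed
  then show "\<tau> \<in> \<int>" by simp
  have "\<nu> = of_int u"
  proof -
    have "n2 = d2 * u" using uw(1) t(1) by (simp add: N_def)
    then show ?thesis using v by simp
  qed
  then show "\<nu> \<in> \<int>" by simp
qed

lemma rat_square_int:
  fixes \<beta> :: real and D m :: int
  assumes "\<beta> \<in> \<rat>" "squarefree D" "of_int D * \<beta>^2 = of_int m"
  shows "\<beta> \<in> \<int>"
proof -
  obtain p q where pq: "q > 0" "coprime p q" "\<beta> = of_int p / of_int q" using assms(1) by (metis Rats_cases')
  have "of_int (D * p^2) = (of_int (m * q^2) :: real)"
    using assms(3) pq(1) by (simp add: pq(3) power_divide field_simps)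
  then have "D * p^2 = m * q^2" by (simp only: of_int_eq_iff)
  then have "q^2 dvd D * p^2" by simp
  moreover have "coprime (q^2) (p^2)" using pq(2) by (simp add: coprime_commute)
  ultimately have "q^2 dvd D" by (simp add: coprime_dvd_mult_left_iff)
  then have "is_unit q" using assms(2) by (rule squarefreeD[rotated])
  then have "q = 1" using pq(1) by simp
  then show ?thesis using pq(3) by simp
qed

text \<open>The integral basis is 1 and (1 + sqrt D) / 2, with conjugate determinant - sqrt D.
  Integrality of trace and norm of an irrational integer (A + B sqrt D) / 2 gives D B^2 = A^2 - 4 V,
  and D = 1 modulo 4 then makes A and B of equal parity.\<close>

theorem fundamental_discriminant_squarefree:
  fixes D :: int
  assumes sf: "squarefree D" and D1: "D > 1" and D4: "D mod 4 = 1"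
  shows "fundamental_discriminant D"
proof -
  define r where "r = sqrt (of_int D)"
  have irr: "sqrt (of_int D) \<notin> \<rat>" by (rule sqrt_irrational[OF sf D1])
  have r2: "r^2 = of_int D" using D1 by (simp add: r_def)
  define w where "w = (1 + r) / 2"
  have w_rat: "w = of_rat (1/2) + of_rat (1/2) * sqrt (of_int D)"
    by (simp add: w_def r_def of_rat_divide field_simps)
  have one_rat: "1 = (of_rat 1 :: real) + of_rat 0 * sqrt (of_int D)" by simp
  obtain d where d: "D = 4 * d + 1" using D4 by (metis mult_div_mod_eq)
  have "algebraic_int w"
  proof -
    have "poly (map_poly of_int [:- d, -1, 1:]) w = w^2 - w - of_int d"
      by (simp add: map_poly_pCons power2_eq_square algebra_simps)
    also have "\<dots> = 0" using r2 by (simp add: w_def d power2_eq_square field_simps)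
    finally show ?thesis unfolding algebraic_int_altdef_ipoly by (intro exI[of _ "[:- d, -1, 1:]"]) simp
  qed
  then have w_int: "w \<in> quad_integers D" using w_rat by (auto simp: quad_integers_def quad_field_def)
  have one_int: "1 \<in> quad_integers D"
    using one_rat unfolding quad_integers_def quad_field_def by blast
  have uniq: "\<exists>!(m, n). x = of_int m * 1 + of_int n * w" if x: "x \<in> quad_integers D" for x
  proof -
    obtain a b where ab: "x = of_rat a + of_rat b * r" and alg: "algebraic_int x"
      using x by (auto simp: quad_integers_def quad_field_def r_def)
    have ex: "\<exists>m n. x = of_int m + of_int n * w"
    proof (cases "b = 0")
      case True
      then have "x \<in> \<rat>" using ab by simp
      then have "x \<in> \<int>" using alg rational_algebraic_int_is_int by blast
      then obtain m where "x = of_int m" by (elim Ints_cases)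
      then show ?thesis by (intro exI[of _ m] exI[of _ 0]) simp
    next
      case False
      have xr: "x \<notin> \<rat>"
      proof
        assume "x \<in> \<rat>"
        then obtain z where "x = of_rat z" by (elim Rats_cases)
        then have "of_rat a + of_rat b * sqrt (of_int D) = of_rat z + of_rat 0 * sqrt (of_int D)"
          using ab by (simp add: r_def)
        then show False using False rat_sqrt_eq_iff[OF irr] by blast
      qed
      define \<tau> where "\<tau> = 2 * (of_rat a :: real)"
      define \<beta> where "\<beta> = 2 * (of_rat b :: real)"
      define \<nu> where "\<nu> = (of_rat a)^2 - of_int D * (of_rat b :: real)^2"
      have "x^2 - \<tau> * x + \<nu> = (of_rat b)^2 * (r^2 - of_int D)"
        by (simp add: ab \<tau>_def \<nu>_def power2_eq_square algebra_simps)
      then have q: "x^2 - \<tau> * x + \<nu> = 0" using r2 by simp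
      have "\<tau> \<in> \<int>" "\<nu> \<in> \<int>" using quadratic_algebraic_int[OF alg xr q] by (auto simp: \<tau>_def \<nu>_def)
      then obtain A V where AV: "\<tau> = of_int A" "\<nu> = of_int V" by (auto elim!: Ints_cases)
      have Db: "of_int D * \<beta>^2 = of_int (A^2 - 4 * V)"
        using AV by (simp add: \<tau>_def \<nu>_def \<beta>_def flip: AV)
      have "\<beta> \<in> \<int>" using rat_square_int[OF _ sf Db] by (simp add: \<beta>_def)
      then obtain B where B: "\<beta> = of_int B" by (elim Ints_cases)
      have "of_int (D * B^2) = (of_int (A^2 - 4 * V) :: real)" using Db B by simp
      then have DB: "D * B^2 = A^2 - 4 * V" by (simp only: of_int_eq_iff)
      have "even (A - B)"
      proof -
        have "A^2 - B^2 = 4 * (d * B^2 + V)" using DB unfolding d by (simp add: algebra_simps)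
        then have "even (A^2 - B^2)" by simp
        then show ?thesis by simp
      qed
      then obtain m where m: "A - B = 2 * m" by (elim evenE)
      have "x = (of_int A + of_int B * r) / 2" using ab AV(1) B by (simp add: \<tau>_def \<beta>_def field_simps)
      also have "of_int A = 2 * of_int m + (of_int B :: real)" using m by (metis diff_eq_eq of_int_add of_int_mult of_int_numeral)
      finally have "x = of_int m + of_int B * w" by (simp add: w_def field_simps)
      then show ?thesis by blast
    qed
    then obtain m n where mn: "x = of_int m + of_int n * w" by blast
    show ?thesis
    proof (rule ex1I[of _ "(m, n)"])
      show "case (m, n) of (m, n) \<Rightarrow> x = of_int m * 1 + of_int n * w" using mn by simp
      fix y assume y: "case y of (m, n) \<Rightarrow> x = of_int m * 1 + of_int n * w"
      obtain m' n' where y': "y = (m', n')" by (metis surj_pair)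
      have e: "of_int m + of_int n * w = of_int m' + (of_int n' * w :: real)" using mn y y' by simp
      have "of_rat (of_int m + of_int n / 2) + of_rat (of_int n / 2) * sqrt (of_int D)
        = of_rat (of_int m' + of_int n' / 2) + of_rat (of_int n' / 2) * sqrt (of_int D)"
        using e by (simp add: w_def r_def of_rat_add of_rat_divide of_rat_mult field_simps)
      then have "(of_int m + of_int n / 2 :: rat) = of_int m' + of_int n' / 2" "(of_int n / 2 :: rat) = of_int n' / 2"
        using rat_sqrt_eq_iff[OF irr] by blast+
      then show "y = (m, n)" using y' by simp
    qed
  qed
  have "integral_basis D 1 w" unfolding integral_basis_def using one_int w_int uniq by blast
  moreover have "of_int D = (1 * quad_conj D w - w * quad_conj D 1)^2"
  proof -
    have "quad_conj D w = of_rat (1/2) - of_rat (1/2) * r" unfolding w_rat r_def by (rule quad_conj_eq[OF irr])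
    moreover have "quad_conj D 1 = 1"
    proof -
      have "quad_conj D (of_rat 1 + of_rat 0 * sqrt (of_int D)) = of_rat 1 - of_rat 0 * sqrt (of_int D)"
        by (rule quad_conj_eq[OF irr])
      then show ?thesis by simp
    qed
    ultimately have "1 * quad_conj D w - w * quad_conj D 1 = - r"
      by (simp add: w_def of_rat_divide field_simps)
    then show ?thesis using r2 by simp
  qed
  ultimately show ?thesis using irr D1 unfolding fundamental_discriminant_def by (intro conjI exI[of _ 1] exI[of _ w]) auto
qed

subsection \<open>Cosets and the geodesic flow\<close>

lemma real_mat_nth [simp]: "real_mat A $ i $ j = real_of_int (A $ i $ j)"
  by (simp add: real_mat_def)

lemma real_mat_mult: "real_mat (A ** B) = real_mat A ** real_mat B"
  by (simp add: mat22_eq_iff)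

lemma real_mat_one [simp]: "real_mat (mat 1) = mat 1"
  by (simp add: mat22_eq_iff)

lemma real_mat_uminus: "real_mat (- A) = - real_mat A"
  by (simp add: mat22_eq_iff)

lemma det_real_mat: "det (real_mat A) = real_of_int (det A)"
  by (simp add: det_2)

lemma trace_real_mat: "trace (real_mat A) = real_of_int (trace A)"
  by (simp add: trace22)

lemma real_mat_inject: "real_mat A = real_mat B \<longleftrightarrow> A = B"
  by (simp add: mat22_eq_iff)

lemma mult22_minus_right: "A ** (- B) = - (A ** B)" for A B :: "'a::comm_ring_1^2^2"
  by (simp add: mat22_eq_iff)

lemma mult22_minus_left: "(- A) ** B = - (A ** B)" for A B :: "'a::comm_ring_1^2^2"
  by (simp add: mat22_eq_iff)

lemma SL2Z_mult: "A \<in> SL2Z \<Longrightarrow> B \<in> SL2Z \<Longrightarrow> A ** B \<in> SL2Z"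
  by (simp add: SL2Z_def det_mul)

lemma SL2Z_one: "mat 1 \<in> SL2Z"
  by (simp add: SL2Z_def)

lemma SL2Z_uminus: "A \<in> SL2Z \<Longrightarrow> - A \<in> SL2Z"
  by (simp add: SL2Z_def det_2)

lemma SL2Z_adj22: "A \<in> SL2Z \<Longrightarrow> adj22 A \<in> SL2Z"
  by (simp add: SL2Z_def det_adj22)

lemma coset_self: "g \<in> coset g"
  unfolding coset_def using SL2Z_one by (intro image_eqI[of _ _ "mat 1"]) auto

lemma coset_mult_left:
  assumes "A \<in> SL2Z"
  shows "coset (real_mat A ** g) = coset g"
proof
  show "coset (real_mat A ** g) \<subseteq> coset g"
  proof
    fix h assume "h \<in> coset (real_mat A ** g)"
    then obtain B where "B \<in> SL2Z" "h = real_mat (B ** A) ** g"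
      by (auto simp: coset_def real_mat_mult matrix_mul_assoc)
    then show "h \<in> coset g" unfolding coset_def using SL2Z_mult assms by blast
  qed
  show "coset g \<subseteq> coset (real_mat A ** g)"
  proof
    fix h assume "h \<in> coset g"
    then obtain B where B: "B \<in> SL2Z" "h = real_mat B ** g" by (auto simp: coset_def)
    have "h = real_mat (B ** adj22 A) ** (real_mat A ** g)"
    proof -
      have "real_mat (B ** adj22 A) ** (real_mat A ** g) = real_mat (B ** (adj22 A ** A)) ** g"
        by (simp add: real_mat_mult matrix_mul_assoc)
      also have "adj22 A ** A = mat 1" using assms by (intro adj22_mult_left) (simp add: SL2Z_def)
      finally show ?thesis using B by simp
    qed
    then show "h \<in> coset (real_mat A ** g)" unfolding coset_def using SL2Z_mult SL2Z_adj22 assms B by blast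
  qed
qed

lemma coset_eqD: "coset h = coset g \<Longrightarrow> \<exists>A\<in>SL2Z. h = real_mat A ** g"
  using coset_self[of h] by (auto simp: coset_def)

lemma coset_uminus: "coset (- g) = coset g"
proof -
  have "coset (real_mat (- mat 1) ** g) = coset g" by (intro coset_mult_left SL2Z_uminus SL2Z_one)
  moreover have "real_mat (- mat 1) ** g = - g" by (simp add: real_mat_uminus mult22_minus_left)
  ultimately show ?thesis by simp
qed

lemma geod_mat_eq: "geod_mat t = mat22 (exp (t / 2)) 0 0 (exp (- t / 2))"
  by (simp add: geod_mat_def mat22_def)

lemma geod_mat_add: "geod_mat s ** geod_mat t = geod_mat (s + t)"
  by (simp add: geod_mat_eq mat22_eq_iff exp_add[symmetric] add_divide_distrib)

lemma geod_mat_zero [simp]: "geod_mat 0 = mat 1"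
  by (simp add: geod_mat_eq mat22_eq_iff)

lemma det_geod_mat [simp]: "det (geod_mat t) = 1"
  by (simp add: geod_mat_eq det_2 flip: exp_add)

lemma trace_geod_mat: "trace (geod_mat t) = exp (t / 2) + exp (- t / 2)"
  by (simp add: geod_mat_eq trace22)

lemma geod_flow_coset: "geod_flow t (coset g) = coset (g ** geod_mat t)"
  by (simp add: geod_flow_def coset_def image_image matrix_mul_assoc)

lemma geod_orbit_coset: "geod_orbit (coset g) = range (\<lambda>s. coset (g ** geod_mat s))"
  by (simp add: geod_orbit_def geod_flow_coset)

lemma geod_orbit_shift: "geod_orbit (coset (g ** geod_mat r)) = geod_orbit (coset g)"
proof -
  have "range (\<lambda>s. coset (g ** geod_mat (r + s))) = range (\<lambda>s. coset (g ** geod_mat s))"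
  proof
    show "range (\<lambda>s. coset (g ** geod_mat s)) \<subseteq> range (\<lambda>s. coset (g ** geod_mat (r + s)))"
    proof clarify
      fix s show "coset (g ** geod_mat s) \<in> range (\<lambda>s. coset (g ** geod_mat (r + s)))"
        by (rule image_eqI[of _ _ "s - r"]) auto
    qed
  qed auto
  then show ?thesis by (simp add: geod_orbit_coset geod_mat_add flip: matrix_mul_assoc)
qed

text \<open>Equality in \<open>PSL_2(R)\<close>, on representatives.\<close>

definition sgn_eq :: "real^2^2 \<Rightarrow> real^2^2 \<Rightarrow> bool" where
  "sgn_eq A B \<longleftrightarrow> A = B \<or> A = - B"

lemma sgn_eq_left: "sgn_eq A B \<Longrightarrow> sgn_eq (X ** A) (X ** B)"
  by (auto simp: sgn_eq_def mult22_minus_right)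

lemma sgn_eq_right: "sgn_eq A B \<Longrightarrow> sgn_eq (A ** X) (B ** X)"
  by (auto simp: sgn_eq_def mult22_minus_left)

lemma sgn_eq_minus [simp]: "sgn_eq (- A) B \<longleftrightarrow> sgn_eq A B"
  unfolding sgn_eq_def by (metis minus_minus)

lemma sgn_eq_cancel_left: "det g = 1 \<Longrightarrow> sgn_eq (g ** A) (g ** B) \<longleftrightarrow> sgn_eq A B"
  unfolding sgn_eq_def by (metis mult22_left_cancel mult22_minus_right)

lemma sgn_eq_refl [simp]: "sgn_eq A A" by (simp add: sgn_eq_def)
lemma sgn_eq_sym: "sgn_eq A B \<Longrightarrow> sgn_eq B A" by (auto simp: sgn_eq_def)
lemma sgn_eq_trans: "sgn_eq A B \<Longrightarrow> sgn_eq B C \<Longrightarrow> sgn_eq A C" by (auto simp: sgn_eq_def)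

text \<open>\<open>is_axis g s A\<close>: the class of \<open>A\<close> acts on the geodesic of \<open>g\<close> as the translation by \<open>s\<close>.\<close>

definition is_axis :: "real^2^2 \<Rightarrow> real \<Rightarrow> int^2^2 \<Rightarrow> bool" where
  "is_axis g s A \<longleftrightarrow> A \<in> SL2Z \<and> sgn_eq (real_mat A ** g) (g ** geod_mat s)"

lemma axis_mult:
  assumes "is_axis g s A" "is_axis g t B"
  shows "is_axis g (s + t) (A ** B)"
proof -
  have "sgn_eq (real_mat A ** (real_mat B ** g)) (real_mat A ** (g ** geod_mat t))"
    by (rule sgn_eq_left) (use assms in \<open>simp add: is_axis_def\<close>)
  also have "real_mat A ** (g ** geod_mat t) = (real_mat A ** g) ** geod_mat t" by (simp add: matrix_mul_assoc)
  finally have "sgn_eq (real_mat A ** (real_mat B ** g)) ((real_mat A ** g) ** geod_mat t)" .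
  moreover have "sgn_eq ((real_mat A ** g) ** geod_mat t) ((g ** geod_mat s) ** geod_mat t)"
    by (rule sgn_eq_right) (use assms in \<open>simp add: is_axis_def\<close>)
  ultimately have "sgn_eq (real_mat A ** (real_mat B ** g)) ((g ** geod_mat s) ** geod_mat t)"
    by (rule sgn_eq_trans)
  then show ?thesis using assms
    by (simp add: is_axis_def SL2Z_mult real_mat_mult geod_mat_add flip: matrix_mul_assoc)
qed

lemma axis_one: "is_axis g 0 (mat 1)"
  by (simp add: is_axis_def SL2Z_one)

lemma axis_adj22:
  assumes "is_axis g s A"
  shows "is_axis g (- s) (adj22 A)"
proof -
  have A: "A \<in> SL2Z" "det A = 1" using assms by (auto simp: is_axis_def SL2Z_def)
  have inv: "real_mat (adj22 A) ** (real_mat A ** X) = X" for X :: "real^2^2"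
    by (simp add: matrix_mul_assoc flip: real_mat_mult) (simp add: adj22_mult_left[OF A(2)])
  have "sgn_eq (real_mat (adj22 A) ** (real_mat A ** g) ** geod_mat (- s)) (real_mat (adj22 A) ** (g ** geod_mat s) ** geod_mat (- s))"
    by (intro sgn_eq_right[OF sgn_eq_left]) (use assms in \<open>simp add: is_axis_def\<close>)
  moreover have "real_mat (adj22 A) ** (g ** geod_mat s) ** geod_mat (- s) = real_mat (adj22 A) ** g"
    by (simp add: geod_mat_add flip: matrix_mul_assoc)
  ultimately have "sgn_eq (g ** geod_mat (- s)) (real_mat (adj22 A) ** g)" unfolding inv by simp
  then show ?thesis using A by (simp add: is_axis_def SL2Z_adj22 sgn_eq_sym)
qed

lemma mat_power_simps [simp]: "mat_power A 0 = mat 1" "mat_power A (Suc n) = A ** mat_power A n"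
  by (simp_all add: mat_power_def)

lemma axis_power: "is_axis g s A \<Longrightarrow> is_axis g (real n * s) (mat_power A n)"
proof (induction n)
  case (Suc n)
  then show ?case using axis_mult[of g s A "real n * s" "mat_power A n"] by (simp add: algebra_simps)
qed (simp add: axis_one)

lemma axis_unique:
  assumes "g \<in> SL2R" "is_axis g s A" "is_axis g s B"
  shows "A = B \<or> A = - B"
proof -
  have g: "det g = 1" using assms(1) by (simp add: SL2R_def)
  have "sgn_eq (real_mat A ** g) (real_mat B ** g)"
    using assms by (meson is_axis_def sgn_eq_sym sgn_eq_trans)
  then have "sgn_eq (real_mat A) (real_mat B)"
    using mult22_right_cancel[OF g] by (auto simp: sgn_eq_def mult22_minus_left[symmetric])
  then show ?thesis unfolding sgn_eq_def by (metis real_mat_inject real_mat_uminus)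
qed

lemma trace_similar:
  fixes A B g :: "real^2^2"
  assumes "det g = 1" "A ** g = g ** B"
  shows "trace A = trace B"
proof -
  have "A = g ** B ** adj22 g"
    by (metis adj22_mult_right assms matrix_mul_assoc matrix_mul_rid)
  then have "trace A = trace B * det g"
    by (simp add: trace22 det_2 algebra_simps)
  then show ?thesis using assms(1) by simp
qed

lemma axis_trace:
  assumes "g \<in> SL2R" "is_axis g s A"
  shows "\<bar>real_of_int (trace A)\<bar> = exp (s / 2) + exp (- s / 2)"
proof -
  have g: "det g = 1" using assms(1) by (simp add: SL2R_def)
  have "real_mat A ** g = g ** geod_mat s \<or> (- real_mat A) ** g = g ** geod_mat s"
    using assms(2) by (auto simp: is_axis_def sgn_eq_def mult22_minus_left)
  then have "trace (real_mat A) = trace (geod_mat s) \<or> trace (- real_mat A) = trace (geod_mat s)"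
    using trace_similar[OF g] by blast
  moreover have "trace (- real_mat A) = - trace (real_mat A)" by (simp add: trace22)
  moreover have "trace (geod_mat s) > 0" unfolding trace_geod_mat by (intro add_pos_pos) auto
  ultimately show ?thesis unfolding trace_real_mat[symmetric] trace_geod_mat[symmetric] by auto
qed

lemma cosh_like_mono:
  fixes s t :: real
  assumes "0 \<le> s" "s < t"
  shows "exp (s / 2) + exp (- s / 2) < exp (t / 2) + exp (- t / 2)"
proof -
  define u v where "u = exp (s / 2)" and "v = exp (t / 2)"
  have uv: "1 \<le> u" "u < v" using assms by (auto simp: u_def v_def)
  have e: "exp (- s / 2) = 1 / u" "exp (- t / 2) = 1 / v" by (simp_all add: u_def v_def exp_minus field_simps)
  have "1 < u * v" using uv by (metis less_1_mult' mult.commute less_le_trans order.strict_trans1 mult_le_cancel_left1 mult_less_cancel_left1 less_eq_real_def)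
  then have "0 < (v - u) * (u * v - 1)" using uv by simp
  then have "u * v * u + v < u * v * v + u" by (simp add: algebra_simps)
  then have "u + 1 / u < v + 1 / v" using uv by (simp add: field_simps)
  then show ?thesis unfolding e u_def v_def .
qed

lemma axis_trace_less:
  assumes "g \<in> SL2R" "is_axis g s A" "is_axis g t B" "0 \<le> s" "s < t"
  shows "\<bar>trace A\<bar> < \<bar>trace B\<bar>"
  using axis_trace[OF assms(1,2)] axis_trace[OF assms(1,3)] cosh_like_mono[OF assms(4,5)] by linarith

lemma axis_hyperbolic:
  assumes "g \<in> SL2R" "is_axis g s A" "s > 0"
  shows "hyperbolic A"
  using axis_trace_less[OF assms(1) axis_one assms(2) order_refl assms(3)] by (simp add: hyperbolic_def trace22)

text \<open>\<delta> commutes with its power, so X = g^(-1) \<delta> g commutes up to sign with a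
  diagonal matrix having distinct diagonal entries. Commuting forces X to be diagonal, and
  anticommuting would force det X = 0. So a root of a translation is a translation along the same
  geodesic.\<close>

lemma power_commutes_diag:
  fixes \<delta> :: "int^2^2"
  assumes g: "g \<in> SL2R" and d: "\<delta> \<in> SL2Z" and n: "n \<ge> 1" and ax: "is_axis g s A" "s > 0"
    and A: "A = mat_power \<delta> n \<or> A = - mat_power \<delta> n"
  shows "is_axis g (s / real n) \<delta>"
proof -
  have dg: "det g = 1" using g by (simp add: SL2R_def)
  define X where "X = adj22 g ** real_mat \<delta> ** g"
  have Xg: "g ** X = real_mat \<delta> ** g"
    by (simp add: X_def matrix_mul_assoc adj22_mult_right[OF dg])
  have comm: "mat_power \<delta> m ** \<delta> = \<delta> ** mat_power \<delta> m" for m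
    by (induction m) (simp_all flip: matrix_mul_assoc)
  have pw: "sgn_eq (real_mat (mat_power \<delta> n) ** g) (g ** geod_mat s)"
    using ax(1) A by (elim disjE) (simp_all add: is_axis_def real_mat_uminus mult22_minus_left)
  have "sgn_eq (g ** (geod_mat s ** X)) (g ** (X ** geod_mat s))"
  proof -
    have "sgn_eq (g ** geod_mat s ** X) (real_mat (mat_power \<delta> n) ** g ** X)"
      by (rule sgn_eq_right[OF sgn_eq_sym[OF pw]])
    also have "real_mat (mat_power \<delta> n) ** g ** X = real_mat \<delta> ** (real_mat (mat_power \<delta> n) ** g)"
      unfolding matrix_mul_assoc[symmetric] Xg by (simp add: matrix_mul_assoc comm flip: real_mat_mult)
    finally have 1: "sgn_eq (g ** geod_mat s ** X) (real_mat \<delta> ** (real_mat (mat_power \<delta> n) ** g))" .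
    have "sgn_eq (real_mat \<delta> ** (real_mat (mat_power \<delta> n) ** g)) (real_mat \<delta> ** (g ** geod_mat s))"
      by (rule sgn_eq_left[OF pw])
    also have "real_mat \<delta> ** (g ** geod_mat s) = g ** (X ** geod_mat s)"
      by (simp add: matrix_mul_assoc Xg)
    finally have 2: "sgn_eq (real_mat \<delta> ** (real_mat (mat_power \<delta> n) ** g)) (g ** (X ** geod_mat s))" .
    from sgn_eq_trans[OF 1 2] show ?thesis by (simp only: matrix_mul_assoc)
  qed
  then have c: "sgn_eq (geod_mat s ** X) (X ** geod_mat s)"
    by (simp add: sgn_eq_cancel_left[OF dg])
  define u where "u = exp (s / 2)"
  have u: "u > 1" using ax(2) by (simp add: u_def)
  have e: "exp (- s / 2) = 1 / u" by (simp add: u_def exp_minus field_simps)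
  have dX: "det X = 1" using d dg by (simp add: X_def det_mul det_adj22 det_real_mat SL2Z_def)
  have gm: "geod_mat s = mat22 u 0 0 (1 / u)" unfolding geod_mat_eq e u_def[symmetric] ..
  have X0: "X $ 1 $ 2 = 0 \<and> X $ 2 $ 1 = 0"
  proof -
    from c consider "geod_mat s ** X = X ** geod_mat s" | "geod_mat s ** X = - (X ** geod_mat s)"
      by (auto simp: sgn_eq_def)
    then show ?thesis
    proof cases
      case 1
      then have "u * X $ 1 $ 2 = X $ 1 $ 2 / u" "X $ 2 $ 1 / u = X $ 2 $ 1 * u"
        by (auto simp: mat22_eq_iff gm)
      then have "(u * u - 1) * X $ 1 $ 2 = 0" "(u * u - 1) * X $ 2 $ 1 = 0" using u by (auto simp: field_simps)
      moreover have "u * u > 1" using u by (metis less_1_mult)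
      ultimately show ?thesis by auto
    next
      case 2
      then have "u * X $ 1 $ 1 = - (X $ 1 $ 1 * u)" "X $ 2 $ 2 / u = - (X $ 2 $ 2 / u)"
        "u * X $ 1 $ 2 = - (X $ 1 $ 2 / u)"
        by (auto simp: mat22_eq_iff gm)
      then have "X $ 1 $ 1 = 0" "(u * u + 1) * X $ 1 $ 2 = 0" using u by (auto simp: field_simps)
      moreover have "u * u + 1 > 0" using u by (simp add: add_pos_pos)
      ultimately have "X $ 1 $ 1 = 0" "X $ 1 $ 2 = 0" by auto
      then show ?thesis using dX by (simp add: det_2)
    qed
  qed
  define \<mu> where "\<mu> = X $ 1 $ 1"
  have \<mu>: "\<mu> * X $ 2 $ 2 = 1" using dX X0 by (simp add: det_2 \<mu>_def)
  then have \<mu>0: "\<mu> \<noteq> 0" by auto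
  define r where "r = 2 * ln \<bar>\<mu>\<bar>"
  have er: "exp (r / 2) = \<bar>\<mu>\<bar>" "exp (- r / 2) = 1 / \<bar>\<mu>\<bar>" using \<mu>0 by (simp_all add: r_def exp_minus field_simps)
  have "sgn_eq X (geod_mat r)"
  proof -
    have X22: "X $ 2 $ 2 = 1 / \<mu>" using \<mu> \<mu>0 by (simp add: field_simps)
    show ?thesis using X0 X22 \<mu>0 unfolding sgn_eq_def geod_mat_eq er
      by (cases "\<mu> > 0") (auto simp: mat22_eq_iff \<mu>_def)
  qed
  then have axd: "is_axis g r \<delta>"
    unfolding is_axis_def using d Xg[symmetric] by (simp add: sgn_eq_left)
  have "is_axis g (real n * r) (mat_power \<delta> n)" by (rule axis_power[OF axd])
  moreover have "is_axis g s (mat_power \<delta> n)"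
    using ax(1) pw A by (auto simp: is_axis_def dest: SL2Z_uminus)
  ultimately have "exp (real n * r / 2) + exp (- (real n * r) / 2) = exp (s / 2) + exp (- s / 2)"
    using axis_trace[OF g] by metis
  moreover have "exp (real n * r / 2) + exp (- (real n * r) / 2) = exp (\<bar>real n * r\<bar> / 2) + exp (- \<bar>real n * r\<bar> / 2)"
    by (auto simp: abs_if)
  ultimately have eq: "exp (\<bar>real n * r\<bar> / 2) + exp (- \<bar>real n * r\<bar> / 2) = exp (s / 2) + exp (- s / 2)" by simp
  have abs_nr: "\<bar>real n * r\<bar> = s"
  proof (rule ccontr)
    assume "\<bar>real n * r\<bar> \<noteq> s"
    then consider "\<bar>real n * r\<bar> < s" | "s < \<bar>real n * r\<bar>" by linarith
    then show False
    proof cases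
      case 1
      then show False using cosh_like_mono[OF abs_ge_zero 1] eq by simp
    next
      case 2
      then show False using cosh_like_mono[OF less_imp_le[OF ax(2)] 2] eq by simp
    qed
  qed
  have "real n * r > 0 \<or> real n * r < 0" using abs_nr ax(2) by linarith
  \<comment> \<open>The trace only fixes the absolute value of n r; comparing the matrices
    themselves excludes the inverse translation.\<close>
  moreover have "\<not> real n * r < 0"
  proof
    assume neg: "real n * r < 0"
    have "is_axis g (real n * r) (mat_power \<delta> n)" by (rule axis_power[OF axd])
    then have "sgn_eq (g ** geod_mat (real n * r)) (g ** geod_mat s)"
      using \<open>is_axis g s (mat_power \<delta> n)\<close> unfolding is_axis_def by (meson sgn_eq_sym sgn_eq_trans)
    then have "sgn_eq (geod_mat (real n * r)) (geod_mat s)"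
      by (simp add: sgn_eq_cancel_left[OF dg])
    then have "exp (real n * r / 2) = exp (s / 2) \<or> exp (real n * r / 2) = - exp (s / 2)"
      by (auto simp: sgn_eq_def geod_mat_eq mat22_eq_iff)
    moreover have "exp (real n * r / 2) > 0" "exp (s / 2) > 0" by simp_all
    ultimately have "real n * r = s" by auto
    then show False using neg ax(2) by simp
  qed
  ultimately have "real n * r = s" using abs_nr by linarith
  then have "r = s / real n" using n by (simp add: field_simps)
  then show ?thesis using axd by simp
qed

text \<open>Integrality of the trace makes the translation lengths discrete: the least absolute
  trace belongs to a shortest translation, and a division with remainder makes all others its
  powers. A proper root of it would be a shorter translation by \<open>power_commutes_diag\<close>,
  hence primitivity.\<close>

theorem axis_generator:
  assumes g: "g \<in> SL2R" and t: "t > 0" "is_axis g t A"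
  obtains s0 \<gamma> where "s0 > 0" "is_axis g s0 \<gamma>" "primitive \<gamma>"
    "\<And>s B. s > 0 \<Longrightarrow> is_axis g s B \<Longrightarrow> \<exists>n\<ge>1. s = real n * s0 \<and> (B = mat_power \<gamma> n \<or> B = - mat_power \<gamma> n)"
proof -
  define P where "P m \<longleftrightarrow> (\<exists>s>0. \<exists>B. is_axis g s B \<and> nat \<bar>trace B\<bar> = m)" for m
  define m0 where "m0 = (LEAST m. P m)"
  have "P (nat \<bar>trace A\<bar>)" unfolding P_def using t by blast
  then have "P m0" unfolding m0_def by (rule LeastI)
  then obtain s0 \<gamma> where s0: "s0 > 0" "is_axis g s0 \<gamma>" "nat \<bar>trace \<gamma>\<bar> = m0" by (auto simp: P_def)
  have least: "\<not> s < s0" if "s > 0" "is_axis g s B" for s B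
  proof
    assume "s < s0"
    then have "nat \<bar>trace B\<bar> < m0" using axis_trace_less[OF g that(2) s0(2)] that(1) s0(3) by simp
    then have "\<not> P (nat \<bar>trace B\<bar>)" unfolding m0_def by (rule not_less_Least)
    then show False using that by (auto simp: P_def)
  qed
  have gen: "\<exists>n\<ge>1. s = real n * s0 \<and> (B = mat_power \<gamma> n \<or> B = - mat_power \<gamma> n)" if s: "s > 0" "is_axis g s B" for s B
  proof -
    define n where "n = nat \<lfloor>s / s0\<rfloor>"
    have sn: "real n * s0 \<le> s" "s < (real n + 1) * s0"
    proof -
      have "0 \<le> s / s0" using s s0 by simp
      then have "real n \<le> s / s0" "s / s0 < real n + 1" unfolding n_def by linarith+
      then show "real n * s0 \<le> s" "s < (real n + 1) * s0" using s0(1) by (simp_all add: field_simps)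
    qed
    have ax: "is_axis g (s + - (real n * s0)) (B ** adj22 (mat_power \<gamma> n))"
      by (intro axis_mult s axis_adj22 axis_power s0)
    have "s = real n * s0"
    proof (rule ccontr)
      assume "s \<noteq> real n * s0"
      then have "s + - (real n * s0) > 0" using sn by simp
      from least[OF this ax] show False using sn by (simp add: algebra_simps)
    qed
    moreover have "n \<ge> 1" using calculation s by (cases n) auto
    moreover have "is_axis g s (mat_power \<gamma> n)" using axis_power[OF s0(2), of n] calculation by simp
    ultimately show ?thesis using axis_unique[OF g s(2)] by blast
  qed
  have "primitive \<gamma>"
    unfolding primitive_def
  proof
    assume "\<exists>\<delta>\<in>SL2Z. \<exists>n\<ge>2. \<gamma> = mat_power \<delta> n \<or> \<gamma> = - mat_power \<delta> n"
    then obtain \<delta> n where d: "\<delta> \<in> SL2Z" "n \<ge> 2" "\<gamma> = mat_power \<delta> n \<or> \<gamma> = - mat_power \<delta> n" by blast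
    then have "is_axis g (s0 / real n) \<delta>" using s0 by (intro power_commutes_diag[OF g d(1) _ s0(2,1)]) auto
    moreover have "s0 / real n > 0" "s0 / real n < s0" using s0 d(2) by (auto simp: field_simps)
    ultimately show False using least by blast
  qed
  then show thesis using that s0 gen by blast
qed

lemma mat_power_conj:
  assumes "\<delta> \<in> SL2Z"
  shows "mat_power (\<delta> ** A ** adj22 \<delta>) n = \<delta> ** mat_power A n ** adj22 \<delta>"
proof -
  have d: "det \<delta> = 1" using assms by (simp add: SL2Z_def)
  show ?thesis
  proof (induction n)
    case 0
    then show ?case by (simp add: adj22_mult_right[OF d])
  next
    case (Suc n)
    have "\<delta> ** A ** adj22 \<delta> ** (\<delta> ** mat_power A n ** adj22 \<delta>) = \<delta> ** (A ** ((adj22 \<delta> ** \<delta>) ** (mat_power A n ** adj22 \<delta>)))"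
      by (simp only: matrix_mul_assoc)
    also have "\<dots> = \<delta> ** (A ** (mat_power A n ** adj22 \<delta>))"
      unfolding adj22_mult_left[OF d] by simp
    finally show ?case using Suc by (simp add: matrix_mul_assoc)
  qed
qed

lemma geod_class_iff_axis:
  "A \<in> geod_class C \<longleftrightarrow> hyperbolic A \<and> primitive A \<and>
     (\<exists>g\<in>SL2R. geod_orbit (coset g) = C \<and> (\<exists>t>0. is_axis g t A))"
  by (auto simp: geod_class_def is_axis_def sgn_eq_def)

text \<open>Makes the description operator in \<open>geod_trace\<close> meaningful. A member of the
  class taken at another base point h = \<delta> g a_s becomes, after conjugation by \<delta>, a
  translation along g, hence a power of \<gamma> up to sign. Primitivity is invariant under
  conjugation, so the exponent is 1.\<close>

lemma geod_class_trace:
  assumes g: "g \<in> SL2R" and s0: "s0 > 0" "is_axis g s0 \<gamma>"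
    and gen: "\<And>s B. s > 0 \<Longrightarrow> is_axis g s B \<Longrightarrow> \<exists>n\<ge>1. s = real n * s0 \<and> (B = mat_power \<gamma> n \<or> B = - mat_power \<gamma> n)"
    and A: "A \<in> geod_class (geod_orbit (coset g))"
  shows "\<bar>trace A\<bar> = \<bar>trace \<gamma>\<bar>"
proof -
  obtain h t where h: "h \<in> SL2R" "geod_orbit (coset h) = geod_orbit (coset g)" "t > 0" "is_axis h t A"
    and prim: "primitive A"
    using A by (auto simp: geod_class_iff_axis)
  have "coset (h ** geod_mat 0) \<in> geod_orbit (coset h)" unfolding geod_orbit_coset by blast
  then have "coset h \<in> geod_orbit (coset g)" using h(2) by simp
  then obtain s where "coset h = coset (g ** geod_mat s)" by (auto simp: geod_orbit_coset)
  then obtain \<delta> where d: "\<delta> \<in> SL2Z" "h = real_mat \<delta> ** (g ** geod_mat s)" using coset_eqD by blast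
  have dd: "det \<delta> = 1" using d by (simp add: SL2Z_def)
  define B where "B = adj22 \<delta> ** A ** \<delta>"
  have A_eq: "A = \<delta> ** B ** adj22 \<delta>"
    by (simp add: B_def matrix_mul_assoc adj22_mult_right[OF dd]) (simp add: adj22_mult_right[OF dd] flip: matrix_mul_assoc)
  have ASL: "A \<in> SL2Z" using h by (simp add: is_axis_def)
  have axB: "is_axis g t B"
  proof -
    have 1: "sgn_eq (real_mat A ** h) (h ** geod_mat t)" using h by (simp add: is_axis_def)
    have "sgn_eq (real_mat (adj22 \<delta>) ** (real_mat A ** h) ** geod_mat (- s)) (real_mat (adj22 \<delta>) ** (h ** geod_mat t) ** geod_mat (- s))"
      by (intro sgn_eq_right[OF sgn_eq_left] 1)
    moreover have "real_mat (adj22 \<delta>) ** (real_mat A ** h) ** geod_mat (- s) = real_mat B ** g"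
    proof -
      have "real_mat (adj22 \<delta>) ** (real_mat A ** h) ** geod_mat (- s)
        = real_mat (adj22 \<delta>) ** real_mat A ** real_mat \<delta> ** (g ** (geod_mat s ** geod_mat (- s)))"
        unfolding d(2) by (simp only: matrix_mul_assoc)
      then show ?thesis by (simp add: geod_mat_add B_def real_mat_mult)
    qed
    moreover have "real_mat (adj22 \<delta>) ** (h ** geod_mat t) ** geod_mat (- s) = g ** geod_mat t"
    proof -
      have "real_mat (adj22 \<delta>) ** (h ** geod_mat t) ** geod_mat (- s)
        = real_mat (adj22 \<delta> ** \<delta>) ** (g ** (geod_mat s ** (geod_mat t ** geod_mat (- s))))"
        unfolding d(2) real_mat_mult by (simp only: matrix_mul_assoc)
      then show ?thesis by (simp add: geod_mat_add adj22_mult_left[OF dd])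
    qed
    ultimately show ?thesis using d ASL by (simp add: is_axis_def B_def SL2Z_mult SL2Z_adj22)
  qed
  obtain n where n: "n \<ge> 1" "B = mat_power \<gamma> n \<or> B = - mat_power \<gamma> n" using gen[OF h(3) axB] by blast
  have "n = 1"
  proof (rule ccontr)
    assume "n \<noteq> 1"
    define \<gamma>' where "\<gamma>' = \<delta> ** \<gamma> ** adj22 \<delta>"
    have "A = mat_power \<gamma>' n \<or> A = - mat_power \<gamma>' n"
      using n(2) unfolding \<gamma>'_def mat_power_conj[OF d(1)] A_eq by (auto simp: mult22_minus_left mult22_minus_right)
    moreover have "\<gamma>' \<in> SL2Z" using d s0 by (simp add: \<gamma>'_def is_axis_def SL2Z_mult SL2Z_adj22)
    ultimately show False using prim n(1) \<open>n \<noteq> 1\<close> unfolding primitive_def by force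
  qed
  then have "B = \<gamma> \<or> B = - \<gamma>" using n(2) by simp
  then have "\<bar>trace B\<bar> = \<bar>trace \<gamma>\<bar>" by (auto simp: trace22)
  moreover have "trace A = trace B"
  proof -
    have "trace A = trace B * det \<delta>" unfolding A_eq by (simp add: trace22 det_2 algebra_simps)
    then show ?thesis by (simp add: dd)
  qed
  ultimately show ?thesis by simp
qed

lemma geod_trace_generator:
  assumes g: "g \<in> SL2R" and s0: "s0 > 0" "is_axis g s0 \<gamma>" and prim: "primitive \<gamma>"
    and gen: "\<And>s B. s > 0 \<Longrightarrow> is_axis g s B \<Longrightarrow> \<exists>n\<ge>1. s = real n * s0 \<and> (B = mat_power \<gamma> n \<or> B = - mat_power \<gamma> n)"
  shows "\<gamma> \<in> geod_class (geod_orbit (coset g))" "geod_trace (geod_orbit (coset g)) = \<bar>trace \<gamma>\<bar>"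
proof -
  show 1: "\<gamma> \<in> geod_class (geod_orbit (coset g))"
    using g s0 prim axis_hyperbolic[OF g s0(2,1)] by (auto simp: geod_class_iff_axis)
  show "geod_trace (geod_orbit (coset g)) = \<bar>trace \<gamma>\<bar>"
    unfolding geod_trace_def
    using 1 geod_class_trace[OF g s0 gen] by (intro the_equality) blast+
qed

lemma closed_iff_axis:
  assumes "coset (g ** geod_mat t) = coset g"
  shows "\<exists>A. is_axis g t A"
proof -
  obtain A where A: "A \<in> SL2Z" "g ** geod_mat t = real_mat A ** g" using coset_eqD[OF assms] by blast
  then show ?thesis by (intro exI[of _ A]) (simp add: is_axis_def)
qed

lemma axis_closed:
  assumes "is_axis g t A"
  shows "coset (g ** geod_mat t) = coset g"
proof -
  have "coset (real_mat A ** g) = coset g" using assms by (intro coset_mult_left) (simp add: is_axis_def)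
  moreover have "g ** geod_mat t = real_mat A ** g \<or> g ** geod_mat t = - (real_mat A ** g)"
    using assms by (auto simp: is_axis_def sgn_eq_def)
  ultimately show ?thesis using coset_uminus by metis
qed

lemma closed_geodesicsE:
  assumes "C \<in> closed_geodesics"
  obtains g t A where "g \<in> SL2R" "C = geod_orbit (coset g)" "t > 0" "is_axis g t A"
proof -
  obtain x t where x: "C = geod_orbit x" "x \<in> modular_X" "t > 0" "geod_flow t x = x"
    using assms by (auto simp: closed_geodesics_def)
  then obtain g where g: "g \<in> SL2R" "x = coset g" by (auto simp: modular_X_def)
  then have "coset (g ** geod_mat t) = coset g" using x by (simp add: geod_flow_coset)
  then show thesis using that g x closed_iff_axis by blast
qed

subsection \<open>The geodesic of a positive definite integral matrix\<close>

text \<open>(b, l - a) is an eigenvector for the larger eigenvalue l, and by symmetry the orthogonal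
  vector belongs to 1 / l. From b > 0 and (l - a) (l - d) = b^2 both coordinates are positive; this
  positivity starts the descent in \<open>low_lying_word\<close>.\<close>

lemma diagonalise_symmetric:
  fixes A :: "int^2^2"
  assumes det: "det A = 1" and sym: "A $ 2 $ 1 = A $ 1 $ 2" and pos: "A $ 1 $ 2 > 0" and tr: "trace A > 2"
  obtains x y \<tau> :: real where "x > 0" "y > 0" "x^2 + y^2 = 1" "\<tau> > 0"
    "real_mat A ** mat22 x (- y) y x = mat22 x (- y) y x ** geod_mat \<tau>"
proof -
  define a b d t where "a = real_of_int (A $ 1 $ 1)" and "b = real_of_int (A $ 1 $ 2)"
    and "d = real_of_int (A $ 2 $ 2)" and "t = a + d"
  have b0: "b > 0" using pos by (simp add: b_def)
  have t2: "t > 2" using tr unfolding trace22 t_def a_def d_def by linarith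
  have ad: "a * d - b * b = 1"
    using arg_cong[OF det, of real_of_int] sym by (simp add: det_2 a_def b_def d_def)
  define r where "r = sqrt (t^2 - 4)"
  have "2^2 < t^2" using t2 by (intro power_strict_mono) auto
  then have r: "r > 0" "r^2 = t^2 - 4" by (simp_all add: r_def)
  define l where "l = (t + r) / 2"
  have l1: "l > 1" using t2 r by (simp add: l_def)
  have "4 * l^2 = t^2 + 2 * t * r + r^2" by (simp add: l_def power2_eq_square field_simps)
  then have l2: "l^2 = t * l - 1" using r(2) by (simp add: l_def power2_eq_square field_simps)
  have li: "t - l = 1 / l" using l2 l1 by (simp add: field_simps power2_eq_square)
  have pr: "(l - a) * (l - d) = b * b"
  proof -
    have "(l - a) * (l - d) = l^2 - t * l + a * d" by (simp add: t_def power2_eq_square algebra_simps)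
    then show ?thesis using l2 ad by simp
  qed
  have la: "l - a > 0"
  proof (rule ccontr)
    assume "\<not> l - a > 0"
    moreover have "(l - a) + (l - d) = r" by (simp add: l_def t_def)
    ultimately have "l - a \<le> 0" "l - d > 0" using r by auto
    then have "(l - a) * (l - d) \<le> 0" by (simp add: mult_nonpos_nonneg)
    moreover have "b * b > 0" using b0 by simp
    ultimately show False using pr by linarith
  qed
  define n where "n = sqrt (b^2 + (l - a)^2)"
  have n: "n > 0" "n^2 = b^2 + (l - a)^2" using b0 by (simp_all add: n_def add_pos_nonneg)
  define x y where "x = b * inverse n" and "y = (l - a) * inverse n"
  define \<tau> where "\<tau> = 2 * ln l"
  have e: "exp (\<tau> / 2) = l" "exp (- \<tau> / 2) = 1 / l" using l1 by (simp_all add: \<tau>_def exp_minus field_simps)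
  have e1: "a * x + b * y = x * l" by (simp add: x_def y_def algebra_simps)
  have "b * b + d * (l - a) = (l - a) * l" unfolding pr[symmetric] by (simp add: algebra_simps)
  from arg_cong[OF this, of "\<lambda>z. inverse n * z"]
  have e2: "b * x + d * y = y * l" by (simp add: x_def y_def algebra_simps)
  have "- a * (l - a) + b * b = - (l - a) * (t - l)" unfolding pr[symmetric] by (simp add: t_def algebra_simps)
  from arg_cong[OF this, of "\<lambda>z. inverse n * z"]
  have "- (a * y) + b * x = - y * (t - l)" by (simp add: x_def y_def algebra_simps)
  then have e3: "- (a * y) + b * x = - y / l" by (simp add: li)
  have "- (b * y) + d * x = x * (t - l)" by (simp add: x_def y_def t_def algebra_simps)
  then have e4: "- (b * y) + d * x = x / l" by (simp add: li)
  show thesis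
  proof (rule that[of x y \<tau>])
    show "x > 0" "y > 0" using b0 la n by (simp_all add: x_def y_def)
    have "x^2 + y^2 = n^2 * (inverse n)^2" unfolding n(2) by (simp add: x_def y_def power_mult_distrib distrib_right)
    then show "x^2 + y^2 = 1" using n(1) by (simp add: power_inverse)
    show "\<tau> > 0" using l1 by (simp add: \<tau>_def)
    show "real_mat A ** mat22 x (- y) y x = mat22 x (- y) y x ** geod_mat \<tau>"
      unfolding geod_mat_eq e using e1 e2 e3 e4 sym
      by (simp add: mat22_eq_iff a_def[symmetric] b_def[symmetric] d_def[symmetric])
  qed
qed

lemma rotation_reciprocal:
  fixes x y :: real
  shows "reciprocal (geod_orbit (coset (mat22 x (- y) y x)))"
proof -
  define k where "k = mat22 x (- y) y x"
  define w :: "int^2^2" where "w = mat22 0 1 (-1) 0"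
  have w: "w \<in> SL2Z" by (simp add: SL2Z_def w_def det_2)
  have rw: "reversal_mat = real_mat w" by (simp add: reversal_mat_def mat22_eq_iff w_def)
  have tr: "time_reversal (coset (k ** geod_mat s)) = coset (k ** geod_mat (- s))" for s
  proof -
    have "time_reversal (coset (k ** geod_mat s)) = coset (k ** geod_mat s ** reversal_mat)"
      by (simp add: time_reversal_def coset_def image_image matrix_mul_assoc)
    also have "k ** geod_mat s ** reversal_mat = real_mat w ** (k ** geod_mat (- s))"
      by (simp add: mat22_eq_iff rw w_def k_def geod_mat_eq)
    also have "coset \<dots> = coset (k ** geod_mat (- s))" by (rule coset_mult_left[OF w])
    finally show ?thesis .
  qed
  have "time_reversal ` geod_orbit (coset k) = range (\<lambda>s. coset (k ** geod_mat (- s)))"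
    by (simp add: geod_orbit_coset image_image tr)
  also have "\<dots> = range (\<lambda>s. coset (k ** geod_mat s))"
  proof
    show "range (\<lambda>s. coset (k ** geod_mat s)) \<subseteq> range (\<lambda>s. coset (k ** geod_mat (- s)))"
    proof clarify
      fix s show "coset (k ** geod_mat s) \<in> range (\<lambda>s. coset (k ** geod_mat (- s)))"
        by (rule image_eqI[of _ _ "- s"]) auto
    qed
  qed auto
  finally show ?thesis unfolding reciprocal_def k_def geod_orbit_coset .
qed

text \<open>By Cayley-Hamilton every power is u A + v. The recursion (u, v) -> (u * trace A + v, -u)
  makes |u| grow strictly, as |trace A| >= 3.\<close>

lemma mat_power_linear:
  fixes A :: "int^2^2"
  assumes A: "det A = 1" "\<bar>trace A\<bar> \<ge> 3" and n: "n \<ge> 1"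
  shows "\<exists>u v. mat_power A n = mat22 (u * A $ 1 $ 1 + v) (u * A $ 1 $ 2) (u * A $ 2 $ 1) (u * A $ 2 $ 2 + v)
    \<and> \<bar>v\<bar> < \<bar>u\<bar> \<and> int n \<le> \<bar>u\<bar>"
  using n
proof (induction n rule: nat_induct_at_least)
  case base
  show ?case by (intro exI[of _ 1] exI[of _ 0]) (simp add: mat22_eq_iff)
next
  case (Suc n)
  then obtain u v where uv: "mat_power A n = mat22 (u * A $ 1 $ 1 + v) (u * A $ 1 $ 2) (u * A $ 2 $ 1) (u * A $ 2 $ 2 + v)"
    "\<bar>v\<bar> < \<bar>u\<bar>" "int n \<le> \<bar>u\<bar>" by blast
  define s where "s = trace A"
  have ad: "A $ 1 $ 1 * A $ 2 $ 2 = 1 + A $ 1 $ 2 * A $ 2 $ 1" using A(1) by (simp add: det_2 algebra_simps)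
  have "mat_power A (Suc n) = mat22 ((u * s + v) * A $ 1 $ 1 + - u) ((u * s + v) * A $ 1 $ 2)
      ((u * s + v) * A $ 2 $ 1) ((u * s + v) * A $ 2 $ 2 + - u)"
    using ad by (simp add: uv(1) mat22_eq_iff s_def trace22 algebra_simps)
  moreover have "\<bar>u * s + v\<bar> \<ge> 2 * \<bar>u\<bar> + 1"
  proof -
    have "3 * \<bar>u\<bar> \<le> \<bar>s\<bar> * \<bar>u\<bar>" using A(2) by (intro mult_right_mono) (auto simp: s_def)
    then have "3 * \<bar>u\<bar> \<le> \<bar>u * s\<bar>" by (simp add: abs_mult mult.commute)
    then show ?thesis using uv(2) by linarith
  qed
  moreover have "\<bar>u\<bar> \<ge> 1" using uv by linarith
  ultimately show ?case using uv(3)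
    by (intro exI[of _ "u * s + v"] exI[of _ "- u"]) auto
qed

text \<open>If A is, up to sign, \<gamma>^n = u \<gamma> + v, then (trace A)^2 - 4 is u^2 times the
  same expression for \<gamma>. Squarefreeness gives |u| = 1, hence n = 1, and A is the primitive
  generator up to sign. For the same reason the gcd removed in \<open>form_of\<close> is 1, since
  its square divides the discriminant.\<close>

theorem squarefree_axis_invariants:
  assumes g: "g \<in> SL2R" and ax: "is_axis g \<tau> A" "\<tau> > 0" and sf: "squarefree ((trace A)^2 - 4)"
  shows "geod_trace (geod_orbit (coset g)) = \<bar>trace A\<bar>" "geod_disc (geod_orbit (coset g)) = (trace A)^2 - 4"
proof -
  define t where "t = trace A"
  obtain s0 \<gamma> where s0: "s0 > 0" "is_axis g s0 \<gamma>" "primitive \<gamma>"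
    and gen: "\<And>s B. s > 0 \<Longrightarrow> is_axis g s B \<Longrightarrow> \<exists>n\<ge>1. s = real n * s0 \<and> (B = mat_power \<gamma> n \<or> B = - mat_power \<gamma> n)"
    using axis_generator[OF g ax(2,1)] by metis
  obtain n where n: "n \<ge> 1" "A = mat_power \<gamma> n \<or> A = - mat_power \<gamma> n" using gen[OF ax(2,1)] by blast
  have dg: "det \<gamma> = 1" using s0 by (simp add: is_axis_def SL2Z_def)
  have dA: "det A = 1" using ax by (simp add: is_axis_def SL2Z_def)
  have "hyperbolic \<gamma>" using axis_hyperbolic[OF g s0(2,1)] .
  then have tg: "\<bar>trace \<gamma>\<bar> \<ge> 3" by (simp add: hyperbolic_def)
  obtain u v where uv: "mat_power \<gamma> n = mat22 (u * \<gamma> $ 1 $ 1 + v) (u * \<gamma> $ 1 $ 2) (u * \<gamma> $ 2 $ 1) (u * \<gamma> $ 2 $ 2 + v)"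
    "int n \<le> \<bar>u\<bar>" using mat_power_linear[OF dg tg n(1)] by blast
  have disc: "(trace B)^2 - 4 = (B $ 2 $ 2 - B $ 1 $ 1)^2 + 4 * B $ 1 $ 2 * B $ 2 $ 1" if "det B = 1" for B :: "int^2^2"
  proof -
    have "(trace B)^2 - 4 = (B $ 2 $ 2 - B $ 1 $ 1)^2 + 4 * B $ 1 $ 2 * B $ 2 $ 1 + 4 * (det B - 1)"
      by (simp add: trace22 det_2 power2_eq_square algebra_simps)
    then show ?thesis by (simp add: that)
  qed
  have "t^2 - 4 = u^2 * ((\<gamma> $ 2 $ 2 - \<gamma> $ 1 $ 1)^2 + 4 * \<gamma> $ 1 $ 2 * \<gamma> $ 2 $ 1)"
    unfolding t_def disc[OF dA] using n(2) uv(1)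
    by (elim disjE) (simp_all add: power2_eq_square algebra_simps)
  then have "u^2 dvd t^2 - 4" by simp
  then have "is_unit u" using squarefreeD[OF sf] by (simp add: t_def)
  then have "\<bar>u\<bar> = 1" by simp
  then have "n = 1" using uv(2) n(1) by simp
  then have trA: "\<bar>trace A\<bar> = \<bar>trace \<gamma>\<bar>" using n(2) by (auto simp: trace22)
  show "geod_trace (geod_orbit (coset g)) = \<bar>trace A\<bar>"
    using geod_trace_generator(2)[OF g s0(1,2,3) gen] trA by simp
  have fd: "form_disc (form_of B) = t^2 - 4" if B: "B \<in> geod_class (geod_orbit (coset g))" for B
  proof -
    have "\<bar>trace B\<bar> = \<bar>t\<bar>" using geod_class_trace[OF g s0(1,2) gen B] trA by (simp add: t_def)
    then have tB: "(trace B)^2 = t^2" by (metis power2_abs)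
    have hB: "hyperbolic B" and dB: "det B = 1" using B by (auto simp: geod_class_def SL2Z_def)
    define w where "w = gcd (B $ 2 $ 1) (gcd (B $ 2 $ 2 - B $ 1 $ 1) (B $ 1 $ 2))"
    have wd: "w dvd B $ 2 $ 1" "w dvd B $ 2 $ 2 - B $ 1 $ 1" "w dvd B $ 1 $ 2"
      unfolding w_def by (meson dvd_trans gcd_dvd1 gcd_dvd2)+
    have "w^2 dvd (B $ 2 $ 2 - B $ 1 $ 1)^2 + 4 * (B $ 1 $ 2 * B $ 2 $ 1)"
    proof (rule dvd_add)
      show "w^2 dvd (B $ 2 $ 2 - B $ 1 $ 1)^2" using wd(2) by (rule dvd_power_same)
      show "w^2 dvd 4 * (B $ 1 $ 2 * B $ 2 $ 1)" unfolding power2_eq_square by (intro dvd_mult mult_dvd_mono wd)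
    qed
    then have "w^2 dvd t^2 - 4" using disc[OF dB] tB by (simp add: mult.assoc)
    then have "is_unit w" using squarefreeD[OF sf] by (simp add: t_def)
    moreover have "w \<ge> 0" by (simp add: w_def)
    ultimately have w1: "w = 1" by simp
    define s where "s = sgn (trace B)"
    have s2: "s * s = 1" using hB by (auto simp: s_def hyperbolic_def sgn_if)
    have "form_of B = (s * B $ 2 $ 1, s * (B $ 2 $ 2 - B $ 1 $ 1), s * (- B $ 1 $ 2))"
      unfolding form_of_def Let_def w_def[symmetric] s_def w1 by simp
    then have "form_disc (form_of B) = (s * s) * ((B $ 2 $ 2 - B $ 1 $ 1)^2 + 4 * B $ 1 $ 2 * B $ 2 $ 1)"
      by (simp add: form_disc_def power2_eq_square algebra_simps)
    then show ?thesis using disc[OF dB] tB s2 by simp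
  qed
  have "\<gamma> \<in> geod_class (geod_orbit (coset g))" using geod_trace_generator(1)[OF g s0(1,2,3) gen] .
  then show "geod_disc (geod_orbit (coset g)) = (trace A)^2 - 4"
    unfolding geod_disc_def geod_forms_def using fd unfolding t_def
    by (intro the_equality) (auto intro!: imageI bexI[of _ \<gamma>])
qed

subsection \<open>Low-lying geodesics\<close>

definition box_region :: "real \<Rightarrow> (real^2^2) set set" where
  "box_region r = coset ` {g \<in> SL2R. \<forall>i j. \<bar>g $ i $ j\<bar> \<le> r}"

lemma compact_box_region: "compactin X_topology (box_region r)"
proof -
  let ?K = "{g::real^2^2. det g = 1 \<and> (\<forall>i j. \<bar>g $ i $ j\<bar> \<le> r)}"
  have "bounded ?K"
  proof -
    have "norm g \<le> 4 * r" if "g \<in> ?K" for g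
    proof -
      have "norm v \<le> 2 * r" if "\<forall>j. \<bar>v $ j\<bar> \<le> r" for v :: "real^2"
        using norm_le_l1_cart[of v] that[THEN spec, of 1] that[THEN spec, of 2] by (simp add: sum_2)
      then have "norm (g $ i) \<le> 2 * r" for i using that by simp
      moreover have "norm g \<le> (\<Sum>i\<in>UNIV. norm (g $ i))" unfolding norm_vec_def by (rule L2_set_le_sum) simp
      ultimately show ?thesis by (simp add: sum_2) (smt (verit))
    qed
    then show ?thesis unfolding bounded_iff by blast
  qed
  moreover have "closed ?K"
  proof -
    have "closed {g::real^2^2. det g = 1}"
      unfolding det_2 by (intro closed_Collect_eq continuous_intros)
    moreover have "closed {g::real^2^2. \<bar>g $ i $ j\<bar> \<le> r}" for i j
      by (intro closed_Collect_le continuous_intros)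
    then have "closed {g::real^2^2. \<forall>i j. \<bar>g $ i $ j\<bar> \<le> r}"
      by (intro closed_Collect_all)
    ultimately show ?thesis by (rule closed_Collect_conj)
  qed
  ultimately have "compact ?K" by (simp add: compact_eq_bounded_closed)
  moreover have "?K = {g \<in> SL2R. \<forall>i j. \<bar>g $ i $ j\<bar> \<le> r}" by (simp add: SL2R_def)
  ultimately have "compactin (top_of_set SL2R) {g \<in> SL2R. \<forall>i j. \<bar>g $ i $ j\<bar> \<le> r}"
    by (simp add: compactin_subtopology)
  then show ?thesis unfolding box_region_def
    by (rule image_compactin[OF _ quotient_imp_continuous_map[OF quotient_map_coset]])
qed

text \<open>Follow the sum of the first column through the suffix products: it is at most 2 at the
  empty suffix and at least 1 at the full word, and one letter changes it by a bounded factor. So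
  some suffix has a first column that is bounded above and below.\<close>

lemma descent:
  fixes xs :: "(real^2^2) list" and Z :: "real^2^2" and \<Lambda> :: real
  assumes "xs \<noteq> []" "\<And>A i j. A \<in> set xs \<Longrightarrow> 1 \<le> A $ i $ j \<and> A $ i $ j \<le> \<Lambda>"
    and Z: "Z $ 1 $ 1 > 0" "Z $ 2 $ 1 > 0" "Z $ 1 $ 1 + Z $ 2 $ 1 \<le> 2"
    and start: "1 \<le> (lprod xs ** Z) $ 1 $ 1 + (lprod xs ** Z) $ 2 $ 1"
  shows "\<exists>ys zs. xs = ys @ zs \<and> (\<forall>i. 1 / (2 * \<Lambda>) \<le> (lprod zs ** Z) $ i $ 1 \<and> (lprod zs ** Z) $ i $ 1 \<le> 4 * \<Lambda>)"
  using assms(1,2) start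
proof (induction xs)
  case (Cons A xs)
  define u v where "u = (lprod xs ** Z) $ 1 $ 1" and "v = (lprod xs ** Z) $ 2 $ 1"
  have A: "1 \<le> A $ i $ j" "A $ i $ j \<le> \<Lambda>" for i j using Cons.prems(2)[of A] by auto
  have \<Lambda>1: "\<Lambda> \<ge> 1" using A(1)[of 1 1] A(2)[of 1 1] by linarith
  have nonneg: "0 < (lprod ws ** Z) $ 1 $ 1 \<and> 0 < (lprod ws ** Z) $ 2 $ 1" if "set ws \<subseteq> set (A # xs)" for ws
    using that
  proof (induction ws)
    case Nil
    then show ?case using Z by simp
  next
    case (Cons B ws)
    have B: "1 \<le> B $ i $ j" for i j using Cons.prems \<open>\<And>B i j. B \<in> set (A # xs) \<Longrightarrow> 1 \<le> B $ i $ j \<and> B $ i $ j \<le> \<Lambda>\<close> by auto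
    have Bp: "0 < B $ i $ j" for i j using B[of i j] by linarith
    show ?case using Cons Bp by (simp add: add_pos_pos flip: matrix_mul_assoc)
  qed
  have uv: "u > 0" "v > 0" using nonneg[of xs] by (auto simp: u_def v_def)
  have w: "(lprod (A # xs) ** Z) $ i $ 1 = A $ i $ 1 * u + A $ i $ 2 * v" for i
    using exhaust_2[of i] by (auto simp: u_def v_def simp flip: matrix_mul_assoc)
  have lo: "u + v \<le> (lprod (A # xs) ** Z) $ i $ 1" for i
    unfolding w using mult_right_mono[OF A(1)[of i 1] less_imp_le[OF uv(1)]]
      mult_right_mono[OF A(1)[of i 2] less_imp_le[OF uv(2)]] by simp
  have hi: "(lprod (A # xs) ** Z) $ i $ 1 \<le> \<Lambda> * (u + v)" for i
    unfolding w distrib_left by (intro add_mono mult_right_mono A(2) less_imp_le uv)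
  show ?case
  \<comment> \<open>The suffix keeps the letter \<open>A\<close>, because the action of
    \<open>A\<close> makes both entries at least u + v; without it one of them could be arbitrarily
    small.\<close>
  proof (cases "u + v \<le> 2")
    case True
    have "1 \<le> \<Lambda> * (u + v) + \<Lambda> * (u + v)" using Cons.prems(3) hi[of 1] hi[of 2] by linarith
    then have "1 / (2 * \<Lambda>) \<le> u + v" using \<Lambda>1 by (simp add: field_simps)
    moreover have "\<Lambda> * (u + v) \<le> \<Lambda> * 4" using True \<Lambda>1 by (intro mult_left_mono) auto
    ultimately have "\<forall>i. 1 / (2 * \<Lambda>) \<le> (lprod (A # xs) ** Z) $ i $ 1 \<and> (lprod (A # xs) ** Z) $ i $ 1 \<le> 4 * \<Lambda>"
      using lo hi by (smt (verit) mult.commute)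
    then show ?thesis by (intro exI[of _ "[]"] exI[of _ "A # xs"]) simp
  next
    case False
    have "xs \<noteq> []"
    proof
      assume "xs = []"
      then show False using False Z(3) by (simp add: u_def v_def)
    qed
    moreover have "1 \<le> B $ i $ j \<and> B $ i $ j \<le> \<Lambda>" if "B \<in> set xs" for B i j
      using Cons.prems(2)[of B] that by simp
    moreover have "1 \<le> (lprod xs ** Z) $ 1 $ 1 + (lprod xs ** Z) $ 2 $ 1"
      using False unfolding u_def v_def by linarith
    ultimately obtain ys zs where "xs = ys @ zs"
      "\<forall>i. 1 / (2 * \<Lambda>) \<le> (lprod zs ** Z) $ i $ 1 \<and> (lprod zs ** Z) $ i $ 1 \<le> 4 * \<Lambda>"
      using Cons.IH by metis
    then show ?thesis by (intro exI[of _ "A # ys"] exI[of _ zs]) simp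
  qed
qed simp

lemma real_mat_lprod: "real_mat (lprod xs) = lprod (map real_mat xs)"
  by (induction xs) (simp_all add: real_mat_mult)

lemma coset_axis_translate:
  assumes "is_axis g t A"
  shows "coset (g ** geod_mat (t + s)) = coset (g ** geod_mat s)"
proof -
  have "sgn_eq (real_mat A ** g ** geod_mat s) (g ** geod_mat t ** geod_mat s)"
    using assms by (intro sgn_eq_right) (simp add: is_axis_def)
  then have "sgn_eq (real_mat A ** (g ** geod_mat s)) (g ** geod_mat (t + s))"
    by (simp add: geod_mat_add flip: matrix_mul_assoc)
  moreover have "coset (real_mat A ** (g ** geod_mat s)) = coset (g ** geod_mat s)"
    using assms by (intro coset_mult_left) (simp add: is_axis_def)
  ultimately show ?thesis unfolding sgn_eq_def using coset_uminus by metis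
qed

text \<open>A point k a_s with 0 <= s < \<tau> is the word applied to Z = k a_(s - \<tau>).
  Cancelling the prefix \<open>P\<close> found by \<open>descent\<close>, an element of
  \<open>SL2Z\<close>, keeps the coset and leaves a matrix with controlled first column. Its second
  column equals that of P^(-1) k a_s and has signs (-, +), so the determinant 1 is a sum of two
  nonnegative products, which bounds it.\<close>

theorem low_lying_word:
  fixes xs :: "(int^2^2) list" and \<Lambda> :: real
  assumes xs: "xs \<noteq> []" "\<And>A. A \<in> set xs \<Longrightarrow> det A = 1"
    "\<And>A i j. A \<in> set xs \<Longrightarrow> 1 \<le> A $ i $ j \<and> real_of_int (A $ i $ j) \<le> \<Lambda>"
    and xy: "x > 0" "y > 0" "x^2 + y^2 = 1" and \<tau>: "\<tau> > 0"
    and eq: "real_mat (lprod xs) ** mat22 x (- y) y x = mat22 x (- y) y x ** geod_mat \<tau>"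
  shows "geod_orbit (coset (mat22 x (- y) y x)) \<subseteq> box_region (4 * \<Lambda>)"
proof -
  define k where "k = mat22 x (- y) y x"
  have dk: "det k = 1" using xy(3) by (simp add: k_def det_2 power2_eq_square)
  have ax: "is_axis k \<tau> (lprod xs)"
    unfolding is_axis_def SL2Z_def using det_lprod[of xs] xs(2) eq by (auto simp: k_def)
  obtain A0 where "A0 \<in> set xs" using xs(1) by (cases xs) auto
  then have \<Lambda>1: "\<Lambda> \<ge> 1" using xs(3)[of A0 1 1] by linarith
  have base: "coset (k ** geod_mat s) \<in> box_region (4 * \<Lambda>)" if s: "0 \<le> s" "s < \<tau>" for s
  proof -
    define Z where "Z = k ** geod_mat (s - \<tau>)"
    have xy1: "x \<le> 1" "y \<le> 1" "1 \<le> x + y"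
    proof -
      have x1: "x^2 \<le> 1" "y^2 \<le> 1" using xy(3) zero_le_power2[of x] zero_le_power2[of y] by linarith+
      then show "x \<le> 1" "y \<le> 1" using xy by (auto simp: power2_le_iff_abs_le abs_square_le_1)
      have "(x + y)^2 \<ge> 1^2" using xy by (simp add: power2_sum)
      then show "1 \<le> x + y" using xy by (intro power2_le_imp_le[of 1 "x + y"]) auto
    qed
    have lZ: "real_mat (lprod xs) ** Z = k ** geod_mat s"
    proof -
      have "real_mat (lprod xs) ** Z = (real_mat (lprod xs) ** k) ** geod_mat (s - \<tau>)"
        by (simp add: Z_def matrix_mul_assoc)
      also have "\<dots> = k ** (geod_mat \<tau> ** geod_mat (s - \<tau>))" using eq by (simp add: k_def matrix_mul_assoc)
      finally show ?thesis by (simp add: geod_mat_add)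
    qed
    have "\<exists>ys zs. map real_mat xs = ys @ zs \<and> (\<forall>i. 1 / (2 * \<Lambda>) \<le> (lprod zs ** Z) $ i $ 1 \<and> (lprod zs ** Z) $ i $ 1 \<le> 4 * \<Lambda>)"
    proof (rule descent)
      show "map real_mat xs \<noteq> []" using xs(1) by simp
      show "1 \<le> A $ i $ j \<and> A $ i $ j \<le> \<Lambda>" if "A \<in> set (map real_mat xs)" for A i j
        using that xs(3) by auto
      have "exp ((s - \<tau>) / 2) \<le> 1" using s by simp
      then have "x * exp ((s - \<tau>) / 2) \<le> x * 1" "y * exp ((s - \<tau>) / 2) \<le> y * 1"
        using xy by (auto intro!: mult_left_mono)
      then show "Z $ 1 $ 1 + Z $ 2 $ 1 \<le> 2" using xy1 by (simp add: Z_def k_def geod_mat_eq)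
      show "Z $ 1 $ 1 > 0" "Z $ 2 $ 1 > 0" using xy by (simp_all add: Z_def k_def geod_mat_eq)
      have "1 \<le> exp (s / 2)" using s by simp
      then have "x * 1 \<le> x * exp (s / 2)" "y * 1 \<le> y * exp (s / 2)"
        using xy by (auto intro!: mult_left_mono)
      then show "1 \<le> (lprod (map real_mat xs) ** Z) $ 1 $ 1 + (lprod (map real_mat xs) ** Z) $ 2 $ 1"
        unfolding real_mat_lprod[symmetric] lZ using xy1 by (simp add: k_def geod_mat_eq)
    qed
    then obtain ys' zs' where split: "map real_mat xs = ys' @ zs'"
      and b: "\<And>i. 1 / (2 * \<Lambda>) \<le> (lprod zs' ** Z) $ i $ 1" "\<And>i. (lprod zs' ** Z) $ i $ 1 \<le> 4 * \<Lambda>" by blast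
    obtain ys zs where yz: "xs = ys @ zs" "ys' = map real_mat ys" "zs' = map real_mat zs"
      using split by (auto simp: map_eq_append_conv)
    define P where "P = lprod ys"
    have dP: "det P = 1" unfolding P_def using xs(2) yz by (intro det_lprod) auto
    have Pnn: "0 \<le> P $ i $ j" for i j
    proof -
      have "set ws \<subseteq> set xs \<Longrightarrow> \<forall>i j. 0 \<le> lprod ws $ i $ j" for ws
      proof (induction ws)
        case (Cons B ws)
        have "1 \<le> B $ i $ j" for i j using Cons.prems xs(3) by auto
        then have "0 \<le> B $ i $ j" for i j by (meson order_trans zero_le_one)
        then show ?case using Cons by (simp add: forall_2)
      qed (simp add: forall_2)
      then show ?thesis using yz by (auto simp: P_def)
    qed
    define g where "g = lprod zs' ** Z"
    have Pg: "real_mat P ** g = k ** geod_mat s"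
    proof -
      have "real_mat P ** g = real_mat (lprod xs) ** Z"
        by (simp add: P_def g_def yz lprod_append real_mat_lprod real_mat_mult matrix_mul_assoc)
      then show ?thesis using lZ by simp
    qed
    have gP: "g = real_mat (adj22 P) ** (k ** geod_mat s)"
      unfolding Pg[symmetric] by (simp add: matrix_mul_assoc adj22_mult_left[OF dP] flip: real_mat_mult)
    have dg: "det g = 1"
      unfolding gP by (simp add: det_mul det_real_mat det_adj22 dP dk)
    have neg: "g $ 1 $ 2 \<le> 0" "g $ 2 $ 2 \<ge> 0"
    proof -
      have p: "0 \<le> real_of_int (P $ i $ j)" for i j using Pnn by simp
      have "g $ 1 $ 2 = - ((real_of_int (P $ 2 $ 2) * y + real_of_int (P $ 1 $ 2) * x) * exp (- s / 2))"
        by (simp add: gP k_def geod_mat_eq algebra_simps)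
      then show "g $ 1 $ 2 \<le> 0" using p xy by (simp add: add_nonneg_nonneg)
      have "g $ 2 $ 2 = (real_of_int (P $ 2 $ 1) * y + real_of_int (P $ 1 $ 1) * x) * exp (- s / 2)"
        by (simp add: gP k_def geod_mat_eq algebra_simps)
      then show "g $ 2 $ 2 \<ge> 0" using p xy by (simp add: add_nonneg_nonneg)
    qed
    have pos: "g $ i $ 1 \<ge> 1 / (2 * \<Lambda>)" "g $ i $ 1 \<le> 4 * \<Lambda>" for i using b by (auto simp: g_def)
    have L0: "1 / (2 * \<Lambda>) > 0" using \<Lambda>1 by simp
    have d1: "g $ 1 $ 1 * g $ 2 $ 2 + g $ 2 $ 1 * (- g $ 1 $ 2) = 1" using dg by (simp add: det_2 mult.commute)
    have "1 / (2 * \<Lambda>) * g $ 2 $ 2 \<le> g $ 1 $ 1 * g $ 2 $ 2" "1 / (2 * \<Lambda>) * (- g $ 1 $ 2) \<le> g $ 2 $ 1 * (- g $ 1 $ 2)"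
      using pos(1) neg by (intro mult_right_mono; simp)+
    moreover have "0 \<le> 1 / (2 * \<Lambda>) * g $ 2 $ 2" "0 \<le> 1 / (2 * \<Lambda>) * (- g $ 1 $ 2)"
      using L0 neg by (intro mult_nonneg_nonneg; simp)+
    ultimately have "1 / (2 * \<Lambda>) * g $ 2 $ 2 \<le> 1" "1 / (2 * \<Lambda>) * (- g $ 1 $ 2) \<le> 1" using d1 by linarith+
    then have "g $ 2 $ 2 \<le> 2 * \<Lambda>" "- g $ 1 $ 2 \<le> 2 * \<Lambda>" using \<Lambda>1 by (auto simp: field_simps)
    then have "\<forall>i j. \<bar>g $ i $ j\<bar> \<le> 4 * \<Lambda>"
      unfolding forall_2 abs_le_iff using pos[of 1] pos[of 2] neg L0 \<Lambda>1 by linarith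
    moreover have "g \<in> SL2R" using dg by (simp add: SL2R_def)
    moreover have "coset g = coset (k ** geod_mat s)"
      unfolding gP using dP by (intro coset_mult_left SL2Z_adj22) (simp add: SL2Z_def)
    ultimately show ?thesis unfolding box_region_def by (intro image_eqI[of _ _ g]) auto
  qed
  have axm: "\<exists>B. is_axis k (real_of_int m * \<tau>) B" for m :: int
  proof (cases "m \<ge> 0")
    case True
    then show ?thesis using axis_power[OF ax, of "nat m"] by auto
  next
    case False
    then show ?thesis using axis_adj22[OF axis_power[OF ax, of "nat (- m)"]] by auto
  qed
  have "coset (k ** geod_mat s) \<in> box_region (4 * \<Lambda>)" for s
  proof -
    define m where "m = \<lfloor>s / \<tau>\<rfloor>"
    have "real_of_int m \<le> s / \<tau>" "s / \<tau> < real_of_int m + 1" unfolding m_def by linarith+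
    then have "0 \<le> s - real_of_int m * \<tau>" "s - real_of_int m * \<tau> < \<tau>" using \<tau> by (auto simp: field_simps)
    then have "coset (k ** geod_mat (s - real_of_int m * \<tau>)) \<in> box_region (4 * \<Lambda>)" by (rule base)
    moreover obtain B where "is_axis k (real_of_int m * \<tau>) B" using axm by blast
    from coset_axis_translate[OF this, of "s - real_of_int m * \<tau>"]
    have "coset (k ** geod_mat s) = coset (k ** geod_mat (s - real_of_int m * \<tau>))" by simp
    ultimately show ?thesis by simp
  qed
  then show ?thesis by (auto simp: geod_orbit_coset k_def)
qed

text \<open>A lower bound for \<open>card\<close> requires finiteness, since an infinite set has
  \<open>card\<close> 0. A geodesic in the box has a base point g with entries at most r, so its
  generator g a g^(-1), up to sign, has bounded entries; and by \<open>single\<close> a matrix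
  belongs to at most one geodesic.\<close>

theorem finite_low_lying:
  "finite {C \<in> closed_geodesics. C \<subseteq> box_region r \<and> real_of_int (geod_trace C) < X}"
proof -
  define \<Phi> where "\<Phi> \<gamma> = {C. \<exists>g s. g \<in> SL2R \<and> s > 0 \<and> is_axis g s \<gamma> \<and> C = geod_orbit (coset g)}" for \<gamma>
  define N where "N = \<lceil>4 * r^2 * X\<rceil>"
  define \<G> where "\<G> = (\<lambda>(a, b, c, d). mat22 a b c d) ` ({-N..N} \<times> {-N..N} \<times> {-N..N} \<times> {-N..N})"
  have single: "C = C'" if C: "C \<in> \<Phi> \<gamma>" "C' \<in> \<Phi> \<gamma>" for C C' \<gamma>
  proof -
    obtain g s g' s' where g: "g \<in> SL2R" "s > 0" "is_axis g s \<gamma>" "C = geod_orbit (coset g)"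
      and g': "g' \<in> SL2R" "s' > 0" "is_axis g' s' \<gamma>" "C' = geod_orbit (coset g')"
      using C unfolding \<Phi>_def by blast
    have dg: "det g = 1" "det g' = 1" using g g' by (auto simp: SL2R_def)
    have "exp (s / 2) + exp (- s / 2) = exp (s' / 2) + exp (- s' / 2)"
      using axis_trace[OF g(1,3)] axis_trace[OF g'(1,3)] by simp
    then have ss: "s' = s"
      using cosh_like_mono[of s s'] cosh_like_mono[of s' s] g(2) g'(2)
      by (metis less_imp_le less_irrefl linorder_neqE_linordered_idom)
    have trg: "trace (geod_mat s) > 0" unfolding trace_geod_mat by (intro add_pos_pos) auto
    \<comment> \<open>The sign hidden in \<open>is_axis\<close> is the sign of the trace of
      \<gamma>, hence the same at both base points. So g^(-1) g' commutes exactly with the flow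
      matrix, is diagonal, and merely shifts the base point along the geodesic.\<close>
    have sg: "(real_mat \<gamma> ** h = h ** geod_mat s \<and> trace (real_mat \<gamma>) > 0) \<or>
        (real_mat \<gamma> ** h = - (h ** geod_mat s) \<and> trace (real_mat \<gamma>) < 0)" if h: "is_axis h s \<gamma>" "det h = 1" for h
    proof -
      consider "real_mat \<gamma> ** h = h ** geod_mat s" | "real_mat \<gamma> ** h = - (h ** geod_mat s)"
        using h by (auto simp: is_axis_def sgn_eq_def)
      then show ?thesis
      proof cases
        case 1
        then show ?thesis using trace_similar[OF h(2) 1] trg by simp
      next
        case 2
        then have "(- real_mat \<gamma>) ** h = h ** geod_mat s" by (simp add: mult22_minus_left)
        then have "trace (- real_mat \<gamma>) = trace (geod_mat s)" by (rule trace_similar[OF h(2)])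
        then show ?thesis using 2 trg by (simp add: trace22)
      qed
    qed
    define X where "X = adj22 g ** g'"
    have gX: "g' = g ** X" by (simp add: X_def matrix_mul_assoc adj22_mult_right[OF dg(1)])
    have dX: "det X = 1" using dg by (simp add: X_def det_mul det_adj22)
    have "g ** (geod_mat s ** X) = g ** (X ** geod_mat s)"
    proof -
      have "g ** geod_mat s ** X = g' ** geod_mat s"
        using sg[OF g(3) dg(1)] sg[OF g'(3)[unfolded ss] dg(2)]
      proof (elim disjE conjE)
        assume "real_mat \<gamma> ** g = g ** geod_mat s" "real_mat \<gamma> ** g' = g' ** geod_mat s"
        then show ?thesis unfolding gX by (simp add: matrix_mul_assoc)
      next
        assume a: "real_mat \<gamma> ** g = - (g ** geod_mat s)" "real_mat \<gamma> ** g' = - (g' ** geod_mat s)"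
        have "real_mat \<gamma> ** g' = (real_mat \<gamma> ** g) ** X" unfolding gX by (simp add: matrix_mul_assoc)
        then have "- (g' ** geod_mat s) = - (g ** geod_mat s ** X)" unfolding a by (simp add: mult22_minus_left)
        then show ?thesis by simp
      qed auto
      then show ?thesis unfolding gX by (simp add: matrix_mul_assoc)
    qed
    then have comm: "geod_mat s ** X = X ** geod_mat s" by (simp add: mult22_left_cancel[OF dg(1)])
    define u where "u = exp (s / 2)"
    have u: "u > 1" using g(2) by (simp add: u_def)
    have e: "exp (- s / 2) = 1 / u" by (simp add: u_def exp_minus field_simps)
    have "geod_mat s = mat22 u 0 0 (1 / u)" unfolding geod_mat_eq e u_def[symmetric] ..
    then have "u * X $ 1 $ 2 = X $ 1 $ 2 / u" "X $ 2 $ 1 / u = X $ 2 $ 1 * u"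
      using comm by (auto simp: mat22_eq_iff)
    then have "(u * u - 1) * X $ 1 $ 2 = 0" "(u * u - 1) * X $ 2 $ 1 = 0" using u by (auto simp: field_simps)
    moreover have "u * u > 1" using u by (metis less_1_mult)
    ultimately have X0: "X $ 1 $ 2 = 0" "X $ 2 $ 1 = 0" by auto
    define m where "m = X $ 1 $ 1"
    have m: "m * X $ 2 $ 2 = 1" using dX X0 by (simp add: det_2 m_def)
    then have m0: "m \<noteq> 0" by auto
    define r where "r = 2 * ln \<bar>m\<bar>"
    have er: "exp (r / 2) = \<bar>m\<bar>" "exp (- r / 2) = 1 / \<bar>m\<bar>" using m0 by (simp_all add: r_def exp_minus field_simps)
    have X22: "X $ 2 $ 2 = 1 / m" using m m0 by (simp add: field_simps)
    have "X = geod_mat r \<or> X = - geod_mat r"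
      using X0 X22 m0 unfolding geod_mat_eq er by (cases "m > 0") (auto simp: mat22_eq_iff m_def)
    then have "coset g' = coset (g ** geod_mat r)" unfolding gX by (auto simp: mult22_minus_right coset_uminus)
    then show ?thesis using g(4) g'(4) by (simp add: geod_orbit_shift)
  qed
  have "{C \<in> closed_geodesics. C \<subseteq> box_region r \<and> real_of_int (geod_trace C) < X} \<subseteq> (\<Union>\<gamma>\<in>\<G>. \<Phi> \<gamma>)"
  proof clarify
    fix C assume C: "C \<in> closed_geodesics" "C \<subseteq> box_region r" "real_of_int (geod_trace C) < X"
    obtain g0 t A where g0: "g0 \<in> SL2R" "C = geod_orbit (coset g0)" "t > 0" "is_axis g0 t A"
      using closed_geodesicsE[OF C(1)] by metis
    have "coset (g0 ** geod_mat 0) \<in> geod_orbit (coset g0)" unfolding geod_orbit_coset by blast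
    then have "coset g0 \<in> box_region r" using C(2) g0(2) by auto
    then obtain g where g: "g \<in> SL2R" "\<And>i j. \<bar>g $ i $ j\<bar> \<le> r" "coset g = coset g0" by (auto simp: box_region_def)
    have Cg: "C = geod_orbit (coset g)" using g0 g by simp
    have "coset (g0 ** geod_mat t) = coset g0" by (rule axis_closed[OF g0(4)])
    then have "geod_flow t (coset g) = coset g" unfolding g(3) geod_flow_coset .
    then have "coset (g ** geod_mat t) = coset g" unfolding geod_flow_coset .
    then obtain B where B: "is_axis g t B" using closed_iff_axis by blast
    obtain s0 \<gamma> where s0: "s0 > 0" "is_axis g s0 \<gamma>" "primitive \<gamma>"
      and gen: "\<And>s B. s > 0 \<Longrightarrow> is_axis g s B \<Longrightarrow> \<exists>n\<ge>1. s = real n * s0 \<and> (B = mat_power \<gamma> n \<or> B = - mat_power \<gamma> n)"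
      using axis_generator[OF g(1) g0(3) B] by metis
    have "real_of_int \<bar>trace \<gamma>\<bar> < X"
      using C(3) geod_trace_generator(2)[OF g(1) s0(1,2,3) gen] Cg by simp
    then have ex: "exp (s0 / 2) + exp (- s0 / 2) < X" using axis_trace[OF g(1) s0(2)] by simp
    have dg: "det g = 1" using g(1) by (simp add: SL2R_def)
    have "r \<ge> 0" using g(2)[of 1 1] by linarith
    have "sgn_eq (real_mat \<gamma> ** g ** adj22 g) (g ** geod_mat s0 ** adj22 g)"
      using s0(2) by (intro sgn_eq_right) (simp add: is_axis_def)
    moreover have "real_mat \<gamma> ** g ** adj22 g = real_mat \<gamma>"
      by (simp add: adj22_mult_right[OF dg] flip: matrix_mul_assoc)
    ultimately have "sgn_eq (real_mat \<gamma>) (g ** geod_mat s0 ** adj22 g)" by simp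
    then have ab: "\<bar>real_of_int (\<gamma> $ i $ j)\<bar> = \<bar>(g ** geod_mat s0 ** adj22 g) $ i $ j\<bar>" for i j
      by (auto simp: sgn_eq_def simp flip: real_mat_nth)
    have prod_le: "\<bar>p * e * q\<bar> \<le> r^2 * X" if "\<bar>p\<bar> \<le> r" "\<bar>q\<bar> \<le> r" "0 \<le> e" "e \<le> X" for p q e
    proof -
      have "\<bar>p * e * q\<bar> = \<bar>p\<bar> * e * \<bar>q\<bar>" using that by (simp add: abs_mult)
      also have "\<dots> \<le> r * X * r" using that \<open>r \<ge> 0\<close> by (intro mult_mono) auto
      finally show ?thesis by (simp add: power2_eq_square mult_ac)
    qed
    have exs: "0 \<le> exp (s0 / 2)" "exp (s0 / 2) \<le> X" "0 \<le> exp (- s0 / 2)" "exp (- s0 / 2) \<le> X"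
      using ex exp_gt_zero[of "s0 / 2"] exp_gt_zero[of "- s0 / 2"] by linarith+
    have "0 \<le> X" using exs by linarith
    then have rX: "0 \<le> r^2 * X" by simp
    have gg: "\<bar>adj22 g $ i $ j\<bar> \<le> r" for i j
      using g(2) exhaust_2[of i] exhaust_2[of j] by auto
    have bound: "\<bar>real_of_int (\<gamma> $ i $ j)\<bar> \<le> 4 * r^2 * X" for i j
    proof -
      have "(g ** geod_mat s0 ** adj22 g) $ i $ j = g $ i $ 1 * exp (s0 / 2) * adj22 g $ 1 $ j + g $ i $ 2 * exp (- s0 / 2) * adj22 g $ 2 $ j"
        using exhaust_2[of i] exhaust_2[of j] by (auto simp: geod_mat_eq)
      then have "\<bar>(g ** geod_mat s0 ** adj22 g) $ i $ j\<bar> \<le> r^2 * X + r^2 * X"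
        using prod_le[OF g(2)[of i 1] gg[of 1 j] exs(1,2)] prod_le[OF g(2)[of i 2] gg[of 2 j] exs(3,4)] by linarith
      then show ?thesis unfolding ab using rX by linarith
    qed
    have "\<gamma> $ i $ j \<in> {-N..N}" for i j
      using bound[of i j] unfolding N_def atLeastAtMost_iff abs_le_iff by linarith
    then have "\<gamma> \<in> \<G>" unfolding \<G>_def
      by (intro image_eqI[where x = "(\<gamma> $ 1 $ 1, \<gamma> $ 1 $ 2, \<gamma> $ 2 $ 1, \<gamma> $ 2 $ 2)"]) (auto simp: mat22_collapse)
    moreover have "C \<in> \<Phi> \<gamma>" unfolding \<Phi>_def using g s0 Cg by blast
    ultimately show "C \<in> (\<Union>\<gamma>\<in>\<G>. \<Phi> \<gamma>)" by blast
  qed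
  moreover have "finite (\<Union>\<gamma>\<in>\<G>. \<Phi> \<gamma>)"
  proof (rule finite_UN_I)
    show "finite \<G>" by (simp add: \<G>_def)
    fix \<gamma>
    show "finite (\<Phi> \<gamma>)"
    proof (cases "\<Phi> \<gamma> = {}")
      case False
      then obtain C where "C \<in> \<Phi> \<gamma>" by blast
      then have "\<Phi> \<gamma> = {C}" using single by blast
      then show ?thesis by simp
    qed simp
  qed
  ultimately show ?thesis by (rule finite_subset)
qed

lemma word_geodesic:
  fixes ws :: "(int^2^2) list" and \<Lambda> :: real
  assumes ws: "ws \<noteq> []" "\<And>A. A \<in> set ws \<Longrightarrow> det A = 1"
    "\<And>A i j. A \<in> set ws \<Longrightarrow> 1 \<le> A $ i $ j \<and> real_of_int (A $ i $ j) \<le> \<Lambda>"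
    and t: "nsq (lprod ws) = t" "odd t" "squarefree (t^2 - 4)"
  shows "\<exists>C\<in>closed_geodesics. C \<subseteq> box_region (4 * \<Lambda>) \<and> fundamental C \<and> reciprocal C \<and> geod_trace C = t"
proof -
  define M where "M = lprod ws"
  define A where "A = M ** transpose M"
  \<comment> \<open>M M^T is itself a word, in the letters and their transposes, and transposition
    preserves the bounds on the entries.\<close>
  define xs where "xs = ws @ rev (map transpose ws)"
  have A_eq: "A = lprod xs" by (simp add: A_def M_def xs_def lprod_append lprod_transpose)
  have dM: "det M = 1" unfolding M_def using ws by (intro det_lprod) auto
  have pos: "vs \<noteq> [] \<Longrightarrow> set vs \<subseteq> set ws \<Longrightarrow> \<forall>i j. 1 \<le> lprod vs $ i $ j" for vs
  proof (induction vs)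
    case (Cons B vs)
    have B: "1 \<le> B $ i $ j" for i j using Cons.prems ws(3) by auto
    show ?case
    proof (cases "vs = []")
      case True
      then show ?thesis using B by simp
    next
      case False
      then have V: "1 \<le> lprod vs $ i $ j" for i j using Cons by auto
      have pr: "1 \<le> B $ i $ l * lprod vs $ l $ j" for i j l
        using mult_mono[OF B[of i l] V[of l j]] B[of i l] by simp
      show ?thesis unfolding forall_2 lprod_simps mult22_nth
        using pr[of 1 1 1] pr[of 1 2 1] pr[of 1 1 2] pr[of 1 2 2] pr[of 2 1 1] pr[of 2 2 1] pr[of 2 1 2] pr[of 2 2 2] by linarith
    qed
  qed simp
  have M1: "1 \<le> M $ i $ j" for i j using pos[of ws] ws(1) by (auto simp: M_def)
  have pr: "1 \<le> M $ i $ j * M $ i' $ j'" for i j i' j'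
    using mult_mono[OF M1[of i j] M1[of i' j']] M1[of i j] by simp
  have tr: "trace A = t" unfolding A_def trace_mult_transpose using t(1) by (simp add: M_def)
  have t4: "t \<ge> 4"
    unfolding t(1)[symmetric] nsq_def M_def[symmetric] power2_eq_square
    using pr[of 1 1 1 1] pr[of 1 2 1 2] pr[of 2 1 2 1] pr[of 2 2 2 2] by linarith
  have dA: "det A = 1" by (simp add: A_def det_mul dM)
  have sym: "A $ 2 $ 1 = A $ 1 $ 2" by (simp add: A_def mult.commute)
  have A12: "A $ 1 $ 2 > 0"
  proof -
    have "A $ 1 $ 2 = M $ 1 $ 1 * M $ 2 $ 1 + M $ 1 $ 2 * M $ 2 $ 2" by (simp add: A_def)
    then show ?thesis using pr[of 1 1 2 1] pr[of 1 2 2 2] by linarith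
  qed
  obtain x y \<tau> where xy: "x > 0" "y > 0" "x^2 + y^2 = 1" "\<tau> > 0"
    "real_mat A ** mat22 x (- y) y x = mat22 x (- y) y x ** geod_mat \<tau>"
    using diagonalise_symmetric[OF dA sym A12] tr t4 by auto
  define k where "k = mat22 x (- y) y x"
  define C where "C = geod_orbit (coset k)"
  have k: "k \<in> SL2R" using xy(3) by (simp add: SL2R_def k_def det_2 power2_eq_square)
  have ax: "is_axis k \<tau> A" unfolding is_axis_def SL2Z_def using dA xy(5) by (simp add: k_def)
  have "coset k \<in> modular_X" using k by (simp add: modular_X_def)
  moreover have "geod_flow \<tau> (coset k) = coset k" unfolding geod_flow_coset by (rule axis_closed[OF ax])
  ultimately have "C \<in> closed_geodesics" unfolding closed_geodesics_def C_def using xy(4) by blast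
  moreover have "C \<subseteq> box_region (4 * \<Lambda>)"
    unfolding C_def k_def
  proof (rule low_lying_word[OF _ _ _ xy(1-4)])
    show "xs \<noteq> []" using ws(1) by (simp add: xs_def)
    show "det B = 1" if "B \<in> set xs" for B using that ws(2) by (auto simp: xs_def)
    show "1 \<le> B $ i $ j \<and> real_of_int (B $ i $ j) \<le> \<Lambda>" if "B \<in> set xs" for B i j
      using that ws(3) by (auto simp: xs_def)
    show "real_mat (lprod xs) ** mat22 x (- y) y x = mat22 x (- y) y x ** geod_mat \<tau>"
      using xy(5) by (simp add: A_eq)
  qed
  moreover have "reciprocal C" unfolding C_def k_def by (rule rotation_reciprocal)
  moreover have "geod_trace C = t" "geod_disc C = t^2 - 4"
    using squarefree_axis_invariants[OF k ax xy(4)] t(3) t4 unfolding tr C_def by auto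
  moreover have "fundamental_discriminant (t^2 - 4)"
  proof (rule fundamental_discriminant_squarefree[OF t(3)])
    have "4^2 \<le> t^2" using t4 by (intro power_mono) auto
    then show "t^2 - 4 > 1" by simp
    obtain s where "t = 2 * s + 1" using t(2) by (elim oddE)
    then have "t^2 - 4 = 1 + 4 * (s^2 + s - 1)" by (simp add: power2_eq_square algebra_simps)
    then show "(t^2 - 4) mod 4 = 1" by (simp only: mod_mult_self2) simp
  qed
  ultimately show ?thesis unfolding fundamental_def by (intro bexI[of _ C]) auto
qed

theorem mainTheorem1:
  fixes \<eta> :: real
  assumes "\<eta> > 0"
  shows "\<exists>Y. compactin X_topology Y \<and>
    (\<lambda>X::real. real (card {C \<in> closed_geodesics. low_lying Y C \<and> fundamental C \<and>
        reciprocal C \<and> real_of_int (geod_trace C) < X}))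
      \<in> \<Omega>[at_top](\<lambda>X. X powr (1 - \<eta>))"
proof -
  \<comment> \<open>\<open>many_squarefree_traces\<close> needs an exponent below 1. Passing to a
    smaller \<eta> only strengthens the claim once X >= 1.\<close>
  define \<eta>' where "\<eta>' = min \<eta> (1/2)"
  have \<eta>': "0 < \<eta>'" "\<eta>' < 1" "\<eta>' \<le> \<eta>" using assms by (auto simp: \<eta>'_def)
  obtain S c X0 where fin: "finite S" and letters: "\<forall>A\<in>S. det A = 1 \<and> (\<forall>i j. 1 \<le> A $ i $ j)"
    and c: "c > 0" "\<forall>X\<ge>X0. c * X powr (1 - \<eta>') \<le>
      real (card {t::int. real_of_int t < X \<and> odd t \<and> squarefree (t^2 - 4) \<and>
        (\<exists>xs. xs \<noteq> [] \<and> set xs \<subseteq> S \<and> nsq (lprod xs) = t)})"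
    using many_squarefree_traces[OF \<eta>'(1,2)] by (elim exE conjE)
  have S: "finite S" "\<And>A. A \<in> S \<Longrightarrow> det A = 1" "\<And>A i j. A \<in> S \<Longrightarrow> 1 \<le> A $ i $ j"
    using fin letters by simp_all
  define \<Lambda> where "\<Lambda> = real_of_int (\<Sum>A\<in>S. A $ 1 $ 1 + A $ 1 $ 2 + A $ 2 $ 1 + A $ 2 $ 2)"
  have \<Lambda>: "real_of_int (A $ i $ j) \<le> \<Lambda>" if "A \<in> S" for A i j
  proof -
    have p: "0 \<le> B $ i $ j" if "B \<in> S" for B i j using S(3)[OF that, of i j] by linarith
    have "A $ i $ j \<le> A $ 1 $ 1 + A $ 1 $ 2 + A $ 2 $ 1 + A $ 2 $ 2"
      using p[OF \<open>A \<in> S\<close>] exhaust_2[of i] exhaust_2[of j] by (auto simp: add_nonneg_nonneg)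
    also have "\<dots> \<le> (\<Sum>A\<in>S. A $ 1 $ 1 + A $ 1 $ 2 + A $ 2 $ 1 + A $ 2 $ 2)"
      using p S(1) that by (intro member_le_sum) (auto intro!: add_nonneg_nonneg)
    finally show ?thesis unfolding \<Lambda>_def by (simp only: of_int_le_iff)
  qed
  define Y where "Y = box_region (4 * \<Lambda>)"
  define F where "F X = {C \<in> closed_geodesics. low_lying Y C \<and> fundamental C \<and>
        reciprocal C \<and> real_of_int (geod_trace C) < X}" for X :: real
  define V where "V X = {t::int. real_of_int t < X \<and> odd t \<and> squarefree (t^2 - 4) \<and>
        (\<exists>xs. xs \<noteq> [] \<and> set xs \<subseteq> S \<and> nsq (lprod xs) = t)}" for X :: real
  have le: "card (V X) \<le> card (F X)" for X
  proof (rule surj_card_le)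
    show "finite (F X)"
      by (rule finite_subset[OF _ finite_low_lying[of "4 * \<Lambda>" X]]) (auto simp: F_def Y_def low_lying_def)
    show "V X \<subseteq> geod_trace ` F X"
    proof
      fix t assume t: "t \<in> V X"
      then obtain ws where ws: "ws \<noteq> []" "set ws \<subseteq> S" "nsq (lprod ws) = t" by (auto simp: V_def)
      have "\<exists>C\<in>closed_geodesics. C \<subseteq> box_region (4 * \<Lambda>) \<and> fundamental C \<and> reciprocal C \<and> geod_trace C = t"
        using ws S \<Lambda> t by (intro word_geodesic[of ws]) (auto simp: V_def)
      then obtain C where "C \<in> closed_geodesics" "C \<subseteq> box_region (4 * \<Lambda>)" "fundamental C" "reciprocal C" "geod_trace C = t"
        by blast
      then show "t \<in> geod_trace ` F X"
        using t by (intro image_eqI[of _ _ C]) (auto simp: F_def Y_def low_lying_def V_def)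
    qed
  qed
  have "(\<lambda>X. real (card (F X))) \<in> \<Omega>[at_top](\<lambda>X. X powr (1 - \<eta>))"
  proof (rule landau_omega.bigI[OF c(1)])
    show "\<forall>\<^sub>F X in at_top. c * norm (X powr (1 - \<eta>)) \<le> norm (real (card (F X)))"
      using eventually_ge_at_top[of "max 1 X0"]
    proof eventually_elim
      case (elim X)
      have "c * X powr (1 - \<eta>) \<le> c * X powr (1 - \<eta>')"
        using elim \<eta>' c(1) by (intro mult_left_mono powr_mono) auto
      also have "\<dots> \<le> real (card (V X))" using c(2) elim by (simp add: V_def)
      also have "\<dots> \<le> real (card (F X))" using le by simp
      finally show ?case by simp
    qed
  qed
  then show ?thesis unfolding F_def Y_def using compact_box_region by blast
qed

end
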